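(* The minor-minimal non-$2$-graphs are exactly the prism and the pyramid. That is, a graph $G$ is a minor-minimal non-$2$-graph (i.e. $k^*(G) > 2$ but $k^*(G') \leqslant 2$ for every proper minor $G'$ of $G$) if and only if $G$ is (isomorphic to) the prism or the pyramid.
   Context: Graphs are finite, undirected, may have loops and parallel edges, and have at least two nodes. For $G=(V,E)$ and $S\subseteq V$, $\delta(S)$ is the set of edges with exactly one endnode in $S$; it is a proper cut if $\varnothing\neq S\subsetneq V$. For $E'\subseteq E$, $\chi^{E'}\in\{0,1\}^E$ is its characteristic vector. The cut dominant is $\mathrm{CUT}(G)=\mathrm{conv}\{\chi^{\delta(S)} : \varnothing\neq S\subsetneq V\}+\mathbb{R}^E_+$. It is full-dimensional, so each facet-defining inequality $\langle c,x\rangle\geqslant\lambda$ has a unique scaling (its minimum integer form) in which all coefficients of $c$ and $\lambda$ are integers that are relatively prime. $G$ is a $k$-graph if every facet-defining inequality $\langle c,x\rangle\geqslant\lambda$ of $\mathrm{CUT}(G)$, written in minimum integer form, has $\lambda\leqslant k$; $k^*(G)$ is the least nonnegative integer $k$ such that $G$ is a $k$-graph. A minor of $G$ is obtained by a sequence of edge contractions, edge deletions and node deletions. The prism is the triangular prism, i.e. the complement of the $6$-cycle. The pyramid is obtained from $K_4$ by choosing a node $v$ and subdividing each of the three edges incident to $v$ once. *)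

theory Defs
  imports "HOL-Analysis.Analysis"
begin

section \<open>Finite multigraphs with loops and parallel edges\<close>

text \<open>The set \<open>ends G e\<close> is \<open>{u, v}\<close> for an edge joining \<open>u\<close> and \<open>v\<close>, so it is a singleton
  exactly if \<open>e\<close> is a loop. Its value is irrelevant for \<open>e \<notin> edges G\<close>.\<close>

record ('v, 'e) multigraph =
  nodes :: "'v set"
  edges :: "'e set"
  ends :: "'e \<Rightarrow> 'v set"

definition is_graph :: "('v, 'e) multigraph \<Rightarrow> bool" where
  "is_graph G \<longleftrightarrow>
     finite (nodes G) \<and> finite (edges G) \<and> card (nodes G) \<ge> 2 \<and>
     (\<forall>e\<in>edges G. ends G e \<subseteq> nodes G \<and> card (ends G e) \<in> {1, 2})"

definition isomorphic :: "('v, 'e) multigraph \<Rightarrow> ('w, 'f) multigraph \<Rightarrow> bool" where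
  "isomorphic G H \<longleftrightarrow>
     (\<exists>f g. bij_betw f (nodes G) (nodes H) \<and> bij_betw g (edges G) (edges H) \<and>
            (\<forall>e\<in>edges G. ends H (g e) = f ` ends G e))"


section \<open>Minors\<close>

definition delete_edge :: "('v, 'e) multigraph \<Rightarrow> 'e \<Rightarrow> ('v, 'e) multigraph" where
  "delete_edge G e = \<lparr>nodes = nodes G, edges = edges G - {e}, ends = ends G\<rparr>"

definition delete_node :: "('v, 'e) multigraph \<Rightarrow> 'v \<Rightarrow> ('v, 'e) multigraph" where
  "delete_node G v =
     \<lparr>nodes = nodes G - {v}, edges = {e \<in> edges G. v \<notin> ends G e}, ends = ends G\<rparr>"

text \<open>Contraction of an edge \<open>e\<close> with ends \<open>u\<close> and \<open>v\<close>: the node \<open>v\<close> is merged into \<open>u\<close>, and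
  other edges between \<open>u\<close> and \<open>v\<close> become loops. For \<open>u = v\<close>, a loop, this just deletes \<open>e\<close>.\<close>

definition contract_edge :: "('v, 'e) multigraph \<Rightarrow> 'e \<Rightarrow> 'v \<Rightarrow> 'v \<Rightarrow> ('v, 'e) multigraph" where
  "contract_edge G e u v =
     (let h = (\<lambda>x. if x = v then u else x)
      in \<lparr>nodes = h ` nodes G, edges = edges G - {e}, ends = (\<lambda>f. h ` ends G f)\<rparr>)"

inductive minor_step :: "('v, 'e) multigraph \<Rightarrow> ('v, 'e) multigraph \<Rightarrow> bool" where
  contract: "e \<in> edges G \<Longrightarrow> ends G e = {u, v} \<Longrightarrow> minor_step G (contract_edge G e u v)"
| del_edge: "e \<in> edges G \<Longrightarrow> minor_step G (delete_edge G e)"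
| del_node: "v \<in> nodes G \<Longrightarrow> minor_step G (delete_node G v)"

text \<open>Each step strictly decreases the number of nodes or edges, so a minor is proper exactly if
  at least one step is made. Like every graph, a minor must have at least two nodes.\<close>

definition proper_minor :: "('v, 'e) multigraph \<Rightarrow> ('v, 'e) multigraph \<Rightarrow> bool" where
  "proper_minor H G \<longleftrightarrow> minor_step\<^sup>+\<^sup>+ G H \<and> is_graph H"


section \<open>The cut dominant\<close>

text \<open>The edge labels are taken from a finite type, and for a graph with edge set \<open>E\<close> the space
  \<open>\<real>\<^sup>E\<close> is the coordinate subspace of those vectors of \<^typ>\<open>real ^ 'e\<close> that vanish outside \<open>E\<close>.
  A graph and all its minors thus live in the same type. The notion \<^const>\<open>facet_of\<close> is relative
  to the affine hull and hence does not depend on the ambient space.\<close>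

text \<open>A loop belongs to no cut, since its two endnodes coincide.\<close>

definition cut :: "('v, 'e) multigraph \<Rightarrow> 'v set \<Rightarrow> 'e set" where
  "cut G S = {e \<in> edges G. ends G e \<inter> S \<noteq> {} \<and> ends G e - S \<noteq> {}}"

definition char_vec :: "'e set \<Rightarrow> real ^ 'e::finite" where
  "char_vec A = (\<chi> e. indicator A e)"

definition edge_space :: "('v, 'e::finite) multigraph \<Rightarrow> (real ^ 'e) set" where
  "edge_space G = {x. \<forall>e. e \<notin> edges G \<longrightarrow> x $ e = 0}"

definition cut_dominant :: "('v, 'e::finite) multigraph \<Rightarrow> (real ^ 'e) set" where
  "cut_dominant G =
     convex hull {char_vec (cut G S) | S. S \<noteq> {} \<and> S \<subset> nodes G}
     + {y \<in> edge_space G. \<forall>e. y $ e \<ge> 0}"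


section \<open>Facet-defining inequalities and k-graphs\<close>

definition facet_defining :: "('v, 'e::finite) multigraph \<Rightarrow> real ^ 'e \<Rightarrow> real \<Rightarrow> bool" where
  "facet_defining G c l \<longleftrightarrow>
     c \<in> edge_space G \<and> (\<forall>x\<in>cut_dominant G. c \<bullet> x \<ge> l) \<and>
     {x \<in> cut_dominant G. c \<bullet> x = l} facet_of cut_dominant G"

definition min_integer_form :: "('v, 'e::finite) multigraph \<Rightarrow> real ^ 'e \<Rightarrow> real \<Rightarrow> bool" where
  "min_integer_form G c l \<longleftrightarrow>
     (\<exists>(a :: 'e \<Rightarrow> int) (b :: int).
        (\<forall>e\<in>edges G. c $ e = of_int (a e)) \<and> l = of_int b \<and> Gcd (insert b (a ` edges G)) = 1)"

definition k_graph :: "nat \<Rightarrow> ('v, 'e::finite) multigraph \<Rightarrow> bool" where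
  "k_graph k G \<longleftrightarrow>
     (\<forall>c l. facet_defining G c l \<and> min_integer_form G c l \<longrightarrow> l \<le> real k)"

definition k_star :: "('v, 'e::finite) multigraph \<Rightarrow> nat" where
  "k_star G = (LEAST k. k_graph k G)"

definition minor_minimal_non_2_graph :: "('v, 'e::finite) multigraph \<Rightarrow> bool" where
  "minor_minimal_non_2_graph G \<longleftrightarrow>
     is_graph G \<and> k_star G > 2 \<and> (\<forall>H. proper_minor H G \<longrightarrow> k_star H \<le> 2)"


section \<open>Prism and pyramid\<close>

definition simple_graph :: "'v set \<Rightarrow> 'v set set \<Rightarrow> ('v, 'v set) multigraph" where
  "simple_graph V E = \<lparr>nodes = V, edges = E, ends = (\<lambda>e. e)\<rparr>"

text \<open>The complement of the 6-cycle.\<close>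

definition prism :: "(nat, nat set) multigraph" where
  "prism = simple_graph {..<6}
     ({e. e \<subseteq> {..<6} \<and> card e = 2} - {{i, (i + 1) mod 6} | i. i < 6})"

text \<open>\<open>K\<^sub>4\<close> on the nodes 0, 1, 2, 3, where the edges from 0 to 1, 2, 3 are subdivided by the nodes
  4, 5, 6, respectively.\<close>

definition pyramid :: "(nat, nat set) multigraph" where
  "pyramid = simple_graph {..<7}
     {{0, 4}, {4, 1}, {0, 5}, {5, 2}, {0, 6}, {6, 3}, {1, 2}, {1, 3}, {2, 3}}"

end

theory Submission
  imports Defs
begin

text \<open>Rescaling every facet-defining inequality to right-hand side 2 turns the facets of the cut dominant
  into the vertices \<open>x\<close> of \<open>{x \<ge> 0. x(\<delta>(S)) \<ge> 2 for all S}\<close>, and \<open>G\<close> is a 2-graph iff all of them are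
  integral. Contracting the side of a tight set of a nonintegral vertex \<open>x\<close> yields a minor, so in a
  minor-minimal graph every vertex of such a contraction is integral. Uncrossing tight sets and
  counting then show that a minimal tight set with at least two nodes on both sides is a pair joined by an
  edge of value 1, whence \<open>x\<close> is half-integral, and that no node together with an edge of value 1/2
  separates the graph. If some tight cut has at least three nodes on both sides, it contains three disjoint
  edges, and each side contains a triangle rooted at their ends: a prism minor. Otherwise all tight
  sets are nodes or pairs, and the edges of value 1/2 form cycles. The cut around such a cycle
  links a rooted triangle inside it to a rooted triangle or a rooted claw outside, which gives a prism
  or a pyramid minor. By minimality this minor is the whole graph. Conversely, prism and pyramid have
  nonintegral vertices, and their proper minors have fewer than nine edges.\<close>

section \<open>Basic points and 2-graphs\<close>

text \<open>Right-hand side 2 is chosen because a positive right-hand side of a minimum integer form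
  is 1 or 2 exactly if the rescaled point is integral. If a nonintegral value survives a
  contraction, the restricted point is no longer a vertex, since tight sets crossing the contracted
  side are lost. The loss is controlled by directions: weight changes that preserve the tight sets
  of one side (\<open>dirs\<close>). Uncrossing reduces every crossing tight set to sets on the two
  sides, so directions of the two sides that agree on the cut paste to a direction of the whole
  graph. As \<open>x\<close> is a vertex, the boundary patterns of the two sides meet only in 0. If
  the directions of one side form a line, the restriction of \<open>x\<close> lies inside an edge of
  the smaller polyhedron, whose ends are integral by minimality. Half-integrality arises because,
  beyond a minimal tight pair, both ends are reached at step length exactly 1: each node of the pair
  sends boundary value 1 there. Minors are handled as relabellings of the nodes with connected
  classes plus a set of kept edges, and branch sets are grown to partitions of all nodes to fit this
  form.\<close>

definition cuts :: "('v, 'e) multigraph \<Rightarrow> 'e set set" where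
  "cuts G = {cut G S | S. S \<noteq> {} \<and> S \<subset> nodes G}"

text \<open>The vertices of \<open>{x \<ge> 0. x(C) \<ge> 2 for C \<in> K}\<close> in \<open>\<real>\<^sup>F\<close>: no nonzero direction preserves all tight
  constraints. The values of \<open>x\<close> outside \<open>F\<close> are irrelevant.\<close>

definition basic_point :: "'e set \<Rightarrow> 'e set set \<Rightarrow> ('e \<Rightarrow> real) \<Rightarrow> bool" where
  "basic_point F K x \<longleftrightarrow>
     (\<forall>e\<in>F. 0 \<le> x e) \<and> (\<forall>C\<in>K. 2 \<le> sum x C) \<and>
     (\<forall>d. (\<forall>e. e \<notin> F \<longrightarrow> d e = 0) \<longrightarrow> (\<forall>e\<in>F. x e = 0 \<longrightarrow> d e = 0) \<longrightarrow>
        (\<forall>C\<in>K. sum x C = 2 \<longrightarrow> sum d C = 0) \<longrightarrow> (\<forall>e. d e = (0::real)))"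

lemma basic_pointD:
  fixes d :: "'e \<Rightarrow> real"
  assumes "basic_point F K x"
  shows "\<And>e. e \<in> F \<Longrightarrow> 0 \<le> x e" "\<And>C. C \<in> K \<Longrightarrow> 2 \<le> sum x C"
    "\<And>e. (\<And>e. e \<notin> F \<Longrightarrow> d e = 0) \<Longrightarrow> (\<And>e. e \<in> F \<Longrightarrow> x e = 0 \<Longrightarrow> d e = 0) \<Longrightarrow>
       (\<And>C. C \<in> K \<Longrightarrow> sum x C = 2 \<Longrightarrow> sum d C = 0) \<Longrightarrow> d e = 0"
proof -
  show "\<And>e. e \<in> F \<Longrightarrow> 0 \<le> x e" "\<And>C. C \<in> K \<Longrightarrow> 2 \<le> sum x C"
    using assms by (auto simp: basic_point_def)
  fix e
  assume d: "\<And>e. e \<notin> F \<Longrightarrow> d e = 0" "\<And>e. e \<in> F \<Longrightarrow> x e = 0 \<Longrightarrow> d e = 0"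
    "\<And>C. C \<in> K \<Longrightarrow> sum x C = 2 \<Longrightarrow> sum d C = 0"
  have "\<forall>e. d e = 0"
    using assms[unfolded basic_point_def, THEN conjunct2, THEN conjunct2, rule_format, of d] d by metis
  then show "d e = 0" by blast
qed

lemma basic_pointI:
  assumes "\<And>e. e \<in> F \<Longrightarrow> 0 \<le> x e" "\<And>C. C \<in> K \<Longrightarrow> 2 \<le> sum x C"
    "\<And>d :: 'e \<Rightarrow> real. (\<And>e. e \<notin> F \<Longrightarrow> d e = 0) \<Longrightarrow> (\<And>e. e \<in> F \<Longrightarrow> x e = 0 \<Longrightarrow> d e = 0) \<Longrightarrow>
       (\<And>C. C \<in> K \<Longrightarrow> sum x C = 2 \<Longrightarrow> sum d C = 0) \<Longrightarrow> \<forall>e. d e = 0"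
  shows "basic_point F K x"
  unfolding basic_point_def
proof (intro conjI ballI allI impI)
  fix d :: "'e \<Rightarrow> real" and e
  assume "\<forall>e. e \<notin> F \<longrightarrow> d e = 0" "\<forall>e\<in>F. x e = 0 \<longrightarrow> d e = 0" "\<forall>C\<in>K. sum x C = 2 \<longrightarrow> sum d C = 0"
  then show "d e = 0" using assms(3)[of d] by simp
qed (use assms in auto)

lemma cuts_subset_edges: "C \<in> cuts G \<Longrightarrow> C \<subseteq> edges G"
  by (auto simp: cuts_def cut_def)

section \<open>Facets of the cut dominant and basic points\<close>

lemma inner_char_vec: "c \<bullet> char_vec A = (\<Sum>e\<in>A. c $ e)"
proof -
  have "c \<bullet> char_vec A = (\<Sum>e\<in>UNIV. if e \<in> A then c $ e else 0)"
    unfolding inner_vec_def by (rule sum.cong) (auto simp: char_vec_def indicator_def)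
  then show ?thesis by (simp add: sum.If_cases)
qed

lemma cut_dominant_cuts:
  "cut_dominant G = convex hull (char_vec ` cuts G) + {y \<in> edge_space G. \<forall>e. y $ e \<ge> 0}"
  unfolding cut_dominant_def cuts_def by (rule arg_cong2[where f="(+)"]) (auto intro!: arg_cong[where f="(hull) convex"])

lemma in_cut_dominantI:
  "p \<in> convex hull (char_vec ` cuts G) \<Longrightarrow> y \<in> edge_space G \<Longrightarrow> (\<And>e. y $ e \<ge> 0) \<Longrightarrow> p + y \<in> cut_dominant G"
  unfolding cut_dominant_cuts by (auto intro!: set_plus_intro)

lemma cut_dominantE:
  assumes "z \<in> cut_dominant G"
  obtains p y where "z = p + y" "p \<in> convex hull (char_vec ` cuts G)" "y \<in> edge_space G" "\<And>e. y $ e \<ge> 0"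
  using assms unfolding cut_dominant_cuts by (auto elim!: set_plus_elim)

lemma axis_in_edge_space: "e \<in> edges G \<Longrightarrow> axis e t \<in> edge_space G"
  by (auto simp: edge_space_def axis_def)

lemma char_vec_in_cut_dominant: "C \<in> cuts G \<Longrightarrow> char_vec C \<in> cut_dominant G"
  using in_cut_dominantI[of "char_vec C" G 0] by (auto simp: hull_inc edge_space_def)

lemma char_vec_axis_in_cut_dominant:
  "C \<in> cuts G \<Longrightarrow> e \<in> edges G \<Longrightarrow> 0 \<le> t \<Longrightarrow> char_vec C + axis e t \<in> cut_dominant G"
  by (rule in_cut_dominantI) (auto simp: hull_inc axis_in_edge_space, simp add: axis_def)

lemma subspace_edge_space: "subspace (edge_space G)"
  by (auto simp: edge_space_def subspace_def)

lemma char_vec_in_edge_space: "C \<in> cuts G \<Longrightarrow> char_vec C \<in> edge_space G"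
  by (auto simp: edge_space_def char_vec_def indicator_def dest: cuts_subset_edges)

lemma cut_dominant_subset: "cut_dominant G \<subseteq> edge_space G"
proof
  fix z assume "z \<in> cut_dominant G"
  then obtain p y where z: "z = p + y" "p \<in> convex hull (char_vec ` cuts G)" "y \<in> edge_space G"
    by (rule cut_dominantE)
  have "convex hull (char_vec ` cuts G) \<subseteq> edge_space G"
    by (rule hull_minimal) (auto intro: char_vec_in_edge_space subspace_imp_convex subspace_edge_space)
  then show "z \<in> edge_space G"
    using z subspace_edge_space[of G] by (auto intro: subspace_add)
qed

lemma convex_cut_dominant: "convex (cut_dominant G)"
proof -
  have "convex {y \<in> edge_space G. \<forall>e. y $ e \<ge> 0}"
    by (auto simp: convex_def edge_space_def)
  then show ?thesis
    unfolding cut_dominant_cuts by (intro convex_set_plus) auto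
qed

lemma cut_dominant_ge:
  assumes "\<And>C. C \<in> cuts G \<Longrightarrow> l \<le> (\<Sum>e\<in>C. c $ e)" "\<And>e. e \<in> edges G \<Longrightarrow> 0 \<le> c $ e" "z \<in> cut_dominant G"
  shows "l \<le> c \<bullet> z"
proof -
  obtain p y where z: "z = p + y" "p \<in> convex hull (char_vec ` cuts G)" "y \<in> edge_space G" "\<And>e. y $ e \<ge> 0"
    using assms(3) by (rule cut_dominantE) blast
  have "convex hull (char_vec ` cuts G) \<subseteq> {p. c \<bullet> p \<ge> l}"
    by (rule hull_minimal) (auto simp: inner_char_vec assms convex_halfspace_ge)
  moreover have "0 \<le> c \<bullet> y"
  proof -
    have "0 \<le> c $ e * y $ e" for e
      using z assms(2)[of e] by (cases "e \<in> edges G") (auto simp: edge_space_def)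
    then show ?thesis by (simp add: inner_vec_def sum_nonneg)
  qed
  ultimately show ?thesis using z by (auto simp: inner_add_right)
qed

text \<open>A point of the face is a convex combination of tight cuts plus a nonnegative combination of
  unit vectors on which the inequality vanishes.\<close>

lemma face_orthogonal:
  assumes "\<And>C. C \<in> cuts G \<Longrightarrow> l \<le> (\<Sum>e\<in>C. c $ e)" "\<And>e. e \<in> edges G \<Longrightarrow> 0 \<le> c $ e"
    and "z \<in> cut_dominant G" "c \<bullet> z = l"
    and "\<And>e. e \<in> edges G \<Longrightarrow> c $ e = 0 \<Longrightarrow> d $ e = 0"
    and "\<And>C. C \<in> cuts G \<Longrightarrow> (\<Sum>e\<in>C. c $ e) = l \<Longrightarrow> (\<Sum>e\<in>C. d $ e) = 0"
  shows "d \<bullet> z = 0"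
proof -
  obtain p y where z: "z = p + y" "p \<in> convex hull (char_vec ` cuts G)" "y \<in> edge_space G" "\<And>e. y $ e \<ge> 0"
    using assms(3) by (rule cut_dominantE) blast
  have cy: "0 \<le> c $ e * y $ e" for e
    using z assms(2)[of e] by (cases "e \<in> edges G") (auto simp: edge_space_def)
  have "finite (char_vec ` cuts G)"
    by (intro finite_imageI) (rule finite_subset[of _ "Pow UNIV"], auto)
  then obtain u where u: "\<And>v. v \<in> char_vec ` cuts G \<Longrightarrow> 0 \<le> u v" "sum u (char_vec ` cuts G) = 1"
    "p = (\<Sum>v\<in>char_vec ` cuts G. u v *\<^sub>R v)"
    using z(2) by (auto simp: convex_hull_finite)
  have cp: "c \<bullet> p = (\<Sum>v\<in>char_vec ` cuts G. u v * (c \<bullet> v))"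
    by (simp add: u(3) inner_sum_right)
  have le: "u v * l \<le> u v * (c \<bullet> v)" if "v \<in> char_vec ` cuts G" for v
    using that u(1) assms(1) by (auto simp: inner_char_vec intro!: mult_left_mono)
  have l: "l = (\<Sum>v\<in>char_vec ` cuts G. u v * l)"
    by (simp add: sum_distrib_right[symmetric] u(2))
  have "l \<le> c \<bullet> p" unfolding cp by (subst l, rule sum_mono) (rule le)
  moreover have cy0: "0 \<le> c \<bullet> y" unfolding inner_vec_def by (auto intro: sum_nonneg cy)
  moreover have "c \<bullet> p + c \<bullet> y = l" using assms(4) z by (simp add: inner_add_right)
  ultimately have eq: "c \<bullet> p = l" "c \<bullet> y = 0" by auto
  have "u v * l = u v * (c \<bullet> v)" if "v \<in> char_vec ` cuts G" for v
  proof -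
    have "(\<Sum>v\<in>char_vec ` cuts G. u v * (c \<bullet> v) - u v * l) = 0"
      using cp eq l by (simp add: sum_subtractf)
    then have "\<forall>v\<in>char_vec ` cuts G. u v * (c \<bullet> v) - u v * l = 0"
      by (subst (asm) sum_nonneg_eq_0_iff) (use le in \<open>auto intro: finite_imageI finite_subset[of _ "Pow UNIV"]\<close>)
    then show ?thesis using that by auto
  qed
  then have "u v * (d \<bullet> v) = 0" if "v \<in> char_vec ` cuts G" for v
    using that assms(6) by (force simp: inner_char_vec)
  then have "d \<bullet> p = 0"
    by (simp only: u(3) inner_sum_right inner_scaleR_right) (auto intro!: sum.neutral)
  moreover have "c $ e * y $ e = 0" for e
    using eq(2) cy unfolding inner_vec_def by (simp add: sum_nonneg_eq_0_iff)
  then have "d $ e * y $ e = 0" for e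
    using assms(5)[of e] z(3) by (cases "e \<in> edges G") (auto simp: edge_space_def)
  then have "d \<bullet> y = 0" by (simp only: inner_vec_def inner_real_def) (auto intro!: sum.neutral)
  ultimately show ?thesis using z by (simp add: inner_add_right)
qed

text \<open>From a single cut vector every unit vector of \<open>edge_space G\<close> is an
  admissible displacement, and these span. Full-dimensionality turns \<open>facet_of\<close> into a
  codimension-one condition inside \<open>edge_space G\<close>.\<close>

lemma aff_dim_cut_dominant:
  assumes "cuts G \<noteq> {}"
  shows "aff_dim (cut_dominant G) = int (dim (edge_space G))"
proof (rule antisym)
  show "aff_dim (cut_dominant G) \<le> int (dim (edge_space G))"
    using aff_dim_subset[OF cut_dominant_subset[of G]] aff_dim_subspace[OF subspace_edge_space[of G]] by simp
  obtain C where C: "C \<in> cuts G" using assms by blast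
  have "aff_dim (cut_dominant G) = int (dim ((+) (- char_vec C) ` cut_dominant G))"
    by (intro aff_dim_eq_dim hull_inc char_vec_in_cut_dominant C)
  moreover have "edge_space G \<subseteq> span ((+) (- char_vec C) ` cut_dominant G)"
  proof
    fix z assume z: "z \<in> edge_space G"
    have "axis e 1 \<in> (+) (- char_vec C) ` cut_dominant G" if "e \<in> edges G" for e
      using char_vec_axis_in_cut_dominant[OF C that, of 1] by (force simp: image_iff)
    then have "(\<Sum>e\<in>edges G. z $ e *\<^sub>R axis e 1) \<in> span ((+) (- char_vec C) ` cut_dominant G)"
      by (intro span_sum span_mul span_base)
    moreover have "(\<Sum>e\<in>edges G. z $ e *\<^sub>R axis e 1) = z"
    proof (rule vec_eq_iff[THEN iffD2], rule allI)
      fix i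
      have "(\<Sum>e\<in>edges G. z $ e *\<^sub>R axis e 1) $ i = (\<Sum>e\<in>edges G. if i = e then z $ e else 0)"
        unfolding sum_component by (rule sum.cong) (auto simp: axis_def)
      also have "\<dots> = z $ i" using z by (auto simp: edge_space_def)
      finally show "(\<Sum>e\<in>edges G. z $ e *\<^sub>R axis e 1) $ i = z $ i" .
    qed
    ultimately show "z \<in> span ((+) (- char_vec C) ` cut_dominant G)" by simp
  qed
  ultimately show "int (dim (edge_space G)) \<le> aff_dim (cut_dominant G)"
    using dim_subset[of "edge_space G" "span ((+) (- char_vec C) ` cut_dominant G)"] by (simp add: dim_span)
qed

text \<open>A hyperplane \<open>c \<bullet> z = l\<close> with \<open>l \<noteq> 0\<close> misses
  the origin, so adding 0 to \<open>F\<close> raises its affine dimension by exactly one. Facets can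
  thus be recognised by their linear span.\<close>

lemma aff_dim_no_zero:
  fixes F :: "'a::euclidean_space set"
  assumes "\<And>z. z \<in> F \<Longrightarrow> c \<bullet> z = l" "l \<noteq> 0"
  shows "aff_dim F = int (dim F) - 1"
proof -
  have "affine hull F \<subseteq> {z. c \<bullet> z = l}"
    by (rule hull_minimal) (auto simp: assms affine_hyperplane)
  then have "0 \<notin> affine hull F" using assms(2) by auto
  then have "aff_dim (insert 0 F) = aff_dim F + 1" by (simp add: aff_dim_insert)
  moreover have "aff_dim (insert 0 F) = int (dim F)"
    by (subst aff_dim_zero) (auto simp: hull_inc dim_insert span_zero)
  ultimately show ?thesis by simp
qed

text \<open>It suffices that the face spans \<open>edge_space G\<close> linearly. A nonzero vector
  of this space orthogonal to the face would be a direction preserving all tight constraints of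
  \<open>x\<close>, which a basic point excludes.\<close>

lemma facet_of_basic_point:
  assumes bp: "basic_point (edges G) (cuts G) x" and l: "0 < l" and ne: "cuts G \<noteq> {}"
    and c: "\<And>e. c $ e = (if e \<in> edges G then x e * l / 2 else 0)"
  shows "facet_defining G c l"
proof -
  have cC: "(\<Sum>e\<in>C. c $ e) = sum x C * (l / 2)" if "C \<in> cuts G" for C
    using cuts_subset_edges[OF that] by (auto simp: c sum_distrib_right intro!: sum.cong)
  have ge: "l \<le> (\<Sum>e\<in>C. c $ e)" if "C \<in> cuts G" for C
    using mult_right_mono[OF basic_pointD(2)[OF bp that], of "l / 2"] l by (simp add: cC that)
  have nn: "0 \<le> c $ e" if "e \<in> edges G" for e
    using basic_pointD(1)[OF bp that] l by (simp add: c that)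
  define F where "F = {z \<in> cut_dominant G. c \<bullet> z = l}"
  have "c \<in> edge_space G" by (simp add: edge_space_def c)
  moreover have val: "\<forall>z\<in>cut_dominant G. l \<le> c \<bullet> z"
    using cut_dominant_ge[of G l c] ge nn by blast
  moreover have "F facet_of cut_dominant G"
  proof -
    have Feq: "F = cut_dominant G \<inter> {z. c \<bullet> z = l}" by (auto simp: F_def)
    have face: "F face_of cut_dominant G"
      unfolding Feq by (rule face_of_Int_supporting_hyperplane_ge[OF convex_cut_dominant]) (use val in auto)
    have sp: "span F = span (edge_space G)"
    proof (rule ccontr)
      assume neq: "span F \<noteq> span (edge_space G)"
      have "F \<subseteq> edge_space G" using cut_dominant_subset by (auto simp: F_def)
      then have "span F \<subset> span (edge_space G)" using neq span_mono by blast
      then obtain d where d: "d \<noteq> 0" "d \<in> span (edge_space G)" "\<And>y. y \<in> span F \<Longrightarrow> orthogonal d y"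
        by (rule orthogonal_to_subspace_exists_gen) blast
      have dU: "d \<in> edge_space G" using d(2) by (metis span_eq_iff subspace_edge_space)
      have dF: "d \<bullet> y = 0" if "y \<in> F" for y using d(3)[of y] that by (auto simp: orthogonal_def span_base)
      have tight: "char_vec C \<in> F" if "C \<in> cuts G" "sum x C = 2" for C
        using that cC[OF that(1)] by (auto simp: F_def char_vec_in_cut_dominant inner_char_vec)
      have dC: "sum (($) d) C = 0" if "C \<in> cuts G" "sum x C = 2" for C
        using dF[OF tight[OF that]] by (simp add: inner_char_vec)
      \<comment> \<open>Without a tight cut, the unit vector on any edge with
        \<open>x e \<noteq> 0\<close> would be a free direction; so \<open>x\<close> would vanish
        and violate the cut constraints.\<close>
      have "\<exists>C\<in>cuts G. sum x C = 2"
      proof (rule ccontr)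
        assume no: "\<not> ?thesis"
        then have "basic_point (edges G) (cuts G) x" "\<forall>C\<in>cuts G. sum x C \<noteq> 2" using bp by auto
        have "x e = 0" if "e \<in> edges G" for e
        proof (rule ccontr)
          assume "x e \<noteq> 0"
          have "(\<lambda>f. if f = e then 1 else 0 :: real) e = 0"
            by (rule basic_pointD(3)[OF bp, where d = "\<lambda>f. if f = e then 1 else 0"])
              (use that no \<open>x e \<noteq> 0\<close> in \<open>auto split: if_splits\<close>)
          then show False by simp
        qed
        then have "sum x C = 0" if "C \<in> cuts G" for C
          using cuts_subset_edges[OF that] by (auto intro!: sum.neutral)
        then show False using ne basic_pointD(2)[OF bp] by fastforce
      qed
      then obtain C where C: "C \<in> cuts G" "sum x C = 2" by blast
      \<comment> \<open>Moving from a tight cut vector along an edge of coefficient 0 stays in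
        \<open>F\<close>; the difference of the two points isolates \<open>d $ e\<close>.\<close>
      have "d $ e = 0" if "e \<in> edges G" "x e = 0" for e
      proof -
        have "char_vec C + axis e 1 \<in> F"
          using tight[OF C] that char_vec_axis_in_cut_dominant[OF C(1) that(1), of 1]
          by (auto simp: F_def inner_add_right inner_axis c)
        from dF[OF this] dF[OF tight[OF C]] show ?thesis by (simp add: inner_add_right inner_axis)
      qed
      note dx = this
      have "d $ e = 0" for e
        by (rule basic_pointD(3)[OF bp, where d = "($) d"]) (use dU dC dx in \<open>auto simp: edge_space_def\<close>)
      then show False using d(1) by (simp add: vec_eq_iff)
    qed
    have "dim F = dim (edge_space G)" using sp by (metis dim_span)
    moreover have "aff_dim F = int (dim F) - 1"
      by (rule aff_dim_no_zero[of F c l]) (use l in \<open>auto simp: F_def\<close>)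
    ultimately have ad: "aff_dim F = aff_dim (cut_dominant G) - 1"
      using aff_dim_cut_dominant[OF ne] by simp
    have "F \<noteq> {}"
    proof
      assume "F = {}"
      then have "edge_space G \<subseteq> {0}" using sp span_superset[of "edge_space G"] by auto
      then have "edges G = {}" using axis_in_edge_space[of _ G "1::real"] by (force simp: axis_eq_0_iff)
      then have "sum x C = 0" if "C \<in> cuts G" for C using cuts_subset_edges[OF that] by auto
      then show False using ne basic_pointD(2)[OF bp] by fastforce
    qed
    with face ad show ?thesis by (simp add: facet_of_def)
  qed
  ultimately show ?thesis by (simp add: facet_defining_def F_def)
qed

lemma facet_defining_valid:
  assumes "facet_defining G c l" and ne: "cuts G \<noteq> {}"
  shows "\<And>C. C \<in> cuts G \<Longrightarrow> l \<le> (\<Sum>e\<in>C. c $ e)" "\<And>e. e \<in> edges G \<Longrightarrow> 0 \<le> c $ e"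
proof -
  have val: "l \<le> c \<bullet> z" if "z \<in> cut_dominant G" for z
    using assms that by (auto simp: facet_defining_def)
  show "l \<le> (\<Sum>e\<in>C. c $ e)" if "C \<in> cuts G" for C
    using val[OF char_vec_in_cut_dominant[OF that]] by (simp add: inner_char_vec)
  fix e assume e: "e \<in> edges G"
  obtain C where C: "C \<in> cuts G" using ne by blast
  show "0 \<le> c $ e"
  proof (rule ccontr)
    assume neg: "\<not> 0 \<le> c $ e"
    \<comment> \<open>Long enough for the left-hand side to drop below
      \<open>- \<bar>l\<bar>\<close>.\<close>
    define t where "t = (\<bar>c \<bullet> char_vec C\<bar> + \<bar>l\<bar> + 1) / (- (c $ e))"
    have t0: "0 \<le> t" unfolding t_def using neg by (intro divide_nonneg_nonneg) auto
    have "l \<le> c \<bullet> char_vec C + c $ e * t"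
      using val[OF char_vec_axis_in_cut_dominant[OF C e t0]] by (simp add: inner_add_right inner_axis)
    also have "c $ e * t = - (\<bar>c \<bullet> char_vec C\<bar> + \<bar>l\<bar> + 1)"
      using neg by (simp add: t_def)
    finally show False by linarith
  qed
qed

text \<open>An admissible direction \<open>d\<close> is orthogonal to the facet by
  \<open>face_orthogonal\<close>. The facet spans \<open>edge_space G\<close> linearly, because its
  hyperplane misses the origin, so \<open>d\<close> is orthogonal to itself.\<close>

lemma basic_point_of_facet:
  assumes fd: "facet_defining G c l" and l: "0 < l" and ne: "cuts G \<noteq> {}"
  shows "basic_point (edges G) (cuts G) (\<lambda>e. 2 * c $ e / l)"
proof (rule basic_pointI)
  note val = facet_defining_valid[OF fd ne]
  have sumx: "(\<Sum>e\<in>C. 2 * c $ e / l) = 2 * (\<Sum>e\<in>C. c $ e) / l" for C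
    by (simp add: sum_distrib_left sum_divide_distrib)
  show "0 \<le> 2 * c $ e / l" if "e \<in> edges G" for e using val(2)[OF that] l by simp
  show "2 \<le> (\<Sum>e\<in>C. 2 * c $ e / l)" if "C \<in> cuts G" for C
    unfolding sumx using val(1)[OF that] l by (simp add: field_simps)
  fix d :: "'b \<Rightarrow> real"
  assume d: "\<And>e. e \<notin> edges G \<Longrightarrow> d e = 0" "\<And>e. e \<in> edges G \<Longrightarrow> 2 * c $ e / l = 0 \<Longrightarrow> d e = 0"
    "\<And>C. C \<in> cuts G \<Longrightarrow> (\<Sum>e\<in>C. 2 * c $ e / l) = 2 \<Longrightarrow> sum d C = 0"
  define D where "D = (\<chi> e. d e)"
  define F where "F = {z \<in> cut_dominant G. c \<bullet> z = l}"
  have facet: "F facet_of cut_dominant G" and cU: "c \<in> edge_space G"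
    using fd by (auto simp: facet_defining_def F_def)
  have DF: "D \<bullet> z = 0" if "z \<in> F" for z
    by (rule face_orthogonal[of G l c]) (use that val d(2) l d(3)[unfolded sumx] in \<open>auto simp: F_def D_def\<close>)
  have dimF: "int (dim F) = int (dim (edge_space G))"
    using facet aff_dim_no_zero[of F c l] l aff_dim_cut_dominant[OF ne] by (auto simp: F_def facet_of_def)
  have "F \<subseteq> edge_space G" using cut_dominant_subset by (auto simp: F_def)
  then have "span F = span (edge_space G)"
    by (rule dim_eq_span) (use dimF in simp)
  then have "span F = edge_space G"
    using subspace_edge_space[of G] by (simp add: span_eq_iff[THEN iffD2])
  moreover have "D \<in> edge_space G" using d(1) by (simp add: D_def edge_space_def)
  ultimately have "D \<in> span F" by simp
  then have "orthogonal D D" by (rule orthogonal_to_span) (auto simp: orthogonal_def DF)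
  then have "D = 0" by (simp add: orthogonal_def)
  then show "\<forall>e. d e = 0" by (auto simp: D_def vec_eq_iff)
qed

text \<open>The reals are taken as a vector space over the rationals, where \<open>{1}\<close> is
  independent; the map is a linear extension from this set. Additivity and
  \<open>\<phi> 1 = 1\<close> suffice to preserve equations of the form
  \<open>sum x C = 2\<close>.\<close>

lemma rational_projection:
  obtains \<phi> :: "real \<Rightarrow> rat" where "\<And>a b. \<phi> (a + b) = \<phi> a + \<phi> b" "\<phi> 1 = 1"
proof -
  interpret vs: vector_space_pair "\<lambda>(q::rat) (x::real). of_rat q * x" "\<lambda>(q::rat) (x::rat). q * x"
    by unfold_locales (auto simp: algebra_simps of_rat_add of_rat_mult)
  have "vs.vs1.independent {1}" by simp
  from vs.linear_independent_extend[OF this, of "\<lambda>_. 1"]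
  obtain g where "Vector_Spaces.linear (\<lambda>(q::rat) (x::real). of_rat q * x) (\<lambda>(q::rat) (x::rat). q * x) g" "g 1 = 1"
    by blast
  then show ?thesis using that[of g] by (auto simp: vs.linear_add)
qed

text \<open>A \<open>\<rat>\<close>-linear projection \<open>\<phi>\<close> of \<open>\<real>\<close> onto \<open>\<rat>\<close> maps \<open>x\<close> to a solution of the same tight constraints.\<close>

lemma basic_point_rational:
  fixes x :: "'e::finite \<Rightarrow> real"
  assumes bp: "basic_point F K x" and K: "\<And>C. C \<in> K \<Longrightarrow> C \<subseteq> F" and e: "e \<in> F"
  shows "x e \<in> \<rat>"
proof -
  obtain \<phi> :: "real \<Rightarrow> rat" where add: "\<And>a b. \<phi> (a + b) = \<phi> a + \<phi> b" and one: "\<phi> 1 = 1"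
    using rational_projection by blast
  have zero: "\<phi> 0 = 0" using add[of 0 0] by simp
  have two: "\<phi> 2 = 2" using add[of 1 1] one by simp
  have sum: "\<phi> (sum x C) = (\<Sum>e\<in>C. \<phi> (x e))" for C
    by (induction C rule: infinite_finite_induct) (auto simp: zero add)
  define d where "d = (\<lambda>e. if e \<in> F then of_rat (\<phi> (x e)) - x e else 0)"
  have "d e = 0"
  proof (rule basic_pointD(3)[OF bp, where d = d])
    fix C assume C: "C \<in> K" "sum x C = 2"
    have "sum d C = (\<Sum>e\<in>C. of_rat (\<phi> (x e)) - x e)"
      using K[OF C(1)] by (auto simp: d_def intro!: sum.cong)
    also have "\<dots> = 0"
      using C(2) sum[of C] by (simp add: sum_subtractf two flip: of_rat_sum)
    finally show "sum d C = 0" .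
  qed (auto simp: d_def zero)
  then show ?thesis using e by (simp add: d_def) (metis Rats_of_rat)
qed

section \<open>Minimum integer forms: 2-graphs are the graphs with integral basic points\<close>

lemma common_denominator:
  fixes y :: "'a \<Rightarrow> real"
  assumes "finite A" "\<And>e. e \<in> A \<Longrightarrow> y e \<in> \<rat>"
  obtains N :: int where "N > 0" "\<And>e. e \<in> A \<Longrightarrow> of_int N * y e \<in> \<int>"
proof -
  have "\<exists>N::int. N > 0 \<and> (\<forall>e\<in>A. of_int N * y e \<in> \<int>)"
    using assms
  proof (induction A)
    case empty show ?case by (rule exI[of _ 1]) auto
  next
    case (insert a A)
    then obtain N :: int where N: "N > 0" "\<forall>e\<in>A. of_int N * y e \<in> \<int>" by auto
    from insert have "y a \<in> \<rat>" by auto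
    then obtain m n :: int where mn: "n > 0" "y a = of_int m / of_int n" by (auto elim: Rats_cases')
    have "of_int (n * N) * y a = of_int (N * m)" using mn by simp
    moreover have "of_int (n * N) * y e \<in> \<int>" if "e \<in> A" for e
      using N(2) that Ints_mult[OF Ints_of_int[of n], of "of_int N * y e"] by (auto simp: algebra_simps)
    ultimately show ?case using N mn by (intro exI[of _ "n * N"]) (auto simp del: of_int_mult)
  qed
  then show ?thesis using that by blast
qed

lemma cuts_nonempty:
  assumes "is_graph G" shows "cuts G \<noteq> {}"
proof -
  have "2 \<le> card (nodes G)" using assms by (simp add: is_graph_def)
  then obtain v where "v \<in> nodes G" by (metis card.empty ex_in_conv not_numeral_le_zero)
  moreover have "{v} \<noteq> nodes G"
  proof
    assume "{v} = nodes G"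
    then have "card (nodes G) = 1" by (metis is_singleton_altdef is_singletonI)
    then show False using \<open>2 \<le> card (nodes G)\<close> by simp
  qed
  ultimately have "cut G {v} \<in> cuts G" by (auto simp: cuts_def)
  then show ?thesis by blast
qed

text \<open>Clearing denominators gives the integer inequality with coefficients
  \<open>N * y e\<close> and right-hand side \<open>2 * N\<close>; division by the gcd
  \<open>g\<close> gives its minimum integer form, with right-hand side \<open>b'\<close>. The bound
  leaves \<open>b' = 1\<close> and \<open>b' = 2\<close>, and \<open>y e = 2 * a' e / b'\<close> is
  an integer for both.\<close>

lemma k_graph_2_imp_integral:
  fixes H :: "('v, 'e::finite) multigraph"
  assumes G: "is_graph H" and k: "k_graph 2 H" and bp: "basic_point (edges H) (cuts H) y" and e: "e \<in> edges H"
  shows "y e \<in> \<int>"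
proof -
  obtain N :: int where N: "N > 0" "\<And>e. e \<in> edges H \<Longrightarrow> of_int N * y e \<in> \<int>"
    using common_denominator[of "edges H" y] basic_point_rational[OF bp cuts_subset_edges] by auto
  define a where "a = (\<lambda>e. \<lfloor>of_int N * y e\<rfloor>)"
  have a: "of_int (a e) = of_int N * y e" if "e \<in> edges H" for e
    using N(2)[OF that] by (simp add: a_def of_int_floor)
  define g where "g = Gcd (insert (2 * N) (a ` edges H))"
  have g0: "g > 0" using N(1) unfolding g_def by (metis Gcd_0_iff Gcd_int_greater_eq_0 insert_subset less_le mult_eq_0_iff order_less_irrefl singletonD zero_neq_numeral)
  define a' where "a' = (\<lambda>e. a e div g)"
  define b' where "b' = 2 * N div g"
  have ga: "a e = g * a' e" if "e \<in> edges H" for e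
  proof -
    have "g dvd a e" unfolding g_def using that by (intro Gcd_dvd) auto
    then show ?thesis by (simp add: a'_def)
  qed
  have gb: "2 * N = g * b'"
  proof -
    have "g dvd 2 * N" unfolding g_def by (intro Gcd_dvd) auto
    then show ?thesis by (simp add: b'_def)
  qed
  have "insert (2 * N) (a ` edges H) = (*) g ` insert b' (a' ` edges H)"
    using ga gb by (auto simp: image_iff) 
  then have "g = normalize (g * Gcd (insert b' (a' ` edges H)))"
    unfolding g_def by (metis Gcd_mult)
  then have gcd1: "Gcd (insert b' (a' ` edges H)) = 1"
    using g0 by (simp add: abs_mult)
  have b0: "b' > 0" using gb N(1) g0 by (metis mult_pos_pos zero_less_mult_pos zero_less_numeral)
  define c :: "real ^ 'e" where "c = (\<chi> e. if e \<in> edges H then y e * of_int b' / 2 else 0)"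
  have ca: "c $ e = of_int (a' e)" if "e \<in> edges H" for e
  proof -
    have "real_of_int g * of_int (a' e) = of_int N * y e" using a[OF that] ga[OF that] by simp
    moreover have "2 * real_of_int N = of_int g * of_int b'" using gb by (metis of_int_mult of_int_numeral)
    ultimately have "real_of_int g * of_int (a' e) = of_int g * (y e * of_int b' / 2)" by simp
    then show ?thesis using g0 that by (simp add: c_def)
  qed
  have "facet_defining H c (of_int b')"
    by (rule facet_of_basic_point[OF bp]) (use b0 cuts_nonempty[OF G] in \<open>auto simp: c_def\<close>)
  moreover have "min_integer_form H c (of_int b')"
    unfolding min_integer_form_def using ca gcd1 by blast
  ultimately have "real_of_int b' \<le> 2" using k unfolding k_graph_def by fastforce
  then have "b' = 1 \<or> b' = 2" using b0 by linarith
  moreover have "of_int (a' e) = y e * of_int b' / 2" using ca[OF e] e by (simp add: c_def)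
  ultimately have "y e = of_int (2 * a' e) \<or> y e = of_int (a' e)" by auto
  then show ?thesis by (metis Ints_of_int)
qed

text \<open>If \<open>2 * c $ e / l\<close> were integral on all edges, then \<open>l\<close> would
  divide twice each coefficient and twice itself, hence twice their gcd, which is 2.\<close>

lemma not_k_graph_2_imp_nonintegral:
  fixes G :: "('v, 'e::finite) multigraph"
  assumes G: "is_graph G" and k: "\<not> k_graph 2 G"
  obtains x where "basic_point (edges G) (cuts G) x" "\<exists>e\<in>edges G. x e \<notin> \<int>"
proof -
  obtain c l where cl: "facet_defining G c l" "min_integer_form G c l" "l > 2"
    using k unfolding k_graph_def by (auto simp: not_le)
  define x where "x = (\<lambda>e. 2 * c $ e / l)"
  have bp: "basic_point (edges G) (cuts G) x"
    unfolding x_def by (rule basic_point_of_facet[OF cl(1) _ cuts_nonempty[OF G]]) (use cl in auto)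
  obtain a :: "'e \<Rightarrow> int" and b :: int where ab: "\<And>e. e \<in> edges G \<Longrightarrow> c $ e = of_int (a e)" "l = of_int b"
    "Gcd (insert b (a ` edges G)) = 1"
    using cl(2) unfolding min_integer_form_def by blast
  have "\<exists>e\<in>edges G. x e \<notin> \<int>"
  proof (rule ccontr)
    assume "\<not> ?thesis"
    then have int: "x e \<in> \<int>" if "e \<in> edges G" for e using that by auto
    have "b dvd 2 * z" if z: "z \<in> insert b (a ` edges G)" for z
    proof -
      have "b dvd 2 * a e" if e: "e \<in> edges G" for e
      proof -
        obtain n where n: "x e = of_int n" using int[OF e] by (auto elim: Ints_cases)
        have "2 * real_of_int (a e) = of_int b * of_int n"
          using n cl(3) ab(1)[OF e] ab(2) by (simp add: x_def field_simps)
        then have "2 * a e = b * n" by (metis of_int_eq_iff of_int_mult of_int_numeral)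
        then show ?thesis by simp
      qed
      then show ?thesis using z by auto
    qed
    then have "b dvd Gcd ((*) 2 ` insert b (a ` edges G))" by (intro Gcd_greatest) auto
    then have "b dvd 2" unfolding Gcd_mult ab(3) by simp
    then have "b \<le> 2" by (rule zdvd_imp_le) simp
    then show False using cl(3) ab(2) by simp
  qed
  then show ?thesis using bp that by blast
qed

text \<open>Tight cuts and zero coefficients determine the inequality up to scaling, as the
  difference of the two normalised inequalities is a direction that a basic point forbids.
  Coprimality then makes \<open>l\<close> divide \<open>l'\<close>. Exchanging the two forms gives
  equality.\<close>

lemma min_integer_form_unique:
  fixes G :: "('v, 'e::finite) multigraph"
  assumes G: "is_graph G"
    and 1: "facet_defining G c l" "min_integer_form G c l" "l > 0"
    and 2: "facet_defining G c' l'" "min_integer_form G c' l'" "l' > 0"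
    and tight: "{C \<in> cuts G. (\<Sum>e\<in>C. c $ e) = l} = {C \<in> cuts G. (\<Sum>e\<in>C. c' $ e) = l'}"
    and zero: "{e \<in> edges G. c $ e = 0} = {e \<in> edges G. c' $ e = 0}"
  shows "l \<le> l'"
proof -
  note ne = cuts_nonempty[OF G]
  have bp: "basic_point (edges G) (cuts G) (\<lambda>e. 2 * c $ e / l)" by (rule basic_point_of_facet[OF 1(1,3) ne])
  have s: "(\<Sum>e\<in>C. 2 * c $ e / l) = 2 \<longleftrightarrow> (\<Sum>e\<in>C. c $ e) = l" for C
  proof -
    have sum2: "(\<Sum>e\<in>C. 2 * c $ e / l) = 2 * (\<Sum>e\<in>C. c $ e) / l"
      by (simp add: sum_distrib_left sum_divide_distrib)
    then show ?thesis using 1(3) by (subst sum2) (auto simp: divide_eq_eq)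
  qed
  have cU: "c $ e = 0" "c' $ e = 0" if "e \<notin> edges G" for e
    using 1(1) 2(1) that by (auto simp: facet_defining_def edge_space_def)
  have eq: "c $ e / l - c' $ e / l' = 0" for e
  proof (rule basic_pointD(3)[OF bp, where d = "\<lambda>e. c $ e / l - c' $ e / l'"])
    show "c $ e / l - c' $ e / l' = 0" if "e \<in> edges G" "2 * c $ e / l = 0" for e
      using that 1(3) zero by auto
    fix C assume C: "C \<in> cuts G" "(\<Sum>e\<in>C. 2 * c $ e / l) = 2"
    then have "(\<Sum>e\<in>C. c $ e) = l" "(\<Sum>e\<in>C. c' $ e) = l'" using tight s by auto
    then show "(\<Sum>e\<in>C. c $ e / l - c' $ e / l') = 0"
      using 1(3) 2(3) by (simp add: sum_subtractf flip: sum_divide_distrib)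
  qed (use cU in auto)
  obtain a b where ab: "\<And>e. e \<in> edges G \<Longrightarrow> c $ e = of_int (a e)" "l = of_int b" "Gcd (insert b (a ` edges G)) = 1"
    using 1(2) unfolding min_integer_form_def by blast
  obtain a' b' where ab': "\<And>e. e \<in> edges G \<Longrightarrow> c' $ e = of_int (a' e)" "l' = of_int b'"
    using 2(2) unfolding min_integer_form_def by blast
  have "b dvd b' * z" if z: "z \<in> insert b (a ` edges G)" for z
  proof -
    have "b dvd b' * a e" if e: "e \<in> edges G" for e
    proof -
      have "real_of_int b' * of_int (a e) = of_int b * of_int (a' e)"
        using eq[of e] ab(1)[OF e] ab(2) ab'(1)[OF e] ab'(2) 1(3) 2(3) by (simp add: field_simps)
      then have "b' * a e = b * a' e" by (metis of_int_eq_iff of_int_mult)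
      then show ?thesis by simp
    qed
    then show ?thesis using z by auto
  qed
  then have "b dvd Gcd ((*) b' ` insert b (a ` edges G))" by (intro Gcd_greatest) auto
  then have "b dvd b'" unfolding Gcd_mult ab(3) by simp
  then have "b \<le> b'" using 2(3) ab'(2) by (intro zdvd_imp_le) auto
  then show ?thesis using ab(2) ab'(2) by simp
qed

text \<open>\<open>k_star\<close> is a \<open>LEAST\<close>, which is meaningful only if some bound
  exists. A positive right-hand side is determined by its set of tight cuts and its set of zero
  edges, and there are finitely many such pairs; nonpositive ones are below every
  \<open>k\<close>.\<close>

lemma k_graph_exists:
  fixes G :: "('v, 'e::finite) multigraph"
  assumes G: "is_graph G"
  shows "\<exists>k. k_graph k G"
proof -
  define L where "L = {l. l > 0 \<and> (\<exists>c. facet_defining G c l \<and> min_integer_form G c l)}"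
  have "\<forall>l\<in>L. \<exists>c. facet_defining G c l \<and> min_integer_form G c l \<and> l > 0" by (auto simp: L_def)
  then obtain c where c: "\<And>l. l \<in> L \<Longrightarrow> facet_defining G (c l) l \<and> min_integer_form G (c l) l \<and> l > 0"
    by metis
  define t where "t = (\<lambda>l. ({C \<in> cuts G. (\<Sum>e\<in>C. c l $ e) = l}, {e \<in> edges G. c l $ e = 0}))"
  have "inj_on t L"
  proof (rule inj_onI)
    fix l l' assume ll: "l \<in> L" "l' \<in> L" "t l = t l'"
    note cl = c[OF ll(1)] and cl' = c[OF ll(2)]
    show "l = l'"
    proof (rule antisym)
      show "l \<le> l'" by (rule min_integer_form_unique[OF G, of "c l" _ "c l'"]) (use cl cl' ll(3) in \<open>auto simp: t_def\<close>)
      show "l' \<le> l" by (rule min_integer_form_unique[OF G, of "c l'" _ "c l"]) (use cl cl' ll(3) in \<open>auto simp: t_def\<close>)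
    qed
  qed
  moreover have "finite (t ` L)" by simp
  ultimately have fin: "finite L" by (rule finite_imageD[rotated])
  define k where "k = nat \<lceil>Max (insert 0 L)\<rceil>"
  have "l \<le> real k" if "facet_defining G c' l" "min_integer_form G c' l" for c' l
  proof (cases "l > 0")
    case True
    then have "l \<in> L" using that by (auto simp: L_def)
    then have "l \<le> Max (insert 0 L)" using fin by simp
    then show ?thesis unfolding k_def by linarith
  qed auto
  then show ?thesis unfolding k_graph_def by blast
qed

lemma k_star_le_2_iff:
  fixes G :: "('v, 'e::finite) multigraph"
  assumes "is_graph G"
  shows "k_star G \<le> 2 \<longleftrightarrow> k_graph 2 G"
proof
  assume le: "k_star G \<le> 2"
  have "k_graph (k_star G) G" unfolding k_star_def using k_graph_exists[OF assms] by (auto intro: LeastI_ex)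
  then show "k_graph 2 G" using le unfolding k_graph_def by (metis of_nat_le_iff order_trans)
next
  assume "k_graph 2 G" then show "k_star G \<le> 2" unfolding k_star_def by (rule Least_le)
qed

lemma k_star_gt_2_iff:
  fixes G :: "('v, 'e::finite) multigraph"
  assumes "is_graph G"
  shows "k_star G > 2 \<longleftrightarrow> (\<exists>x. basic_point (edges G) (cuts G) x \<and> (\<exists>e\<in>edges G. x e \<notin> \<int>))"
  using k_star_le_2_iff[OF assms] k_graph_2_imp_integral[OF assms] not_k_graph_2_imp_nonintegral[OF assms]
  by (metis not_le)

section \<open>Quotients by connected classes\<close>

text \<open>Connectivity is expressed by cuts instead of walks: cut inequalities deliver it
  directly, and contraction only asks for one edge leaving a node of its class.\<close>

definition conn :: "('v, 'e) multigraph \<Rightarrow> 'v set \<Rightarrow> bool" where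
  "conn G U \<longleftrightarrow> U \<noteq> {} \<and>
     (\<forall>A. A \<noteq> {} \<longrightarrow> A \<subset> U \<longrightarrow> (\<exists>e\<in>edges G. \<exists>a\<in>A. \<exists>b\<in>U - A. ends G e = {a, b}))"

text \<open>The cuts of the minor that contracts the classes of \<open>f\<close> and keeps the edges
  \<open>F\<close>, written with the edges of \<open>G\<close> so that the minor itself need not be
  mentioned.\<close>

definition quotient_cuts :: "('v, 'e) multigraph \<Rightarrow> ('v \<Rightarrow> 'w) \<Rightarrow> 'e set \<Rightarrow> 'e set set" where
  "quotient_cuts G f F = {F \<inter> cut G (f -` Y) | Y. Y \<noteq> {} \<and> Y \<subset> f ` nodes G}"

lemma connE:
  assumes "conn G U" "A \<noteq> {}" "A \<subset> U"
  obtains e a b where "e \<in> edges G" "a \<in> A" "b \<in> U - A" "ends G e = {a, b}"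
proof -
  have "\<exists>e\<in>edges G. \<exists>a\<in>A. \<exists>b\<in>U - A. ends G e = {a, b}"
    using assms by (simp add: conn_def)
  then show ?thesis using that by blast
qed

lemma conn_singleton: "conn G {v}"
  unfolding conn_def by auto

lemma minor_steps_delete_edges:
  assumes "finite D" "D \<subseteq> edges G"
  shows "minor_step\<^sup>*\<^sup>* G \<lparr>nodes = nodes G, edges = edges G - D, ends = ends G\<rparr>"
  using assms
proof (induction D)
  case empty
  have "\<lparr>nodes = nodes G, edges = edges G - {}, ends = ends G\<rparr> = G" by simp
  then show ?case by (simp only: rtranclp.rtrancl_refl)
next
  case (insert e D)
  let ?H = "\<lparr>nodes = nodes G, edges = edges G - D, ends = ends G\<rparr>"
  have "minor_step ?H (delete_edge ?H e)" by (rule minor_step.del_edge) (use insert in auto)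
  moreover have "delete_edge ?H e = \<lparr>nodes = nodes G, edges = edges G - insert e D, ends = ends G\<rparr>"
    by (auto simp: delete_edge_def)
  ultimately show ?case using insert by (auto intro: rtranclp.rtrancl_into_rtrancl)
qed

text \<open>As long as two nodes share a label, some edge inside their class can be contracted, and
  the classes remain connected. It is never an edge of \<open>F\<close>, whose ends have two labels.
  Once \<open>f\<close> is injective only edge deletions remain.\<close>

lemma quotient_minor:
  assumes "finite (nodes G)" "finite (edges G)" "\<And>e. e \<in> edges G \<Longrightarrow> ends G e \<subseteq> nodes G"
    and "\<And>y. y \<in> f ` nodes G \<Longrightarrow> conn G {v \<in> nodes G. f v = y}"
    and "F \<subseteq> edges G" "\<And>e. e \<in> F \<Longrightarrow> card (f ` ends G e) = 2"
  shows "\<exists>H. minor_step\<^sup>*\<^sup>* G H \<and> edges H = F \<and> bij_betw f (nodes H) (f ` nodes G) \<and>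
           (\<forall>e\<in>F. f ` ends H e = f ` ends G e \<and> ends H e \<subseteq> nodes H)"
  using assms
proof (induction "card (nodes G)" arbitrary: G rule: less_induct)
  case less
  show ?case
  proof (cases "inj_on f (nodes G)")
    case True
    define H where "H = \<lparr>nodes = nodes G, edges = edges G - (edges G - F), ends = ends G\<rparr>"
    have "minor_step\<^sup>*\<^sup>* G H" unfolding H_def by (rule minor_steps_delete_edges) (use less(3) in auto)
    moreover have "edges H = F" using less(6) by (auto simp: H_def)
    moreover have "\<forall>e\<in>F. ends H e \<subseteq> nodes H" using less(4,6) by (auto simp: H_def)
    moreover have "ends H = ends G" "bij_betw f (nodes H) (f ` nodes G)" using True by (auto simp: H_def bij_betw_def)
    ultimately show ?thesis by (intro exI[of _ H]) simp
  next
    case False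
    then obtain p q where pq: "p \<in> nodes G" "q \<in> nodes G" "p \<noteq> q" "f p = f q" by (auto simp: inj_on_def)
    define U where "U = {v \<in> nodes G. f v = f p}"
    have "conn G U" unfolding U_def by (rule less(5)) (use pq in auto)
    moreover have "{p} \<subset> U" using pq by (auto simp: U_def)
    ultimately obtain e a b where "e \<in> edges G" "a \<in> {p}" "b \<in> U - {p}" "ends G e = {a, b}"
      using connE[of G U "{p}"] by blast
    then have e: "e \<in> edges G" "ends G e = {p, b}" "b \<in> nodes G" "b \<noteq> p" "f b = f p" by (auto simp: U_def)
    define h where "h = (\<lambda>x. if x = b then p else x)"
    define G' where "G' = contract_edge G e p b"
    have G': "nodes G' = h ` nodes G" "edges G' = edges G - {e}" "ends G' = (\<lambda>f. h ` ends G f)"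
      by (auto simp: G'_def contract_edge_def h_def Let_def)
    have nG': "nodes G' = nodes G - {b}" using pq e by (auto simp: G' h_def)
    have fh: "f (h x) = f x" for x using e by (auto simp: h_def)
    have fim: "f ` nodes G' = f ` nodes G" unfolding G' image_image fh ..
    have fends: "f ` ends G' e' = f ` ends G e'" for e' unfolding G' image_image fh ..
    have step: "minor_step G G'" unfolding G'_def by (rule minor_step.contract) (use e in auto)
    have eF: "e \<notin> F"
    proof
      assume "e \<in> F"
      then have "card (f ` ends G e) = 2" by (rule less(7))
      then show False using e by simp
    qed
    have "\<exists>H. minor_step\<^sup>*\<^sup>* G' H \<and> edges H = F \<and> bij_betw f (nodes H) (f ` nodes G') \<and>
           (\<forall>e\<in>F. f ` ends H e = f ` ends G' e \<and> ends H e \<subseteq> nodes H)"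
    proof (rule less(1))
      show "card (nodes G') < card (nodes G)" unfolding nG' by (rule psubset_card_mono) (use less(2) e in auto)
      show "finite (nodes G')" "finite (edges G')" using less(2,3) by (auto simp: G')
      show "ends G' e' \<subseteq> nodes G'" if "e' \<in> edges G'" for e' using that less(4)[of e'] by (auto simp: G')
      show "F \<subseteq> edges G'" using less(6) eF by (auto simp: G')
      show "card (f ` ends G' e') = 2" if "e' \<in> F" for e' unfolding fends using less(7)[OF that] by simp
      fix y assume "y \<in> f ` nodes G'"
      then have y: "y \<in> f ` nodes G" by (simp add: fim)
      define W where "W = {v \<in> nodes G. f v = y}"
      have W: "conn G W" unfolding W_def by (rule less(5)[OF y])
      have W': "{v \<in> nodes G'. f v = y} = W - {b}" by (auto simp: nG' W_def)
      have hW: "h w \<in> W - {b} \<longleftrightarrow> w \<in> W" if "w \<in> nodes G" for w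
        using e that pq by (auto simp: W_def h_def)
      show "conn G' {v \<in> nodes G'. f v = y}"
        unfolding conn_def W'
      proof (intro conjI allI impI)
        obtain w where "w \<in> nodes G" "f w = y" using y by auto
        then have "w \<in> W" by (simp add: W_def)
        then have "h w \<in> W - {b}" using hW[of w] \<open>w \<in> nodes G\<close> by simp
        then show "W - {b} \<noteq> {}" by blast
        fix A assume A: "A \<noteq> {}" "A \<subset> W - {b}"
        \<comment> \<open>The part \<open>A\<close> of the contracted class is pulled back along the
          merging map \<open>h\<close>. An edge of \<open>G\<close> leaving \<open>A'\<close> has
          its ends on different sides also after the merge, so it is not the contracted
          edge.\<close>
        define A' where "A' = {w \<in> W. h w \<in> A}"
        have "A' \<subset> W"
        proof -
          obtain w where "w \<in> W - {b}" "w \<notin> A" using A by blast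
          then have "w \<notin> A'" by (auto simp: A'_def h_def)
          then show ?thesis using \<open>w \<in> W - {b}\<close> by (auto simp: A'_def)
        qed
        moreover have "A' \<noteq> {}" using A by (auto simp: A'_def h_def)
        ultimately obtain e' a c where e': "e' \<in> edges G" "a \<in> A'" "c \<in> W - A'" "ends G e' = {a, c}"
          using connE[OF W, of A'] by blast
        have "h p = h b" by (simp add: h_def)
        then have "e' \<noteq> e" using e' e by (auto simp: A'_def doubleton_eq_iff)
        moreover have "h a \<in> A" using e' by (auto simp: A'_def)
        moreover have "h c \<in> W - {b} - A" using e' hW[of c] by (auto simp: A'_def W_def)
        moreover have "ends G' e' = {h a, h c}" by (simp add: G' e')
        ultimately show "\<exists>e\<in>edges G'. \<exists>a\<in>A. \<exists>ba\<in>W - {b} - A. ends G' e = {a, ba}"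
          unfolding G'(2) using e'(1) by blast
      qed
    qed
    then obtain H where H: "minor_step\<^sup>*\<^sup>* G' H" "edges H = F" "bij_betw f (nodes H) (f ` nodes G)"
      "\<forall>e\<in>F. f ` ends H e = f ` ends G e \<and> ends H e \<subseteq> nodes H" unfolding fim fends by blast
    have "minor_step\<^sup>*\<^sup>* G H" using step H(1) by (rule converse_rtranclp_into_rtranclp)
    then show ?thesis using H by blast
  qed
qed

lemma cuts_eq_quotient_cuts:
  assumes F: "edges H = F" "F \<subseteq> edges G" and f: "bij_betw f (nodes H) (f ` nodes G)"
    and e: "\<forall>e\<in>F. f ` ends H e = f ` ends G e \<and> ends H e \<subseteq> nodes H"
  shows "cuts H = quotient_cuts G f F"
proof -
  have cut: "cut H S = F \<inter> cut G (f -` (f ` S))" if S: "S \<subseteq> nodes H" for S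
  proof -
    have "ends H e \<inter> S \<noteq> {} \<longleftrightarrow> ends G e \<inter> f -` (f ` S) \<noteq> {}"
      "ends H e - S \<noteq> {} \<longleftrightarrow> ends G e - f -` (f ` S) \<noteq> {}" if "e \<in> F" for e
    proof -
      have inj: "f v = f s \<longleftrightarrow> v = s" if "v \<in> ends H e" "s \<in> S" for v s
      proof (rule inj_on_eq_iff[OF bij_betw_imp_inj_on[OF f]])
        show "v \<in> nodes H" "s \<in> nodes H" using S e \<open>e \<in> F\<close> that by auto
      qed
      have fe: "f ` ends H e = f ` ends G e" using e that by auto
      have mem: "v \<in> S \<longleftrightarrow> f v \<in> f ` S" if "v \<in> ends H e" for v using inj[OF that] by auto
      have "ends H e \<inter> S \<noteq> {} \<longleftrightarrow> f ` ends H e \<inter> f ` S \<noteq> {}" using mem by blast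
      moreover have "ends H e - S \<noteq> {} \<longleftrightarrow> f ` ends H e - f ` S \<noteq> {}" using mem by blast
      moreover have "f ` ends G e \<inter> f ` S \<noteq> {} \<longleftrightarrow> ends G e \<inter> f -` (f ` S) \<noteq> {}" by blast
      moreover have "f ` ends G e - f ` S \<noteq> {} \<longleftrightarrow> ends G e - f -` (f ` S) \<noteq> {}" by blast
      ultimately show "ends H e \<inter> S \<noteq> {} \<longleftrightarrow> ends G e \<inter> f -` (f ` S) \<noteq> {}"
        "ends H e - S \<noteq> {} \<longleftrightarrow> ends G e - f -` (f ` S) \<noteq> {}" unfolding fe by simp_all
    qed
    note iff = this
    show ?thesis
    proof (rule set_eqI)
      fix e show "e \<in> cut H S \<longleftrightarrow> e \<in> F \<inter> cut G (f -` (f ` S))"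
      proof (cases "e \<in> F")
        case True
        then have "e \<in> edges G" using F(2) by blast
        then show ?thesis using iff[OF True] True unfolding cut_def F(1) by simp
      qed (simp add: cut_def F(1))
    qed
  qed
  show ?thesis
  proof (intro set_eqI iffI)
    fix C assume "C \<in> cuts H"
    then obtain S where S: "C = cut H S" "S \<noteq> {}" "S \<subset> nodes H" by (auto simp: cuts_def)
    have "inj_on f (nodes H)" using f by (rule bij_betw_imp_inj_on)
    then have "f ` S \<subset> f ` nodes H"
      using S(3) by (metis image_strict_mono)
    then have "f ` S \<noteq> {}" "f ` S \<subset> f ` nodes G" using S f by (auto simp: bij_betw_def)
    moreover have "C = F \<inter> cut G (f -` (f ` S))" using cut[of S] S by simp
    ultimately show "C \<in> quotient_cuts G f F" unfolding quotient_cuts_def by blast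
  next
    fix C assume "C \<in> quotient_cuts G f F"
    then obtain Y where Y: "C = F \<inter> cut G (f -` Y)" "Y \<noteq> {}" "Y \<subset> f ` nodes G" by (auto simp: quotient_cuts_def)
    define S where "S = nodes H \<inter> f -` Y"
    have fn: "f ` nodes H = f ` nodes G" using f by (simp add: bij_betw_def)
    have fS: "f ` S = Y"
    proof
      show "Y \<subseteq> f ` S"
      proof
        fix y assume "y \<in> Y"
        then obtain w where "w \<in> nodes H" "y = f w" using Y(3) fn by blast
        then show "y \<in> f ` S" using \<open>y \<in> Y\<close> by (auto simp: S_def)
      qed
    qed (auto simp: S_def)
    then have "S \<noteq> {}" "S \<subset> nodes H" using Y fn by (auto simp: S_def)
    moreover have "C = cut H S" using cut[of S] Y fS by (simp add: S_def)
    ultimately show "C \<in> cuts H" unfolding cuts_def by blast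
  qed
qed

text \<open>This turns statements about labels into statements about minors: from here on, a minor
  is a relabelling with connected classes together with a set \<open>F\<close> of edges joining
  different classes.\<close>

lemma quotient_nonintegral_proper_minor:
  fixes G :: "('v, 'e::finite) multigraph"
  assumes G: "is_graph G"
    and conn: "\<And>y. y \<in> f ` nodes G \<Longrightarrow> conn G {v \<in> nodes G. f v = y}" and card: "card (f ` nodes G) \<ge> 2"
    and F: "F \<subseteq> edges G" "\<And>e. e \<in> F \<Longrightarrow> card (f ` ends G e) = 2"
    and proper: "\<not> (inj_on f (nodes G) \<and> F = edges G)"
    and bp: "basic_point F (quotient_cuts G f F) y" and nonint: "\<exists>e\<in>F. y e \<notin> \<int>"
  shows "\<exists>H. proper_minor H G \<and> k_star H > 2"
proof -
  obtain H where H: "minor_step\<^sup>*\<^sup>* G H" "edges H = F" "bij_betw f (nodes H) (f ` nodes G)"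
    "\<forall>e\<in>F. f ` ends H e = f ` ends G e \<and> ends H e \<subseteq> nodes H"
  proof -
    have "finite (nodes G)" "finite (edges G)" "\<And>e. e \<in> edges G \<Longrightarrow> ends G e \<subseteq> nodes G"
      using G by (auto simp: is_graph_def)
    from quotient_minor[OF this conn F] show ?thesis using that by blast
  qed
  have "H \<noteq> G" using H proper by (auto simp: bij_betw_def)
  then have "minor_step\<^sup>+\<^sup>+ G H" using H(1) by (metis rtranclpD)
  moreover have gH: "is_graph H"
  proof -
    have "finite (nodes H)" using H(3) G by (metis bij_betw_finite finite_imageI is_graph_def)
    moreover have "card (nodes H) = card (f ` nodes G)" by (rule bij_betw_same_card[OF H(3)])
    moreover have "card (ends H e) = 2" if "e \<in> F" for e
    proof -
      have "inj_on f (ends H e)" using H(3,4) that by (meson bij_betw_imp_inj_on inj_on_subset)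
      then have "card (ends H e) = card (f ` ends H e)" by (simp add: card_image)
      then show ?thesis using H(4) F(2) that by simp
    qed
    moreover have "finite (edges H)" using H(2) F(1) G unfolding is_graph_def by (metis finite_subset)
    ultimately show ?thesis using card H(2,4) unfolding is_graph_def by simp
  qed
  ultimately have "proper_minor H G" by (simp add: proper_minor_def)
  moreover have "cuts H = quotient_cuts G f F" by (rule cuts_eq_quotient_cuts[OF H(2) F(1) H(3,4)])
  then have "k_star H > 2" using k_star_gt_2_iff[OF gH] bp nonint H(2) by auto
  ultimately show ?thesis by blast
qed

section \<open>Tight sets of a minimal fractional vertex\<close>

text \<open>The minimality assumption is stated once for relabellings by nodes and once for relabellings by
  numbers, since locale assumptions are monomorphic.\<close>

locale fractional_minimal =
  fixes G :: "('v, 'e::finite) multigraph" and x :: "'e \<Rightarrow> real"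
  assumes graph: "is_graph G"
    and basic: "basic_point (edges G) (cuts G) x"
    and nonintegral: "\<exists>e\<in>edges G. x e \<notin> \<int>"
    and minimal: "\<And>(f :: 'v \<Rightarrow> 'v) F y e. (\<And>u. u \<in> f ` nodes G \<Longrightarrow> conn G {v \<in> nodes G. f v = u}) \<Longrightarrow>
      card (f ` nodes G) \<ge> 2 \<Longrightarrow> F \<subseteq> edges G \<Longrightarrow> (\<And>e. e \<in> F \<Longrightarrow> card (f ` ends G e) = 2) \<Longrightarrow>
      \<not> (inj_on f (nodes G) \<and> F = edges G) \<Longrightarrow> basic_point F (quotient_cuts G f F) y \<Longrightarrow> e \<in> F \<Longrightarrow> y e \<in> \<int>"
    and minimal_nat: "\<And>(f :: 'v \<Rightarrow> nat) F y e. (\<And>u. u \<in> f ` nodes G \<Longrightarrow> conn G {v \<in> nodes G. f v = u}) \<Longrightarrow>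
      card (f ` nodes G) \<ge> 2 \<Longrightarrow> F \<subseteq> edges G \<Longrightarrow> (\<And>e. e \<in> F \<Longrightarrow> card (f ` ends G e) = 2) \<Longrightarrow>
      \<not> (inj_on f (nodes G) \<and> F = edges G) \<Longrightarrow> basic_point F (quotient_cuts G f F) y \<Longrightarrow> e \<in> F \<Longrightarrow> y e \<in> \<int>"
begin

abbreviation "V \<equiv> nodes G"
abbreviation "E \<equiv> edges G"
abbreviation "\<delta> \<equiv> cut G"

definition val :: "('e \<Rightarrow> real) \<Rightarrow> 'v set \<Rightarrow> real" where "val w S = sum w (\<delta> S)"
definition tight :: "'v set \<Rightarrow> bool" where "tight S \<longleftrightarrow> S \<noteq> {} \<and> S \<subset> V \<and> val x S = 2"
definition touch :: "'v set \<Rightarrow> 'e set" where "touch T = {e \<in> E. ends G e \<inter> T \<noteq> {}}"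
definition inside :: "'v set \<Rightarrow> 'e set" where "inside T = {e \<in> E. ends G e \<subseteq> T}"
definition between :: "'v set \<Rightarrow> 'v set \<Rightarrow> 'e set" where
  "between P Q = {e \<in> E. ends G e \<inter> P \<noteq> {} \<and> ends G e \<inter> Q \<noteq> {}}"
text \<open>Moving \<open>x\<close> along such a \<open>d\<close> keeps the tight sets inside \<open>T\<close> tight.\<close>
definition dirs :: "'v set \<Rightarrow> ('e \<Rightarrow> real) \<Rightarrow> bool" where
  "dirs T d \<longleftrightarrow> (\<forall>S. S \<subseteq> T \<longrightarrow> tight S \<longrightarrow> val d S = 0)"

lemma finV[simp]: "finite V" and finE[simp]: "finite (A :: 'e set)"
  using graph by (auto simp: is_graph_def)

lemma cardV: "card V \<ge> 2"
  using graph by (auto simp: is_graph_def)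

lemma finVsub: "S \<subseteq> V \<Longrightarrow> finite S"
  using finV by (rule rev_finite_subset)

lemma ends_sub: "e \<in> E \<Longrightarrow> ends G e \<subseteq> V"
  using graph by (auto simp: is_graph_def)

lemma cut_sub: "\<delta> S \<subseteq> E"
  by (auto simp: cut_def)

lemma val_ge: "S \<noteq> {} \<Longrightarrow> S \<subset> V \<Longrightarrow> 2 \<le> val x S"
  unfolding val_def by (rule basic_pointD(2)[OF basic]) (auto simp: cuts_def)

lemma direction_zero:
  assumes "\<And>e. e \<notin> E \<Longrightarrow> d e = 0" "\<And>e. e \<in> E \<Longrightarrow> x e = 0 \<Longrightarrow> d e = 0"
    "\<And>S. tight S \<Longrightarrow> val d S = 0"
  shows "d e = 0"
proof (rule basic_pointD(3)[OF basic, where d = d])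
  fix C assume "C \<in> cuts G" "sum x C = 2"
  then show "sum d C = 0" using assms(3) unfolding cuts_def tight_def val_def by blast
qed (use assms in auto)

text \<open>A loop is in no cut, so the unit vector on it would be a free direction. Loops of value
  0 escape this argument; they disappear with all other zero edges in \<open>pos\<close>.\<close>

lemma nonloop_aux: "e \<in> E \<Longrightarrow> x e \<noteq> 0 \<Longrightarrow> card (ends G e) = 2"
proof (rule ccontr)
  assume e: "e \<in> E" "x e \<noteq> 0" "card (ends G e) \<noteq> 2"
  then have "card (ends G e) = 1" using graph by (auto simp: is_graph_def)
  then obtain u where "ends G e = {u}" by (auto simp: card_1_singleton_iff)
  then have "e \<notin> \<delta> S" for S by (auto simp: cut_def)
  then have v: "val (\<lambda>f. if f = e then 1 else 0) S = 0" for S by (simp add: val_def)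
  define d where "d = (\<lambda>f. if f = e then 1 else (0::real))"
  have "d e = 0"
  proof (rule direction_zero)
    show "val d S = 0" for S using v by (simp add: d_def)
  qed (use e in \<open>auto simp: d_def split: if_splits\<close>)
  then show False by (simp add: d_def)
qed

text \<open>Deleting all edges of value 0 keeps \<open>x\<close> basic and keeps its nonintegral
  values, so minimality, applied with the identity as labelling, leaves no such edge.\<close>

lemma pos: "e \<in> E \<Longrightarrow> 0 < x e"
proof -
  define F where "F = {e \<in> E. x e \<noteq> 0}"
  have sumF: "sum w (F \<inter> C) = sum w C" if "\<And>e. e \<in> E \<Longrightarrow> x e = 0 \<Longrightarrow> w e = 0" "C \<subseteq> E" for w :: "'e \<Rightarrow> real" and C
    by (rule sum.mono_neutral_left) (use that in \<open>auto simp: F_def\<close>)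
  have "F = E"
  proof (rule ccontr)
    assume neq: "F \<noteq> E"
    have bp: "basic_point F (quotient_cuts G id F) x"
    proof (rule basic_pointI)
      fix C assume "C \<in> quotient_cuts G id F"
      then obtain S where S: "C = F \<inter> \<delta> S" "S \<noteq> {}" "S \<subset> V" by (auto simp: quotient_cuts_def)
      then show "2 \<le> sum x C" using val_ge[of S] sumF[of x "\<delta> S"] cut_sub by (simp add: val_def)
    next
      fix d :: "'e \<Rightarrow> real"
      assume d: "\<And>e. e \<notin> F \<Longrightarrow> d e = 0" "\<And>C. C \<in> quotient_cuts G id F \<Longrightarrow> sum x C = 2 \<Longrightarrow> sum d C = 0"
      have "d e = 0" for e
      proof (rule direction_zero)
        fix S assume S: "tight S"
        then have "F \<inter> \<delta> S \<in> quotient_cuts G id F" by (auto simp: quotient_cuts_def tight_def)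
        moreover have "sum x (F \<inter> \<delta> S) = 2" using S sumF[of x "\<delta> S"] cut_sub by (simp add: val_def tight_def)
        ultimately have "sum d (F \<inter> \<delta> S) = 0" by (rule d(2))
        then show "val d S = 0" using sumF[of d "\<delta> S"] cut_sub d(1) by (simp add: val_def F_def)
      qed (use d(1) in \<open>auto simp: F_def\<close>)
      then show "\<forall>e. d e = 0" by blast
    qed (use basic_pointD(1)[OF basic] in \<open>auto simp: F_def\<close>)
    have "x e \<in> \<int>" if "e \<in> F" for e
    proof (rule minimal[of id F x])
      fix u assume "u \<in> id ` V"
      then have "{v \<in> V. id v = u} = {u}" by auto
      then show "conn G {v \<in> V. id v = u}" by (simp add: conn_singleton)
    qed (use bp that neq cardV in \<open>auto simp: F_def nonloop_aux\<close>)
    then show False using nonintegral by (force simp: F_def)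
  qed
  moreover assume "e \<in> E"
  ultimately show ?thesis using basic_pointD(1)[OF basic, of e] unfolding F_def by force
qed

lemma card_ends: "e \<in> E \<Longrightarrow> card (ends G e) = 2"
  using nonloop_aux pos by force

lemma edgeE:
  assumes "e \<in> E"
  obtains u v where "ends G e = {u, v}" "u \<noteq> v" "u \<in> V" "v \<in> V"
proof -
  obtain u v where "ends G e = {u, v}" "u \<noteq> v" using card_ends[OF assms] by (auto simp: card_2_iff)
  then show ?thesis using that ends_sub[OF assms] by auto
qed

lemma zero_direction:
  assumes "\<And>S. tight S \<Longrightarrow> val d S = 0" "e \<in> E"
  shows "d e = 0"
proof -
  have "(\<lambda>e. if e \<in> E then d e else 0) e = 0"
  proof (rule direction_zero[where d = "\<lambda>e. if e \<in> E then d e else 0"])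
    fix S assume S: "tight S"
    have "val (\<lambda>e. if e \<in> E then d e else 0) S = val d S"
      unfolding val_def by (rule sum.cong) (auto simp: cut_def)
    then show "val (\<lambda>e. if e \<in> E then d e else 0) S = 0" using assms(1)[OF S] by simp
  qed (use pos in force)+
  then show ?thesis using assms(2) by simp
qed

lemma in_cut: "e \<in> E \<Longrightarrow> ends G e = {u, v} \<Longrightarrow> e \<in> \<delta> S \<longleftrightarrow> (u \<in> S) \<noteq> (v \<in> S)"
  by (auto simp: cut_def)

lemma val_E: "val w S = (\<Sum>e\<in>E. if e \<in> \<delta> S then w e else 0)"
  unfolding val_def using cut_sub[of S] by (simp add: sum.inter_restrict[symmetric] Int_absorb1)

lemma val_compl: "val w (V - S) = val w S"
proof -
  have "\<delta> (V - S) = \<delta> S"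
  proof (rule set_eqI)
    fix e show "e \<in> \<delta> (V - S) \<longleftrightarrow> e \<in> \<delta> S"
    proof (cases "e \<in> E")
      case True
      obtain u v where uv: "ends G e = {u, v}" "u \<in> V" "v \<in> V" using True by (rule edgeE)
      show ?thesis unfolding in_cut[OF True uv(1)] using uv by auto
    qed (simp add: cut_def)
  qed
  then show ?thesis by (simp add: val_def)
qed

lemma cut_Int: "\<delta> (S \<inter> V) = \<delta> S"
  using ends_sub by (auto simp: cut_def)

lemma cut_compl: "\<delta> (V - S) = \<delta> S"
  using ends_sub by (auto simp: cut_def)

lemma val_submodular:
  "val w A + val w B = val w (A \<inter> B) + val w (A \<union> B) + 2 * sum w (between (A - B) (B - A))"
proof -
  have "2 * sum w (between (A - B) (B - A)) = (\<Sum>e\<in>E. if e \<in> between (A - B) (B - A) then 2 * w e else 0)"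
    unfolding sum_distrib_left
    by (rule sum.mono_neutral_cong_left) (auto simp: between_def)
  moreover have "(if e \<in> \<delta> A then w e else 0) + (if e \<in> \<delta> B then w e else 0) =
      (if e \<in> \<delta> (A \<inter> B) then w e else 0) + (if e \<in> \<delta> (A \<union> B) then w e else 0)
       + (if e \<in> between (A - B) (B - A) then 2 * w e else 0)" if e: "e \<in> E" for e
  proof -
    obtain u v where uv: "ends G e = {u, v}" using e by (rule edgeE)
    have b: "e \<in> between (A - B) (B - A) \<longleftrightarrow>
        (u \<in> A - B \<and> v \<in> B - A) \<or> (v \<in> A - B \<and> u \<in> B - A)"
      using e by (auto simp: between_def uv)
    show ?thesis unfolding in_cut[OF e uv] b by auto
  qed
  ultimately show ?thesis unfolding val_E by (simp add: sum.distrib[symmetric] cong: sum.cong)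
qed

lemma val_empty: "val w {} = 0" by (simp add: val_def cut_def)

lemma val_disjoint: "A \<inter> B = {} \<Longrightarrow> val w A + val w B = val w (A \<union> B) + 2 * sum w (between A B)"
  using val_submodular[of w A B] by (simp add: val_empty Diff_triv Int_commute)

lemma sum_pos_E: "A \<subseteq> E \<Longrightarrow> 0 \<le> sum x A"
  by (rule sum_nonneg) (use pos in force)

lemma sum_zero_E: "A \<subseteq> E \<Longrightarrow> sum x A = 0 \<Longrightarrow> A = {}"
  using sum_pos[of A x] pos by force

lemma between_sub: "between A B \<subseteq> E" by (auto simp: between_def)

text \<open>Parallel edges lie in the same cuts, so shifting weight from one to the other would be a
  free direction.\<close>

lemma simple: "e \<in> E \<Longrightarrow> f \<in> E \<Longrightarrow> ends G e = ends G f \<Longrightarrow> e = f"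
proof (rule ccontr)
  assume ef: "e \<in> E" "f \<in> E" "ends G e = ends G f" "e \<noteq> f"
  define d where "d = (\<lambda>g. if g = e then 1 else if g = f then -1 else (0::real))"
  have "val d S = 0" for S
  proof -
    have "val d S = sum d (\<delta> S \<inter> {e, f})"
      unfolding val_def by (rule sum.mono_neutral_right) (auto simp: d_def)
    also have "\<delta> S \<inter> {e, f} = (if e \<in> \<delta> S then {e, f} else {})" using ef by (auto simp: cut_def)
    also have "sum d \<dots> = 0" using ef by (simp add: d_def)
    finally show ?thesis .
  qed
  then have "d e = 0" using zero_direction ef by blast
  then show False by (simp add: d_def)
qed

section \<open>Uncrossing tight sets and pasting directions across a tight cut\<close>

lemma tight_compl: "tight S \<Longrightarrow> tight (V - S)"
  by (auto simp: tight_def val_compl)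

lemma tight_sub: "tight S \<Longrightarrow> S \<subseteq> V" by (auto simp: tight_def)

text \<open>Otherwise the unit vector on \<open>e\<close> would be a free direction.\<close>

lemma in_tight: 
  assumes "e \<in> E" obtains S where "tight S" "e \<in> \<delta> S"
proof -
  have "\<exists>S. tight S \<and> e \<in> \<delta> S"
  proof (rule ccontr)
    assume "\<not> ?thesis"
    then have v: "val (\<lambda>f. if f = e then 1 else 0) S = 0" if "tight S" for S using that by (auto simp: val_def)
    define d where "d = (\<lambda>f. if f = e then 1 else (0::real))"
    have "d e = 0" by (rule zero_direction[OF _ assms]) (use v in \<open>simp add: d_def\<close>)
    then show False by (simp add: d_def)
  qed
  then show ?thesis using that by blast
qed

text \<open>A part \<open>A\<close> with no edge to \<open>S - A\<close> would give
  \<open>val x S = val x A + val x (S - A) \<ge> 4\<close>. This is what allows contracting either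
  side of a tight cut.\<close>

lemma tight_conn: assumes "tight S" shows "conn G S"
  unfolding conn_def
proof (intro conjI allI impI)
  show "S \<noteq> {}" using assms by (simp add: tight_def)
  fix A assume A: "A \<noteq> {}" "A \<subset> S"
  have "val x A + val x (S - A) = val x S + 2 * sum x (between A (S - A))"
    using val_disjoint[of A "S - A" x] A by (simp add: Un_absorb1)
  moreover have "2 \<le> val x A" "2 \<le> val x (S - A)" by (rule val_ge; use A assms in \<open>auto simp: tight_def\<close>)+
  ultimately have "between A (S - A) \<noteq> {}" using assms by (auto simp: tight_def)
  then obtain e where e: "e \<in> E" "ends G e \<inter> A \<noteq> {}" "ends G e \<inter> (S - A) \<noteq> {}" by (auto simp: between_def)
  obtain u v where uv: "ends G e = {u, v}" using e(1) by (rule edgeE)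
  show "\<exists>e\<in>E. \<exists>a\<in>A. \<exists>b\<in>S - A. ends G e = {a, b}" using e uv by (metis Diff_iff Int_insert_left_if0 Int_empty_left doubleton_eq_iff insert_commute)
qed

text \<open>Submodularity leaves no room for edges between \<open>S - T\<close> and
  \<open>T - S\<close>, as both resulting sets have value at least 2. In the absence of such edges
  the identity of cut values is exact for every \<open>d\<close>, not only for \<open>x\<close>;
  this is how directions are uncrossed.\<close>

lemma val_uncross:
  assumes S: "tight S" and T: "tight T" and c: "S \<inter> T \<noteq> {}" "S \<union> T \<noteq> V"
  shows "tight (S \<inter> T)" "tight (S \<union> T)" "between (S - T) (T - S) = {}"
    "\<And>d. val d S + val d T = val d (S \<inter> T) + val d (S \<union> T)"
proof -
  have "2 \<le> val x (S \<inter> T)" "2 \<le> val x (S \<union> T)" by (rule val_ge; use assms in \<open>auto simp: tight_def\<close>)+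
  moreover have "0 \<le> sum x (between (S - T) (T - S))" by (rule sum_pos_E[OF between_sub])
  ultimately have *: "val x (S \<inter> T) = 2" "val x (S \<union> T) = 2" "sum x (between (S - T) (T - S)) = 0"
    using val_submodular[of x S T] S T unfolding tight_def by linarith+
  show "tight (S \<inter> T)" "tight (S \<union> T)" using * assms by (auto simp: tight_def)
  show b: "between (S - T) (T - S) = {}" by (rule sum_zero_E[OF between_sub *(3)])
  show "val d S + val d T = val d (S \<inter> T) + val d (S \<union> T)" for d
    using val_submodular[of d S T] b by simp
qed

text \<open>A tight set crossing \<open>S\<close> uncrosses into \<open>S \<inter> T\<close> and, up
  to complement, \<open>S \<union> T\<close>, which lie on the two sides. Hence the constraints of
  the two sides imply those of all tight sets.\<close>

lemma glue:
  assumes S: "tight S" and d: "dirs S d" "dirs (V - S) d" and e: "e \<in> E"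
  shows "d e = 0"
proof (rule zero_direction[OF _ e])
  fix T assume T: "tight T"
  have sub: "val d R = 0" if "tight R" "R \<subseteq> S \<or> R \<subseteq> V - S" for R using d that by (auto simp: dirs_def)
  consider "S \<inter> T = {}" | "S \<union> T = V" | "S \<inter> T \<noteq> {}" "S \<union> T \<noteq> V" by blast
  then show "val d T = 0"
  proof cases
    case 1 then show ?thesis using sub[OF T] tight_sub[OF T] by blast
  next
    case 2 then show ?thesis using sub[OF tight_compl[OF T]] by (auto simp: val_compl)
  next
    case 3
    note u = val_uncross[OF S T 3]
    have "val d (S \<inter> T) = 0" using sub[OF u(1)] by blast
    moreover have "val d (S \<union> T) = 0" using sub[OF tight_compl[OF u(2)]] by (auto simp: val_compl)
    moreover have "val d S = 0" using sub[OF S] by blast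
    ultimately show ?thesis using u(4)[of d] by simp
  qed
qed

lemma cut_touch: "T \<subseteq> S \<Longrightarrow> \<delta> T \<subseteq> touch S"
  by (auto simp: cut_def touch_def)

lemma inside_touch: "inside S \<subseteq> touch S"
proof
  fix e assume e: "e \<in> inside S"
  then have "e \<in> E" by (simp add: inside_def)
  then obtain u v where "ends G e = {u, v}" by (rule edgeE)
  then show "e \<in> touch S" using e by (auto simp: inside_def touch_def)
qed

lemma touch_split: "S \<subseteq> V \<Longrightarrow> touch S = inside S \<union> \<delta> S"
  using inside_touch[of S] by (auto simp: inside_def touch_def cut_def)

lemma inside_cut: "inside S \<inter> \<delta> S = {}"
  by (auto simp: inside_def cut_def)

lemma touch_compl: "S \<subseteq> V \<Longrightarrow> touch (V - S) = E - inside S"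
  using ends_sub by (auto simp: inside_def touch_def)

lemma val_cong: "(\<And>e. e \<in> \<delta> S \<Longrightarrow> d e = d' e) \<Longrightarrow> val d S = val d' S"
  unfolding val_def by (rule sum.cong) auto

text \<open>The two functions are pasted along the cut and \<open>glue\<close> is applied. So a
  function on the cut edges that extends to a direction on both sides is 0, the source of most
  contradictions at tight cuts.\<close>

lemma glue2:
  assumes S: "tight S" and d: "dirs S d1" "dirs (V - S) d2" and eq: "\<And>e. e \<in> \<delta> S \<Longrightarrow> d1 e = d2 e"
  shows "e \<in> touch S \<Longrightarrow> d1 e = 0" "e \<in> touch (V - S) \<Longrightarrow> d2 e = 0"
proof -
  define d where "d = (\<lambda>e. if e \<in> inside S then d1 e else d2 e)"
  note SV = tight_sub[OF S]
  have 1: "d e = d1 e" if "e \<in> touch S" for e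
    using that eq unfolding touch_split[OF SV] by (auto simp: d_def)
  have 2: "d e = d2 e" if "e \<in> touch (V - S)" for e
    using that eq unfolding touch_compl[OF SV] by (auto simp: d_def)
  have "val d T = val d1 T" if "T \<subseteq> S" for T by (rule val_cong) (use 1 cut_touch[OF that] in blast)
  then have "dirs S d" using d by (simp add: dirs_def)
  moreover have "val d T = val d2 T" if "T \<subseteq> V - S" for T by (rule val_cong) (use 2 cut_touch[OF that] in blast)
  then have "dirs (V - S) d" using d by (simp add: dirs_def)
  ultimately have "d e = 0" if "e \<in> E" for e using glue[OF S _ _ that] by blast
  then show "e \<in> touch S \<Longrightarrow> d1 e = 0" "e \<in> touch (V - S) \<Longrightarrow> d2 e = 0"
    using 1 2 unfolding touch_def by auto
qed

section \<open>Contracting one side: integrality, directions and rays\<close>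

lemma compl_psubset: "conn G U \<Longrightarrow> U \<subseteq> V \<Longrightarrow> T \<subseteq> V - U \<Longrightarrow> T \<subset> V"
proof -
  assume "conn G U" "U \<subseteq> V" "T \<subseteq> V - U"
  moreover from this have "U \<noteq> {}" by (simp add: conn_def)
  ultimately show ?thesis by blast
qed

text \<open>Minimality is applied to the relabelling that sends \<open>U\<close> to one of its nodes
  \<open>u0\<close>. Each cut of the contracted graph has a side avoiding \<open>u0\<close>, so its
  cuts are the \<open>\<delta> T\<close> with \<open>T\<close> outside \<open>U\<close>.\<close>

lemma contraction_integral:
  assumes U: "U \<subseteq> V" "conn G U" "card U \<ge> 2" "U \<noteq> V"
    and bp: "basic_point (touch (V - U)) {\<delta> T | T. T \<noteq> {} \<and> T \<subseteq> V - U} y"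
    and e: "e \<in> touch (V - U)"
  shows "y e \<in> \<int>"
proof -
  obtain u0 where u0: "u0 \<in> U" using U by (auto simp: conn_def)
  define f where "f = (\<lambda>v. if v \<in> U then u0 else v)"
  have fV: "f ` V = insert u0 (V - U)" using u0 U by (auto simp: f_def)
  have q: "quotient_cuts G f (touch (V - U)) = {\<delta> T | T. T \<noteq> {} \<and> T \<subseteq> V - U}"
  proof (intro set_eqI iffI)
    fix C assume "C \<in> quotient_cuts G f (touch (V - U))"
    then obtain Y where Y: "C = touch (V - U) \<inter> \<delta> (f -` Y)" "Y \<noteq> {}" "Y \<subset> insert u0 (V - U)"
      unfolding quotient_cuts_def fV by blast
    define T where "T = (if u0 \<in> Y then (V - U) - Y else Y)"
    have T: "T \<noteq> {}" "T \<subseteq> V - U" using Y by (auto simp: T_def)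
    have "\<delta> (f -` Y) = \<delta> T"
    proof (cases "u0 \<in> Y")
      case True
      then have "V - (f -` Y \<inter> V) = T" by (auto simp: f_def T_def)
      then show ?thesis using cut_compl[of "f -` Y \<inter> V"] by (simp add: cut_Int)
    next
      case False
      have "f v \<in> Y \<longleftrightarrow> v \<in> Y" if "v \<in> V" for v using Y(3) False by (auto simp: f_def)
      then have "f -` Y \<inter> V = T" using Y(3) False U(1) u0 by (auto simp: T_def)
      then show ?thesis using cut_Int[of "f -` Y"] by simp
    qed
    then show "C \<in> {\<delta> T | T. T \<noteq> {} \<and> T \<subseteq> V - U}" using Y(1) T cut_touch[OF T(2)] by blast
  next
    fix C assume "C \<in> {\<delta> T | T. T \<noteq> {} \<and> T \<subseteq> V - U}"
    then obtain T where T: "C = \<delta> T" "T \<noteq> {}" "T \<subseteq> V - U" by blast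
    have "u0 \<notin> T" "T \<subseteq> V" using T(3) u0 by auto
    then have "f v \<in> T \<longleftrightarrow> v \<in> T" for v using T(3) by (auto simp: f_def)
    then have "f -` T \<inter> V = T" using \<open>T \<subseteq> V\<close> by auto
    then have "\<delta> (f -` T) = \<delta> T" using cut_Int[of "f -` T"] by simp
    then have "C = touch (V - U) \<inter> \<delta> (f -` T)" using T cut_touch[OF T(3)] by blast
    moreover have "T \<subset> f ` V" using T u0 unfolding fV by blast
    ultimately show "C \<in> quotient_cuts G f (touch (V - U))" using T(2) unfolding quotient_cuts_def by blast
  qed
  show ?thesis
  proof (rule minimal[of f "touch (V - U)" y])
    fix u assume "u \<in> f ` V"
    then have "{v \<in> V. f v = u} = (if u = u0 then U else {u})" using u0 U(1) by (auto simp: f_def split: if_splits)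
    then show "conn G {v \<in> V. f v = u}" using U(2) conn_singleton[of G u] by (simp split: if_splits)
  next
    obtain t where "t \<in> V - U" using U by blast
    then have t: "{u0, t} \<subseteq> f ` V" "u0 \<noteq> t" using u0 unfolding fV by auto
    have "card {u0, t} \<le> card (f ` V)" by (rule card_mono[OF finite_imageI[OF finV] t(1)])
    then show "2 \<le> card (f ` V)" using t(2) by simp
  next
    fix e assume e: "e \<in> touch (V - U)"
    then have "e \<in> E" by (simp add: touch_def)
    then obtain u v where uv: "ends G e = {u, v}" "u \<noteq> v" by (rule edgeE)
    have "f u \<noteq> f v" using e uv u0 by (auto simp: touch_def f_def)
    then show "card (f ` ends G e) = 2" by (simp add: uv)
  next
    have "\<not> inj_on f V"
    proof
      assume "inj_on f V"
      then have "card (f ` U) = card U" using U(1) by (intro card_image) (rule inj_on_subset)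
      moreover have "f ` U = {u0}" using u0 by (auto simp: f_def)
      ultimately show False using U by simp
    qed
    then show "\<not> (inj_on f V \<and> touch (V - U) = E)" by blast
  next
    show "touch (V - U) \<subseteq> E" by (auto simp: touch_def)
    show "basic_point (touch (V - U)) (quotient_cuts G f (touch (V - U))) y" using bp by (simp only: q)
  qed (rule e)
qed

text \<open>If only the zero function preserved the tight sets outside \<open>U\<close>, then
  \<open>x\<close> itself would be a basic point of the contraction, and \<open>x e\<close> would be
  an integer.\<close>

lemma contraction_direction:
  assumes U: "U \<subseteq> V" "conn G U" "card U \<ge> 2" "U \<noteq> V" and e: "e \<in> touch (V - U)" "x e \<notin> \<int>"
  shows "\<exists>d. dirs (V - U) d \<and> (\<exists>e\<in>touch (V - U). d e \<noteq> 0)"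
proof (rule ccontr)
  assume no: "\<not> ?thesis"
  have "basic_point (touch (V - U)) {\<delta> T | T. T \<noteq> {} \<and> T \<subseteq> V - U} x"
  proof (rule basic_pointI)
    fix C assume "C \<in> {\<delta> T | T. T \<noteq> {} \<and> T \<subseteq> V - U}"
    then obtain T where T: "C = \<delta> T" "T \<noteq> {}" "T \<subseteq> V - U" by blast
    then have "T \<subset> V" using compl_psubset[OF U(2,1)] by blast
    then show "2 \<le> sum x C" using val_ge[of T] T by (simp add: val_def)
  next
    fix d :: "'e \<Rightarrow> real"
    assume d: "\<And>e. e \<notin> touch (V - U) \<Longrightarrow> d e = 0"
      "\<And>C. C \<in> {\<delta> T | T. T \<noteq> {} \<and> T \<subseteq> V - U} \<Longrightarrow> sum x C = 2 \<Longrightarrow> sum d C = 0"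
    have "dirs (V - U) d" unfolding dirs_def
    proof (intro allI impI)
      fix S assume "S \<subseteq> V - U" "tight S"
      then have "S \<noteq> {}" "S \<subseteq> V - U" "sum x (\<delta> S) = 2" by (auto simp: tight_def val_def)
      then show "val d S = 0" using d(2)[of "\<delta> S"] unfolding val_def by blast
    qed
    then show "\<forall>e. d e = 0" using no d(1) by blast
  qed (use pos in \<open>auto simp: touch_def less_imp_le\<close>)
  from contraction_integral[OF U this e(1)] e(2) show False by simp
qed

text \<open>When the directions outside \<open>U\<close> form a line, \<open>x\<close> lies inside
  an edge of the contracted polyhedron. Moving along \<open>g\<close> until the first further
  constraint becomes tight reaches a basic point, which is integral by
  \<open>contraction_integral\<close>.\<close>

lemma contraction_ray:
  assumes U: "U \<subseteq> V" "conn G U" "card U \<ge> 2" "U \<noteq> V"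
    and g: "dirs (V - U) g" "e0 \<in> touch (V - U)" "g e0 \<noteq> 0"
    and one: "\<And>d. dirs (V - U) d \<Longrightarrow> \<exists>\<mu>. \<forall>e\<in>touch (V - U). d e = \<mu> * g e"
    and cov: "\<And>e. e \<in> touch (V - U) \<Longrightarrow> \<exists>T\<subseteq>V - U. tight T \<and> e \<in> \<delta> T"
  obtains \<alpha> where "\<alpha> > 0" "\<And>e. e \<in> touch (V - U) \<Longrightarrow> x e + \<alpha> * g e \<in> \<int> \<and> 0 \<le> x e + \<alpha> * g e"
    "\<And>T. T \<noteq> {} \<Longrightarrow> T \<subseteq> V - U \<Longrightarrow> 2 \<le> val (\<lambda>e. x e + \<alpha> * g e) T"
proof -
  define T1 where "T1 = V - U"
  \<comment> \<open>Ratio test: \<open>R1\<close> holds the step lengths at which an edge value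
    reaches 0, \<open>R2\<close> those at which a cut reaches 2.\<close>
  define R1 where "R1 = (\<lambda>e. x e / (- g e)) ` {e \<in> touch T1. g e < 0}"
  define R2 where "R2 = (\<lambda>T. (val x T - 2) / (- val g T)) ` {T. T \<noteq> {} \<and> T \<subseteq> T1 \<and> val g T < 0}"
  have fin: "finite (R1 \<union> R2)"
  proof -
    have "finite {T. T \<noteq> {} \<and> T \<subseteq> T1 \<and> val g T < 0}"
      by (rule finite_subset[of _ "Pow V"]) (auto simp: T1_def)
    then show ?thesis by (simp add: R1_def R2_def)
  qed
  \<comment> \<open>The ray is bounded because \<open>e0\<close> lies in a tight cut, where positive
    values of \<open>g\<close> must be balanced by negative ones.\<close>
  have "\<exists>e\<in>touch T1. g e < 0"
  proof (rule ccontr)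
    assume no: "\<not> ?thesis"
    obtain T where T: "T \<subseteq> T1" "tight T" "e0 \<in> \<delta> T" using cov[OF g(2)] by (auto simp: T1_def)
    have "val g T = 0" using g(1) T by (auto simp: dirs_def T1_def)
    moreover have "0 \<le> g e" if "e \<in> \<delta> T" for e using no that cut_touch[OF T(1)] by (meson not_le subsetD)
    ultimately have "g e0 = 0" using T(3) unfolding val_def by (simp add: sum_nonneg_eq_0_iff)
    then show False using g(3) by simp
  qed
  then have ne: "R1 \<union> R2 \<noteq> {}" by (auto simp: R1_def)
  have pos12: "r > 0" if "r \<in> R1 \<union> R2" for r
    using that
  proof
    assume "r \<in> R1" then show ?thesis using pos by (auto simp: R1_def touch_def intro!: divide_pos_neg)
  next
    assume "r \<in> R2"
    then obtain T where T: "r = (val x T - 2) / (- val g T)" "T \<noteq> {}" "T \<subseteq> T1" "val g T < 0" by (auto simp: R2_def)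
    have TV: "T \<subset> V" using compl_psubset[OF U(2,1)] T(3) unfolding T1_def by blast
    have "\<not> tight T" using g(1) T(3,4) unfolding dirs_def T1_def by (metis less_irrefl)
    then have "val x T \<noteq> 2" using T(2) TV by (simp add: tight_def)
    then have "2 < val x T" using val_ge[OF T(2) TV] by simp
    then show ?thesis using T by (auto intro!: divide_pos_neg)
  qed
  define \<alpha> where "\<alpha> = Min (R1 \<union> R2)"
  have \<alpha>R: "\<alpha> \<in> R1 \<union> R2" unfolding \<alpha>_def by (rule Min_in[OF fin ne])
  have \<alpha>0: "\<alpha> > 0" by (rule pos12[OF \<alpha>R])
  have \<alpha>le: "\<alpha> \<le> r" if "r \<in> R1 \<union> R2" for r unfolding \<alpha>_def by (rule Min_le[OF fin that])
  define y where "y = (\<lambda>e. x e + \<alpha> * g e)"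
  have valy: "val y T = val x T + \<alpha> * val g T" for T
    by (simp add: val_def y_def sum.distrib sum_distrib_left)
  have nn: "0 \<le> y e" if e: "e \<in> touch T1" for e
  proof (cases "g e < 0")
    case True
    then have "x e / (- g e) \<in> R1 \<union> R2" using e by (auto simp: R1_def)
    then have "\<alpha> \<le> x e / (- g e)" by (rule \<alpha>le)
    then show ?thesis using True by (simp add: y_def field_simps)
  next
    case False
    then show ?thesis using pos[of e] e \<alpha>0 by (simp add: y_def touch_def)
  qed
  have ge2: "2 \<le> val y T" if T: "T \<noteq> {}" "T \<subseteq> T1" for T
  proof (cases "val g T < 0")
    case True
    then have "(val x T - 2) / (- val g T) \<in> R1 \<union> R2" using T by (auto simp: R2_def)
    then have "\<alpha> \<le> (val x T - 2) / (- val g T)" by (rule \<alpha>le)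
    then show ?thesis using True by (simp add: valy field_simps)
  next
    case False
    have "T \<subset> V" using compl_psubset[OF U(2,1)] T(2) unfolding T1_def by blast
    then have "2 \<le> val x T" using val_ge T by blast
    then show ?thesis using False \<alpha>0 by (simp add: valy add_increasing2)
  qed
  have bp: "basic_point (touch T1) {\<delta> T | T. T \<noteq> {} \<and> T \<subseteq> T1} y"
  proof (rule basic_pointI)
    fix d :: "'e \<Rightarrow> real"
    assume d: "\<And>e. e \<notin> touch T1 \<Longrightarrow> d e = 0" "\<And>e. e \<in> touch T1 \<Longrightarrow> y e = 0 \<Longrightarrow> d e = 0"
      "\<And>C. C \<in> {\<delta> T | T. T \<noteq> {} \<and> T \<subseteq> T1} \<Longrightarrow> sum y C = 2 \<Longrightarrow> sum d C = 0"
    have d3: "val d T = 0" if "T \<noteq> {}" "T \<subseteq> T1" "val y T = 2" for T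
      using d(3)[of "\<delta> T"] that unfolding val_def by blast
    have "dirs T1 d" unfolding dirs_def
    proof (intro allI impI)
      fix T assume T: "T \<subseteq> T1" "tight T"
      then have "val g T = 0" using g(1) by (auto simp: dirs_def T1_def)
      then show "val d T = 0" using T by (intro d3) (auto simp: tight_def valy)
    qed
    then obtain \<mu> where \<mu>: "\<And>e. e \<in> touch T1 \<Longrightarrow> d e = \<mu> * g e" using one unfolding T1_def by blast
    \<comment> \<open>The constraint that stopped the ray is not preserved by any nonzero multiple
      of \<open>g\<close>.\<close>
    have "\<mu> = 0" using \<alpha>R
    proof
      assume "\<alpha> \<in> R1"
      then obtain e where e: "\<alpha> = x e / (- g e)" "e \<in> touch T1" "g e < 0" by (auto simp: R1_def)
      then have "y e = 0" by (simp add: y_def)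
      then show ?thesis using d(2)[OF e(2)] \<mu>[OF e(2)] e(3) by simp
    next
      assume "\<alpha> \<in> R2"
      then obtain T where T: "\<alpha> = (val x T - 2) / (- val g T)" "T \<noteq> {}" "T \<subseteq> T1" "val g T < 0" by (auto simp: R2_def)
      have "val d T = \<mu> * val g T"
        unfolding val_def sum_distrib_left by (rule sum.cong) (use \<mu> cut_touch[OF T(3)] in auto)
      moreover have "val y T = 2" using T by (simp add: valy field_simps)
      ultimately show ?thesis using d3[OF T(2,3)] T(4) by simp
    qed
    then show "\<forall>e. d e = 0" using \<mu> d(1) by (metis mult_zero_left)
  next
    fix C assume "C \<in> {\<delta> T | T. T \<noteq> {} \<and> T \<subseteq> T1}"
    then show "2 \<le> sum y C" using ge2 unfolding val_def by blast
  qed (use nn in auto)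
  have "y e \<in> \<int>" if "e \<in> touch T1" for e
    by (rule contraction_integral[OF U]) (use bp that in \<open>auto simp: T1_def\<close>)
  then show ?thesis using that[of \<alpha>] \<alpha>0 nn ge2 unfolding y_def T1_def by blast
qed

end

text \<open>The coefficient vectors of the equations span at most \<open>card B\<close> dimensions,
  a proper subspace of the functions on \<open>A\<close>; the solution is a vector orthogonal to
  it.\<close>

lemma more_unknowns_than_equations:
  fixes \<phi> :: "'b \<Rightarrow> 'e::finite \<Rightarrow> real"
  assumes "finite B" "card B < card A"
  obtains d e where "\<And>e. e \<notin> A \<Longrightarrow> d e = 0" "e \<in> A" "d e \<noteq> 0" "\<And>b. b \<in> B \<Longrightarrow> (\<Sum>e\<in>A. d e * \<phi> b e) = 0"
proof -
  define U where "U = {d :: real ^ 'e. \<forall>e. e \<notin> A \<longrightarrow> d $ e = 0}"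
  define C where "C = (\<lambda>b. \<chi> e. if e \<in> A then \<phi> b e else 0) ` B"
  have sU: "subspace U" by (auto simp: U_def subspace_def)
  have "vec.dim U = card A" unfolding U_def by (rule dim_substandard_cart)
  then have dU: "dim U = card A" by (simp add: dim_vec_eq)
  have CU: "C \<subseteq> U" by (auto simp: C_def U_def)
  have "dim C \<le> card C" using assms(1) by (intro dim_le_card') (simp add: C_def)
  also have "\<dots> \<le> card B" unfolding C_def by (rule card_image_le[OF assms(1)])
  finally have dC: "dim C < dim U" using dU assms(2) by simp
  have "span C \<noteq> span U" using dC by (metis dim_span less_irrefl)
  then have "span C \<subset> span U" using span_mono[OF CU] by blast
  then obtain z where z: "z \<noteq> 0" "z \<in> span U" "\<And>y. y \<in> span C \<Longrightarrow> orthogonal z y"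
    by (rule orthogonal_to_subspace_exists_gen) blast
  have zU: "z \<in> U" using z(2) sU by (metis span_eq_iff)
  obtain e where e: "z $ e \<noteq> 0" using z(1) by (auto simp: vec_eq_iff)
  have "(\<Sum>e\<in>A. z $ e * \<phi> b e) = 0" if "b \<in> B" for b
  proof -
    have "z \<bullet> (\<chi> e. if e \<in> A then \<phi> b e else 0) = 0"
      using z(3) that by (auto simp: orthogonal_def C_def intro: span_base)
    also have "z \<bullet> (\<chi> e. if e \<in> A then \<phi> b e else 0) = (\<Sum>e\<in>UNIV. if e \<in> A then z $ e * \<phi> b e else 0)"
      unfolding inner_vec_def by (rule sum.cong) auto
    also have "\<dots> = (\<Sum>e\<in>A. z $ e * \<phi> b e)" by (simp add: sum.If_cases)
    finally show ?thesis .
  qed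
  moreover have "e \<in> A" using zU e by (auto simp: U_def)
  ultimately show ?thesis using that[of "($) z" e] e zU by (auto simp: U_def)
qed

lemma conn_insert:
  assumes "conn G U" "e \<in> edges G" "ends G e = {a, b}" "a \<in> U"
  shows "conn G (insert b U)"
  unfolding conn_def
proof (intro conjI allI impI)
  fix A assume A: "A \<noteq> {}" "A \<subset> insert b U"
  show "\<exists>e\<in>edges G. \<exists>a\<in>A. \<exists>c\<in>insert b U - A. ends G e = {a, c}"
  proof (cases "A \<inter> U \<noteq> {} \<and> A \<inter> U \<subset> U")
    case True
    then obtain e' p q where "e' \<in> edges G" "p \<in> A \<inter> U" "q \<in> U - (A \<inter> U)" "ends G e' = {p, q}"
      using connE[OF assms(1), of "A \<inter> U"] by blast
    then show ?thesis by (intro bexI[of _ e'] bexI[of _ p] bexI[of _ q]) auto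
  next
    case False
    then consider "A \<inter> U = {}" | "U \<subseteq> A" by blast
    then show ?thesis
    proof cases
      case 1
      then have "A = {b}" "b \<notin> U" using A by auto
      then show ?thesis using assms by (intro bexI[of _ e] bexI[of _ b] bexI[of _ a]) auto
    next
      case 2
      then have "b \<notin> A" using A by auto
      then show ?thesis using assms 2 by (intro bexI[of _ e] bexI[of _ a] bexI[of _ b]) auto
    qed
  qed
qed simp

context fractional_minimal
begin

section \<open>Directions near a tight set and their boundary values\<close>

lemma val_diff_scale: "val (\<lambda>e. p e - c * q e) S = val p S - c * val q S"
  by (simp add: val_def sum_subtractf sum_distrib_left)

lemma val_scale: "val (\<lambda>e. c * q e) S = c * val q S"
  by (simp add: val_def sum_distrib_left)

lemma dirs_scale: "dirs T d \<Longrightarrow> dirs T (\<lambda>e. c * d e)"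
  by (simp add: dirs_def val_scale)

lemma dirs_diff: "dirs T d \<Longrightarrow> dirs T d' \<Longrightarrow> dirs T (\<lambda>e. d e - c * d' e)"
  by (simp add: dirs_def val_diff_scale)

lemma dirs_zero: "dirs T (\<lambda>_. 0)"
  by (simp add: dirs_def val_def)

text \<open>Pasting with the zero direction on the other side shows that a direction on a tight side
  is determined by its values on the cut.\<close>

lemma dirs_cut_zero:
  assumes "tight S" "dirs S d" "\<And>e. e \<in> \<delta> S \<Longrightarrow> d e = 0" "e \<in> touch S"
  shows "d e = 0"
  using glue2(1)[OF assms(1,2) dirs_zero, of e] assms by simp

text \<open>A tight set separating the ends of \<open>e\<close> need not lie in \<open>T\<close>,
  but its complement or its intersection with \<open>T\<close> does and is tight. This provides the
  covering hypothesis of \<open>contraction_ray\<close>.\<close>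

lemma covered:
  assumes "tight T" "e \<in> touch T" shows "\<exists>S\<subseteq>T. tight S \<and> e \<in> \<delta> S"
proof (cases "e \<in> \<delta> T")
  case True then show ?thesis using assms(1) by blast
next
  case False
  note TV = tight_sub[OF assms(1)]
  have e: "e \<in> E" "ends G e \<subseteq> T" using assms(2) False unfolding touch_split[OF TV] by (auto simp: inside_def)
  obtain X where X: "tight X" "e \<in> \<delta> X" using in_tight[OF e(1)] .
  obtain u v where uv: "ends G e = {u, v}" using e(1) by (rule edgeE)
  have uvT: "u \<in> T" "v \<in> T" using e(2) uv by auto
  have uvX: "(u \<in> X) \<noteq> (v \<in> X)" using X(2) in_cut[OF e(1) uv] by blast
  show ?thesis
  proof (cases "X \<union> T = V")
    case True
    have "e \<in> \<delta> (V - X)" using X(2) by (simp add: cut_compl)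
    then show ?thesis using tight_compl[OF X(1)] True by blast
  next
    case False
    have "X \<inter> T \<noteq> {}" using uvX uvT by blast
    from val_uncross(1)[OF X(1) assms(1) this False]
    have "tight (X \<inter> T)" .
    moreover have "e \<in> \<delta> (X \<inter> T)" using uvX uvT unfolding in_cut[OF e(1) uv] by blast
    ultimately show ?thesis by blast
  qed
qed

text \<open>Handshake counting: an edge inside \<open>S\<close> is seen from both its ends, a cut
  edge from one.\<close>

lemma sum_val_nodes:
  assumes "S \<subseteq> V"
  shows "(\<Sum>z\<in>S. val w {z}) = 2 * sum w (inside S) + val w S"
proof -
  have fS: "finite S" using assms by (rule finVsub)
  have "(\<Sum>z\<in>S. val w {z}) = (\<Sum>z\<in>S. \<Sum>e\<in>E. if e \<in> \<delta> {z} then w e else 0)" by (simp add: val_E)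
  also have "\<dots> = (\<Sum>e\<in>E. \<Sum>z\<in>S. if e \<in> \<delta> {z} then w e else 0)" by (rule sum.swap)
  also have "\<dots> = (\<Sum>e\<in>E. (if e \<in> inside S then 2 * w e else 0) + (if e \<in> \<delta> S then w e else 0))"
  proof (rule sum.cong)
    fix e assume e: "e \<in> E"
    obtain u v where uv: "ends G e = {u, v}" "u \<noteq> v" using e by (rule edgeE)
    have "(\<Sum>z\<in>S. if e \<in> \<delta> {z} then w e else 0) = (\<Sum>z\<in>S. (if z = u then w e else 0) + (if z = v then w e else 0))"
      by (rule sum.cong) (use uv in \<open>auto simp: in_cut[OF e uv(1)]\<close>)
    also have "\<dots> = (if u \<in> S then w e else 0) + (if v \<in> S then w e else 0)"
      using fS by (simp add: sum.distrib)
    also have "\<dots> = (if e \<in> inside S then 2 * w e else 0) + (if e \<in> \<delta> S then w e else 0)"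
      using e uv by (auto simp: in_cut[OF e uv(1)] inside_def)
    finally show "(\<Sum>z\<in>S. if e \<in> \<delta> {z} then w e else 0) = \<dots>" .
  qed simp
  also have "\<dots> = 2 * sum w (inside S) + val w S"
  proof -
    have "(\<Sum>e\<in>E. if e \<in> inside S then 2 * w e else 0) = (\<Sum>e\<in>inside S. 2 * w e)"
      by (rule sum.mono_neutral_cong_right) (auto simp: inside_def)
    then show ?thesis by (simp add: sum.distrib val_E sum_distrib_left)
  qed
  finally show ?thesis .
qed

text \<open>Alternating signs along a walk from \<open>v\<close> to \<open>r\<close>.\<close>

lemma alternating_walk:
  assumes S: "conn G S" "S \<subseteq> V" "r \<in> S" "v \<in> S"
  shows "\<exists>d s. (\<forall>e. e \<notin> inside S \<longrightarrow> d e = 0) \<and>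
    (\<forall>z. val d {z} = (if z = v then 1 else 0) + (if z = r then s else 0))"
proof (rule ccontr)
  define P where "P = (\<lambda>v. \<exists>d s. (\<forall>e. e \<notin> inside S \<longrightarrow> d e = 0) \<and>
    (\<forall>z. val d {z} = (if z = v then 1 else 0) + (if z = r then s else (0::real))))"
  assume "\<not> ?thesis"
  then have nP: "\<not> P v" by (simp add: P_def)
  have "P r" unfolding P_def by (rule exI[of _ "\<lambda>_. 0"], rule exI[of _ "-1"]) (simp add: val_def)
  define A where "A = {v \<in> S. P v}"
  have "A \<noteq> {}" "A \<subset> S" using \<open>P r\<close> nP S by (auto simp: A_def)
  then obtain e a b where e: "e \<in> E" "a \<in> A" "b \<in> S - A" "ends G e = {a, b}" using connE[OF S(1)] by metis
  have ab: "a \<noteq> b" using e by auto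
  from e(2) obtain d s where d: "\<And>e. e \<notin> inside S \<Longrightarrow> d e = 0"
    "\<And>z. val d {z} = (if z = a then 1 else 0) + (if z = r then s else 0)" unfolding A_def P_def by blast
  define i where "i = (\<lambda>f. if f = e then 1 else (0::real))"
  have vi: "val i {z} = (if z = a then 1 else 0) + (if z = b then 1 else 0)" for z
  proof -
    have "val i {z} = (if e \<in> \<delta> {z} then 1 else 0)" by (simp add: val_def i_def)
    then show ?thesis using ab unfolding in_cut[OF e(1,4)] by auto
  qed
  have eS: "e \<in> inside S" using e by (auto simp: inside_def A_def)
  have "P b" unfolding P_def
  proof (rule exI[of _ "\<lambda>f. i f - 1 * d f"], rule exI[of _ "- s"], intro conjI allI impI)
    fix f assume "f \<notin> inside S"
    then show "i f - 1 * d f = 0" using d(1) eS by (auto simp: i_def)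
  next
    fix z
    show "val (\<lambda>f. i f - 1 * d f) {z} = (if z = b then 1 else 0) + (if z = r then - s else 0)"
      unfolding val_diff_scale vi d(2) by simp
  qed
  then show False using e(3) by (auto simp: A_def)
qed

text \<open>The imbalance of each node \<open>v\<close> is routed to \<open>r\<close> by the
  alternating walk \<open>D v\<close>, so all of it accumulates at \<open>r\<close>. Thus a boundary
  pattern extends into \<open>S\<close> with only the constraint at one chosen node at risk.\<close>

lemma boundary_extension:
  assumes S: "conn G S" "S \<subseteq> V" "r \<in> S"
  obtains d where "\<And>e. e \<notin> inside S \<Longrightarrow> d e = g e" "\<And>z. z \<in> S \<Longrightarrow> z \<noteq> r \<Longrightarrow> val d {z} = 0"
proof -
  have "\<forall>v\<in>S. \<exists>D. \<exists>s. (\<forall>e. e \<notin> inside S \<longrightarrow> D e = 0) \<and>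
    (\<forall>z. val D {z} = (if z = v then 1 else 0) + (if z = r then s else (0::real)))"
    using alternating_walk[OF S] by blast
  then obtain D where D: "\<And>v. v \<in> S \<Longrightarrow> \<exists>s. (\<forall>e. e \<notin> inside S \<longrightarrow> D v e = 0) \<and>
    (\<forall>z. val (D v) {z} = (if z = v then 1 else 0) + (if z = r then s else (0::real)))"
    by metis
  have fS: "finite S" using S(2) by (rule finVsub)
  define h where "h = (\<lambda>e. if e \<in> inside S then 0 else g e)"
  define d where "d = (\<lambda>e. h e - (\<Sum>v\<in>S. val h {v} * D v e))"
  show ?thesis
  proof (rule that[of d])
    fix e assume "e \<notin> inside S"
    then show "d e = g e" using D by (simp add: d_def h_def sum.neutral)
  next
    fix z assume z: "z \<in> S" "z \<noteq> r"
    have Dz: "val (D v) {z} = (if z = v then 1 else 0)" if "v \<in> S" for v using D[OF that] z by auto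
    have "val d {z} = val h {z} - (\<Sum>e\<in>\<delta> {z}. \<Sum>v\<in>S. val h {v} * D v e)"
      by (simp add: val_def d_def sum_subtractf)
    also have "(\<Sum>e\<in>\<delta> {z}. \<Sum>v\<in>S. val h {v} * D v e) = (\<Sum>v\<in>S. val h {v} * val (D v) {z})"
      by (subst sum.swap) (simp add: val_def sum_distrib_left)
    also have "\<dots> = (\<Sum>v\<in>S. if z = v then val h {v} else 0)" by (rule sum.cong) (simp_all add: Dz)
    also have "\<dots> = val h {z}" using fS z by simp
    finally show "val d {z} = 0" by simp
  qed
qed

text \<open>An edge of value 2 would be the whole of every tight cut containing it. Contracting it
  leaves a direction \<open>d\<close>. Set to 0 on the edge, \<open>d\<close> trivially respects the
  tight sets separating its ends, and the other tight sets by choice of \<open>d\<close>; it would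
  be a free direction of \<open>G\<close>.\<close>

lemma less_two: assumes e: "e \<in> E" shows "x e < 2"
proof (rule ccontr)
  assume "\<not> x e < 2"
  obtain S where S: "tight S" "e \<in> \<delta> S" using in_tight[OF e] .
  have single: "\<delta> R = {e} \<and> x e = 2" if "tight R" "e \<in> \<delta> R" for R
  proof -
    have "val x R = x e + sum x (\<delta> R - {e})" unfolding val_def using that(2) by (simp add: sum.remove)
    moreover have "0 \<le> sum x (\<delta> R - {e})" by (rule sum_pos_E) (use cut_sub in blast)
    ultimately have "x e = 2" "sum x (\<delta> R - {e}) = 0" using that(1) \<open>\<not> x e < 2\<close> unfolding tight_def by linarith+
    moreover from this(2) have "\<delta> R - {e} = {}" by (rule sum_zero_E[rotated]) (use cut_sub in blast)
    ultimately show ?thesis using that(2) by blast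
  qed
  obtain u v where uv: "ends G e = {u, v}" "u \<noteq> v" "u \<in> V" "v \<in> V" using e by (rule edgeE)
  obtain e' where e': "e' \<in> E" "x e' \<notin> \<int>" using nonintegral by blast
  then have "e' \<noteq> e" using single[OF S] by auto
  define U where "U = {u, v}"
  have e'U: "\<not> ends G e' \<subseteq> U"
  proof
    assume "ends G e' \<subseteq> U"
    then have "ends G e' = U" using card_ends[OF e'(1)] uv by (intro card_subset_eq) (auto simp: U_def)
    then show False using simple[OF e'(1) e] \<open>e' \<noteq> e\<close> uv by (simp add: U_def)
  qed
  have t: "e' \<in> touch (V - U)" using e'U e' ends_sub[OF e'(1)] by (auto simp: touch_def)
  have "conn G (insert v {u})" by (rule conn_insert[OF conn_singleton e uv(1)]) simp
  then have cU: "conn G U" by (simp add: U_def insert_commute)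
  have UV: "U \<subseteq> V" "U \<noteq> V" "card U \<ge> 2" using uv e'U ends_sub[OF e'(1)] by (auto simp: U_def)
  obtain d f where d: "dirs (V - U) d" "f \<in> touch (V - U)" "d f \<noteq> 0"
    using contraction_direction[OF UV(1) cU UV(3,2) t e'(2)] by blast
  define d' where "d' = (\<lambda>g. if g = e then 0 else d g)"
  have "d' f = 0"
  proof (rule zero_direction)
    fix R assume R: "tight R"
    show "val d' R = 0"
    proof (cases "e \<in> \<delta> R")
      case True then show ?thesis using single[OF R] by (simp add: val_def d'_def)
    next
      case False
      then have "val d' R = val d R" by (intro val_cong) (auto simp: d'_def)
      also have "\<dots> = 0"
      proof (cases "u \<in> R")
        case True
        then have "v \<in> R" using False in_cut[OF e uv(1)] by blast
        then have "V - R \<subseteq> V - U" using True by (auto simp: U_def)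
        then have "val d (V - R) = 0" using d(1) tight_compl[OF R] by (auto simp: dirs_def)
        then show ?thesis by (simp add: val_compl)
      next
        case u: False
        then have "v \<notin> R" using False in_cut[OF e uv(1)] by blast
        then have "R \<subseteq> V - U" using u tight_sub[OF R] by (auto simp: U_def)
        then show ?thesis using d(1) R by (auto simp: dirs_def)
      qed
      finally show ?thesis .
    qed
  qed (use d(2) in \<open>auto simp: touch_def\<close>)
  moreover have "f \<noteq> e" using d(2) uv by (auto simp: touch_def U_def)
  ultimately show False using d(3) by (simp add: d'_def)
qed

text \<open>A nonintegral value touching \<open>S\<close> forces a direction after
  \<open>V - S\<close> is contracted, and by \<open>dirs_cut_zero\<close> it cannot vanish on the
  whole cut.\<close>

lemma tight_side_direction:
  assumes S: "tight S" "card (V - S) \<ge> 2" and e: "e \<in> touch S" "x e \<notin> \<int>"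
  obtains d f where "dirs S d" "f \<in> \<delta> S" "d f \<noteq> 0"
proof -
  note SV = tight_sub[OF S(1)]
  have VV: "V - (V - S) = S" using SV by blast
  have "V - S \<noteq> V" using S(1) by (auto simp: tight_def)
  then obtain d where d: "dirs S d" "\<exists>f\<in>touch S. d f \<noteq> 0"
    using contraction_direction[of "V - S" e] tight_conn[OF tight_compl[OF S(1)]] S(2) e unfolding VV by blast
  then have "\<exists>f\<in>\<delta> S. d f \<noteq> 0" using dirs_cut_zero[OF S(1) d(1)] by blast
  then show ?thesis using d(1) that by blast
qed

text \<open>Directions on a tight side are determined on the cut, so proportionality to
  \<open>g\<close> has to be checked only there.\<close>

lemma tight_side_ray:
  assumes S: "tight S" "card (V - S) \<ge> 2" and g: "dirs S g" "f \<in> touch S" "g f \<noteq> 0"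
    and one: "\<And>d. dirs S d \<Longrightarrow> \<exists>\<mu>. \<forall>e\<in>\<delta> S. d e = \<mu> * g e"
  obtains \<alpha> where "\<alpha> > 0" "\<And>e. e \<in> touch S \<Longrightarrow> x e + \<alpha> * g e \<in> \<int> \<and> 0 \<le> x e + \<alpha> * g e"
    "\<And>T. T \<noteq> {} \<Longrightarrow> T \<subseteq> S \<Longrightarrow> 2 \<le> val (\<lambda>e. x e + \<alpha> * g e) T"
proof -
  note SV = tight_sub[OF S(1)]
  have VV: "V - (V - S) = S" using SV by blast
  have ne: "V - S \<noteq> V" using S(1) by (auto simp: tight_def)
  have one': "\<exists>\<mu>. \<forall>e\<in>touch S. d e = \<mu> * g e" if d: "dirs S d" for d
  proof -
    obtain \<mu> where \<mu>: "\<And>e. e \<in> \<delta> S \<Longrightarrow> d e = \<mu> * g e" using one[OF d] by blast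
    have "d e - \<mu> * g e = 0" if "e \<in> touch S" for e
      using dirs_cut_zero[OF S(1) dirs_diff[OF d g(1), of \<mu>], of e] \<mu> that by simp
    then show ?thesis by (intro exI[of _ \<mu>]) auto
  qed
  show ?thesis
    by (rule contraction_ray[of "V - S" g f, unfolded VV, OF _ tight_conn[OF tight_compl[OF S(1)]] S(2) ne g one'])
      (use that covered[OF S(1)] in blast)+
qed

lemma inside_cut_diff: "T \<subseteq> S \<Longrightarrow> inside S \<inter> \<delta> (S - T) = inside S \<inter> \<delta> T"
  by (auto simp: inside_def cut_def)

text \<open>On the side of \<open>S\<close> there is one direction up to scaling, 1 on
  \<open>a\<close> and -1 on \<open>b\<close>, and integrality at both ends of its line forces step
  length 1. Averaging these ends shows that the edges inside \<open>S\<close> alone satisfy all cut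
  constraints with the values of \<open>x\<close>. Hence contracting \<open>V - S\<close> into the
  end \<open>b0\<close> of \<open>b\<close> and giving \<open>a\<close> value 0 yields a smaller
  nonintegral basic point.\<close>

lemma two_edge_cut_aux:
  assumes S: "tight S" "card S \<ge> 2" "card (V - S) \<ge> 2" and ab: "\<delta> S = {a, b}" "a \<noteq> b" "x a = 1" "x b = 1"
    and e': "e' \<in> inside S" "x e' \<notin> \<int>"
  shows False
proof -
  note SV = tight_sub[OF S(1)]
  have valS: "val d S = d a + d b" for d using ab(1,2) by (simp add: val_def)
  have e't: "e' \<in> touch S" using e'(1) inside_touch by blast
  obtain g0 f where g0: "dirs S g0" "f \<in> \<delta> S" "g0 f \<noteq> 0" using tight_side_direction[OF S(1,3) e't e'(2)] .
  have "val g0 S = 0" using g0(1) S(1) by (auto simp: dirs_def)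
  then have g0b: "g0 b = - g0 a" unfolding valS by simp
  then have g0a: "g0 a \<noteq> 0" using g0 ab(1) by auto
  define g where "g = (\<lambda>e. (1 / g0 a) * g0 e)"
  have g: "dirs S g" unfolding g_def by (rule dirs_scale[OF g0(1)])
  have ga: "g a = 1" "g b = -1" using g0a g0b by (auto simp: g_def)
  have tab: "a \<in> touch S" "b \<in> touch S" using ab(1) cut_touch[of S S] by auto
  have one: "\<exists>\<mu>. \<forall>e\<in>\<delta> S. d e = \<mu> * g e" if "dirs S d" for d
  proof -
    have "val d S = 0" using that S(1) by (auto simp: dirs_def)
    then show ?thesis unfolding ab(1) valS using ga by (intro exI[of _ "d a"]) auto
  qed
  have neg: "dirs S (\<lambda>e. - g e)" using dirs_scale[OF g, of "-1"] by simp
  obtain \<alpha> where \<alpha>: "\<alpha> > 0" "\<And>e. e \<in> touch S \<Longrightarrow> x e + \<alpha> * g e \<in> \<int> \<and> 0 \<le> x e + \<alpha> * g e"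
    "\<And>T. T \<noteq> {} \<Longrightarrow> T \<subseteq> S \<Longrightarrow> 2 \<le> val (\<lambda>e. x e + \<alpha> * g e) T"
    by (rule tight_side_ray[OF S(1,3) g tab(1) _ one]) (use ga in auto)
  obtain \<beta> where \<beta>: "\<beta> > 0" "\<And>e. e \<in> touch S \<Longrightarrow> x e + \<beta> * - g e \<in> \<int> \<and> 0 \<le> x e + \<beta> * - g e"
    "\<And>T. T \<noteq> {} \<Longrightarrow> T \<subseteq> S \<Longrightarrow> 2 \<le> val (\<lambda>e. x e + \<beta> * - g e) T"
  proof (rule tight_side_ray[OF S(1,3) neg tab(1)])
    show "- g a \<noteq> 0" using ga by simp
    fix d assume "dirs S d"
    then obtain \<mu> where "\<forall>e\<in>\<delta> S. d e = \<mu> * g e" using one by blast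
    then show "\<exists>\<mu>. \<forall>e\<in>\<delta> S. d e = \<mu> * - g e" by (intro exI[of _ "- \<mu>"]) simp
  qed (rule that)
  \<comment> \<open>The number \<open>1 - t\<close> is an integer, nonnegative and below 1.\<close>
  have one_of: "t = 1" if t: "t > 0" "1 + t * -1 \<in> \<int>" "0 \<le> 1 + t * -1" for t :: real
  proof -
    obtain k where k: "1 + t * -1 = of_int k" using t(2) by (rule Ints_cases)
    then have "0 \<le> k" "k < 1" using t(1,3) by linarith+
    then show ?thesis using k by simp
  qed
  have "\<alpha> = 1" using \<alpha>(1) \<alpha>(2)[OF tab(2)] ga ab by (intro one_of) auto
  have "\<beta> = 1" using \<beta>(1) \<beta>(2)[OF tab(1)] ga ab by (intro one_of) auto
  define y1 where "y1 = (\<lambda>e. x e + g e)"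
  define y2 where "y2 = (\<lambda>e. x e - g e)"
  have y1: "2 \<le> val y1 T" and y2: "2 \<le> val y2 T" if "T \<noteq> {}" "T \<subseteq> S" for T
    using \<alpha>(3)[OF that] \<beta>(3)[OF that] \<open>\<alpha> = 1\<close> \<open>\<beta> = 1\<close> by (auto simp: y1_def y2_def)
  have y0: "y1 b = 0" "y2 a = 0" using ga ab by (auto simp: y1_def y2_def)
  have bE: "b \<in> E" "a \<in> E" using ab(1) cut_sub[of S] by auto
  obtain p q where pq: "ends G b = {p, q}" using bE(1) by (rule edgeE)
  have "b \<in> \<delta> S" using ab by simp
  then have "(p \<in> S) \<noteq> (q \<in> S)" using in_cut[OF bE(1) pq] by blast
  then obtain b0 b1 where b: "ends G b = {b1, b0}" "b0 \<in> S" "b1 \<notin> S" using pq by (metis insert_commute)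
  have b1V: "b1 \<in> V - S" using b ends_sub[OF bE(1)] by auto
  define U where "U = insert b0 (V - S)"
  have cU: "conn G U" unfolding U_def
    by (rule conn_insert[OF tight_conn[OF tight_compl[OF S(1)]] bE(1) b(1) b1V])
  have UV: "U \<subseteq> V" "V - U = S - {b0}" using b SV by (auto simp: U_def)
  have fS: "finite S" using SV by (rule finVsub)
  have "card (S - {b0}) \<noteq> 0" using S(2) b fS by simp
  then have "S - {b0} \<noteq> {}" by (metis card.empty)
  then have UneV: "U \<noteq> V" using UV by blast
  have "card (V - S) \<le> card U" unfolding U_def by (rule card_mono) auto
  then have card: "card U \<ge> 2" using S(3) by simp
  have tU: "touch (S - {b0}) \<subseteq> inside S \<union> {a}"
  proof
    fix e assume e: "e \<in> touch (S - {b0})"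
    then have "e \<in> touch S" by (auto simp: touch_def)
    then have "e \<in> inside S \<or> e \<in> {a, b}" using touch_split[OF SV] ab by auto
    moreover have "e \<noteq> b" using e b by (auto simp: touch_def)
    ultimately show "e \<in> inside S \<union> {a}" by blast
  qed
  have iU: "inside S \<subseteq> touch (S - {b0})"
  proof
    fix e assume e: "e \<in> inside S"
    then have "e \<in> E" by (simp add: inside_def)
    then obtain u v where "ends G e = {u, v}" "u \<noteq> v" by (rule edgeE)
    then show "e \<in> touch (S - {b0})" using e by (auto simp: inside_def touch_def)
  qed
  define y where "y = (\<lambda>e. if e \<in> inside S then x e else 0)"
  have a_not: "a \<notin> inside S" "b \<notin> inside S" using ab(1) inside_cut[of S] by auto
  have sum_y: "val y T = sum x (inside S \<inter> \<delta> T)" for T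
    unfolding val_def by (rule sum.mono_neutral_cong_right) (auto simp: y_def)
  have sub_b: "\<delta> T \<subseteq> inside S \<union> {a}" if "T \<subseteq> S - {b0}" for T using cut_touch[OF that] tU by blast
  have ge2: "2 \<le> val y T" if T: "T \<noteq> {}" "T \<subseteq> S - {b0}" for T
  proof (cases "a \<in> \<delta> T")
    case False
    then have "inside S \<inter> \<delta> T = \<delta> T" using sub_b[OF T(2)] by blast
    moreover have "2 \<le> val x T" by (rule val_ge) (use T b SV in auto)
    ultimately show ?thesis unfolding sum_y by (simp add: val_def)
  next
    case True
    let ?I = "inside S \<inter> \<delta> T"
    have dT: "\<delta> T = insert a ?I" using True sub_b[OF T(2)] by blast
    \<comment> \<open>\<open>y2\<close> vanishes on \<open>a\<close> and is tested on
      \<open>T\<close>; \<open>y1\<close> vanishes on \<open>b\<close> and is tested on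
      \<open>S - T\<close>. Both cuts have the same edges inside \<open>S\<close>, and
      \<open>x\<close> is the average of \<open>y1\<close> and \<open>y2\<close>.\<close>
    have "val y2 T = sum y2 ?I" unfolding val_def by (subst dT) (simp add: a_not y0)
    then have 2: "2 \<le> sum y2 ?I" using y2[of T] T by auto
    have TS: "T \<subseteq> S" using T by blast
    have aT: "a \<notin> \<delta> (S - T)"
    proof -
      obtain p q where pq: "ends G a = {p, q}" using bE(2) by (rule edgeE)
      have "(p \<in> T) \<noteq> (q \<in> T)" "(p \<in> S) \<noteq> (q \<in> S)"
        using True ab(1) in_cut[OF bE(2) pq] by blast+
      then show ?thesis using TS unfolding in_cut[OF bE(2) pq] by blast
    qed
    have "\<delta> (S - T) \<subseteq> inside S \<union> {a, b}" using cut_touch[of "S - T" S] touch_split[OF SV] ab by auto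
    then have "\<delta> (S - T) \<subseteq> insert b (inside S \<inter> \<delta> (S - T))" using aT by blast
    then have d: "\<delta> (S - T) \<subseteq> insert b ?I" using inside_cut_diff[OF TS] by simp
    have "?I \<subseteq> \<delta> (S - T)" using inside_cut_diff[OF TS] by blast
    then have "val y1 (S - T) = sum y1 ?I" unfolding val_def
      by (intro sum.mono_neutral_right) (use d y0 in auto)
    moreover have "S - T \<noteq> {}" using T b by auto
    ultimately have 1: "2 \<le> sum y1 ?I" using y1[of "S - T"] by auto
    have "sum y1 ?I + sum y2 ?I = 2 * sum x ?I"
      by (simp add: y1_def y2_def sum.distrib sum_subtractf)
    then show ?thesis using 1 2 sum_y by simp
  qed
  have "basic_point (touch (V - U)) {\<delta> T | T. T \<noteq> {} \<and> T \<subseteq> V - U} y"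
  proof (rule basic_pointI)
    fix C assume "C \<in> {\<delta> T | T. T \<noteq> {} \<and> T \<subseteq> V - U}"
    then show "2 \<le> sum y C" using ge2 unfolding val_def UV by blast
  next
    fix d :: "'e \<Rightarrow> real"
    assume d: "\<And>e. e \<notin> touch (V - U) \<Longrightarrow> d e = 0" "\<And>e. e \<in> touch (V - U) \<Longrightarrow> y e = 0 \<Longrightarrow> d e = 0"
      "\<And>C. C \<in> {\<delta> T | T. T \<noteq> {} \<and> T \<subseteq> V - U} \<Longrightarrow> sum y C = 2 \<Longrightarrow> sum d C = 0"
    have d3: "val d T = 0" if "T \<noteq> {}" "T \<subseteq> S - {b0}" "val y T = 2" for T
      using d(3)[of "\<delta> T"] that unfolding val_def UV by blast
    have d0: "d e = 0" if "e \<notin> inside S" for e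
    proof (cases "e \<in> touch (V - U)")
      case True then show ?thesis using d(2)[OF True] that by (simp add: y_def)
    qed (use d(1) in auto)
    have dI: "val d T = sum d (inside S \<inter> \<delta> T)" for T
      unfolding val_def by (rule sum.mono_neutral_right) (use d0 in auto)
    \<comment> \<open>Restricting to the edges inside \<open>S\<close> can only lower the value of a
      tight set, and it stays at least 2, so the set stays tight for \<open>y\<close>.\<close>
    have small: "val d T = 0" if T: "tight T" "T \<subseteq> S" "b0 \<notin> T" for T
    proof (rule d3)
      show ne: "T \<noteq> {}" using T(1) by (simp add: tight_def)
      show sub: "T \<subseteq> S - {b0}" using T by blast
      have "val y T \<le> val x T"
        unfolding sum_y unfolding val_def by (rule sum_mono2) (use pos cut_sub[of T] in \<open>auto simp: less_imp_le\<close>)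
      then show "val y T = 2" using ge2[OF ne sub] T(1) by (simp add: tight_def)
    qed
    have "dirs S d" unfolding dirs_def
    proof (intro allI impI)
      fix T assume T: "T \<subseteq> S" "tight T"
      show "val d T = 0"
      proof (cases "b0 \<in> T")
        case False then show ?thesis using small T by blast
      next
        case True
        show ?thesis
        proof (cases "T = S")
          case True
          then have "inside S \<inter> \<delta> T = {}" using inside_cut by blast
          then show ?thesis unfolding dI by simp
        next
          case False
          then have S': "S - T \<noteq> {}" "S - T \<subseteq> S - {b0}" using T True by auto
          have "val y (S - T) = val y T" unfolding sum_y inside_cut_diff[OF T(1)] ..
          also have "\<dots> \<le> val x T"
            unfolding sum_y unfolding val_def by (rule sum_mono2) (use pos cut_sub[of T] in \<open>auto simp: less_imp_le\<close>)
          finally have "val y (S - T) = 2" using ge2[OF S'] T by (simp add: tight_def)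
          then have "val d (S - T) = 0" by (rule d3[OF S'])
          then show ?thesis unfolding dI inside_cut_diff[OF T(1)] .
        qed
      qed
    qed
    moreover have "dirs (V - S) d" unfolding dirs_def
    proof (intro allI impI)
      fix T assume T: "T \<subseteq> V - S" "tight T"
      then have "inside S \<inter> \<delta> T = {}" by (auto simp: inside_def cut_def)
      then show "val d T = 0" unfolding dI by simp
    qed
    ultimately have "d e = 0" if "e \<in> E" for e using glue[OF S(1) _ _ that] by blast
    then show "\<forall>e. d e = 0" using d0 by (auto simp: inside_def)
  qed (use pos in \<open>auto simp: y_def inside_def less_imp_le\<close>)
  then have "y e' \<in> \<int>"
    by (rule contraction_integral[OF UV(1) cU card UneV]) (use iU e' UV in auto)
  then show False using e' by (simp add: y_def)
qed

lemma cut_nonempty: "tight S \<Longrightarrow> \<delta> S \<noteq> {}"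
  by (auto simp: tight_def val_def)

text \<open>A single cut edge would have value 2. If two cut edges are integral, both have value 1,
  and a nonintegral edge on either side is excluded by \<open>two_edge_cut_aux\<close>. If they are
  nonintegral, each side has a direction that is a nonzero multiple of (1, -1) on the cut, and the
  two can be pasted.\<close>

lemma nontrivial_cut_card:
  assumes S: "tight S" "card S \<ge> 2" "card (V - S) \<ge> 2"
  shows "card (\<delta> S) \<ge> 3"
proof (rule ccontr)
  assume "\<not> card (\<delta> S) \<ge> 3"
  moreover have "card (\<delta> S) \<noteq> 0" using cut_nonempty[OF S(1)] by simp
  ultimately consider "card (\<delta> S) = 1" | "card (\<delta> S) = 2" by linarith
  then show False
  proof cases
    case 1
    then obtain a where "\<delta> S = {a}" by (auto simp: card_1_singleton_iff)
    then show False using S(1) less_two[of a] cut_sub[of S] by (auto simp: tight_def val_def)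
  next
    case 2
    then obtain a b where ab: "\<delta> S = {a, b}" "a \<noteq> b" by (auto simp: card_2_iff)
    have abE: "a \<in> E" "b \<in> E" using ab cut_sub[of S] by auto
    have valS: "val d S = d a + d b" for d using ab by (simp add: val_def)
    have sum2: "x a + x b = 2" using S(1) valS[of x] by (simp add: tight_def)
    note SV = tight_sub[OF S(1)]
    note S' = tight_compl[OF S(1)]
    have VV: "V - (V - S) = S" using SV by blast
    have dd: "\<delta> (V - S) = \<delta> S" by (rule cut_compl)
    show False
    proof (cases "x a \<in> \<int>")
      case True
      then obtain k where k: "x a = of_int k" by (auto elim: Ints_cases)
      have "0 < k" "k < 2" using k pos[OF abE(1)] less_two[OF abE(1)] by linarith+
      then have x1: "x a = 1" "x b = 1" using k sum2 by auto
      obtain e' where e': "e' \<in> E" "x e' \<notin> \<int>" using nonintegral by blast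
      have "e' \<noteq> a" "e' \<noteq> b" using e' x1 by auto
      then have "e' \<notin> \<delta> S" using ab by auto
      then have "e' \<in> inside S \<or> e' \<in> inside (V - S)"
        using e'(1) ends_sub[OF e'(1)] by (auto simp: cut_def inside_def)
      then show False
      proof
        assume "e' \<in> inside S" then show False by (rule two_edge_cut_aux[OF S ab x1 _ e'(2)])
      next
        assume i: "e' \<in> inside (V - S)"
        show False
          by (rule two_edge_cut_aux[OF S' S(3) _ _ ab(2) x1 i e'(2)]) (use S(2) ab in \<open>auto simp: VV dd\<close>)
      qed
    next
      case False
      have t: "a \<in> touch S" "a \<in> touch (V - S)" using ab cut_touch[of S S] cut_touch[of "V - S" "V - S"] dd by auto
      obtain d1 f1 where d1: "dirs S d1" "f1 \<in> \<delta> S" "d1 f1 \<noteq> 0"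
        using tight_side_direction[OF S(1,3) t(1) False] .
      have "card (V - (V - S)) \<ge> 2" using S(2) VV by simp
      then obtain d2 f2 where d2: "dirs (V - S) d2" "f2 \<in> \<delta> S" "d2 f2 \<noteq> 0"
        using tight_side_direction[OF S' _ t(2) False] dd by metis
      have "val d1 S = 0" using d1(1) S(1) by (auto simp: dirs_def)
      then have b1: "d1 b = - d1 a" unfolding valS by simp
      have "val d2 (V - S) = 0" using d2(1) S' by (auto simp: dirs_def)
      then have b2: "d2 b = - d2 a" using valS[of d2] by (simp add: val_compl)
      have a: "d1 a \<noteq> 0" "d2 a \<noteq> 0" using b1 b2 d1 d2 ab by auto
      have "d1 a = 0"
        by (rule glue2(1)[OF S(1) d1(1) dirs_scale[OF d2(1), of "d1 a / d2 a"]]) (use a b1 b2 ab t in auto)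
      then show False using a by simp
    qed
  qed
qed

end

lemma singleton_psubset: "v \<in> S \<Longrightarrow> card S \<ge> 2 \<Longrightarrow> {v} \<subset> S"
proof -
  assume v: "v \<in> S" "card S \<ge> 2"
  have "{v} \<noteq> S"
  proof
    assume "{v} = S"
    then have "card S = 1" by auto
    then show False using v by simp
  qed
  then show ?thesis using v by auto
qed

context fractional_minimal
begin

section \<open>Minimal tight sets are pairs, and half-integrality\<close>

lemma integer_one:
  assumes "t > 0" "1 + t \<in> \<int>" "t \<le> 1" shows "t = (1::real)"
proof -
  obtain k where k: "1 + t = of_int k" using assms(2) by (rule Ints_cases)
  then have "1 < k" "k \<le> 2" using assms by linarith+
  then show ?thesis using k by simp
qed

lemma inside_pair: "e \<in> E \<Longrightarrow> ends G e = {u, v} \<Longrightarrow> inside {u, v} = {e}"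
proof -
  assume e: "e \<in> E" "ends G e = {u, v}"
  have "f = e" if "f \<in> E" "ends G f \<subseteq> {u, v}" for f
  proof -
    have "ends G f = {u, v}"
      by (rule card_subset_eq) (use that e card_ends[of f] card_ends[of e] in auto)
    then show ?thesis using simple[OF that(1) e(1)] e(2) by simp
  qed
  then have "inside {u, v} \<subseteq> {e}" unfolding inside_def by blast
  moreover have "e \<in> inside {u, v}" using e by (simp add: inside_def)
  ultimately show ?thesis by blast
qed

lemma val_pair:
  assumes "e \<in> E" "ends G e = {u, v}" "u \<noteq> v"
  shows "val w {u, v} = val w {u} + val w {v} - 2 * w e"
proof -
  have "{u, v} \<subseteq> V" using ends_sub[OF assms(1)] assms(2) by simp
  then have "(\<Sum>z\<in>{u, v}. val w {z}) = 2 * sum w (inside {u, v}) + val w {u, v}"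
    by (rule sum_val_nodes)
  moreover have "(\<Sum>z\<in>{u, v}. val w {z}) = val w {u} + val w {v}" using assms(3) by simp
  moreover have "sum w (inside {u, v}) = w e" unfolding inside_pair[OF assms(1,2)] by simp
  ultimately show ?thesis by linarith
qed

lemma node_kernel:
  assumes "finite B" "card B < card A"
  shows "\<exists>d. (\<forall>e. e \<notin> A \<longrightarrow> d e = 0) \<and> (\<exists>e\<in>A. d e \<noteq> 0) \<and> (\<forall>z\<in>B. val d {z} = 0)"
proof (rule more_unknowns_than_equations[OF assms, of "\<lambda>z e. if e \<in> \<delta> {z} then 1 else 0"])
  fix d :: "'e \<Rightarrow> real" and e
  assume d: "\<And>e. e \<notin> A \<Longrightarrow> d e = 0" "e \<in> A" "d e \<noteq> 0"
    "\<And>z. z \<in> B \<Longrightarrow> (\<Sum>e\<in>A. d e * (if e \<in> \<delta> {z} then 1 else 0)) = 0"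
  have "val d {z} = (\<Sum>e\<in>A. d e * (if e \<in> \<delta> {z} then 1 else 0))" for z
    unfolding val_def by (rule sum.mono_neutral_cong) (use d(1) in auto)
  then show ?thesis using d by (intro exI[of _ d]) auto
qed

text \<open>Inside \<open>S\<close> only the tight nodes and \<open>S\<close> itself constrain a
  direction. A node that is not tight, or more than \<open>card S - 1\<close> inner edges, would
  leave enough freedom to extend an outside direction across the cut. So there are at most
  \<open>card S - 1\<close> inner edges, of total value \<open>card S - 1\<close> and of value at
  most 1 each; all values are 1, and the ends of any inner edge form a tight set, which must be
  \<open>S\<close>. The points \<open>y1\<close> and \<open>y2\<close> are the ends of the line of
  outside directions, with \<open>x\<close> as midpoint: one moves the whole boundary value to
  \<open>u\<close>, the other to \<open>v\<close>.\<close>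

lemma minimal_tight_pair:
  assumes S: "tight S" "card S \<ge> 2" "card (V - S) \<ge> 2"
    and min: "\<And>T. tight T \<Longrightarrow> T \<subset> S \<Longrightarrow> card T = 1"
  obtains u v e y1 y2 where "S = {u, v}" "u \<noteq> v" "e \<in> E" "ends G e = {u, v}" "x e = 1" "tight {u}" "tight {v}"
    "\<And>f. f \<in> touch (V - S) \<Longrightarrow> y1 f \<in> \<int> \<and> y2 f \<in> \<int> \<and> 0 \<le> y1 f \<and> 0 \<le> y2 f \<and> y1 f + y2 f = 2 * x f"
    "\<And>T. T \<noteq> {} \<Longrightarrow> T \<subseteq> V - S \<Longrightarrow> 2 \<le> val y1 T \<and> 2 \<le> val y2 T"
    "sum y1 (\<delta> {u} \<inter> \<delta> S) = 2" "sum y1 (\<delta> {v} \<inter> \<delta> S) = 0"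
    "sum y2 (\<delta> {u} \<inter> \<delta> S) = 0" "sum y2 (\<delta> {v} \<inter> \<delta> S) = 2"
proof -
  note SV = tight_sub[OF S(1)]
  note S' = tight_compl[OF S(1)]
  note cS = tight_conn[OF S(1)]
  have VV: "V - (V - S) = S" using SV by blast
  have dd: "\<delta> (V - S) = \<delta> S" by (rule cut_compl)
  have fS: "finite S" using SV by (rule finVsub)
  \<comment> \<open>At least three positive integers cannot sum to 2.\<close>
  have "\<exists>f\<in>\<delta> S. x f \<notin> \<int>"
  proof (rule ccontr)
    assume no: "\<not> ?thesis"
    have "1 \<le> x f" if f: "f \<in> \<delta> S" for f
    proof -
      have "x f \<in> \<int>" using no f by blast
      then obtain k where k: "x f = of_int k" by (rule Ints_cases)
      moreover have "0 < x f" using pos f cut_sub by blast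
      ultimately show ?thesis by simp
    qed
    then have "(\<Sum>f\<in>\<delta> S. 1) \<le> val x S" unfolding val_def by (rule sum_mono)
    then show False using nontrivial_cut_card[OF S] S(1) by (simp add: tight_def)
  qed
  then obtain f1 where f1: "f1 \<in> \<delta> S" "x f1 \<notin> \<int>" by blast
  then have "f1 \<in> touch (V - S)" using cut_touch[of "V - S" "V - S"] dd by auto
  then obtain g0 f0 where g0: "dirs (V - S) g0" "f0 \<in> \<delta> S" "g0 f0 \<noteq> 0"
    using tight_side_direction[OF S' _ _ f1(2)] S(2) unfolding VV dd by metis
  have valS0: "val d S = 0" if "dirs (V - S) d" for d
  proof -
    have "val d (V - S) = 0" using that S' by (auto simp: dirs_def)
    then show ?thesis by (simp add: val_compl)
  qed
  have dirsI: "dirs S d" if "val d S = 0" "\<And>z. z \<in> S \<Longrightarrow> tight {z} \<Longrightarrow> val d {z} = 0" for d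
    unfolding dirs_def
  proof (intro allI impI)
    fix T assume T: "T \<subseteq> S" "tight T"
    show "val d T = 0"
    proof (cases "T = S")
      case False
      then have "card T = 1" using min T by blast
      then obtain z where "T = {z}" by (auto simp: card_1_singleton_iff)
      then show ?thesis using that(2) T by auto
    qed (use that(1) in simp)
  qed
  \<comment> \<open>The extension arguments below end here: an outside direction whose boundary
    values can be balanced at the tight nodes of \<open>S\<close> would paste to a free
    direction.\<close>
  have ext: "d f = 0" if "dirs (V - S) d" "\<And>f. f \<in> \<delta> S \<Longrightarrow> d2 f = d f"
    "\<And>z. z \<in> S \<Longrightarrow> tight {z} \<Longrightarrow> val d2 {z} = 0" "f \<in> \<delta> S" for d d2 f
  proof -
    have "val d2 S = val d S" by (rule val_cong) (rule that(2))
    then have "val d2 S = 0" using valS0[OF that(1)] by simp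
    then have "dirs S d2" using that(3) by (rule dirsI)
    then have "d2 f = 0" using glue2(1)[OF S(1) _ that(1), of d2 f] that(2,4) cut_touch[of S S] by blast
    then show ?thesis using that(2,4) by simp
  qed
  have nin: "f \<notin> inside S" if "f \<in> \<delta> S" for f using that inside_cut by blast
  have tz: "tight {v}" if v: "v \<in> S" for v
  proof (rule ccontr)
    assume nt: "\<not> tight {v}"
    obtain d where d: "\<And>e. e \<notin> inside S \<Longrightarrow> d e = g0 e" "\<And>z. z \<in> S \<Longrightarrow> z \<noteq> v \<Longrightarrow> val d {z} = 0"
      using boundary_extension[OF cS SV v] by metis
    have "g0 f0 = 0" by (rule ext[OF g0(1), of d]) (use d nin nt g0(2) in auto)
    then show False using g0(3) by simp
  qed
  have cin: "card (inside S) \<le> card S - 1"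
  proof (rule ccontr)
    assume big: "\<not> ?thesis"
    obtain r where r: "r \<in> S" using S by (metis card.empty ex_in_conv not_numeral_le_zero)
    have lt: "card (S - {r}) < card (inside S)" using big r fS by simp
    obtain d e where d: "\<And>e. e \<notin> inside S \<Longrightarrow> d e = 0" "e \<in> inside S" "d e \<noteq> 0"
      "\<And>z. z \<in> S - {r} \<Longrightarrow> val d {z} = 0"
      using node_kernel[OF finite_Diff[OF fS] lt] by blast
    then have vd: "val d {z} = 0" if "z \<in> S" "z \<noteq> r" for z using that by blast
    have dS: "val d S = 0" unfolding val_def by (rule sum.neutral) (use d(1) nin in auto)
    show False
    \<comment> \<open>If \<open>d\<close> is balanced at \<open>r\<close> too, it is itself a
      forbidden direction; otherwise a multiple of it repairs the imbalance that
      \<open>boundary_extension\<close> leaves at \<open>r\<close>.\<close>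
    proof (cases "val d {r} = 0")
      case True
      have "dirs S d" by (rule dirsI[OF dS]) (use vd True in metis)
      then have "d e = 0" by (rule dirs_cut_zero[OF S(1)]) (use d(1,2) nin inside_touch in auto)
      then show False using d(3) by simp
    next
      case False
      obtain d1 where d1: "\<And>e. e \<notin> inside S \<Longrightarrow> d1 e = g0 e" "\<And>z. z \<in> S \<Longrightarrow> z \<noteq> r \<Longrightarrow> val d1 {z} = 0"
        using boundary_extension[OF cS SV r] by metis
      have "g0 f0 = 0"
      proof (rule ext[OF g0(1) _ _ g0(2), of "\<lambda>e. d1 e - (val d1 {r} / val d {r}) * d e"])
        fix z assume "z \<in> S"
        then show "val (\<lambda>e. d1 e - val d1 {r} / val d {r} * d e) {z} = 0"
          unfolding val_diff_scale using vd d1(2) False by (cases "z = r") auto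
      qed (use d(1) d1(1) nin in auto)
      then show False using g0(3) by simp
    qed
  qed
  have sumin: "sum x (inside S) = real (card S) - 1"
  proof -
    have "(\<Sum>z\<in>S. val x {z}) = (\<Sum>z\<in>S. 2)" by (rule sum.cong) (use tz in \<open>auto simp: tight_def\<close>)
    then show ?thesis using sum_val_nodes[OF SV, of x] S(1) by (simp add: tight_def)
  qed
  have le1: "x e \<le> 1" if e: "e \<in> inside S" for e
  proof -
    have eE: "e \<in> E" using e by (simp add: inside_def)
    then obtain u v where uv: "ends G e = {u, v}" "u \<noteq> v" by (rule edgeE)
    have "{u, v} \<subseteq> S" using e uv by (simp add: inside_def)
    moreover have "S \<subset> V" using S(1) by (simp add: tight_def)
    ultimately have "2 \<le> val x {u, v}" by (intro val_ge) auto
    moreover have "val x {u} = 2" "val x {v} = 2" using tz \<open>{u, v} \<subseteq> S\<close> by (auto simp: tight_def)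
    ultimately show ?thesis using val_pair[OF eE uv, of x] by simp
  qed
  have eq1: "x e = 1" if e: "e \<in> inside S" for e
  proof -
    have "card S \<noteq> 0" using S(2) by simp
    then have "real (card (inside S)) \<le> real (card S) - 1" using cin by linarith
    then have "(\<Sum>e\<in>inside S. 1 - x e) \<le> 0" using sumin by (simp add: sum_subtractf)
    moreover have nn: "\<And>f. f \<in> inside S \<Longrightarrow> 0 \<le> 1 - x f" using le1 by simp
    ultimately have "(\<Sum>e\<in>inside S. 1 - x e) = 0" using sum_nonneg[of "inside S" "\<lambda>e. 1 - x e"] by simp
    then have "1 - x e = 0" using sum_nonneg_eq_0_iff[of "inside S" "\<lambda>e. 1 - x e"] nn e by simp
    then show ?thesis by simp
  qed
  obtain p where p: "p \<in> S" using S by (metis card.empty ex_in_conv not_numeral_le_zero)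
  have "{p} \<subset> S" using p S(2) by (rule singleton_psubset)
  then obtain e u v where e: "e \<in> E" "u \<in> {p}" "v \<in> S - {p}" "ends G e = {u, v}"
    using connE[OF cS, of "{p}"] by blast
  have uv: "u \<noteq> v" "u \<in> S" "v \<in> S" using e p by auto
  have eS: "e \<in> inside S" using e uv by (simp add: inside_def)
  have "tight {u, v}"
  proof -
    have "val x {u, v} = 2" using val_pair[OF e(1,4) uv(1), of x] tz uv eq1[OF eS] by (simp add: tight_def)
    then show ?thesis using uv S(1) by (auto simp: tight_def)
  qed
  have Suv: "S = {u, v}"
  proof (rule ccontr)
    assume "S \<noteq> {u, v}"
    then have "{u, v} \<subset> S" using uv by auto
    then have "card {u, v} = 1" using min \<open>tight {u, v}\<close> by blast
    then show False using uv(1) by simp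
  qed
  have inS: "inside S = {e}" unfolding Suv by (rule inside_pair[OF e(1,4)])
  have cutu: "\<delta> {u} = insert e (\<delta> {u} \<inter> \<delta> S)" "\<delta> {v} = insert e (\<delta> {v} \<inter> \<delta> S)"
    and cutS: "\<delta> S = (\<delta> {u} \<inter> \<delta> S) \<union> (\<delta> {v} \<inter> \<delta> S)" "(\<delta> {u} \<inter> \<delta> S) \<inter> (\<delta> {v} \<inter> \<delta> S) = {}"
  proof -
    have t: "touch S = insert e (\<delta> S)" using touch_split[OF SV] inS by simp
    have "e \<in> \<delta> {u}" "e \<in> \<delta> {v}" using uv(1) in_cut[OF e(1,4)] by auto
    then show "\<delta> {u} = insert e (\<delta> {u} \<inter> \<delta> S)" "\<delta> {v} = insert e (\<delta> {v} \<inter> \<delta> S)"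
      using cut_touch[of "{u}" S] cut_touch[of "{v}" S] uv t by auto
    have "(f \<in> \<delta> {u}) \<noteq> (f \<in> \<delta> {v})" if f: "f \<in> \<delta> S" for f
    proof -
      have fE: "f \<in> E" using f cut_sub by blast
      then obtain a b where ab: "ends G f = {a, b}" "a \<noteq> b" by (rule edgeE)
      show ?thesis using f uv(1) ab(2) unfolding in_cut[OF fE ab(1)] Suv by auto
    qed
    then show "\<delta> S = (\<delta> {u} \<inter> \<delta> S) \<union> (\<delta> {v} \<inter> \<delta> S)" "(\<delta> {u} \<inter> \<delta> S) \<inter> (\<delta> {v} \<inter> \<delta> S) = {}"
      by blast+
  qed
  have enS: "e \<notin> \<delta> S" using inS nin by blast
  \<comment> \<open>The part of the boundary value at \<open>u\<close>. Outside directions have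
    opposite parts at \<open>u\<close> and \<open>v\<close>, so \<open>\<rho>\<close> is their only
    freedom on the cut.\<close>
  define \<rho> where "\<rho> = (\<lambda>d::'e \<Rightarrow> real. sum d (\<delta> {u} \<inter> \<delta> S))"
  have valu: "val d {u} = d e + \<rho> d" for d
    unfolding val_def \<rho>_def by (subst cutu(1)) (simp add: enS)
  have valv: "val d {v} = d e + sum d (\<delta> {v} \<inter> \<delta> S)" for d
    unfolding val_def by (subst cutu(2)) (simp add: enS)
  have valS: "val d S = \<rho> d + sum d (\<delta> {v} \<inter> \<delta> S)" for d
    unfolding val_def \<rho>_def by (subst cutS(1), subst sum.union_disjoint) (use cutS(2) in auto)
  have rho0: "d f = 0" if "dirs (V - S) d" "\<rho> d = 0" "f \<in> \<delta> S" for d f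
  proof (rule ext[OF that(1) _ _ that(3), of "\<lambda>f. if f = e then 0 else d f"])
    let ?d = "\<lambda>f. if f = e then 0 else d f"
    have r: "\<rho> ?d = \<rho> d" unfolding \<rho>_def by (rule sum.cong) (use enS in auto)
    have s: "sum ?d (\<delta> {v} \<inter> \<delta> S) = sum d (\<delta> {v} \<inter> \<delta> S)" by (rule sum.cong) (use enS in auto)
    fix z assume "z \<in> S"
    then have "z = u \<or> z = v" using Suv by simp
    moreover have "val ?d {u} = 0" unfolding valu r using that(2) by simp
    moreover have "val ?d {v} = 0" unfolding valv s using that(2) valS0[OF that(1)] valS[of d] by simp
    ultimately show "val ?d {z} = 0" by blast
  qed (use enS in auto)
  have rho_lin: "\<rho> (\<lambda>e. d e - c * d' e) = \<rho> d - c * \<rho> d'" "\<rho> (\<lambda>e. c * d e) = c * \<rho> d" for d d' c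
    by (simp_all add: \<rho>_def sum_subtractf sum_distrib_left)
  have "\<rho> g0 \<noteq> 0" using rho0[OF g0(1) _ g0(2)] g0(3) by blast
  define g where "g = (\<lambda>e. (1 / \<rho> g0) * g0 e)"
  have g: "dirs (V - S) g" unfolding g_def by (rule dirs_scale[OF g0(1)])
  have rg: "\<rho> g = 1" unfolding g_def rho_lin using \<open>\<rho> g0 \<noteq> 0\<close> by simp
  have sg: "sum g (\<delta> {v} \<inter> \<delta> S) = -1" using valS0[OF g] valS[of g] rg by simp
  have gf0: "g f0 \<noteq> 0" using g0(3) \<open>\<rho> g0 \<noteq> 0\<close> by (simp add: g_def)
  have tdS: "\<delta> S \<subseteq> touch (V - S)" using cut_touch[of "V - S" "V - S"] dd by simp
  then have f0t: "f0 \<in> touch (V - S)" using g0(2) by blast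
  have one: "\<exists>\<mu>. \<forall>e\<in>\<delta> (V - S). d e = \<mu> * g e" if d: "dirs (V - S) d" for d
  proof (rule exI[of _ "\<rho> d"], rule ballI)
    fix f assume "f \<in> \<delta> (V - S)"
    then have "f \<in> \<delta> S" by (simp add: dd)
    then have "d f - \<rho> d * g f = 0"
      by (intro rho0[OF dirs_diff[OF d g, of "\<rho> d"]]) (simp_all add: rho_lin rg)
    then show "d f = \<rho> d * g f" by simp
  qed
  have card': "card (V - (V - S)) \<ge> 2" using S(2) VV by simp
  have neg: "dirs (V - S) (\<lambda>e. - g e)" using dirs_scale[OF g, of "-1"] by simp
  obtain \<alpha> where \<alpha>: "\<alpha> > 0" "\<And>e. e \<in> touch (V - S) \<Longrightarrow> x e + \<alpha> * g e \<in> \<int> \<and> 0 \<le> x e + \<alpha> * g e"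
    "\<And>T. T \<noteq> {} \<Longrightarrow> T \<subseteq> V - S \<Longrightarrow> 2 \<le> val (\<lambda>e. x e + \<alpha> * g e) T"
    by (rule tight_side_ray[OF S' card' g f0t gf0 one]) (assumption, rule that)
  obtain \<beta> where \<beta>: "\<beta> > 0" "\<And>e. e \<in> touch (V - S) \<Longrightarrow> x e + \<beta> * - g e \<in> \<int> \<and> 0 \<le> x e + \<beta> * - g e"
    "\<And>T. T \<noteq> {} \<Longrightarrow> T \<subseteq> V - S \<Longrightarrow> 2 \<le> val (\<lambda>e. x e + \<beta> * - g e) T"
  proof (rule tight_side_ray[OF S' card' neg f0t])
    show "- g f0 \<noteq> 0" using gf0 by simp
    fix d assume "dirs (V - S) d"
    then obtain \<mu> where "\<forall>e\<in>\<delta> (V - S). d e = \<mu> * g e" using one by blast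
    then show "\<exists>\<mu>. \<forall>e\<in>\<delta> (V - S). d e = \<mu> * - g e" by (intro exI[of _ "- \<mu>"]) simp
  qed (rule that)
  have xu: "\<rho> x = 1" "sum x (\<delta> {v} \<inter> \<delta> S) = 1"
    using valu[of x] valv[of x] tz uv eq1[OF eS] by (auto simp: tight_def)
  \<comment> \<open>The cut edges at \<open>u\<close> carry \<open>1 + \<alpha>\<close>, an integer,
    and those at \<open>v\<close> carry \<open>1 - \<alpha> \<ge> 0\<close>.\<close>
  have "\<alpha> = 1"
  proof (rule integer_one[OF \<alpha>(1)])
    have "\<rho> (\<lambda>e. x e + \<alpha> * g e) = 1 + \<alpha>" using xu rg by (simp add: \<rho>_def sum.distrib sum_distrib_left[symmetric])
    moreover have "\<rho> (\<lambda>e. x e + \<alpha> * g e) \<in> \<int>" unfolding \<rho>_def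
      by (rule Ints_sum) (use \<alpha>(2) tdS in blast)
    ultimately show "1 + \<alpha> \<in> \<int>" by simp
    have "0 \<le> sum (\<lambda>e. x e + \<alpha> * g e) (\<delta> {v} \<inter> \<delta> S)" by (rule sum_nonneg) (use \<alpha>(2) tdS in blast)
    then show "\<alpha> \<le> 1" using xu sg by (simp add: sum.distrib sum_distrib_left[symmetric])
  qed
  have "\<beta> = 1"
  proof (rule integer_one[OF \<beta>(1)])
    have "sum (\<lambda>e. x e + \<beta> * - g e) (\<delta> {v} \<inter> \<delta> S) = 1 + \<beta>"
      using xu sg by (simp add: sum_subtractf sum_distrib_left[symmetric])
    moreover have "sum (\<lambda>e. x e + \<beta> * - g e) (\<delta> {v} \<inter> \<delta> S) \<in> \<int>"
      by (rule Ints_sum) (use \<beta>(2) tdS in blast)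
    ultimately show "1 + \<beta> \<in> \<int>" by simp
    have "0 \<le> \<rho> (\<lambda>e. x e + \<beta> * - g e)" unfolding \<rho>_def by (rule sum_nonneg) (use \<beta>(2) tdS in blast)
    then show "\<beta> \<le> 1" using xu rg by (simp add: \<rho>_def sum_subtractf sum_distrib_left[symmetric])
  qed
  define y1 where "y1 = (\<lambda>e. x e + \<alpha> * g e)"
  define y2 where "y2 = (\<lambda>e. x e + \<beta> * - g e)"
  show ?thesis
  proof (rule that[of u v e y1 y2])
    show "y1 f \<in> \<int> \<and> y2 f \<in> \<int> \<and> 0 \<le> y1 f \<and> 0 \<le> y2 f \<and> y1 f + y2 f = 2 * x f" if "f \<in> touch (V - S)" for f
      using \<alpha>(2)[OF that] \<beta>(2)[OF that] \<open>\<alpha> = 1\<close> \<open>\<beta> = 1\<close> by (auto simp: y1_def y2_def)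
    show "2 \<le> val y1 T \<and> 2 \<le> val y2 T" if "T \<noteq> {}" "T \<subseteq> V - S" for T
      using \<alpha>(3)[OF that] \<beta>(3)[OF that] by (auto simp: y1_def y2_def)
    show "sum y1 (\<delta> {u} \<inter> \<delta> S) = 2" "sum y1 (\<delta> {v} \<inter> \<delta> S) = 0"
      "sum y2 (\<delta> {u} \<inter> \<delta> S) = 0" "sum y2 (\<delta> {v} \<inter> \<delta> S) = 2"
      using xu rg sg \<open>\<alpha> = 1\<close> \<open>\<beta> = 1\<close> by (auto simp: y1_def y2_def sum.distrib sum_subtractf \<rho>_def)
  qed (use Suv uv e tz eq1[OF eS] in auto)
qed

lemma node_degree: assumes v: "v \<in> V" shows "2 \<le> card (\<delta> {v})"
proof (rule ccontr)
  assume small: "\<not> ?thesis"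
  have "{v} \<subset> V" using v cardV by (rule singleton_psubset)
  then have ge: "2 \<le> val x {v}" by (intro val_ge) auto
  have "card (\<delta> {v}) = 0 \<or> card (\<delta> {v}) = 1" using small by linarith
  then show False
  proof
    assume "card (\<delta> {v}) = 0" then show False using ge by (simp add: val_def)
  next
    assume "card (\<delta> {v}) = 1"
    then obtain a where a: "\<delta> {v} = {a}" by (auto simp: card_1_singleton_iff)
    then show False using ge less_two[of a] cut_sub[of "{v}"] by (auto simp: val_def)
  qed
qed

text \<open>If only nodes and their complements were tight, the dimension count would give
  \<open>card E \<le> card N\<close>, while all degrees are at least 2. Equality throughout makes
  every node tight of degree 2; then subtracting 1 from \<open>x\<close> on every edge gives a
  direction, so \<open>x\<close> is constantly 1.\<close>

lemma exists_nontrivial_tight: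
  "\<exists>S. tight S \<and> card S \<ge> 2 \<and> card (V - S) \<ge> 2"
proof (rule ccontr)
  assume no: "\<not> ?thesis"
  define N where "N = {v \<in> V. tight {v}}"
  have kernel: "d e = 0" if d: "\<And>v. v \<in> N \<Longrightarrow> val d {v} = 0" and e: "e \<in> E" for d e
  proof (rule zero_direction[OF _ e])
    have small: "val d S = 0" if "tight S" "\<not> card S \<ge> 2" for S
    proof -
      have "card S \<noteq> 0" using that(1) finVsub[OF tight_sub[OF that(1)]] by (auto simp: tight_def)
      then have "card S = 1" using that(2) by linarith
      then obtain v where "S = {v}" by (auto simp: card_1_singleton_iff)
      then show ?thesis using d[of v] that(1) by (auto simp: N_def tight_def)
    qed
    fix S assume S: "tight S"
    then have "\<not> card S \<ge> 2 \<or> \<not> card (V - S) \<ge> 2" using no by blast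
    then show "val d S = 0" using small[OF S] small[OF tight_compl[OF S]] val_compl[of d S] by auto
  qed
  have fN: "finite N" by (simp add: N_def)
  have cE: "card E \<le> card N"
  proof (rule ccontr)
    assume "\<not> ?thesis"
    then have lt: "card N < card E" by simp
    obtain d e where d: "e \<in> E" "d e \<noteq> 0" "\<And>z. z \<in> N \<Longrightarrow> val d {z} = 0"
      using node_kernel[OF fN lt] by blast
    then have "d e = 0" using kernel[of d e] by blast
    then show False using d(2) by simp
  qed
  note deg = node_degree
  have hand: "(\<Sum>v\<in>V. card (\<delta> {v})) = 2 * card E"
  proof -
    have "inside V = E" "\<delta> V = {}" using ends_sub by (auto simp: inside_def cut_def)
    then have "(\<Sum>v\<in>V. val (\<lambda>_. 1) {v}) = 2 * real (card E)" using sum_val_nodes[of V "\<lambda>_. 1"] by (simp add: val_def)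
    then have "real (\<Sum>v\<in>V. card (\<delta> {v})) = real (2 * card E)" by (simp add: val_def)
    then show ?thesis by linarith
  qed
  have "card N \<le> card V" by (rule card_mono) (auto simp: N_def)
  moreover have "2 * card V \<le> (\<Sum>v\<in>V. card (\<delta> {v}))" using sum_mono[of V "\<lambda>_. 2" "\<lambda>v. card (\<delta> {v})"] deg by simp
  ultimately have "card N = card V" "(\<Sum>v\<in>V. card (\<delta> {v})) = 2 * card V" using hand cE by linarith+
  then have "N = V" using card_subset_eq[of V N] by (auto simp: N_def)
  have deg2: "card (\<delta> {v}) = 2" if v: "v \<in> V" for v
  proof -
    have "(\<Sum>v\<in>V. card (\<delta> {v}) - 2) = (\<Sum>v\<in>V. card (\<delta> {v})) - (\<Sum>v\<in>V. 2)"
      by (rule sum_subtractf_nat) (use deg in auto)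
    then have "(\<Sum>v\<in>V. card (\<delta> {v}) - 2) = 0" using \<open>(\<Sum>v\<in>V. card (\<delta> {v})) = 2 * card V\<close> by simp
    then have "card (\<delta> {v}) - 2 = 0" using v by (simp add: sum_eq_0_iff)
    then show ?thesis using deg[OF v] by simp
  qed
  have "x e - 1 = 0" if "e \<in> E" for e
  proof (rule kernel[OF _ that, of "\<lambda>e. x e - 1"])
    fix v assume "v \<in> N"
    then show "val (\<lambda>e. x e - 1) {v} = 0" using deg2[of v] by (simp add: N_def tight_def val_def sum_subtractf)
  qed
  then have "x e = 1" if "e \<in> E" for e using that by force
  then show False using nonintegral by auto
qed

lemma pair_in_tight:
  assumes S: "tight S" "card S \<ge> 2" "card (V - S) \<ge> 2"
  obtains u v e y1 y2 where "{u, v} \<subseteq> S" "u \<noteq> v" "e \<in> E" "ends G e = {u, v}" "x e = 1" "tight {u}" "tight {v}" "tight {u, v}"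
    "\<And>f. f \<in> touch (V - {u, v}) \<Longrightarrow> y1 f \<in> \<int> \<and> y2 f \<in> \<int> \<and> 0 \<le> y1 f \<and> 0 \<le> y2 f \<and> y1 f + y2 f = 2 * x f"
    "\<And>T. T \<noteq> {} \<Longrightarrow> T \<subseteq> V - {u, v} \<Longrightarrow> 2 \<le> val y1 T \<and> 2 \<le> val y2 T"
    "sum y1 (\<delta> {u} \<inter> \<delta> {u, v}) = 2" "sum y1 (\<delta> {v} \<inter> \<delta> {u, v}) = 0"
    "sum y2 (\<delta> {u} \<inter> \<delta> {u, v}) = 0" "sum y2 (\<delta> {v} \<inter> \<delta> {u, v}) = 2"
proof -
  obtain R where R: "R \<subseteq> S" "tight R" "card R \<ge> 2"
    and minR: "\<And>T. T \<subseteq> S \<Longrightarrow> tight T \<Longrightarrow> card T \<ge> 2 \<Longrightarrow> card R \<le> card T"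
    using ex_has_least_nat[of "\<lambda>T. T \<subseteq> S \<and> tight T \<and> card T \<ge> 2" S card] S by blast
  have fR: "finite R" using R(2) tight_sub finVsub by blast
  have "V - S \<subseteq> V - R" using R(1) by blast
  then have cR: "card (V - R) \<ge> 2" using S(3) card_mono[of "V - R" "V - S"] by simp
  have min: "card T = 1" if "tight T" "T \<subset> R" for T
  proof -
    have "card T < card R" by (rule psubset_card_mono[OF fR that(2)])
    then have "\<not> card T \<ge> 2" using minR[of T] that R(1) by auto
    moreover have "card T \<noteq> 0" using that(1) finVsub[OF tight_sub[OF that(1)]] by (auto simp: tight_def)
    ultimately show ?thesis by linarith
  qed
  show ?thesis
  proof (rule minimal_tight_pair[OF R(2,3) cR min])
    fix u v e y1 y2
    assume a: "R = {u, v}" "u \<noteq> v" "e \<in> E" "ends G e = {u, v}" "x e = 1" "tight {u}" "tight {v}"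
      "\<And>f. f \<in> touch (V - R) \<Longrightarrow> y1 f \<in> \<int> \<and> y2 f \<in> \<int> \<and> 0 \<le> y1 f \<and> 0 \<le> y2 f \<and> y1 f + y2 f = 2 * x f"
      "\<And>T. T \<noteq> {} \<Longrightarrow> T \<subseteq> V - R \<Longrightarrow> 2 \<le> val y1 T \<and> 2 \<le> val y2 T"
      "sum y1 (\<delta> {u} \<inter> \<delta> R) = 2" "sum y1 (\<delta> {v} \<inter> \<delta> R) = 0"
      "sum y2 (\<delta> {u} \<inter> \<delta> R) = 0" "sum y2 (\<delta> {v} \<inter> \<delta> R) = 2"
    show thesis by (rule that[of u v e y1 y2]) (use a R in auto)
  qed
qed

text \<open>Off the edge joining a tight pair, \<open>x\<close> is the midpoint of two integral
  points, and on this edge it is 1. The strict bounds 0 and 2 leave three values.\<close>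

lemma half_integral: assumes "e \<in> E" shows "x e = 1/2 \<or> x e = 1 \<or> x e = 3/2"
proof -
  obtain S where S: "tight S" "card S \<ge> 2" "card (V - S) \<ge> 2" using exists_nontrivial_tight by blast
  have "2 * x e \<in> \<int>"
  proof (rule pair_in_tight[OF S])
    fix u v f y1 y2
    assume a: "f \<in> E" "ends G f = {u, v}" "x f = 1"
      "\<And>f. f \<in> touch (V - {u, v}) \<Longrightarrow> y1 f \<in> \<int> \<and> y2 f \<in> \<int> \<and> 0 \<le> y1 f \<and> 0 \<le> y2 f \<and> y1 f + y2 f = 2 * x f"
    show ?thesis
    proof (cases "e = f")
      case True then show ?thesis using a(3) by simp
    next
      case False
      then have "e \<notin> inside {u, v}" using inside_pair[OF a(1,2)] by simp
      then have "e \<in> touch (V - {u, v})" using touch_compl[of "{u, v}"] assms a(1,2) ends_sub[of f] by simp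
      then have "y1 e + y2 e = 2 * x e" "y1 e \<in> \<int>" "y2 e \<in> \<int>" using a(4) by blast+
      then show ?thesis by (metis Ints_add)
    qed
  qed
  then obtain k where k: "2 * x e = of_int k" by (rule Ints_cases)
  have "0 < k" "k < 4" using k pos[OF assms] less_two[OF assms] by linarith+
  then have "k = 1 \<or> k = 2 \<or> k = 3" by linarith
  then show ?thesis using k by auto
qed

text \<open>If a proper part had no edge to the remainder, the one of the two that avoids
  \<open>c\<close> would have its cut edges only between \<open>Q\<close> and \<open>R\<close>, that
  is, at most one edge, of value less than 2.\<close>

lemma separation_side_conn:
  assumes c: "c \<in> V" "V - {c} = Q \<union> R" "Q \<inter> R = {}" and e: "between Q R \<subseteq> {e}"
  shows "conn G (insert c Q)"
  unfolding conn_def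
proof (intro conjI allI impI)
  fix A assume A: "A \<noteq> {}" "A \<subset> insert c Q"
  show "\<exists>e\<in>E. \<exists>a\<in>A. \<exists>b\<in>insert c Q - A. ends G e = {a, b}"
  proof (rule ccontr)
    assume no: "\<not> ?thesis"
    define B where "B = (if c \<in> A then insert c Q - A else A)"
    have B: "B \<noteq> {}" "B \<subseteq> Q" using A by (auto simp: B_def)
    have noB: "\<not> (a \<in> B \<and> b \<in> insert c Q - B)" if "f \<in> E" "ends G f = {a, b}" for f a b
    proof
      assume ab: "a \<in> B \<and> b \<in> insert c Q - B"
      show False
      proof (cases "c \<in> A")
        case True
        then have "b \<in> A" "a \<in> insert c Q - A" using ab A by (auto simp: B_def)
        moreover have "ends G f = {b, a}" using that(2) by (simp add: insert_commute)
        ultimately show False using no that(1) by blast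
      next
        case False
        then show False using ab no that by (auto simp: B_def)
      qed
    qed
    have "\<delta> B \<subseteq> {e}"
    proof
      fix f assume f: "f \<in> \<delta> B"
      then have fE: "f \<in> E" using cut_sub by blast
      then obtain a b where ab: "ends G f = {a, b}" "a \<in> V" "b \<in> V" by (rule edgeE)
      have ba: "ends G f = {b, a}" using ab(1) by (simp add: insert_commute)
      have "(a \<in> B) \<noteq> (b \<in> B)" using f in_cut[OF fE ab(1)] by blast
      then have "f \<in> between Q R"
        using noB[OF fE ab(1)] noB[OF fE ba] ab B(2) c fE by (auto simp: between_def)
      then show "f \<in> {e}" using e by blast
    qed
    moreover have "2 \<le> val x B" by (rule val_ge) (use B c in auto)
    moreover from this have "\<delta> B \<noteq> {}" by (auto simp: val_def)
    ultimately have "\<delta> B = {e}" by blast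
    then show False using \<open>2 \<le> val x B\<close> less_two[of e] cut_sub[of B] by (auto simp: val_def)
  qed
qed simp

text \<open>No node together with at most one edge of value less than one separates the graph.\<close>

lemma no_separation:
  assumes c: "c \<in> V" "V - {c} = Q \<union> R" "Q \<inter> R = {}" "Q \<noteq> {}" "R \<noteq> {}"
    and e: "between Q R \<subseteq> {e}" "e \<in> between Q R \<Longrightarrow> x e < 1"
  shows False
proof -
  have bsym: "between R Q = between Q R" by (auto simp: between_def)
  have QV: "Q \<subseteq> V" "R \<subseteq> V" "c \<notin> Q" "c \<notin> R" using c by auto
  have fin: "finite Q" "finite R" using QV finVsub by auto
  have connQ: "conn G (insert c Q)" by (rule separation_side_conn[OF c(1-3) e(1)])
  have connR: "conn G (insert c R)"
    by (rule separation_side_conn[of c R Q e]) (use c e bsym in auto)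
  have VQ: "V - insert c R = Q" "V - insert c Q = R" using c by auto
  have sb: "sum x (between Q R) < 1"
  proof (cases "e \<in> between Q R")
    case True
    then have "between Q R = {e}" using e(1) by blast
    then show ?thesis using e(2) True by simp
  next
    case False
    then have "between Q R = {}" using e(1) by blast
    then show ?thesis by simp
  qed
  \<comment> \<open>The parts of \<open>X\<close> in \<open>Q\<close> and \<open>R\<close> have
    total value at least 4 and share less than 1, so \<open>X\<close> would have value above
    2.\<close>
  have split: "X \<subseteq> Q \<or> X \<subseteq> R" if X: "tight X" "c \<notin> X" for X
  proof (rule ccontr)
    assume "\<not> ?thesis"
    then have ne: "X \<inter> Q \<noteq> {}" "X \<inter> R \<noteq> {}" using X tight_sub[OF X(1)] c by auto
    have un: "X \<inter> Q \<union> X \<inter> R = X" using X tight_sub[OF X(1)] c by auto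
    have "val x (X \<inter> Q) + val x (X \<inter> R) = val x X + 2 * sum x (between (X \<inter> Q) (X \<inter> R))"
      using val_disjoint[of "X \<inter> Q" "X \<inter> R" x] c(3) un by auto
    moreover have "sum x (between (X \<inter> Q) (X \<inter> R)) \<le> sum x (between Q R)"
      by (rule sum_mono2) (use pos in \<open>auto simp: between_def less_imp_le\<close>)
    moreover have "2 \<le> val x (X \<inter> Q)" "2 \<le> val x (X \<inter> R)" by (rule val_ge; use ne QV c in auto)+
    ultimately show False using sb X(1) by (simp add: tight_def)
  qed
  have zeroI: "d f = 0" if d: "dirs Q d" "dirs R d" and f: "f \<in> E" for d f
  proof (rule zero_direction[OF _ f])
    have a: "val d X = 0" if "tight X" "c \<notin> X" for X using split[OF that] d that by (auto simp: dirs_def)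
    fix X assume X: "tight X"
    show "val d X = 0"
    proof (cases "c \<in> X")
      case True
      then have "val d (V - X) = 0" by (intro a tight_compl[OF X]) auto
      then show ?thesis by (simp add: val_compl)
    qed (use a X in auto)
  qed
  \<comment> \<open>Tight sets avoiding \<open>c\<close> lie on one side, so directions on the two
    sides can be pasted as soon as they agree on \<open>e\<close>.\<close>
  have glueQR: "(\<forall>f\<in>touch Q. d1 f = 0) \<and> (\<forall>f\<in>touch R. d2 f = 0)"
    if d: "dirs Q d1" "dirs R d2" and eq: "e \<in> between Q R \<Longrightarrow> d1 e = d2 e" for d1 d2
  proof -
    define d where "d = (\<lambda>f. if f \<in> touch Q then d1 f else d2 f)"
    have 2: "d f = d2 f" if "f \<in> touch R" for f
    proof (cases "f \<in> touch Q")
      case True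
      then have "f \<in> between Q R" using that by (auto simp: touch_def between_def)
      then have "f = e" using e(1) by blast
      then show ?thesis using eq \<open>f \<in> between Q R\<close> by (simp add: d_def)
    qed (simp add: d_def)
    have "val d T = val d1 T" if "T \<subseteq> Q" for T
      by (rule val_cong) (use cut_touch[OF that] in \<open>auto simp: d_def\<close>)
    then have dQ: "dirs Q d" using d(1) by (simp add: dirs_def)
    have "val d T = val d2 T" if "T \<subseteq> R" for T
      by (rule val_cong) (use cut_touch[OF that] 2 in blast)
    then have dR: "dirs R d" using d(2) by (simp add: dirs_def)
    have z: "d f = 0" if "f \<in> E" for f using zeroI[OF dQ dR that] .
    have "d1 f = 0" if "f \<in> touch Q" for f using z[of f] that by (simp add: d_def touch_def)
    moreover have "d2 f = 0" if "f \<in> touch R" for f using z[of f] 2[OF that] that by (simp add: touch_def)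
    ultimately show ?thesis by blast
  qed
  have cards: "card (insert c Q) \<ge> 2" "card (insert c R) \<ge> 2"
    using QV fin c(4,5) by (auto simp: Suc_le_eq card_gt_0_iff)
  have ne: "insert c Q \<noteq> V" "insert c R \<noteq> V" using c by auto
  have dQ: "\<exists>d. dirs Q d \<and> (\<exists>f\<in>touch Q. d f \<noteq> 0)" if "f \<in> touch Q" "x f \<notin> \<int>" for f
    using contraction_direction[of "insert c R" f] connR cards ne that QV c(1) unfolding VQ by blast
  have dR: "\<exists>d. dirs R d \<and> (\<exists>f\<in>touch R. d f \<noteq> 0)" if "f \<in> touch R" "x f \<notin> \<int>" for f
    using contraction_direction[of "insert c Q" f] connQ cards ne that QV c(1) unfolding VQ by blast
  show False
  \<comment> \<open>If \<open>e\<close> joins the sides, it is nonintegral and both sides have a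
    direction; each is nonzero on \<open>e\<close>, so one can be scaled to agree with the other.
    Otherwise a single direction is pasted with 0.\<close>
  proof (cases "e \<in> between Q R")
    case True
    then have eE: "e \<in> E" and et: "e \<in> touch Q" "e \<in> touch R" by (auto simp: between_def touch_def)
    have xe: "x e \<notin> \<int>"
    proof
      assume "x e \<in> \<int>"
      then obtain k where "x e = of_int k" by (rule Ints_cases)
      then have "0 < k" "k < 1" using pos[OF eE] e(2)[OF True] by auto
      then show False by simp
    qed
    obtain d1 f1 where d1: "dirs Q d1" "f1 \<in> touch Q" "d1 f1 \<noteq> 0" using dQ[OF et(1) xe] by blast
    obtain d2 f2 where d2: "dirs R d2" "f2 \<in> touch R" "d2 f2 \<noteq> 0" using dR[OF et(2) xe] by blast
    have "d1 e \<noteq> 0" using glueQR[OF d1(1) dirs_zero] d1 by blast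
    have "d2 e \<noteq> 0" using glueQR[OF dirs_zero d2(1)] d2 by auto
    have "d1 e = 0" using glueQR[OF d1(1) dirs_scale[OF d2(1), of "d1 e / d2 e"]] \<open>d2 e \<noteq> 0\<close> et by auto
    then show False using \<open>d1 e \<noteq> 0\<close> by simp
  next
    case False
    obtain f where f: "f \<in> E" "x f \<notin> \<int>" using nonintegral by blast
    obtain a b where ab: "ends G f = {a, b}" "a \<noteq> b" "a \<in> V" "b \<in> V" using f(1) by (rule edgeE)
    then have "f \<in> touch Q \<or> f \<in> touch R" using f(1) c(2) by (auto simp: touch_def)
    then show False
    proof
      assume "f \<in> touch Q"
      then obtain d where "dirs Q d" "\<exists>f\<in>touch Q. d f \<noteq> 0" using dQ f(2) by blast
      then show False using glueQR[OF _ dirs_zero, of d] False by blast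
    next
      assume "f \<in> touch R"
      then obtain d where "dirs R d" "\<exists>f\<in>touch R. d f \<noteq> 0" using dR f(2) by blast
      then show False using glueQR[OF dirs_zero, of d] False by blast
    qed
  qed
qed

end

section \<open>Rooted triangles and claws\<close>

definition adjacent :: "('v, 'e) multigraph \<Rightarrow> 'v set \<Rightarrow> 'v set \<Rightarrow> bool" where
  "adjacent G P Q \<longleftrightarrow> (\<exists>e\<in>edges G. \<exists>a\<in>P. \<exists>b\<in>Q. ends G e = {a, b})"

text \<open>A triangle minor model with one root in each branch set, spanning all of
  \<open>R\<close>.\<close>

definition rooted_triangle :: "('v, 'e) multigraph \<Rightarrow> 'v set \<Rightarrow> 'v \<Rightarrow> 'v \<Rightarrow> 'v \<Rightarrow> bool" where
  "rooted_triangle G R a b c \<longleftrightarrow> (\<exists>A B C. R = A \<union> B \<union> C \<and> A \<inter> B = {} \<and> A \<inter> C = {} \<and> B \<inter> C = {} \<and>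
     conn G A \<and> conn G B \<and> conn G C \<and> a \<in> A \<and> b \<in> B \<and> c \<in> C \<and>
     adjacent G A B \<and> adjacent G A C \<and> adjacent G B C)"

text \<open>The last three clauses make each leg a whole component of \<open>R - {p}\<close>.
  Through them claws can be excluded later, by counting the cut edges such components must meet or
  by connectivity of \<open>R - {p}\<close>.\<close>

definition rooted_claw :: "('v, 'e) multigraph \<Rightarrow> 'v set \<Rightarrow> 'v \<Rightarrow> 'v \<Rightarrow> 'v \<Rightarrow> bool" where
  "rooted_claw G R a b c \<longleftrightarrow> (\<exists>p A B C. p \<in> R \<and> A \<union> B \<union> C \<subseteq> R - {p} \<and> A \<inter> B = {} \<and> A \<inter> C = {} \<and> B \<inter> C = {} \<and>
     conn G A \<and> conn G B \<and> conn G C \<and> a \<in> A \<and> b \<in> B \<and> c \<in> C \<and>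
     adjacent G {p} A \<and> adjacent G {p} B \<and> adjacent G {p} C \<and>
     \<not> adjacent G A (R - {p} - A) \<and> \<not> adjacent G B (R - {p} - B) \<and> \<not> adjacent G C (R - {p} - C))"

lemma adjacent_sym: "adjacent G P Q \<longleftrightarrow> adjacent G Q P"
proof -
  have "adjacent G P Q \<Longrightarrow> adjacent G Q P" for P Q
  proof -
    assume "adjacent G P Q"
    then obtain e a b where "e \<in> edges G" "a \<in> P" "b \<in> Q" "ends G e = {a, b}" unfolding adjacent_def by blast
    moreover from this have "ends G e = {b, a}" by (simp add: insert_commute)
    ultimately show "adjacent G Q P" unfolding adjacent_def by blast
  qed
  then show ?thesis by blast
qed

lemma adjacent_mono: "adjacent G P Q \<Longrightarrow> P \<subseteq> P' \<Longrightarrow> Q \<subseteq> Q' \<Longrightarrow> adjacent G P' Q'"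
  unfolding adjacent_def by (meson subsetD)

lemma adjacent_Un: "adjacent G P (Q \<union> Q') \<longleftrightarrow> adjacent G P Q \<or> adjacent G P Q'"
  unfolding adjacent_def by (simp add: bex_Un bex_disj_distrib)

lemma adjacent_witness: "adjacent G P Q \<Longrightarrow> \<exists>p\<in>P. adjacent G {p} Q"
  unfolding adjacent_def by blast

lemma conn_adjacent: "conn G U \<longleftrightarrow> U \<noteq> {} \<and> (\<forall>A. A \<noteq> {} \<longrightarrow> A \<subset> U \<longrightarrow> adjacent G A (U - A))"
  by (simp add: conn_def adjacent_def)

lemma conn_adjD: "conn G U \<Longrightarrow> A \<noteq> {} \<Longrightarrow> A \<subset> U \<Longrightarrow> adjacent G A (U - A)"
  by (simp add: conn_adjacent)

lemma conn_union:
  assumes "conn G P" "conn G Q" "adjacent G P Q"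
  shows "conn G (P \<union> Q)"
  unfolding conn_adjacent
proof (intro conjI allI impI)
  show "P \<union> Q \<noteq> {}" using assms(1) by (simp add: conn_adjacent)
  fix A assume A: "A \<noteq> {}" "A \<subset> P \<union> Q"
  consider "A \<inter> P \<noteq> {}" "A \<inter> P \<subset> P" | "A \<inter> Q \<noteq> {}" "A \<inter> Q \<subset> Q" | "A \<inter> P = {} \<or> P \<subseteq> A" "A \<inter> Q = {} \<or> Q \<subseteq> A"
    by blast
  then show "adjacent G A (P \<union> Q - A)"
  proof cases
    case 1 then show ?thesis by (intro adjacent_mono[OF conn_adjD[OF assms(1) 1]]) auto
  next
    case 2 then show ?thesis by (intro adjacent_mono[OF conn_adjD[OF assms(2) 2]]) auto
  next
    case 3
    then consider "P \<subseteq> A" "A \<inter> Q = {}" | "Q \<subseteq> A" "A \<inter> P = {}" using A by blast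
    then show ?thesis
    proof cases
      case 1 then show ?thesis by (intro adjacent_mono[OF assms(3)]) auto
    next
      case 2 then show ?thesis by (intro adjacent_mono[OF assms(3)[unfolded adjacent_sym[of G P]]]) auto
    qed
  qed
qed

lemma component_exists:
  assumes "finite U" "a \<in> U"
  shows "\<exists>B\<subseteq>U. a \<in> B \<and> conn G B \<and> \<not> adjacent G B (U - B)"
proof -
  let ?P = "\<lambda>B. B \<subseteq> U \<and> a \<in> B \<and> conn G B"
  have "?P {a}" using assms by (simp add: conn_singleton)
  moreover have "\<forall>B. ?P B \<longrightarrow> card B < Suc (card U)" using assms(1) by (auto simp: less_Suc_eq_le card_mono)
  ultimately obtain B where B: "?P B" "\<And>C. ?P C \<Longrightarrow> card C \<le> card B"
    using ex_has_greatest_nat[of ?P "{a}" card "Suc (card U)"] by (metis nat_less_le less_Suc_eq_le)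
  have "\<not> adjacent G B (U - B)"
  proof
    assume "adjacent G B (U - B)"
    then obtain e p q where e: "e \<in> edges G" "p \<in> B" "q \<in> U - B" "ends G e = {p, q}" unfolding adjacent_def by blast
    have "conn G (insert q B)" by (rule conn_insert[OF _ e(1,4,2)]) (use B in blast)
    then have "card (insert q B) \<le> card B" using B e by auto
    moreover have "finite B" using B assms(1) finite_subset by blast
    ultimately show False using e(3) by simp
  qed
  then show ?thesis using B by blast
qed

text \<open>A part of \<open>U - B\<close> without \<open>p\<close> has an edge to the rest of
  \<open>U\<close>, which cannot end in \<open>B\<close>, since \<open>B\<close> is closed in
  \<open>U - {p}\<close>. A part containing \<open>p\<close> is handled through its
  complement.\<close>

lemma conn_minus_component:
  assumes "conn G U" "p \<in> U" "B \<subseteq> U - {p}" "\<not> adjacent G B (U - {p} - B)"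
  shows "conn G (U - B)"
  unfolding conn_adjacent
proof (intro conjI allI impI)
  show "U - B \<noteq> {}" using assms by blast
  fix A assume A: "A \<noteq> {}" "A \<subset> U - B"
  have key: "adjacent G A' (U - B - A')" if A': "A' \<noteq> {}" "A' \<subseteq> U - B" "p \<notin> A'" for A'
  proof -
    have "A' \<subset> U" using A' assms(2) by blast
    then have "adjacent G A' (U - A')" using conn_adjD[OF assms(1)] A' by blast
    moreover have "U - A' = (U - B - A') \<union> (B - A')" using assms(3) by blast
    moreover have "\<not> adjacent G A' (B - A')"
    proof
      assume "adjacent G A' (B - A')"
      then have "adjacent G (B - A') A'" by (simp add: adjacent_sym)
      then have "adjacent G B (U - {p} - B)" by (rule adjacent_mono) (use A' in auto)
      then show False using assms(4) by simp
    qed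
    ultimately show ?thesis by (simp add: adjacent_Un)
  qed
  show "adjacent G A (U - B - A)"
  proof (cases "p \<in> A")
    case True
    have "adjacent G (U - B - A) (U - B - (U - B - A))" by (rule key) (use A True in auto)
    moreover have "U - B - (U - B - A) = A" using A by blast
    ultimately show ?thesis by (simp add: adjacent_sym)
  next
    case False then show ?thesis using key A by blast
  qed
qed

lemma conn_split:
  assumes "conn G U" "finite U" "p \<in> U" "q \<in> U" "p \<noteq> q"
  obtains A B where "U = A \<union> B" "A \<inter> B = {}" "conn G A" "conn G B" "p \<in> A" "q \<in> B" "adjacent G A B"
    "\<not> adjacent G B (U - {p} - B)"
proof -
  obtain B where B: "B \<subseteq> U - {p}" "q \<in> B" "conn G B" "\<not> adjacent G B (U - {p} - B)"
    using component_exists[of "U - {p}" q G] assms by auto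
  have "conn G (U - B)" by (rule conn_minus_component[OF assms(1,3) B(1,4)])
  moreover have "adjacent G B (U - B)" by (rule conn_adjD[OF assms(1)]) (use B assms in auto)
  ultimately show ?thesis using that[of "U - B" B] B assms by (auto simp: adjacent_sym)
qed

text \<open>\<open>B\<close> is the component of \<open>a\<close> in \<open>Z - {p}\<close>: it
  serves as the new class of \<open>a\<close>, while the rest of \<open>Z\<close>, which contains
  \<open>p\<close>, is merged into the neighbouring class \<open>Y\<close>.\<close>

lemma shrink_middle:
  assumes "conn G Z" "finite Z" "a \<in> Z" "p \<in> Z" "p \<noteq> a" "adjacent G {p} Y" "conn G Y"
  obtains B where "B \<subseteq> Z - {p}" "a \<in> B" "conn G B" "conn G ((Z - B) \<union> Y)" "adjacent G B (Z - B)"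
    "\<not> adjacent G B (Z - {p} - B)"
proof -
  obtain B where B: "B \<subseteq> Z - {p}" "a \<in> B" "conn G B" "\<not> adjacent G B (Z - {p} - B)"
    using component_exists[of "Z - {p}" a G] assms by auto
  have "conn G (Z - B)" by (rule conn_minus_component[OF assms(1,4) B(1,4)])
  moreover have "adjacent G (Z - B) Y" by (rule adjacent_mono[OF assms(6)]) (use B assms in auto)
  ultimately have "conn G ((Z - B) \<union> Y)" using assms(7) by (intro conn_union)
  moreover have "adjacent G B (Z - B)" by (rule conn_adjD[OF assms(1)]) (use B assms in auto)
  ultimately show ?thesis using that B by blast
qed

text \<open>Among the partitions in which the class of \<open>a\<close> is adjacent to the other two, shrink the class of
  \<open>a\<close> as long as possible.\<close>

lemma triangle_or_claw_aux:
  assumes "finite R" and Ra: "conn G (R - {a})"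
  shows "R = Z1 \<union> Z2 \<union> Z3 \<Longrightarrow> Z1 \<inter> Z2 = {} \<Longrightarrow> Z1 \<inter> Z3 = {} \<Longrightarrow> Z2 \<inter> Z3 = {} \<Longrightarrow>
    conn G Z1 \<Longrightarrow> conn G Z2 \<Longrightarrow> conn G Z3 \<Longrightarrow> a \<in> Z1 \<Longrightarrow> b \<in> Z2 \<Longrightarrow> c \<in> Z3 \<Longrightarrow>
    adjacent G Z1 Z2 \<Longrightarrow> adjacent G Z1 Z3 \<Longrightarrow> rooted_triangle G R a b c \<or> rooted_claw G R a b c"
proof (induction "card Z1" arbitrary: Z1 Z2 Z3 rule: less_induct)
  case less
  note P = less.prems
  have fin: "finite Z1" "finite Z2" "finite Z3" using assms(1) P(1) by auto
  show ?case
  proof (cases "adjacent G Z2 Z3")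
    case True
    then have "rooted_triangle G R a b c" unfolding rooted_triangle_def
      by (intro exI[of _ Z1] exI[of _ Z2] exI[of _ Z3]) (use P in simp)
    then show ?thesis ..
  next
    case n23: False
    show ?thesis
    proof (rule ccontr)
      assume no: "\<not> ?thesis"
      \<comment> \<open>If the shrunken class \<open>B\<close> still reached \<open>Z3\<close>, the
        induction hypothesis would apply with \<open>Z2\<close> enlarged.\<close>
      have H2: "\<exists>B. B \<subseteq> Z1 - {p} \<and> a \<in> B \<and> conn G B \<and> adjacent G B (Z1 - B) \<and> \<not> adjacent G B (Z1 - {p} - B) \<and> \<not> adjacent G B Z3"
        if p: "p \<in> Z1" "p \<noteq> a" "adjacent G {p} Z2" for p
      proof -
        obtain B where B: "B \<subseteq> Z1 - {p}" "a \<in> B" "conn G B" "conn G ((Z1 - B) \<union> Z2)" "adjacent G B (Z1 - B)"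
          "\<not> adjacent G B (Z1 - {p} - B)"
          using shrink_middle[OF P(5) fin(1) P(8) p P(6)] .
        have "\<not> adjacent G B Z3"
        proof
          assume a3: "adjacent G B Z3"
          have "rooted_triangle G R a b c \<or> rooted_claw G R a b c"
          proof (rule less.hyps[of B "(Z1 - B) \<union> Z2" Z3])
            show "card B < card Z1" by (rule psubset_card_mono[OF fin(1)]) (use B p in auto)
            show "adjacent G B (Z1 - B \<union> Z2)" using B(5) by (simp add: adjacent_Un)
          qed (use B P a3 in auto)
          then show False using no by simp
        qed
        then show ?thesis using B by blast
      qed
      have H3: "\<exists>B. B \<subseteq> Z1 - {p} \<and> a \<in> B \<and> conn G B \<and> adjacent G B (Z1 - B) \<and> \<not> adjacent G B (Z1 - {p} - B) \<and> \<not> adjacent G B Z2"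
        if p: "p \<in> Z1" "p \<noteq> a" "adjacent G {p} Z3" for p
      proof -
        obtain B where B: "B \<subseteq> Z1 - {p}" "a \<in> B" "conn G B" "conn G ((Z1 - B) \<union> Z3)" "adjacent G B (Z1 - B)"
          "\<not> adjacent G B (Z1 - {p} - B)"
          using shrink_middle[OF P(5) fin(1) P(8) p P(7)] .
        have "\<not> adjacent G B Z2"
        proof
          assume a2: "adjacent G B Z2"
          have "rooted_triangle G R a b c \<or> rooted_claw G R a b c"
          proof (rule less.hyps[of B Z2 "(Z1 - B) \<union> Z3"])
            show "card B < card Z1" by (rule psubset_card_mono[OF fin(1)]) (use B p in auto)
            show "adjacent G B (Z1 - B \<union> Z3)" using B(5) by (simp add: adjacent_Un)
          qed (use B P a2 in auto)
          then show False using no by simp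
        qed
        then show ?thesis using B by blast
      qed
      obtain p where p: "p \<in> Z1" "adjacent G {p} Z2" using adjacent_witness[OF P(11)] by blast
      obtain q where q: "q \<in> Z1" "adjacent G {q} Z3" using adjacent_witness[OF P(12)] by blast
      have up: "adjacent G B Y" if "adjacent G {r} Y" "r \<in> B" for B Y r
        by (rule adjacent_mono[OF that(1)]) (use that(2) in auto)
      \<comment> \<open>If \<open>a\<close> touched both classes, connectivity of
        \<open>R - {a}\<close> would give \<open>Z2\<close> another contact node in
        \<open>Z1\<close>, and shrinking there contradicts \<open>H2\<close>. If it touched only
        one, shrinking at a contact node of the other class gives the contradiction.\<close>
      have not_a: "\<not> adjacent G {a} Z2" "\<not> adjacent G {a} Z3"
      proof -
        have both: "\<not> (adjacent G {a} Z2 \<and> adjacent G {a} Z3)"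
        proof
          assume aa: "adjacent G {a} Z2 \<and> adjacent G {a} Z3"
          have "\<not> adjacent G {r} Z2" if "r \<in> Z1 - {a}" for r using H2[of r] that aa up by blast
          then have "\<not> adjacent G (Z1 - {a}) Z2" using adjacent_witness by blast
          then have "\<not> adjacent G Z2 ((Z1 - {a}) \<union> Z3)" using n23 by (simp add: adjacent_Un adjacent_sym)
          moreover have "adjacent G Z2 (R - {a} - Z2)"
            by (rule conn_adjD[OF Ra]) (use P in auto)
          moreover have "R - {a} - Z2 = (Z1 - {a}) \<union> Z3" using P by auto
          ultimately show False by simp
        qed
        show "\<not> adjacent G {a} Z2" using both H3[of q] q up by blast
        show "\<not> adjacent G {a} Z3" using both H2[of p] p up by blast
      qed
      \<comment> \<open>With two contact nodes, \<open>B\<close> together with \<open>p'\<close> is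
        connected, avoids \<open>q'\<close> and contains \<open>a\<close>, so it would lie in the
        component \<open>D\<close>, which does not contain \<open>p'\<close>.\<close>
      have same: "p' = q'" if p': "p' \<in> Z1" "adjacent G {p'} Z2" and q': "q' \<in> Z1" "adjacent G {q'} Z3" for p' q'
      proof (rule ccontr)
        assume ne: "p' \<noteq> q'"
        have na: "p' \<noteq> a" "q' \<noteq> a" using not_a p' q' by auto
        obtain B where B: "B \<subseteq> Z1 - {p'}" "a \<in> B" "conn G B" "adjacent G B (Z1 - B)"
          "\<not> adjacent G B (Z1 - {p'} - B)" "\<not> adjacent G B Z3" using H2[OF p'(1) na(1) p'(2)] by blast
        obtain D where D: "D \<subseteq> Z1 - {q'}" "a \<in> D" "conn G D" "adjacent G D (Z1 - D)"
          "\<not> adjacent G D (Z1 - {q'} - D)" "\<not> adjacent G D Z2" using H3[OF q'(1) na(2) q'(2)] by blast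
        have qB: "q' \<notin> B" using B(6) q' up by blast
        have pD: "p' \<notin> D" using D(6) p' up by blast
        have "Z1 - B = {p'} \<union> (Z1 - {p'} - B)" using B p' by auto
        then have "adjacent G B {p'}" using B(4,5) by (metis adjacent_Un)
        then have cB: "conn G (B \<union> {p'})" using B(3) conn_singleton by (intro conn_union) auto
        have "adjacent G ((B \<union> {p'}) \<inter> D) (B \<union> {p'} - (B \<union> {p'}) \<inter> D)"
          by (rule conn_adjD[OF cB]) (use B D pD in auto)
        then have "adjacent G D (Z1 - {q'} - D)" by (rule adjacent_mono) (use B p' qB ne in auto)
        then show False using D(5) by simp
      qed
      have pq: "p = q" by (rule same[OF p q])
      have only: "r = p" if "r \<in> Z1" "adjacent G {r} Z2 \<or> adjacent G {r} Z3" for r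
        using same[OF that(1) _ q] same[OF p that(1)] that(2) pq by blast
      have pa: "p \<noteq> a" using not_a p by auto
      obtain B where B: "B \<subseteq> Z1 - {p}" "a \<in> B" "conn G B" "adjacent G B (Z1 - B)"
        "\<not> adjacent G B (Z1 - {p} - B)" using H2[OF p(1) pa p(2)] by blast
      have "Z1 - B = {p} \<union> (Z1 - {p} - B)" using B p by auto
      then have pB: "adjacent G {p} B" using B(4,5) by (metis adjacent_Un adjacent_sym)
      have far: "\<not> adjacent G (Z1 - {p}) Z2" "\<not> adjacent G (Z1 - {p}) Z3"
        using only adjacent_witness[of G "Z1 - {p}"] by blast+
      have n2: "\<not> adjacent G Z2 (R - {p} - Z2)"
      proof -
        have "R - {p} - Z2 = (Z1 - {p}) \<union> Z3" using P p by auto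
        then show ?thesis using far n23 by (simp add: adjacent_Un adjacent_sym)
      qed
      have n3: "\<not> adjacent G Z3 (R - {p} - Z3)"
      proof -
        have "R - {p} - Z3 = (Z1 - {p}) \<union> Z2" using P p by auto
        then show ?thesis using far n23 by (simp add: adjacent_Un adjacent_sym)
      qed
      have nB: "\<not> adjacent G B (R - {p} - B)"
      proof -
        have "R - {p} - B = (Z1 - {p} - B) \<union> (Z2 \<union> Z3)" using P p B by auto
        moreover have "\<not> adjacent G B Z2" "\<not> adjacent G B Z3" using far adjacent_mono[OF _ B(1) order_refl] by blast+
        ultimately show ?thesis using B(5) by (simp add: adjacent_Un)
      qed
      have "rooted_claw G R a b c" unfolding rooted_claw_def
        by (rule exI[of _ p], rule exI[of _ B], rule exI[of _ Z2], rule exI[of _ Z3])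
          (use P p q pq B pB n2 n3 nB in auto)
      then show False using no by simp
    qed
  qed
qed

lemma rooted_triangle_swap: "rooted_triangle G R c b a \<Longrightarrow> rooted_triangle G R a b c"
proof -
  assume "rooted_triangle G R c b a"
  then obtain A B C where h: "R = A \<union> B \<union> C" "A \<inter> B = {}" "A \<inter> C = {}" "B \<inter> C = {}"
     "conn G A" "conn G B" "conn G C" "c \<in> A" "b \<in> B" "a \<in> C" "adjacent G A B" "adjacent G A C" "adjacent G B C"
    unfolding rooted_triangle_def by blast
  have "R = C \<union> B \<union> A" "adjacent G B A" "adjacent G C A" "adjacent G C B"
    using h adjacent_sym[of G] by auto
  then show ?thesis unfolding rooted_triangle_def
    by - (rule exI[of _ C], rule exI[of _ B], rule exI[of _ A], use h in \<open>simp add: Int_commute\<close>)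
qed

lemma rooted_claw_swap: "rooted_claw G R c b a \<Longrightarrow> rooted_claw G R a b c"
proof -
  assume "rooted_claw G R c b a"
  then obtain p A B C where h: "p \<in> R" "A \<union> B \<union> C \<subseteq> R - {p}" "A \<inter> B = {}" "A \<inter> C = {}" "B \<inter> C = {}"
     "conn G A" "conn G B" "conn G C" "c \<in> A" "b \<in> B" "a \<in> C"
     "adjacent G {p} A" "adjacent G {p} B" "adjacent G {p} C"
     "\<not> adjacent G A (R - {p} - A)" "\<not> adjacent G B (R - {p} - B)" "\<not> adjacent G C (R - {p} - C)"
    unfolding rooted_claw_def by blast
  show ?thesis unfolding rooted_claw_def
    by (rule exI[of _ p], rule exI[of _ C], rule exI[of _ B], rule exI[of _ A])
      (use h in \<open>simp add: Int_commute\<close>)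
qed

text \<open>\<open>R - {b}\<close> is split into connected classes of \<open>a\<close> and
  \<open>c\<close>. The root \<open>b\<close> is adjacent to one of them, which becomes the middle
  class in \<open>triangle_or_claw_aux\<close>; if this is the class of \<open>c\<close>, the roles
  of \<open>a\<close> and \<open>c\<close> are exchanged.\<close>

lemma triangle_or_claw:
  assumes R: "conn G R" "finite R" and z: "a \<in> R" "b \<in> R" "c \<in> R" "a \<noteq> b" "a \<noteq> c" "b \<noteq> c"
    and Rz: "conn G (R - {a})" "conn G (R - {b})" "conn G (R - {c})"
  shows "rooted_triangle G R a b c \<or> rooted_claw G R a b c"
proof -
  obtain A C where AC: "R - {b} = A \<union> C" "A \<inter> C = {}" "conn G A" "conn G C" "a \<in> A" "c \<in> C" "adjacent G A C"
  proof (rule conn_split[OF Rz(2)])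
    show "finite (R - {b})" "a \<in> R - {b}" "c \<in> R - {b}" "a \<noteq> c" using R z by simp_all
  qed (rule that)
  have "adjacent G {b} (R - {b})" by (rule conn_adjD[OF R(1)]) (use z in auto)
  then have "adjacent G {b} A \<or> adjacent G {b} C" unfolding AC(1) by (simp add: adjacent_Un)
  then show ?thesis
  proof
    assume "adjacent G {b} A"
    then show ?thesis using AC z R(2)
      by (intro triangle_or_claw_aux[OF R(2) Rz(1), of A "{b}" C]) (auto simp: adjacent_sym conn_singleton)
  next
    assume "adjacent G {b} C"
    then have "rooted_triangle G R c b a \<or> rooted_claw G R c b a" using AC z R(2)
      by (intro triangle_or_claw_aux[OF R(2) Rz(3), of C "{b}" A]) (auto simp: adjacent_sym conn_singleton)
    then show ?thesis using rooted_triangle_swap[of G R c b a] rooted_claw_swap[of G R c b a] by blast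
  qed
qed

section \<open>Replacing one side of a tight cut by an edge\<close>

context fractional_minimal
begin

lemma boundary_split:
  assumes "T \<subseteq> V" "T = W \<union> W'" "W \<inter> W' = {}"
  shows "val w W = sum w (between W W') + sum w (\<delta> T \<inter> touch W)"
    "val w T = sum w (\<delta> T \<inter> touch W) + sum w (\<delta> T \<inter> touch W')"
proof -
  have *: "\<delta> W = between W W' \<union> (\<delta> T \<inter> touch W)" "between W W' \<inter> (\<delta> T \<inter> touch W) = {}"
    "\<delta> T = (\<delta> T \<inter> touch W) \<union> (\<delta> T \<inter> touch W')" "(\<delta> T \<inter> touch W) \<inter> (\<delta> T \<inter> touch W') = {}"
  proof -
    have iff: "(f \<in> \<delta> W \<longleftrightarrow> f \<in> between W W' \<or> f \<in> \<delta> T \<inter> touch W) \<and> \<not> (f \<in> between W W' \<and> f \<in> \<delta> T \<inter> touch W)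
       \<and> (f \<in> \<delta> T \<longleftrightarrow> (f \<in> \<delta> T \<inter> touch W) \<or> (f \<in> \<delta> T \<inter> touch W'))
       \<and> \<not> (f \<in> \<delta> T \<inter> touch W \<and> f \<in> \<delta> T \<inter> touch W')" for f
    proof (cases "f \<in> E")
      case True
      obtain a b where ab: "ends G f = {a, b}" "a \<noteq> b" using True by (rule edgeE)
      have t: "f \<in> touch X \<longleftrightarrow> a \<in> X \<or> b \<in> X" for X using True ab by (auto simp: touch_def)
      have bt: "f \<in> between W W' \<longleftrightarrow> (a \<in> W \<or> b \<in> W) \<and> (a \<in> W' \<or> b \<in> W')"
        using True ab by (auto simp: between_def)
      have d: "a \<notin> W \<or> a \<notin> W'" "b \<notin> W \<or> b \<notin> W'" using assms(3) by auto
      show ?thesis unfolding Int_iff t bt in_cut[OF True ab(1)] assms(2) Un_iff using d by blast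
    qed (auto simp: cut_def between_def)
    show "\<delta> W = between W W' \<union> (\<delta> T \<inter> touch W)" "between W W' \<inter> (\<delta> T \<inter> touch W) = {}"
      "\<delta> T = (\<delta> T \<inter> touch W) \<union> (\<delta> T \<inter> touch W')" "(\<delta> T \<inter> touch W) \<inter> (\<delta> T \<inter> touch W') = {}"
      using iff by blast+
  qed
  show "val w W = sum w (between W W') + sum w (\<delta> T \<inter> touch W)"
    unfolding val_def by (subst *(1), rule sum.union_disjoint) (use *(2) in auto)
  show "val w T = sum w (\<delta> T \<inter> touch W) + sum w (\<delta> T \<inter> touch W')"
    unfolding val_def by (subst *(3), rule sum.union_disjoint) (use *(4) in auto)
qed

text \<open>The side \<open>T\<close> of a tight cut could be replaced by a single edge of value one, which would give a
  smaller graph with a nonintegral basic point.\<close>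

lemma no_pair_replacement:
  assumes T: "tight T" "card T \<ge> 3" and W: "T = W \<union> W'" "W \<inter> W' = {}" "conn G W" "conn G W'"
    and half: "sum x (\<delta> T \<inter> touch W) = 1"
    and f0: "f0 \<in> \<delta> T" "x f0 \<notin> \<int>"
    and uniq: "\<And>q f. dirs (V - T) q \<Longrightarrow> sum q (\<delta> T \<inter> touch W) = 0 \<Longrightarrow> f \<in> \<delta> T \<Longrightarrow> q f = 0"
  shows False
proof -
  note TV = tight_sub[OF T(1)]
  have WT: "W \<noteq> {}" "W' \<noteq> {}" using W by (auto simp: conn_def)
  have "W \<subset> T" using W WT by blast
  \<comment> \<open>An edge between \<open>W\<close> and \<open>W'\<close> survives as the single
    edge that replaces \<open>T\<close>; it gets value 1.\<close>
  then obtain e1 a b where e1: "e1 \<in> E" "a \<in> W" "b \<in> T - W" "ends G e1 = {a, b}"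
    using connE[OF tight_conn[OF T(1)] WT(1)] by blast
  then have bW: "b \<in> W'" "b \<notin> W" "a \<notin> W'" using W by auto
  define f where "f = (\<lambda>v. if v \<in> W then a else if v \<in> W' then b else v)"
  define F where "F = insert e1 (touch (V - T))"
  define y where "y = (\<lambda>e. if e = e1 then 1 else x e)"
  have e1n: "e1 \<notin> touch (V - T)" "e1 \<notin> \<delta> T"
  proof -
    show "e1 \<notin> touch (V - T)" using e1 bW W by (auto simp: touch_def)
    show "e1 \<notin> \<delta> T" using e1 bW W unfolding in_cut[OF e1(1,4)] by auto
  qed
  have fa: "f v = a \<longleftrightarrow> v \<in> W" "f v = b \<longleftrightarrow> v \<in> W'" for v using e1(2) bW W(2) by (simp_all add: f_def, auto)
  have fout: "f v = v" if "v \<notin> T" for v using that W(1) by (simp add: f_def)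
  have fT: "f v \<in> T \<longleftrightarrow> v \<in> T" for v using e1(2,3) bW W(1) by (simp add: f_def)
  \<comment> \<open>The cuts of the quotient are those cuts of \<open>G\<close>, restricted to
    \<open>F\<close>, that split neither \<open>W\<close> nor \<open>W'\<close>.\<close>
  define sat where "sat = (\<lambda>X. X \<noteq> {} \<and> X \<subset> V \<and> (W \<subseteq> X \<or> W \<inter> X = {}) \<and> (W' \<subseteq> X \<or> W' \<inter> X = {}))"
  have qc: "C \<in> quotient_cuts G f F \<longleftrightarrow>
      (\<exists>X. sat X \<and> C = F \<inter> \<delta> X)" for C
  proof
    assume "C \<in> quotient_cuts G f F"
    then obtain Y where Y: "C = F \<inter> \<delta> (f -` Y)" "Y \<noteq> {}" "Y \<subset> f ` V" unfolding quotient_cuts_def by blast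
    define X where "X = f -` Y \<inter> V"
    have fW: "v \<in> X \<longleftrightarrow> a \<in> Y" if "v \<in> W" for v
    proof -
      have "f v = a" "v \<in> V" using that fa(1) W(1) TV by auto
      then show ?thesis by (simp add: X_def)
    qed
    have fW': "v \<in> X \<longleftrightarrow> b \<in> Y" if "v \<in> W'" for v
    proof -
      have "f v = b" "v \<in> V" using that fa(2) W(1) TV by auto
      then show ?thesis by (simp add: X_def)
    qed
    have "W \<subseteq> X \<or> W \<inter> X = {}" "W' \<subseteq> X \<or> W' \<inter> X = {}" using fW fW' by blast+
    moreover have "X \<noteq> {}"
    proof -
      obtain v where "v \<in> V" "f v \<in> Y" using Y(2,3) by blast
      then show ?thesis by (auto simp: X_def)
    qed
    moreover have "X \<subset> V"
    proof -
      obtain v where "v \<in> V" "f v \<notin> Y" using Y(3) by blast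
      then have "v \<in> V - X" by (simp add: X_def)
      then show ?thesis by (auto simp: X_def)
    qed
    moreover have "\<delta> X = \<delta> (f -` Y)" by (simp add: X_def cut_Int)
    ultimately show "\<exists>X. sat X \<and> C = F \<inter> \<delta> X"
      using Y(1) by (intro exI[of _ X]) (simp add: sat_def)
  next
    assume "\<exists>X. sat X \<and> C = F \<inter> \<delta> X"
    then obtain X where "sat X" "C = F \<inter> \<delta> X" by blast
    then have X: "X \<noteq> {}" "X \<subset> V" "W \<subseteq> X \<or> W \<inter> X = {}" "W' \<subseteq> X \<or> W' \<inter> X = {}" "C = F \<inter> \<delta> X"
      by (simp_all add: sat_def)
    have mem: "f v \<in> f ` X \<longleftrightarrow> v \<in> X" for v
    proof
      assume "f v \<in> f ` X"
      then obtain w where w: "w \<in> X" "f v = f w" by auto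
      show "v \<in> X"
      proof (cases "v \<in> T")
        case False
        then have "w \<notin> T" using w(2) fT by metis
        then show ?thesis using fout False w by simp
      next
        case True
        then consider "v \<in> W" | "v \<in> W'" using W by blast
        then show ?thesis
        proof cases
          case 1 then have "w \<in> W" using fa w(2) by metis
          then show ?thesis using X(3) w(1) 1 by blast
        next
          case 2 then have "w \<in> W'" using fa w(2) by metis
          then show ?thesis using X(4) w(1) 2 by blast
        qed
      qed
    qed simp
    then have "f -` (f ` X) = X" by blast
    moreover have "f ` X \<subset> f ` V" using X(2) mem by blast
    moreover have "f ` X \<noteq> {}" using X(1) by simp
    ultimately show "C \<in> quotient_cuts G f F" unfolding quotient_cuts_def
      by (intro CollectI exI[of _ "f ` X"]) (simp add: X(5))
  qed
  have sumF: "sum w (F \<inter> \<delta> X) = (if e1 \<in> \<delta> X then w e1 else 0) + sum w (touch (V - T) \<inter> \<delta> X)" for w :: "'e \<Rightarrow> real" and X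
  proof (cases "e1 \<in> \<delta> X")
    case True
    then have "F \<inter> \<delta> X = insert e1 (touch (V - T) \<inter> \<delta> X)" by (auto simp: F_def)
    then show ?thesis using True e1n by simp
  next
    case False
    then have "F \<inter> \<delta> X = touch (V - T) \<inter> \<delta> X" by (auto simp: F_def)
    then show ?thesis using False by simp
  qed
  have yx: "sum y (touch (V - T) \<inter> \<delta> X) = sum x (touch (V - T) \<inter> \<delta> X)" for X
    by (rule sum.cong) (use e1n in \<open>auto simp: y_def\<close>)
  have e1X: "e1 \<in> \<delta> X \<longleftrightarrow> (a \<in> X) \<noteq> (b \<in> X)" for X by (rule in_cut[OF e1(1,4)])
  have yW: "sum y (F \<inter> \<delta> X) = (if (a \<in> X) \<noteq> (b \<in> X) then 1 else 0) + sum x (touch (V - T) \<inter> \<delta> X)" for X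
    unfolding sumF yx e1X by (simp add: y_def)
  have out: "touch (V - T) \<inter> \<delta> X = \<delta> X" if "X \<subseteq> V - T" for X using cut_touch[OF that] by blast
  have TW: "touch (V - T) \<inter> \<delta> W = \<delta> T \<inter> touch W" "touch (V - T) \<inter> \<delta> W' = \<delta> T \<inter> touch W'"
  proof -
    have iff: "(f \<in> touch (V - T) \<inter> \<delta> W \<longleftrightarrow> f \<in> \<delta> T \<inter> touch W) \<and> (f \<in> touch (V - T) \<inter> \<delta> W' \<longleftrightarrow> f \<in> \<delta> T \<inter> touch W')" for f
    proof (cases "f \<in> E")
      case True
      obtain p q where pq: "ends G f = {p, q}" "p \<noteq> q" "p \<in> V" "q \<in> V" using True by (rule edgeE)
      have t: "f \<in> touch X \<longleftrightarrow> p \<in> X \<or> q \<in> X" for X using True pq by (auto simp: touch_def)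
      have d: "p \<notin> W \<or> p \<notin> W'" "q \<notin> W \<or> q \<notin> W'" using W(2) by auto
      show ?thesis unfolding Int_iff t in_cut[OF True pq(1)] W(1) Un_iff Diff_iff using d pq(3,4) by blast
    qed (auto simp: cut_def touch_def)
    then show "touch (V - T) \<inter> \<delta> W = \<delta> T \<inter> touch W" "touch (V - T) \<inter> \<delta> W' = \<delta> T \<inter> touch W'" by blast+
  qed
  note bs = boundary_split[OF TV W(1,2)]
  have half': "sum x (\<delta> T \<inter> touch W') = 1" using bs(2)[of x] half T(1) by (simp add: tight_def)
  \<comment> \<open>Unless \<open>X\<close> and \<open>T\<close> cover \<open>V\<close>,
    submodularity gives \<open>val x W \<le> val x X\<close>. Both cuts contain all edges between
    \<open>W\<close> and \<open>W'\<close>, and the remainder of the cut of \<open>W\<close> has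
    value 1.\<close>
  have s1: "1 \<le> sum x (touch (V - T) \<inter> \<delta> X)" if X: "X \<subset> V" "W \<subseteq> X" "W' \<inter> X = {}" for X
  proof -
    have XT: "X \<inter> T = W" "T - X = W'" using X W by blast+
    have "\<delta> X = between W W' \<union> (touch (V - T) \<inter> \<delta> X)" "between W W' \<inter> (touch (V - T) \<inter> \<delta> X) = {}"
    proof -
      have "(f \<in> \<delta> X \<longleftrightarrow> f \<in> between W W' \<or> f \<in> touch (V - T) \<inter> \<delta> X) \<and> \<not> (f \<in> between W W' \<and> f \<in> touch (V - T))" for f
      proof (cases "f \<in> E")
        case True
        obtain p q where pq: "ends G f = {p, q}" "p \<noteq> q" "p \<in> V" "q \<in> V" using True by (rule edgeE)
        have t: "f \<in> touch X \<longleftrightarrow> p \<in> X \<or> q \<in> X" for X using True pq by (auto simp: touch_def)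
        have bt: "f \<in> between W W' \<longleftrightarrow> (p \<in> W \<or> q \<in> W) \<and> (p \<in> W' \<or> q \<in> W')"
          using True pq by (auto simp: between_def)
        have d: "p \<in> W \<Longrightarrow> p \<in> X" "q \<in> W \<Longrightarrow> q \<in> X" "p \<in> W' \<Longrightarrow> p \<notin> X" "q \<in> W' \<Longrightarrow> q \<notin> X" using X by auto
        show ?thesis unfolding Int_iff t bt in_cut[OF True pq(1)] W(1) Un_iff Diff_iff using d pq(3,4) by blast
      qed (auto simp: cut_def touch_def between_def)
      then show "\<delta> X = between W W' \<union> (touch (V - T) \<inter> \<delta> X)" "between W W' \<inter> (touch (V - T) \<inter> \<delta> X) = {}" by blast+
    qed
    then have vX: "val x X = sum x (between W W') + sum x (touch (V - T) \<inter> \<delta> X)"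
      unfolding val_def by (metis finE sum.union_disjoint)
    show ?thesis
    proof (cases "X \<union> T = V")
      case True
      then have "V - X = W'" using XT(2) by blast
      then have "\<delta> X = \<delta> W'" using cut_compl[of X] by simp
      then show ?thesis using TW(2) half' by simp
    next
      case False
      have "2 \<le> val x (X \<union> T)" by (rule val_ge) (use False X TV WT in auto)
      moreover have "0 \<le> sum x (between (X - T) (T - X))" by (rule sum_pos_E[OF between_sub])
      ultimately have "val x W + 2 \<le> val x X + val x T" using val_submodular[of x X T] unfolding XT(1) by linarith
      then show ?thesis using vX bs(1)[of x] half T(1) by (simp add: tight_def)
    qed
  qed
  have aX: "a \<in> X \<longleftrightarrow> W \<subseteq> X" if "W \<subseteq> X \<or> W \<inter> X = {}" for X using that e1(2) by blast
  have bX: "b \<in> X \<longleftrightarrow> W' \<subseteq> X" if "W' \<subseteq> X \<or> W' \<inter> X = {}" for X using that bW(1) by blast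
  have ge2: "2 \<le> sum y (F \<inter> \<delta> X)" if X: "X \<noteq> {}" "X \<subset> V" "W \<subseteq> X \<or> W \<inter> X = {}" "W' \<subseteq> X \<or> W' \<inter> X = {}" for X
  proof -
    consider "W \<subseteq> X" "W' \<subseteq> X" | "W \<inter> X = {}" "W' \<inter> X = {}" | "W \<subseteq> X" "W' \<inter> X = {}" | "W \<inter> X = {}" "W' \<subseteq> X"
      using X by blast
    then show ?thesis
    proof cases
      case 1
      then have "V - X \<subseteq> V - T" using W by blast
      then have "touch (V - T) \<inter> \<delta> X = \<delta> X" using out[of "V - X"] by (simp add: cut_compl)
      then show ?thesis using yW[of X] aX[OF X(3)] bX[OF X(4)] 1 val_ge[OF X(1,2)] by (simp add: val_def)
    next
      case 2
      then have "X \<subseteq> V - T" using X W by blast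
      moreover have "a \<notin> X" "b \<notin> X" using 2 e1 bW by auto
      ultimately show ?thesis using yW[of X] out[of X] val_ge[OF X(1,2)] by (simp add: val_def)
    next
      case 3
      have "a \<in> X" "b \<notin> X" using 3 e1 bW by auto
      then show ?thesis using yW[of X] s1[OF X(2) 3] by simp
    next
      case 4
      have "a \<notin> X" "b \<in> X" using 4 e1 bW by auto
      moreover have "1 \<le> sum x (touch (V - T) \<inter> \<delta> (V - X))" by (rule s1) (use 4 X W TV in auto)
      ultimately show ?thesis using yW[of X] by (simp add: cut_compl)
    qed
  qed
  have bp: "basic_point F (quotient_cuts G f F) y"
  proof (rule basic_pointI)
    show "0 \<le> y e" if "e \<in> F" for e using that pos[of e] by (auto simp: y_def F_def touch_def less_imp_le)
    show "2 \<le> sum y C" if C: "C \<in> quotient_cuts G f F" for C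
    proof -
      obtain X where "sat X" "C = F \<inter> \<delta> X" using C unfolding qc by blast
      then show ?thesis using ge2[of X] by (simp add: sat_def)
    qed
    fix d :: "'e \<Rightarrow> real"
    assume d: "\<And>e. e \<notin> F \<Longrightarrow> d e = 0" "\<And>C. C \<in> quotient_cuts G f F \<Longrightarrow> sum y C = 2 \<Longrightarrow> sum d C = 0"
    have d2: "sum d (F \<inter> \<delta> X) = 0" if "X \<noteq> {}" "X \<subset> V" "W \<subseteq> X \<or> W \<inter> X = {}" "W' \<subseteq> X \<or> W' \<inter> X = {}" "sum y (F \<inter> \<delta> X) = 2" for X
    proof (rule d(2)[OF _ that(5)])
      have "sat X" using that(1-4) by (simp add: sat_def)
      then show "F \<inter> \<delta> X \<in> quotient_cuts G f F" unfolding qc by blast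
    qed
    have TV': "T \<subset> V" using T(1) by (simp add: tight_def)
    have "sum d (F \<inter> \<delta> W) = 0"
      by (rule d2) (use WT W TV' e1 bW yW[of W] TW half in auto)
    then have dW: "d e1 + sum d (\<delta> T \<inter> touch W) = 0" unfolding sumF e1X TW using e1 bW by simp
    have "sum d (F \<inter> \<delta> W') = 0"
      by (rule d2) (use WT W TV' e1 bW yW[of W'] TW half' in auto)
    then have dW': "d e1 + sum d (\<delta> T \<inter> touch W') = 0" unfolding sumF e1X TW using e1 bW by simp
    have dir: "dirs (V - T) d" unfolding dirs_def
    proof (intro allI impI)
      fix X assume X: "X \<subseteq> V - T" "tight X"
      have ab: "a \<notin> X" "b \<notin> X" using X W e1 bW by auto
      have "sum d (F \<inter> \<delta> X) = 0"
        by (rule d2) (use X W ab yW[of X] out[OF X(1)] in \<open>auto simp: tight_def val_def\<close>)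
      then show "val d X = 0" unfolding sumF e1X out[OF X(1)] using ab by (simp add: val_def)
    qed
    have "val d (V - T) = 0" using dir tight_compl[OF T(1)] by (auto simp: dirs_def)
    then have "sum d (\<delta> T \<inter> touch W) + sum d (\<delta> T \<inter> touch W') = 0" using bs(2)[of d] by (simp add: val_compl)
    \<comment> \<open>With \<open>s\<close> and \<open>s'\<close> the sums of \<open>d\<close> over
      the two parts of the cut, the classes give \<open>d e1 + s = 0\<close> and
      \<open>d e1 + s' = 0\<close>, and the far side gives \<open>s + s' = 0\<close>.\<close>
    then have z: "d e1 = 0" "sum d (\<delta> T \<inter> touch W) = 0" using dW dW' by linarith+
    have "d g = 0" if "g \<in> \<delta> (V - T)" for g using uniq[OF dir z(2), of g] that by (simp add: cut_compl)
    then have dt: "d g = 0" if "g \<in> touch (V - T)" for g using dirs_cut_zero[OF tight_compl[OF T(1)] dir _ that] by blast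
    have "d g = 0" for g
      using dt[of g] d(1)[of g] z(1) by (cases "g = e1"; cases "g \<in> touch (V - T)") (simp_all add: F_def)
    then show "\<forall>e. d e = 0" by blast
  qed
  have "y f0 \<in> \<int>"
  proof (rule minimal[OF _ _ _ _ _ bp])
    fix u assume "u \<in> f ` V"
    then obtain v where v: "v \<in> V" "u = f v" by blast
    have "{w \<in> V. f w = u} = (if u = a then W else if u = b then W' else {u})"
    proof (cases "v \<in> T")
      case True
      then have "u = a \<or> u = b" using v W by (auto simp: f_def)
      moreover have "a \<noteq> b" using e1 bW by auto
      moreover have "W \<subseteq> V" "W' \<subseteq> V" using W TV by auto
      ultimately show ?thesis using fa by auto
    next
      case False
      then have u: "u = v" "u \<noteq> a" "u \<noteq> b" using v fout W e1 bW by auto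
      have "w = v" if "w \<in> V" "f w = v" for w
      proof -
        have "w \<notin> T" using fT[of w] that False by simp
        then show ?thesis using fout that by simp
      qed
      then show ?thesis using u v by auto
    qed
    then show "conn G {w \<in> V. f w = u}" using W by (simp add: conn_singleton)
  next
    have "f a = a" "f b = b" using e1 bW fa by auto
    then have "{a, b} \<subseteq> f ` V" using W TV e1 bW by (metis UnI1 UnI2 empty_subsetI imageI insert_subset subsetD)
    moreover have "a \<noteq> b" using e1 bW by auto
    then have "card {a, b} = 2" by simp
    ultimately show "2 \<le> card (f ` V)" by (metis card_mono finV finite_imageI)
  next
    show "F \<subseteq> E" using e1 by (auto simp: F_def touch_def)
  next
    fix e assume e: "e \<in> F"
    then have "e \<in> E" using e1 by (auto simp: F_def touch_def)
    then obtain p q where pq: "ends G e = {p, q}" "p \<noteq> q" by (rule edgeE)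
    have "f p \<noteq> f q"
    proof (cases "e = e1")
      case True
      then have "{p, q} = {a, b}" using pq e1 by simp
      then show ?thesis using fa e1 bW by (metis doubleton_eq_iff)
    next
      case False
      then have "p \<notin> T \<or> q \<notin> T" using e pq by (auto simp: F_def touch_def)
      then show ?thesis using fout fT pq(2) by metis
    qed
    then show "card (f ` ends G e) = 2" by (simp add: pq)
  next
    have "\<not> inj_on f V"
    proof
      assume inj: "inj_on f V"
      have "f ` T \<subseteq> {a, b}" using W by (auto simp: f_def)
      then have "card (f ` T) \<le> card {a, b}" by (intro card_mono) auto
      also have "\<dots> \<le> 2" by (simp add: card_insert_if)
      finally have "card (f ` T) \<le> 2" .
      moreover have "card (f ` T) = card T" by (rule card_image[OF inj_on_subset[OF inj TV]])
      ultimately show False using T(2) by simp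
    qed
    then show "\<not> (inj_on f V \<and> F = E)" by blast
  next
    have "f0 \<in> touch (V - T)" using f0(1) cut_touch[of "V - T" "V - T"] by (auto simp: cut_compl)
    then show "f0 \<in> F" by (simp add: F_def)
  qed
  moreover have "y f0 = x f0" using e1n(2) f0(1) by (auto simp: y_def)
  ultimately show False using f0(2) by simp
qed

text \<open>A tight pair on the far side makes \<open>x\<close>, on the edges touching
  \<open>T\<close>, the midpoint of two nonnegative integral points; \<open>g\<close> is their
  difference. Their sum is \<open>2 * x f\<close>, so value 1/2 gives a difference of 1 or -1, and
  value 1 an even one.\<close>

lemma side_pattern:
  assumes T: "tight T" "card T \<ge> 2" "card (V - T) \<ge> 2"
  obtains g where "dirs T g" "\<And>f. f \<in> \<delta> T \<Longrightarrow> x f = 1/2 \<Longrightarrow> g f = 1 \<or> g f = -1"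
    "\<And>f. f \<in> \<delta> T \<Longrightarrow> x f = 1 \<Longrightarrow> g f = 0 \<or> g f = 2 \<or> g f = -2"
proof -
  note TV = tight_sub[OF T(1)]
  have VV: "V - (V - T) = T" using TV by blast
  have cT: "card (V - (V - T)) \<ge> 2" using T(2) VV by simp
  show ?thesis
  proof (rule pair_in_tight[OF tight_compl[OF T(1)] T(3) cT])
    fix u v y1 y2
    assume uv: "{u, v} \<subseteq> V - T"
      and y: "\<And>f. f \<in> touch (V - {u, v}) \<Longrightarrow> y1 f \<in> \<int> \<and> y2 f \<in> \<int> \<and> 0 \<le> y1 f \<and> 0 \<le> y2 f \<and> y1 f + y2 f = 2 * x f"
      and ge: "\<And>T. T \<noteq> {} \<Longrightarrow> T \<subseteq> V - {u, v} \<Longrightarrow> 2 \<le> val y1 T \<and> 2 \<le> val y2 T"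
    have TU: "T \<subseteq> V - {u, v}" using uv TV by blast
    define g where "g = (\<lambda>f. y1 f - y2 f)"
    have "dirs T g" unfolding dirs_def
    proof (intro allI impI)
      fix S assume S: "S \<subseteq> T" "tight S"
      have SU: "S \<subseteq> V - {u, v}" using S TU by blast
      have "val y1 S + val y2 S = (\<Sum>f\<in>\<delta> S. 2 * x f)"
        unfolding val_def sum.distrib[symmetric] by (rule sum.cong) (use y cut_touch[OF SU] in auto)
      also have "\<dots> = 4" using S(2) by (simp add: tight_def val_def sum_distrib_left[symmetric])
      finally have "val y1 S = val y2 S" using ge[OF _ SU] S(2) by (auto simp: tight_def)
      then show "val g S = 0" by (simp add: val_def g_def sum_subtractf)
    qed
    moreover have iy: "\<exists>k l :: int. y1 f = of_int k \<and> y2 f = of_int l \<and> 0 \<le> k \<and> 0 \<le> l \<and> of_int (k + l) = 2 * x f"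
      if "f \<in> \<delta> T" for f
    proof -
      have yf: "y1 f \<in> \<int> \<and> y2 f \<in> \<int> \<and> 0 \<le> y1 f \<and> 0 \<le> y2 f \<and> y1 f + y2 f = 2 * x f"
        using y that cut_touch[OF TU] by blast
      then obtain k l where "y1 f = of_int k" "y2 f = of_int l" by (metis Ints_cases)
      then show ?thesis using yf by (intro exI[of _ k] exI[of _ l]) auto
    qed
    moreover have "g f = 1 \<or> g f = -1" if f: "f \<in> \<delta> T" "x f = 1/2" for f
    proof -
      obtain k l :: int where kl: "y1 f = of_int k" "y2 f = of_int l" "0 \<le> k" "0 \<le> l" "of_int (k + l) = 2 * x f"
        using iy[OF f(1)] by blast
      then have "real_of_int (k + l) = 1" using f(2) by simp
      then have "k + l = 1" by linarith
      then have "(k = 0 \<and> l = 1) \<or> (k = 1 \<and> l = 0)" using kl by linarith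
      then show ?thesis using kl by (auto simp: g_def)
    qed
    moreover have "g f = 0 \<or> g f = 2 \<or> g f = -2" if f: "f \<in> \<delta> T" "x f = 1" for f
    proof -
      obtain k l :: int where kl: "y1 f = of_int k" "y2 f = of_int l" "0 \<le> k" "0 \<le> l" "of_int (k + l) = 2 * x f"
        using iy[OF f(1)] by blast
      then have "real_of_int (k + l) = 2" using f(2) by simp
      then have "k + l = 2" by linarith
      then have "(k = 0 \<and> l = 2) \<or> (k = 1 \<and> l = 1) \<or> (k = 2 \<and> l = 0)" using kl by linarith
      then show ?thesis using kl by (auto simp: g_def)
    qed
    ultimately show thesis using that[of g] by blast
  qed
qed

end

section \<open>Tight cuts with two large sides\<close>

lemma half_not_int: "(1/2 :: real) \<notin> \<int>"
proof
  assume "(1/2 :: real) \<in> \<int>"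
  then obtain k where "(1/2 :: real) = of_int k" by (rule Ints_cases)
  then have "0 < k" "k < 1" by linarith+
  then show False by simp
qed

context fractional_minimal
begin

definition tend :: "'v set \<Rightarrow> 'e \<Rightarrow> 'v" where "tend T f = (SOME v. v \<in> ends G f \<inter> T)"

definition swap_dir :: "'e \<Rightarrow> 'e \<Rightarrow> 'e \<Rightarrow> real" where
  "swap_dir f g e = (if e = f then 1 else 0) - (if e = g then 1 else 0)"

lemma tend:
  assumes "f \<in> \<delta> T"
  shows "ends G f = {tend T f, tend (V - T) f}" "tend T f \<in> T" "tend (V - T) f \<in> V - T" "f \<in> E"
proof -
  have fE: "f \<in> E" using assms cut_sub by blast
  then show "f \<in> E" .
  obtain a b where ab: "ends G f = {a, b}" "a \<noteq> b" "a \<in> V" "b \<in> V" using fE by (rule edgeE)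
  have 1: "tend T f = u \<and> tend (V - T) f = w" if "ends G f = {u, w}" "u \<in> T" "w \<notin> T" "w \<in> V" for u w
  proof -
    have "ends G f \<inter> T = {u}" "ends G f \<inter> (V - T) = {w}" using that by auto
    then show ?thesis by (simp add: tend_def)
  qed
  have "(a \<in> T) \<noteq> (b \<in> T)" using assms in_cut[OF fE ab(1)] by blast
  then have "\<exists>u w. ends G f = {u, w} \<and> u \<in> T \<and> w \<notin> T \<and> w \<in> V" using ab by (metis insert_commute)
  then obtain u w where uw: "ends G f = {u, w}" "u \<in> T" "w \<notin> T" "w \<in> V" by blast
  then show "ends G f = {tend T f, tend (V - T) f}" "tend T f \<in> T" "tend (V - T) f \<in> V - T"
    using 1[OF uw] by simp_all
qed

lemma tend_touch: "f \<in> \<delta> T \<Longrightarrow> X \<subseteq> T \<Longrightarrow> f \<in> touch X \<longleftrightarrow> tend T f \<in> X"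
  using tend[of f T] by (auto simp: touch_def)

lemma tend_cut: "f \<in> \<delta> T \<Longrightarrow> X \<subseteq> T \<Longrightarrow> f \<in> \<delta> X \<longleftrightarrow> tend T f \<in> X"
  using tend[of f T] in_cut[of f "tend T f" "tend (V - T) f" X] by auto

text \<open>Each subset of \<open>T\<close> cuts both edges or neither, since their common end is
  their only end in \<open>T\<close>.\<close>

lemma swap_dir_dirs:
  assumes "f \<in> \<delta> T" "g \<in> \<delta> T" "tend T f = tend T g"
  shows "dirs T (swap_dir f g)"
  unfolding dirs_def
proof (intro allI impI)
  fix S assume S: "S \<subseteq> T"
  have "val (swap_dir f g) S = (if f \<in> \<delta> S then 1 else 0) - (if g \<in> \<delta> S then 1 else 0)"
    by (simp add: val_def swap_dir_def sum_subtractf)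
  then show "val (swap_dir f g) S = 0" using tend_cut[OF assms(1) S] tend_cut[OF assms(2) S] assms(3) by simp
qed

lemma swap_dir_simps [simp]: "f \<noteq> g \<Longrightarrow> swap_dir f g f = 1" "f \<noteq> g \<Longrightarrow> swap_dir f g g = -1"
  "e \<noteq> f \<Longrightarrow> e \<noteq> g \<Longrightarrow> swap_dir f g e = 0"
  by (auto simp: swap_dir_def)

lemma dirs_add: "dirs T d \<Longrightarrow> dirs T d' \<Longrightarrow> dirs T (\<lambda>e. d e + d' e)"
  by (simp add: dirs_def val_def sum.distrib)

text \<open>The patterns that directions of the two sides leave on a tight cut meet only in 0. The
  exclusions below exhibit a common pattern.\<close>

lemma no_common_direction:
  assumes "tight T" "dirs T p" "dirs (V - T) q" "\<And>f. f \<in> \<delta> T \<Longrightarrow> p f = q f" "f \<in> \<delta> T"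
  shows "q f = 0"
  using glue2(1)[OF assms(1-4), of f] assms(4)[OF assms(5)] assms(5) cut_touch[of T T] by auto

lemma dirs_cut_sum: "tight T \<Longrightarrow> dirs T d \<Longrightarrow> val d T = 0"
  by (auto simp: dirs_def)

lemma dirs_cut_sum': "tight T \<Longrightarrow> dirs (V - T) d \<Longrightarrow> val d T = 0"
  using dirs_cut_sum[OF tight_compl, of T d] by (simp add: val_compl)

lemma component_in:
  assumes "tight T" "z \<in> T" "w \<in> T" "w \<noteq> z"
  obtains B where "B \<subseteq> T - {z}" "w \<in> B" "conn G B" "conn G (T - B)" "\<not> adjacent G B (T - {z} - B)"
proof -
  have "finite (T - {z})" using finVsub[OF tight_sub[OF assms(1)]] by simp
  then obtain B where B: "B \<subseteq> T - {z}" "w \<in> B" "conn G B" "\<not> adjacent G B (T - {z} - B)"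
    using component_exists[of "T - {z}" w G] assms by blast
  then show ?thesis using that[OF B(1-3) conn_minus_component[OF tight_conn[OF assms(1)] assms(2) B(1,4)]] by blast
qed

text \<open>An edge leaving \<open>Q\<close> for a node other than \<open>c\<close> must leave
  \<open>T\<close>, so \<open>c\<close> and \<open>e\<close> would separate \<open>Q\<close> from
  the rest of the graph.\<close>

lemma no_separating_node:
  assumes T: "tight T" and c: "c \<in> T" and Q: "Q \<subseteq> T - {c}" "Q \<noteq> {}" "\<not> adjacent G Q (T - {c} - Q)"
    and e: "\<delta> T \<inter> touch Q \<subseteq> {e}" "e \<in> \<delta> T \<Longrightarrow> x e < 1"
  shows False
proof (rule no_separation[of c Q "V - {c} - Q" e])
  note TV = tight_sub[OF T]
  show "c \<in> V" "V - {c} = Q \<union> (V - {c} - Q)" "Q \<inter> (V - {c} - Q) = {}" "Q \<noteq> {}" using c Q TV by auto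
  have "V - T \<noteq> {}" using T by (auto simp: tight_def)
  then show "V - {c} - Q \<noteq> {}" using Q c by blast
  have sub: "between Q (V - {c} - Q) \<subseteq> \<delta> T \<inter> touch Q"
  proof
    fix f assume f: "f \<in> between Q (V - {c} - Q)"
    then have fE: "f \<in> E" by (simp add: between_def)
    obtain p q where "p \<in> Q" "q \<in> V - {c} - Q" "p \<in> ends G f" "q \<in> ends G f" using f by (auto simp: between_def)
    moreover obtain a b where "ends G f = {a, b}" using fE by (rule edgeE)
    ultimately have pq: "p \<in> Q" "q \<in> V - {c} - Q" "ends G f = {p, q}" by auto
    have "q \<notin> T"
    proof
      assume "q \<in> T"
      then have "adjacent G Q (T - {c} - Q)" unfolding adjacent_def using pq fE by blast
      then show False using Q(3) by simp
    qed
    then have "f \<in> \<delta> T" using pq Q(1) unfolding in_cut[OF fE pq(3)] by blast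
    then show "f \<in> \<delta> T \<inter> touch Q" using f by (auto simp: between_def touch_def)
  qed
  then show "between Q (V - {c} - Q) \<subseteq> {e}" using e(1) by blast
  show "e \<in> between Q (V - {c} - Q) \<Longrightarrow> x e < 1" using sub e(2) by blast
qed

text \<open>If \<open>a\<close> and \<open>b\<close> met in \<open>T\<close>, then \<open>g\<close>
  and \<open>swap_dir a b\<close> would realise every pattern of sum 0, including that of
  \<open>h\<close>. Otherwise the component of \<open>T - {tend T a}\<close> at the end of
  \<open>b\<close> contains also the end of \<open>c\<close>, by \<open>no_separating_node\<close>.
  So \<open>T\<close> splits into a part seen by \<open>a\<close> and a part seen by
  \<open>b\<close> and \<open>c\<close>, each of boundary value 1, and
  \<open>no_pair_replacement\<close> applies.\<close>

lemma no_three_edge_cut_aux: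
  assumes T: "tight T" "card T \<ge> 3" and cut: "\<delta> T = {a, b, c}" "a \<noteq> b" "a \<noteq> c" "b \<noteq> c"
    and x: "x a = 1" "x b = 1/2" "x c = 1/2"
    and g: "dirs T g" "g a = 0" "g b = 1" "g c = -1"
    and h: "dirs (V - T) h" "h b \<noteq> 0"
  shows False
proof -
  have valT: "val d T = d a + d b + d c" for d using cut by (simp add: val_def)
  have hs: "h a + h b + h c = 0" using dirs_cut_sum'[OF T(1) h(1)] valT by simp
  have inT: "a \<in> \<delta> T" "b \<in> \<delta> T" "c \<in> \<delta> T" using cut by auto
  have ab: "tend T a \<noteq> tend T b"
  proof
    assume "tend T a = tend T b"
    then have "dirs T (swap_dir a b)" using inT by (intro swap_dir_dirs)
    then have "dirs T (\<lambda>e. h a * swap_dir a b e - h c * g e)" by (intro dirs_diff dirs_scale g)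
    then have "h b = 0" by (rule no_common_direction[OF T(1) _ h(1)]) (use cut g hs in auto)
    then show False using h by simp
  qed
  obtain B where B: "B \<subseteq> T - {tend T a}" "tend T b \<in> B" "conn G B" "conn G (T - B)"
    "\<not> adjacent G B (T - {tend T a} - B)"
    using component_in[OF T(1) tend(2)[OF inT(1)] tend(2)[OF inT(2)]] ab by metis
  have BT: "B \<subseteq> T" using B by blast
  have cB: "tend T c \<in> B"
  proof (rule ccontr)
    assume n: "tend T c \<notin> B"
    show False
    proof (rule no_separating_node[OF T(1) tend(2)[OF inT(1)] B(1) _ B(5), of b])
      show "\<delta> T \<inter> touch B \<subseteq> {b}" using n B tend_touch[OF inT(1) BT] tend_touch[OF inT(3) BT] cut by auto
    qed (use B x in auto)
  qed
  have touchW: "\<delta> T \<inter> touch (T - B) = {a}"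
    using tend_touch[OF inT(1), of "T - B"] tend_touch[OF inT(2), of "T - B"] tend_touch[OF inT(3), of "T - B"]
      tend(2)[OF inT(1)] B cB cut by auto
  show False
  proof (rule no_pair_replacement[OF T, of "T - B" B b])
    show "x b \<notin> \<int>" unfolding x(2) by (rule half_not_int)
    fix q f assume q: "dirs (V - T) q" "sum q (\<delta> T \<inter> touch (T - B)) = 0" "f \<in> \<delta> T"
    have qa: "q a = 0" "q b + q c = 0" using q(2) touchW dirs_cut_sum'[OF T(1) q(1)] valT by auto
    show "q f = 0"
      by (rule no_common_direction[OF T(1) dirs_scale[OF g(1), of "q b"] q(1) _ q(3)]) (use cut g qa in auto)
  qed (use B touchW x cut in auto)
qed

text \<open>Swaps of three cut edges with a common end give all patterns of sum 0 on them, and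
  \<open>g\<close> moves the fourth edge. So the side of \<open>T\<close> realises every pattern of
  sum 0, including that of \<open>h\<close>.\<close>

lemma three_coincidences:
  assumes T: "tight T" and cut: "\<delta> T = {i, j, k, m}" "distinct [i, j, k, m]"
    and t: "tend T i = tend T j" "tend T j = tend T k"
    and g: "dirs T g" "g m \<noteq> 0" and h: "dirs (V - T) h" "h m \<noteq> 0"
  shows False
proof -
  have valT: "val d T = d i + d j + d k + d m" for d using cut by (simp add: val_def)
  have hs: "h i + h j + h k + h m = 0" using dirs_cut_sum'[OF T h(1)] valT by simp
  have gs: "g i + g j + g k + g m = 0" using dirs_cut_sum[OF T g(1)] valT by simp
  have sw: "dirs T (swap_dir i j)" "dirs T (swap_dir j k)" using t cut by (auto intro!: swap_dir_dirs)
  \<comment> \<open>\<open>r\<close> matches \<open>h\<close> at \<open>m\<close>; \<open>A\<close>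
    and \<open>B\<close> are the amounts the swaps must then carry between \<open>i\<close> and
    \<open>j\<close> and between \<open>j\<close> and \<open>k\<close>.\<close>
  define r where "r = h m / g m"
  define A where "A = h i - r * g i"
  define B where "B = A + (h j - r * g j)"
  have rm: "r * g m = h m" using g(2) by (simp add: r_def)
  have "r * (g i + g j + g k + g m) = 0" using gs by simp
  then have rk: "r * g i + r * g j + r * g k + h m = 0" using rm by (simp add: algebra_simps)
  have "dirs T (\<lambda>e. (r * g e + A * swap_dir i j e) + B * swap_dir j k e)"
    by (intro dirs_add dirs_scale g sw)
  then have "h m = 0"
    by (rule no_common_direction[OF T _ h(1)])
      (use cut rm rk hs in \<open>auto simp: A_def B_def\<close>)
  then show False using h(2) by simp
qed

text \<open>Three edges with a common end are excluded by \<open>three_coincidences\<close>. Two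
  pairs meeting at different nodes split \<open>T\<close> into connected parts that see two cut
  edges each, of total value 1; a pattern balanced on each pair is a combination of the two swaps,
  so \<open>no_pair_replacement\<close> applies.\<close>

lemma coincidence_unique:
  assumes T: "tight T" "card T \<ge> 3" and card: "card (\<delta> T) = 4" and x: "\<And>f. f \<in> \<delta> T \<Longrightarrow> x f = 1/2"
    and g: "dirs T g" "\<And>f. f \<in> \<delta> T \<Longrightarrow> g f \<noteq> 0" and h: "dirs (V - T) h" "\<And>f. f \<in> \<delta> T \<Longrightarrow> h f \<noteq> 0"
    and ij: "i \<in> \<delta> T" "j \<in> \<delta> T" "i \<noteq> j" "tend T i = tend T j"
    and kl: "k \<in> \<delta> T" "l \<in> \<delta> T" "k \<noteq> l" "tend T k = tend T l"
  shows "{i, j} = {k, l}"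
proof (rule ccontr)
  assume ne: "{i, j} \<noteq> {k, l}"
  have triple: False if "a \<in> \<delta> T" "b \<in> \<delta> T" "c \<in> \<delta> T" "distinct [a, b, c]" "tend T a = tend T b" "tend T b = tend T c" for a b c
  proof -
    have "card (\<delta> T - {a, b, c}) = 1" using card that by simp
    then obtain m where "\<delta> T - {a, b, c} = {m}" by (auto simp: card_1_singleton_iff)
    then have "\<delta> T = {a, b, c, m}" "distinct [a, b, c, m]" using that by auto
    moreover from this have "m \<in> \<delta> T" by simp
    ultimately show False using three_coincidences[OF T(1) _ _ that(5,6) g(1) _ h(1)] g(2) h(2) by blast
  qed
  show False
  proof (cases "tend T i = tend T k")
    case True
    have "k \<notin> {i, j} \<or> l \<notin> {i, j}" using ne ij(3) kl(3) by auto
    then show False using triple[of i j k] triple[of i j l] ij kl True by auto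
  next
    case nt: False
    have dist: "distinct [i, j, k, l]" using ij kl nt by auto
    have cut: "\<delta> T = {i, j, k, l}"
      by (rule sym, rule card_subset_eq) (use ij kl card dist in auto)
    have valT: "val d T = d i + d j + d k + d l" for d using cut dist by (simp add: val_def)
    obtain B where B: "B \<subseteq> T - {tend T i}" "tend T k \<in> B" "conn G B" "conn G (T - B)"
      using component_in[OF T(1) tend(2)[OF ij(1)] tend(2)[OF kl(1)]] nt by metis
    have touchW: "\<delta> T \<inter> touch (T - B) = {i, j}"
      using tend_touch[OF ij(1), of "T - B"] tend_touch[OF ij(2), of "T - B"] tend_touch[OF kl(1), of "T - B"]
        tend_touch[OF kl(2), of "T - B"] tend(2)[OF ij(1)] B cut ij(4) kl(4) by auto
    show False
    proof (rule no_pair_replacement[OF T, of "T - B" B i])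
      show "x i \<notin> \<int>" unfolding x[OF ij(1)] by (rule half_not_int)
      fix q f assume q: "dirs (V - T) q" "sum q (\<delta> T \<inter> touch (T - B)) = 0" "f \<in> \<delta> T"
      have qs: "q i + q j = 0" "q k + q l = 0" using q(2) ij(3) touchW dirs_cut_sum'[OF T(1) q(1)] valT by auto
      have "dirs T (\<lambda>e. q i * swap_dir i j e + q k * swap_dir k l e)"
        by (intro dirs_add dirs_scale swap_dir_dirs ij kl)
      then show "q f = 0"
        by (rule no_common_direction[OF T(1) _ q(1) _ q(3)]) (use cut dist qs in auto)
    next
      show "sum x (\<delta> T \<inter> touch (T - B)) = 1" unfolding touchW using x[OF ij(1)] x[OF ij(2)] ij(3) by simp
    qed (use B ij in auto)
  qed
qed

text \<open>Four signs sum to 0 only if two are positive. If \<open>g\<close> differs on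
  \<open>i\<close> and \<open>j\<close>, a swap reduces it to a multiple of
  \<open>swap_dir k l\<close>; symmetrically if \<open>h\<close> differs on \<open>k\<close> and
  \<open>l\<close>. Otherwise \<open>g\<close> and \<open>h\<close> are constant on both pairs and
  hence proportional.\<close>

lemma coincidences_meet:
  assumes T: "tight T" and card: "card (\<delta> T) = 4"
    and g: "dirs T g" "\<And>f. f \<in> \<delta> T \<Longrightarrow> g f = 1 \<or> g f = -1" and h: "dirs (V - T) h" "\<And>f. f \<in> \<delta> T \<Longrightarrow> h f = 1 \<or> h f = -1"
    and ij: "i \<in> \<delta> T" "j \<in> \<delta> T" "i \<noteq> j" "tend T i = tend T j"
    and kl: "k \<in> \<delta> T" "l \<in> \<delta> T" "k \<noteq> l" "tend (V - T) k = tend (V - T) l"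
  shows "{i, j} \<inter> {k, l} \<noteq> {}"
proof
  assume "{i, j} \<inter> {k, l} = {}"
  then have dist: "distinct [i, j, k, l]" using ij kl by auto
  have cut: "\<delta> T = {i, j, k, l}"
    by (rule sym, rule card_subset_eq) (use ij kl card dist in auto)
  have valT: "val d T = d i + d j + d k + d l" for d using cut dist by (simp add: val_def)
  have gs: "g i + g j + g k + g l = 0" using dirs_cut_sum[OF T g(1)] valT by simp
  have hs: "h i + h j + h k + h l = 0" using dirs_cut_sum'[OF T h(1)] valT by simp
  have sij: "dirs T (swap_dir i j)" using ij by (intro swap_dir_dirs)
  have skl: "dirs (V - T) (swap_dir k l)" using kl by (intro swap_dir_dirs) (auto simp: cut_compl)
  have gv: "g i = 1 \<or> g i = -1" "g j = 1 \<or> g j = -1" "g k = 1 \<or> g k = -1" "g l = 1 \<or> g l = -1" using g(2) ij kl by auto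
  have hv: "h i = 1 \<or> h i = -1" "h j = 1 \<or> h j = -1" "h k = 1 \<or> h k = -1" "h l = 1 \<or> h l = -1" using h(2) ij kl by auto
  show False
  proof (cases "g i = g j")
    case False
    then have s: "g j = - g i" "g l = - g k" using gv gs by auto
    have "dirs T (\<lambda>e. g e - g i * swap_dir i j e)" by (rule dirs_diff[OF g(1) sij])
    then have "g k * swap_dir k l k = 0"
      by (rule no_common_direction[OF T _ dirs_scale[OF skl, of "g k"]]) (use cut dist s in auto)
    then show False using gv dist by auto
  next
    case gij: True
    show False
    proof (cases "h k = h l")
      case False
      then have s: "h l = - h k" "h j = - h i" using hv hs by auto
      have "dirs (V - T) (\<lambda>e. h e - h k * swap_dir k l e)" by (rule dirs_diff[OF h(1) skl])
      then have "h i - h k * swap_dir k l i = 0"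
        by (rule no_common_direction[OF T dirs_scale[OF sij, of "h i"]]) (use cut dist s in auto)
      then show False using hv dist by auto
    next
      case hkl: True
      have s: "g j = g i" "g k = - g i" "g l = - g i" "h l = - h i" "h k = - h i" "h j = h i"
        using gv hv gs hs gij hkl by auto
      have "h i = 0"
        by (rule no_common_direction[OF T dirs_scale[OF g(1), of "h i / g i"] h(1)])
          (use cut s gv in auto)
      then show False using hv by simp
    qed
  qed
qed

text \<open>A part of \<open>T\<close> split off by one node meets at least two cut edges, by
  \<open>no_separating_node\<close>. There are only four: the deleted end of a cut edge uses one,
  which leaves too few for two parts, and a claw would need six.\<close>

lemma side_triangle:
  assumes T: "tight T" "card T \<ge> 3" and card: "card (\<delta> T) = 4" and x: "\<And>f. f \<in> \<delta> T \<Longrightarrow> x f = 1/2"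
    and abc: "a \<in> \<delta> T" "b \<in> \<delta> T" "c \<in> \<delta> T" and dist: "distinct [tend T a, tend T b, tend T c]"
  shows "rooted_triangle G T (tend T a) (tend T b) (tend T c)"
proof -
  note TV = tight_sub[OF T(1)]
  have fT: "finite T" using TV by (rule finVsub)
  have two: "card (\<delta> T \<inter> touch Q) \<ge> 2"
    if Q: "p \<in> T" "Q \<subseteq> T - {p}" "Q \<noteq> {}" "\<not> adjacent G Q (T - {p} - Q)" for p Q
  proof (rule ccontr)
    assume "\<not> ?thesis"
    then have "card (\<delta> T \<inter> touch Q) \<le> 1" by simp
    then have "\<forall>e1\<in>\<delta> T \<inter> touch Q. \<forall>e2\<in>\<delta> T \<inter> touch Q. e1 = e2" by (simp add: card_le_Suc0_iff_eq)
    then have "\<exists>e. \<delta> T \<inter> touch Q \<subseteq> {e}" by blast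
    then obtain e where "\<delta> T \<inter> touch Q \<subseteq> {e}" by blast
    then show False using no_separating_node[OF T(1) Q, of e] x by auto
  qed
  have disj: "(\<delta> T \<inter> touch A) \<inter> (\<delta> T \<inter> touch B) = {}" if "A \<subseteq> T" "B \<subseteq> T" "A \<inter> B = {}" for A B
  proof -
    have "\<not> (f \<in> touch A \<and> f \<in> touch B)" if "f \<in> \<delta> T" for f
      using tend_touch[OF that \<open>A \<subseteq> T\<close>] tend_touch[OF that \<open>B \<subseteq> T\<close>] \<open>A \<inter> B = {}\<close> by blast
    then show ?thesis by blast
  qed
  have connT: "conn G (T - {tend T f})" if f: "f \<in> \<delta> T" for f
    unfolding conn_adjacent
  proof (intro conjI allI impI)
    have t: "tend T f \<in> T" by (rule tend(2)[OF f])
    have "card (T - {tend T f}) \<noteq> 0" using T(2) fT t by simp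
    then show "T - {tend T f} \<noteq> {}" by (metis card.empty)
    fix A assume A: "A \<noteq> {}" "A \<subset> T - {tend T f}"
    show "adjacent G A (T - {tend T f} - A)"
    proof (rule ccontr)
      assume n: "\<not> ?thesis"
      define B where "B = T - {tend T f} - A"
      have BA: "T - {tend T f} - B = A" using A by (auto simp: B_def)
      have AT: "A \<subseteq> T" "B \<subseteq> T" "A \<inter> B = {}" "tend T f \<notin> A" "tend T f \<notin> B" using A by (auto simp: B_def)
      have c1: "card (\<delta> T \<inter> touch A) \<ge> 2" by (rule two[OF t _ _ n]) (use A in auto)
      have c2: "card (\<delta> T \<inter> touch B) \<ge> 2"
      proof (rule two[OF t])
        show "\<not> adjacent G B (T - {tend T f} - B)" using n unfolding BA by (simp add: B_def adjacent_sym)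
      qed (use A in \<open>auto simp: B_def\<close>)
      have "card ((\<delta> T \<inter> touch A) \<union> (\<delta> T \<inter> touch B)) = card (\<delta> T \<inter> touch A) + card (\<delta> T \<inter> touch B)"
        by (rule card_Un_disjoint) (use disj[OF AT(1-3)] in auto)
      moreover have "f \<notin> (\<delta> T \<inter> touch A) \<union> (\<delta> T \<inter> touch B)"
        using tend_touch[OF f AT(1)] tend_touch[OF f AT(2)] AT by blast
      then have "card (insert f ((\<delta> T \<inter> touch A) \<union> (\<delta> T \<inter> touch B))) = Suc (card ((\<delta> T \<inter> touch A) \<union> (\<delta> T \<inter> touch B)))"
        by simp
      moreover have "card (insert f ((\<delta> T \<inter> touch A) \<union> (\<delta> T \<inter> touch B))) \<le> card (\<delta> T)"
        by (rule card_mono) (use f in auto)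
      ultimately show False using c1 c2 card by linarith
    qed
  qed
  have "rooted_triangle G T (tend T a) (tend T b) (tend T c) \<or> rooted_claw G T (tend T a) (tend T b) (tend T c)"
    by (rule triangle_or_claw[OF tight_conn[OF T(1)] fT]) (use abc dist connT tend(2) in auto)
  moreover have "\<not> rooted_claw G T (tend T a) (tend T b) (tend T c)"
  proof
    assume "rooted_claw G T (tend T a) (tend T b) (tend T c)"
    then obtain p A B C where p: "p \<in> T" "A \<union> B \<union> C \<subseteq> T - {p}" "A \<inter> B = {}" "A \<inter> C = {}" "B \<inter> C = {}"
      "tend T a \<in> A" "tend T b \<in> B" "tend T c \<in> C"
      "\<not> adjacent G A (T - {p} - A)" "\<not> adjacent G B (T - {p} - B)" "\<not> adjacent G C (T - {p} - C)"
      unfolding rooted_claw_def by blast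
    have c: "card (\<delta> T \<inter> touch A) \<ge> 2" "card (\<delta> T \<inter> touch B) \<ge> 2" "card (\<delta> T \<inter> touch C) \<ge> 2"
      by (rule two[OF p(1)]; use p in auto)+
    have sub: "A \<subseteq> T" "B \<subseteq> T" "C \<subseteq> T" using p(2) by auto
    have "card ((\<delta> T \<inter> touch A) \<union> (\<delta> T \<inter> touch B) \<union> (\<delta> T \<inter> touch C)) =
        card (\<delta> T \<inter> touch A) + card (\<delta> T \<inter> touch B) + card (\<delta> T \<inter> touch C)"
    proof -
      have "card ((\<delta> T \<inter> touch A) \<union> (\<delta> T \<inter> touch B)) = card (\<delta> T \<inter> touch A) + card (\<delta> T \<inter> touch B)"
        by (rule card_Un_disjoint) (use disj[OF sub(1,2) p(3)] in auto)
      moreover have "card ((\<delta> T \<inter> touch A) \<union> (\<delta> T \<inter> touch B) \<union> (\<delta> T \<inter> touch C)) =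
          card ((\<delta> T \<inter> touch A) \<union> (\<delta> T \<inter> touch B)) + card (\<delta> T \<inter> touch C)"
        by (rule card_Un_disjoint) (use disj[OF sub(1,3) p(4)] disj[OF sub(2,3) p(5)] in auto)
      ultimately show ?thesis by simp
    qed
    moreover have "card ((\<delta> T \<inter> touch A) \<union> (\<delta> T \<inter> touch B) \<union> (\<delta> T \<inter> touch C)) \<le> card (\<delta> T)"
      by (rule card_mono) auto
    ultimately show False using c card by linarith
  qed
  ultimately show ?thesis by blast
qed

text \<open>The cut consists of four edges of value 1/2. On each side at most one pair of them
  shares an end, and such pairs on the two sides intersect, so dropping one suitable edge leaves
  three with distinct ends on both sides.\<close>

lemma large_tight_cut:
  assumes T: "tight T" "card T \<ge> 3" "card (V - T) \<ge> 3"
  obtains a b c where "a \<in> \<delta> T" "b \<in> \<delta> T" "c \<in> \<delta> T"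
    "rooted_triangle G T (tend T a) (tend T b) (tend T c)"
    "rooted_triangle G (V - T) (tend (V - T) a) (tend (V - T) b) (tend (V - T) c)"
proof -
  note TV = tight_sub[OF T(1)]
  note T' = tight_compl[OF T(1)]
  have VV: "V - (V - T) = T" using TV by blast
  have dd: "\<delta> (V - T) = \<delta> T" by (rule cut_compl)
  have sum2: "sum x (\<delta> T) = 2" using T(1) by (simp add: tight_def val_def)
  have hx: "x f = 1/2 \<or> x f = 1 \<or> x f = 3/2" if "f \<in> \<delta> T" for f using half_integral that cut_sub by blast
  have c2: "card T \<ge> 2" "card (V - T) \<ge> 2" using T by auto
  have c3: "card (\<delta> T) \<ge> 3" by (rule nontrivial_cut_card[OF T(1)]) (use T in auto)
  obtain g where g: "dirs T g" "\<And>f. f \<in> \<delta> T \<Longrightarrow> x f = 1/2 \<Longrightarrow> g f = 1 \<or> g f = -1"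
    "\<And>f. f \<in> \<delta> T \<Longrightarrow> x f = 1 \<Longrightarrow> g f = 0 \<or> g f = 2 \<or> g f = -2"
    using side_pattern[OF T(1) c2] by blast
  obtain h where h: "dirs (V - T) h" "\<And>f. f \<in> \<delta> T \<Longrightarrow> x f = 1/2 \<Longrightarrow> h f = 1 \<or> h f = -1"
    "\<And>f. f \<in> \<delta> T \<Longrightarrow> x f = 1 \<Longrightarrow> h f = 0 \<or> h f = 2 \<or> h f = -2"
    using side_pattern[OF T' c2(2), unfolded VV dd, OF c2(1)] by blast
  \<comment> \<open>With at least three edges of total value 2, a value above 1/2 forces (1, 1/2,
    1/2). A pattern vanishing on the edge of value 1 is excluded by
    \<open>no_three_edge_cut_aux\<close>; otherwise the patterns of both sides are multiples of (2,
    -1, -1).\<close>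
  have allhalf: "x f = 1/2" if f: "f \<in> \<delta> T" for f
  proof (rule ccontr)
    assume "x f \<noteq> 1/2"
    then have x1: "1 \<le> x f" using hx[OF f] by auto
    let ?R = "\<delta> T - {f}"
    have cR: "card ?R \<ge> 2" using c3 f by simp
    have sR: "sum x ?R = 2 - x f" using sum2 f by (simp add: sum_diff1)
    have "(\<Sum>e\<in>?R. 1/2) \<le> sum x ?R" by (rule sum_mono) (use hx in force)
    then have "real (card ?R) * (1/2) \<le> 2 - x f" using sR by simp
    then have "real (card ?R) \<le> 2" "real (card ?R) \<le> 4 - 2 * x f" using x1 by linarith+
    then have cR2: "card ?R = 2" and xf: "x f = 1" using cR x1 by linarith+
    obtain b c where bc: "?R = {b, c}" "b \<noteq> c" using cR2 by (auto simp: card_2_iff)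
    have cut: "\<delta> T = {f, b, c}" "f \<noteq> b" "f \<noteq> c" using bc f by auto
    have "x b + x c = 1" using sR bc xf by simp
    then have xbc: "x b = 1/2" "x c = 1/2" using hx[of b] hx[of c] cut by auto
    have valT: "val d T = d f + d b + d c" for d using cut bc by (simp add: val_def)
    have gs: "g f + g b + g c = 0" using dirs_cut_sum[OF T(1) g(1)] valT by simp
    have hs: "h f + h b + h c = 0" using dirs_cut_sum'[OF T(1) h(1)] valT by simp
    have gv: "g f = 0 \<or> g f = 2 \<or> g f = -2" "g b = 1 \<or> g b = -1" "g c = 1 \<or> g c = -1"
      using g(2,3) cut xf xbc by auto
    have hv: "h f = 0 \<or> h f = 2 \<or> h f = -2" "h b = 1 \<or> h b = -1" "h c = 1 \<or> h c = -1"
      using h(2,3) cut xf xbc by auto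
    show False
    proof (cases "g f = 0")
      case True
      then have gc: "g c = - g b" using gs by simp
      show False
        by (rule no_three_edge_cut_aux[OF T(1,2) cut bc(2) xf xbc dirs_scale[OF g(1), of "g b"] _ _ _ h(1)])
          (use True gc gv hv in auto)
    next
      case gf: False
      show False
      proof (cases "h f = 0")
        case True
        then have hc: "h c = - h b" using hs by simp
        show False
          by (rule no_three_edge_cut_aux[OF T' T(3) _ cut(2,3) bc(2) xf xbc dirs_scale[OF h(1), of "h b"] _ _ _ , unfolded VV dd, OF cut(1) _ _ _ g(1)])
            (use True hc gv hv in auto)
      next
        case False
        have s: "g b = - g f / 2" "g c = - g f / 2" "h b = - h f / 2" "h c = - h f / 2"
          using gf False gv hv gs hs by auto
        have "h b = 0"
          by (rule no_common_direction[OF T(1) dirs_scale[OF g(1), of "h f / g f"] h(1)])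
            (use cut s gf in auto)
        then show False using hv by simp
      qed
    qed
  qed
  have "sum x (\<delta> T) = (\<Sum>f\<in>\<delta> T. 1/2)" by (rule sum.cong) (use allhalf in auto)
  then have card: "card (\<delta> T) = 4" using sum2 by simp
  have gv: "g f = 1 \<or> g f = -1" and hv: "h f = 1 \<or> h f = -1" if "f \<in> \<delta> T" for f
    using g(2) h(2) allhalf that by auto
  have g0: "g f \<noteq> 0" and h0: "h f \<noteq> 0" if "f \<in> \<delta> T" for f using gv[OF that] hv[OF that] by auto
  have uT: "{i, j} = {k, l}" if "i \<in> \<delta> T" "j \<in> \<delta> T" "i \<noteq> j" "tend T i = tend T j" "k \<in> \<delta> T" "l \<in> \<delta> T" "k \<noteq> l" "tend T k = tend T l" for i j k l
    by (rule coincidence_unique[OF T(1,2) card allhalf g(1) g0 h(1) h0 that])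
  have uO: "{i, j} = {k, l}" if "i \<in> \<delta> T" "j \<in> \<delta> T" "i \<noteq> j" "tend (V - T) i = tend (V - T) j"
    "k \<in> \<delta> T" "l \<in> \<delta> T" "k \<noteq> l" "tend (V - T) k = tend (V - T) l" for i j k l
    by (rule coincidence_unique[OF T' T(3), of h g, unfolded VV dd, OF card allhalf h(1) h0 g(1) g0 that])
  have meet: "{i, j} \<inter> {k, l} \<noteq> {}" if "i \<in> \<delta> T" "j \<in> \<delta> T" "i \<noteq> j" "tend T i = tend T j"
    "k \<in> \<delta> T" "l \<in> \<delta> T" "k \<noteq> l" "tend (V - T) k = tend (V - T) l" for i j k l
    by (rule coincidences_meet[OF T(1) card g(1) gv h(1) hv that])
  have "\<exists>m\<in>\<delta> T. inj_on (tend T) (\<delta> T - {m}) \<and> inj_on (tend (V - T)) (\<delta> T - {m})"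
  proof -
    have injT: "inj_on (tend T) (\<delta> T - {m})" if "i \<in> \<delta> T" "j \<in> \<delta> T" "i \<noteq> j" "tend T i = tend T j" "m \<in> {i, j}" for i j m
    proof (rule inj_onI, rule ccontr)
      fix k l assume kl: "k \<in> \<delta> T - {m}" "l \<in> \<delta> T - {m}" "tend T k = tend T l" "k \<noteq> l"
      then have "{i, j} = {k, l}" using that by (intro uT) auto
      then show False using kl that(5) by auto
    qed
    have injO: "inj_on (tend (V - T)) (\<delta> T - {m})" if "i \<in> \<delta> T" "j \<in> \<delta> T" "i \<noteq> j" "tend (V - T) i = tend (V - T) j" "m \<in> {i, j}" for i j m
    proof (rule inj_onI, rule ccontr)
      fix k l assume kl: "k \<in> \<delta> T - {m}" "l \<in> \<delta> T - {m}" "tend (V - T) k = tend (V - T) l" "k \<noteq> l"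
      then have "{i, j} = {k, l}" using that by (intro uO) auto
      then show False using kl that(5) by auto
    qed
    show ?thesis
    proof (cases "inj_on (tend T) (\<delta> T)")
      case True
      show ?thesis
      proof (cases "inj_on (tend (V - T)) (\<delta> T)")
        case O: True
        obtain m where "m \<in> \<delta> T" using cut_nonempty[OF T(1)] by blast
        then show ?thesis using inj_on_subset[OF True, of "\<delta> T - {m}"] inj_on_subset[OF O, of "\<delta> T - {m}"] by blast
      next
        case False
        then obtain k l where "k \<in> \<delta> T" "l \<in> \<delta> T" "k \<noteq> l" "tend (V - T) k = tend (V - T) l" by (auto simp: inj_on_def)
        then show ?thesis using injO[of k l k] inj_on_subset[OF True, of "\<delta> T - {k}"] by blast
      qed
    next
      case False
      then obtain i j where ij: "i \<in> \<delta> T" "j \<in> \<delta> T" "i \<noteq> j" "tend T i = tend T j" by (auto simp: inj_on_def)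
      show ?thesis
      proof (cases "inj_on (tend (V - T)) (\<delta> T)")
        case True
        then show ?thesis using injT[OF ij, of i] inj_on_subset[OF True, of "\<delta> T - {i}"] ij by blast
      next
        case False
        then obtain k l where kl: "k \<in> \<delta> T" "l \<in> \<delta> T" "k \<noteq> l" "tend (V - T) k = tend (V - T) l" by (auto simp: inj_on_def)
        obtain m where m: "m \<in> {i, j}" "m \<in> {k, l}" using meet[OF ij kl] by blast
        then have "m \<in> \<delta> T" using ij by blast
        then show ?thesis using injT[OF ij m(1)] injO[OF kl m(2)] by blast
      qed
    qed
  qed
  then obtain m where m: "m \<in> \<delta> T" "inj_on (tend T) (\<delta> T - {m})" "inj_on (tend (V - T)) (\<delta> T - {m})" by blast
  have "card (\<delta> T - {m}) = 3" using card m by simp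
  then obtain a b c where abc: "\<delta> T - {m} = {a, b, c}" "a \<noteq> b" "b \<noteq> c" "a \<noteq> c" by (auto simp: card_3_iff)
  have in_abc: "a \<in> \<delta> T" "b \<in> \<delta> T" "c \<in> \<delta> T" using abc by auto
  have "distinct [tend T a, tend T b, tend T c]" "distinct [tend (V - T) a, tend (V - T) b, tend (V - T) c]"
    using m(2,3) abc unfolding abc(1) by (auto simp: inj_on_def)
  then have "rooted_triangle G T (tend T a) (tend T b) (tend T c)"
    "rooted_triangle G (V - T) (tend (V - T) a) (tend (V - T) b) (tend (V - T) c)"
    using side_triangle[OF T(1,2) card allhalf in_abc] side_triangle[OF T' T(3), unfolded dd, OF card allhalf in_abc]
    by auto
  then show ?thesis using that in_abc by blast
qed

end

section \<open>Tight sets are nodes and pairs\<close>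

locale small_tight_sets = fractional_minimal +
  assumes small: "\<And>T. tight T \<Longrightarrow> card T \<le> 2 \<or> card (V - T) \<le> 2"
begin

text \<open>In the end \<open>N\<close> is the disjoint union of \<open>U1\<close> and \<open>H\<close>, and \<open>M\<close> is a perfect matching on \<open>N\<close>.\<close>

definition N :: "'a set" where "N = {v \<in> V. tight {v}}"
definition M :: "'b set" where "M = {e \<in> E. x e = 1 \<and> ends G e \<subseteq> N}"
definition U1 :: "'a set" where
  "U1 = {u \<in> N. \<exists>e a. \<delta> {u} = {e, a} \<and> e \<noteq> a \<and> e \<in> M \<and> a \<notin> M \<and> x a = 1 \<and> \<not> ends G a \<subseteq> N}"
definition H :: "'a set" where
  "H = {v \<in> N. \<exists>e p q. \<delta> {v} = {e, p, q} \<and> distinct [e, p, q] \<and> e \<in> M \<and> x p = 1/2 \<and> x q = 1/2}"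

lemma finN [simp]: "finite N" by (simp add: N_def)

lemma card_V_ge_4: "card V \<ge> 4"
proof -
  obtain S where S: "tight S" "card S \<ge> 2" "card (V - S) \<ge> 2" using exists_nontrivial_tight by blast
  note SV = tight_sub[OF S(1)]
  have "card (V - S) = card V - card S" by (rule card_Diff_subset[OF finVsub[OF SV] SV])
  then show ?thesis using S by simp
qed

lemma in_cut_node: "f \<in> \<delta> {v} \<Longrightarrow> v \<in> ends G f"
  by (auto simp: cut_def)

lemma node_cut_iff: "f \<in> E \<Longrightarrow> f \<in> \<delta> {v} \<longleftrightarrow> v \<in> ends G f"
proof -
  assume f: "f \<in> E"
  then obtain a b where ab: "ends G f = {a, b}" "a \<noteq> b" by (rule edgeE)
  then show ?thesis unfolding in_cut[OF f ab(1)] by auto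
qed

lemma pair_psubset: "{u, v} \<subseteq> V \<Longrightarrow> {u, v} \<subset> V"
proof -
  assume a: "{u, v} \<subseteq> V"
  have "card {u, v} \<le> 2" by (simp add: card_insert_if)
  then have "{u, v} \<noteq> V" using card_V_ge_4 by auto
  then show ?thesis using a by blast
qed

lemma M_tight:
  assumes "e \<in> M" "ends G e = {u, v}" "u \<noteq> v"
  shows "tight {u, v}" "card (V - {u, v}) \<ge> 2" "\<And>T. tight T \<Longrightarrow> T \<subset> {u, v} \<Longrightarrow> card T = 1"
proof -
  have e: "e \<in> E" "x e = 1" "{u, v} \<subseteq> N" using assms by (auto simp: M_def)
  have uvV: "{u, v} \<subseteq> V" using e(3) by (auto simp: N_def)
  have "val x {u, v} = 2" using val_pair[OF e(1) assms(2,3), of x] e by (simp add: N_def tight_def)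
  then show "tight {u, v}" using pair_psubset[OF uvV] by (simp add: tight_def)
  have "card (V - {u, v}) = card V - card {u, v}" by (rule card_Diff_subset) (use uvV in auto)
  then show "card (V - {u, v}) \<ge> 2" using card_V_ge_4 assms(3) by simp
  fix T assume T: "tight T" "T \<subset> {u, v}"
  then have "T = {u} \<or> T = {v}" by (auto simp: tight_def)
  then show "card T = 1" by auto
qed

lemma tight_pair_M:
  assumes T: "tight T" "card T = 2"
  obtains u v e where "T = {u, v}" "u \<noteq> v" "e \<in> M" "ends G e = {u, v}"
proof -
  note TV = tight_sub[OF T(1)]
  have "card (V - T) = card V - card T" by (rule card_Diff_subset[OF finVsub[OF TV] TV])
  then have c: "card (V - T) \<ge> 2" using T(2) card_V_ge_4 by simp
  have c2: "card T \<ge> 2" using T by simp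
  have min: "card R = 1" if "tight R" "R \<subset> T" for R
  proof -
    have "card R < 2" using psubset_card_mono[OF finVsub[OF TV] that(2)] T(2) by simp
    moreover have "card R \<noteq> 0" using that(1) finVsub[OF tight_sub[OF that(1)]] by (auto simp: tight_def)
    ultimately show ?thesis by linarith
  qed
  show ?thesis
  proof (rule minimal_tight_pair[OF T(1) c2 c min])
    fix u v e
    assume "T = {u, v}" "u \<noteq> v" "e \<in> E" "ends G e = {u, v}" "x e = 1" "tight {u}" "tight {v}"
    moreover from this have "e \<in> M" using tight_sub[of "{u}"] tight_sub[of "{v}"] by (simp add: M_def N_def)
    ultimately show thesis using that by blast
  qed
qed

text \<open>\<open>y\<close> is the end of the line on which the whole boundary value sits at
  \<open>u\<close>. The cut edges at \<open>u\<close> carry positive integers \<open>2 * x f\<close>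
  of sum 2: either 1 + 1, two edges of value 1/2, or a single 2, an edge of value 1.\<close>

lemma one_of_pair_end:
  assumes e: "e \<in> M" "ends G e = {u, v}" "u \<noteq> v"
    and y: "\<And>f. f \<in> touch (V - {u, v}) \<Longrightarrow> y f \<in> \<int> \<and> 0 \<le> y f"
    and y2: "\<And>f. f \<in> \<delta> {u} \<inter> \<delta> {u, v} \<Longrightarrow> y f = 2 * x f"
    and ge: "\<And>T. T \<noteq> {} \<Longrightarrow> T \<subseteq> V - {u, v} \<Longrightarrow> 2 \<le> val y T"
    and eq: "\<And>T. tight T \<Longrightarrow> T \<subseteq> V - {u, v} \<Longrightarrow> val y T = 2"
    and s: "sum y (\<delta> {u} \<inter> \<delta> {u, v}) = 2" "sum y (\<delta> {v} \<inter> \<delta> {u, v}) = 0"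
  shows "u \<in> U1 \<or> u \<in> H"
proof -
  let ?S = "{u, v}"
  let ?D = "\<delta> {u} \<inter> \<delta> ?S"
  have eE: "e \<in> E" "u \<in> N" "v \<in> N" using e by (auto simp: M_def)
  note Mt = M_tight[OF e]
  have dd: "\<delta> (V - ?S) = \<delta> ?S" by (rule cut_compl)
  have Dt: "?D \<subseteq> touch (V - ?S)" using cut_touch[of "V - ?S" "V - ?S"] dd by auto
  have cutu: "\<delta> {u} = insert e ?D" "e \<notin> ?D"
  proof -
    have eS: "e \<notin> \<delta> ?S" using e unfolding in_cut[OF eE(1) e(2)] by simp
    then show "e \<notin> ?D" by blast
    have "e \<in> \<delta> {u}" using node_cut_iff[OF eE(1)] e by simp
    moreover have "f \<in> \<delta> ?S" if f: "f \<in> \<delta> {u}" "f \<noteq> e" for f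
    proof -
      have fE: "f \<in> E" using f cut_sub by blast
      have "f \<notin> inside ?S" using inside_pair[OF eE(1) e(2)] f by simp
      moreover have "f \<in> touch ?S" using in_cut_node[OF f(1)] fE by (auto simp: touch_def)
      moreover have "?S \<subseteq> V" using Mt(1) tight_sub by blast
      ultimately show ?thesis using touch_split[of ?S] by blast
    qed
    ultimately show "\<delta> {u} = insert e ?D" by blast
  qed
  have y_ge1: "1 \<le> y f" if f: "f \<in> ?D" for f
  proof -
    have "y f \<in> \<int>" using y Dt f by blast
    then obtain k where k: "y f = of_int k" by (rule Ints_cases)
    have "0 < y f" using y2[OF f] pos f cut_sub by fastforce
    then show ?thesis using k by simp
  qed
  have "(\<Sum>f\<in>?D. 1) \<le> sum y ?D" by (rule sum_mono) (rule y_ge1)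
  then have "card ?D \<le> 2" using s by simp
  moreover have "card ?D \<noteq> 0" using s(1) by auto
  ultimately consider "card ?D = 1" | "card ?D = 2" by linarith
  then show ?thesis
  proof cases
    case 2
    then obtain p q where pq: "?D = {p, q}" "p \<noteq> q" by (auto simp: card_2_iff)
    have "y p + y q = 2" using s(1) pq by simp
    moreover have "1 \<le> y p" "1 \<le> y q" using y_ge1 pq by auto
    ultimately have "y p = 1" "y q = 1" by linarith+
    then have "x p = 1/2" "x q = 1/2" using y2[of p] y2[of q] pq by auto
    moreover have "\<delta> {u} = {e, p, q}" "distinct [e, p, q]" using cutu pq by auto
    ultimately have "u \<in> H" using eE e(1) unfolding H_def by blast
    then show ?thesis ..
  next
    case 1
    then obtain a where a: "?D = {a}" by (auto simp: card_1_singleton_iff)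
    have ya: "y a = 2" using s(1) a by simp
    have xa: "x a = 1" using y2[of a] a ya by simp
    have aS: "a \<in> \<delta> ?S" using a by blast
    then have aO: "a \<in> \<delta> (V - ?S)" by (simp add: dd)
    define w where "w = tend (V - ?S) a"
    have w: "w \<in> V - ?S" "w \<in> ends G a" using tend(1,3)[OF aS] by (auto simp: w_def)
    \<comment> \<open>Otherwise \<open>a\<close> exhausts the cut of \<open>w\<close> under
      \<open>y\<close>, so nothing is left between \<open>w\<close> and the rest of the far side.
      Removing \<open>w\<close> from this side, which has value 2, would leave a set of value at
      most 0.\<close>
    have "w \<notin> N"
    proof
      assume wN: "w \<in> N"
      define T' where "T' = V - ?S - {w}"
      have "card (V - ?S - {w}) \<noteq> 0" using Mt(2) w(1) by simp
      then have T'ne: "T' \<noteq> {}" by (auto simp: T'_def)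
      have sp: "V - ?S = {w} \<union> T'" "{w} \<inter> T' = {}" using w by (auto simp: T'_def)
      have vw: "val y {w} = 2" by (rule eq) (use wN w in \<open>auto simp: N_def\<close>)
      have T'2: "2 \<le> val y T'" by (rule ge[OF T'ne]) (auto simp: T'_def)
      have vS: "val y (V - ?S) = 2"
        by (rule eq[OF tight_compl[OF Mt(1)]]) simp
      have "val y {w} = sum y (between {w} T') + sum y (\<delta> (V - ?S) \<inter> touch {w})"
        by (rule boundary_split(1)[OF _ sp]) auto
      moreover have "2 \<le> sum y (\<delta> (V - ?S) \<inter> touch {w})"
      proof -
        have "a \<in> \<delta> (V - ?S) \<inter> touch {w}" using aO w tend(4)[OF aS] by (simp add: touch_def)
        moreover have "0 \<le> y f" if "f \<in> \<delta> (V - ?S) \<inter> touch {w}" for f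
          using y that cut_touch[of "V - ?S" "V - ?S"] by blast
        ultimately have "y a \<le> sum y (\<delta> (V - ?S) \<inter> touch {w})" by (intro member_le_sum) auto
        then show ?thesis using ya by simp
      qed
      ultimately have "sum y (between {w} T') \<le> 0" using vw by linarith
      moreover have "val y {w} + val y T' = val y (V - ?S) + 2 * sum y (between {w} T')"
        using val_disjoint[OF sp(2), of y] sp(1) by simp
      ultimately show False using vw vS T'2 by linarith
    qed
    then have na: "\<not> ends G a \<subseteq> N" using w(2) by blast
    then have "a \<notin> M" by (simp add: M_def)
    moreover have "\<delta> {u} = {e, a}" "e \<noteq> a" using cutu a by auto
    ultimately have "u \<in> U1" using eE e(1) xa na unfolding U1_def by blast
    then show ?thesis ..
  qed
qed

text \<open>\<open>y1\<close> is concentrated at one end of the pair and \<open>y2\<close> at the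
  other; where one of them vanishes, the other is \<open>2 * x\<close>. So
  \<open>one_of_pair_end\<close> applies to both ends.\<close>

lemma M_end_cases:
  assumes e: "e \<in> M" "v \<in> ends G e"
  shows "v \<in> U1 \<or> v \<in> H"
proof -
  have eE: "e \<in> E" using e by (simp add: M_def)
  then obtain a b where ab: "ends G e = {a, b}" "a \<noteq> b" by (rule edgeE)
  note Mt = M_tight[OF e(1) ab]
  have c2: "card {a, b} \<ge> 2" using ab by simp
  show ?thesis
  proof (rule minimal_tight_pair[OF Mt(1) c2 Mt(2) Mt(3)])
    fix u w e' y1 y2
    assume S: "{a, b} = {u, w}" "u \<noteq> w"
      and y: "\<And>f. f \<in> touch (V - {a, b}) \<Longrightarrow> y1 f \<in> \<int> \<and> y2 f \<in> \<int> \<and> 0 \<le> y1 f \<and> 0 \<le> y2 f \<and> y1 f + y2 f = 2 * x f"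
      and ge: "\<And>T. T \<noteq> {} \<Longrightarrow> T \<subseteq> V - {a, b} \<Longrightarrow> 2 \<le> val y1 T \<and> 2 \<le> val y2 T"
      and s: "sum y1 (\<delta> {u} \<inter> \<delta> {a, b}) = 2" "sum y1 (\<delta> {w} \<inter> \<delta> {a, b}) = 0"
        "sum y2 (\<delta> {u} \<inter> \<delta> {a, b}) = 0" "sum y2 (\<delta> {w} \<inter> \<delta> {a, b}) = 2"
    have eq: "val y1 T = 2 \<and> val y2 T = 2" if T: "tight T" "T \<subseteq> V - {a, b}" for T
    proof -
      have "val y1 T + val y2 T = (\<Sum>f\<in>\<delta> T. 2 * x f)"
        unfolding val_def sum.distrib[symmetric] by (rule sum.cong) (use y cut_touch[OF T(2)] in auto)
      also have "\<dots> = 4" using T(1) by (simp add: tight_def val_def sum_distrib_left[symmetric])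
      finally show ?thesis using ge[OF _ T(2)] T(1) by (auto simp: tight_def)
    qed
    have cutt: "\<delta> {a, b} \<subseteq> touch (V - {a, b})"
      using cut_touch[of "V - {a, b}" "V - {a, b}"] cut_compl[of "{a, b}"] by simp
    have y0: "z f = 0" if "sum z (\<delta> {p} \<inter> \<delta> {a, b}) = 0" "\<And>f. f \<in> touch (V - {a, b}) \<Longrightarrow> 0 \<le> z f"
      "f \<in> \<delta> {p} \<inter> \<delta> {a, b}" for z :: "'b \<Rightarrow> real" and p f
    proof -
      have "\<And>f. f \<in> \<delta> {p} \<inter> \<delta> {a, b} \<Longrightarrow> 0 \<le> z f" using that(2) cutt by blast
      then show ?thesis using that(1,3) sum_nonneg_eq_0_iff[of "\<delta> {p} \<inter> \<delta> {a, b}" z] by simp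
    qed
    have eu: "ends G e = {u, w}" "ends G e = {w, u}" using ab S by auto
    have wu: "w \<noteq> u" using S by simp
    have "u \<in> U1 \<or> u \<in> H"
    proof (rule one_of_pair_end[OF e(1) eu(1) S(2), of y1])
      fix f assume f: "f \<in> \<delta> {u} \<inter> \<delta> {u, w}"
      then have "y2 f = 0" using y0[OF s(3)] y S by auto
      moreover have "f \<in> touch (V - {a, b})" using f cutt S by auto
      ultimately show "y1 f = 2 * x f" using y by force
    qed (use y ge eq s S in auto)
    moreover have "w \<in> U1 \<or> w \<in> H"
    proof (rule one_of_pair_end[OF e(1) eu(2) wu, of y2])
      fix f assume f: "f \<in> \<delta> {w} \<inter> \<delta> {w, u}"
      have wu': "{w, u} = {a, b}" using S by auto
      then have "y1 f = 0" using y0[OF s(2), of f] y f by auto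
      moreover have "f \<in> touch (V - {a, b})" using f cutt wu' by auto
      ultimately show "y2 f = 2 * x f" using y by force
    qed (use y ge eq s S in \<open>auto simp: insert_commute\<close>)
    moreover have "v = u \<or> v = w" using e(2) eu by auto
    ultimately show ?thesis by blast
  qed
qed

text \<open>Up to complements the tight sets are nodes of \<open>N\<close> and ends of edges of
  \<open>M\<close>; the constraint of such a pair follows from its two nodes once \<open>d\<close>
  is 0 on the joining edge.\<close>

lemma kernel:
  assumes d: "\<And>e. e \<in> M \<Longrightarrow> d e = 0" "\<And>v. v \<in> N \<Longrightarrow> val d {v} = 0" and e: "e \<in> E"
  shows "d e = 0"
proof (rule zero_direction[OF _ e])
  have key: "val d T = 0" if T: "tight T" "card T \<le> 2" for T
  proof -
    have "card T \<noteq> 0" using T(1) finVsub[OF tight_sub[OF T(1)]] by (auto simp: tight_def)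
    then consider "card T = 1" | "card T = 2" using T(2) by linarith
    then show ?thesis
    proof cases
      case 1
      then obtain v where "T = {v}" by (auto simp: card_1_singleton_iff)
      then show ?thesis using d(2)[of v] T(1) by (auto simp: N_def tight_def)
    next
      case 2
      obtain u v f where f: "T = {u, v}" "u \<noteq> v" "f \<in> M" "ends G f = {u, v}" using tight_pair_M[OF T(1) 2] .
      have fE: "f \<in> E" "u \<in> N" "v \<in> N" using f by (auto simp: M_def)
      show ?thesis using val_pair[OF fE(1) f(4,2), of d] d(1)[OF f(3)] d(2) fE f(1) by simp
    qed
  qed
  fix T assume T: "tight T"
  from small[OF T] show "val d T = 0"
    using key[OF T] key[OF tight_compl[OF T]] val_compl[of d T] by auto
qed

lemma card_free_edges: "card (E - M) \<le> card N"
proof (rule ccontr)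
  assume "\<not> ?thesis"
  then have lt: "card N < card (E - M)" by simp
  obtain d e where d: "\<And>f. f \<notin> E - M \<Longrightarrow> d f = 0" "e \<in> E - M" "d e \<noteq> 0" "\<And>z. z \<in> N \<Longrightarrow> val d {z} = 0"
    using node_kernel[OF finN lt] by blast
  have "d e = 0" by (rule kernel) (use d in auto)
  then show False using d(3) by simp
qed

lemma U1_H_disjoint: "v \<in> U1 \<Longrightarrow> v \<notin> H"
proof
  assume "v \<in> U1" "v \<in> H"
  then obtain e a f p q where "\<delta> {v} = {e, a}" "\<delta> {v} = {f, p, q}" "distinct [f, p, q]"
    unfolding U1_def H_def by blast
  then have "card {e, a} = card {f, p, q}" by simp
  moreover have "card {f, p, q} = 3" using \<open>distinct [f, p, q]\<close> by simp
  moreover have "card {e, a} \<le> 2" by (simp add: card_insert_if)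
  ultimately show False by simp
qed

text \<open>Counting the edges outside \<open>M\<close> by their ends leaves no slack.\<close>

lemma tight_counting:
  shows "\<And>v. v \<in> N \<Longrightarrow> v \<notin> U1 \<Longrightarrow> card (\<delta> {v} - M) = 2"
    and "\<And>e. e \<in> E \<Longrightarrow> \<not> ends G e \<subseteq> N \<Longrightarrow> \<exists>u\<in>U1. e \<in> \<delta> {u} \<and> x e = 1"
proof -
  define deg where "deg = (\<lambda>v. card (\<delta> {v} - M))"
  define A where "A = {e \<in> E. \<not> ends G e \<subseteq> N}"
  define A1 where "A1 = {e \<in> A. \<exists>u\<in>U1. e \<in> \<delta> {u} \<and> x e = 1}"
  have NV: "N \<subseteq> V" by (auto simp: N_def)
  have "\<forall>u\<in>U1. \<exists>a. a \<in> \<delta> {u} \<and> x a = 1 \<and> \<not> ends G a \<subseteq> N"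
    unfolding U1_def by blast
  \<comment> \<open>\<open>\<alpha> u\<close> is the edge by which \<open>u\<close> leaves
    \<open>N\<close>; as its other end is outside \<open>N\<close>, no two nodes of
    \<open>U1\<close> share it.\<close>
  then obtain \<alpha> where \<alpha>: "\<And>u. u \<in> U1 \<Longrightarrow> \<alpha> u \<in> \<delta> {u} \<and> x (\<alpha> u) = 1 \<and> \<not> ends G (\<alpha> u) \<subseteq> N" by metis
  have \<alpha>E: "\<alpha> u \<in> E" if "u \<in> U1" for u using \<alpha>[OF that] cut_sub by blast
  have "inj_on \<alpha> U1"
  proof (rule inj_onI, rule ccontr)
    fix u u' assume u: "u \<in> U1" "u' \<in> U1" "\<alpha> u = \<alpha> u'" "u \<noteq> u'"
    have "u \<in> ends G (\<alpha> u)" "u' \<in> ends G (\<alpha> u)" using \<alpha>[OF u(1)] \<alpha>[OF u(2)] u(3) in_cut_node by auto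
    moreover obtain a b where "ends G (\<alpha> u) = {a, b}" using \<alpha>E[OF u(1)] by (rule edgeE)
    ultimately have "ends G (\<alpha> u) = {u, u'}" using u(4) by auto
    moreover have "u \<in> N" "u' \<in> N" using u by (auto simp: U1_def)
    ultimately show False using \<alpha>[OF u(1)] by simp
  qed
  then have "card U1 = card (\<alpha> ` U1)" by (simp add: card_image)
  also have "\<dots> \<le> card A1" by (rule card_mono) (use \<alpha> \<alpha>E in \<open>auto simp: A1_def A_def\<close>)
  finally have cU: "card U1 \<le> card A1" .
  have A1A: "card A1 \<le> card A" by (rule card_mono) (auto simp: A1_def)
  have degN: "(if v \<in> U1 then 1 else 2) \<le> deg v" if v: "v \<in> N" for v
  proof (cases "\<delta> {v} \<inter> M = {}")
    case True
    then have "\<delta> {v} - M = \<delta> {v}" by blast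
    then show ?thesis using node_degree[of v] v NV by (auto simp: deg_def)
  next
    case False
    then obtain e where e: "e \<in> M" "v \<in> ends G e" using in_cut_node by blast
    from M_end_cases[OF e] show ?thesis
    proof
      assume "v \<in> U1"
      moreover then obtain f a where "\<delta> {v} = {f, a}" "a \<notin> M" unfolding U1_def by blast
      then have "a \<in> \<delta> {v} - M" by blast
      then have "deg v \<noteq> 0" unfolding deg_def by (metis card_0_eq empty_iff finE)
      ultimately show ?thesis by simp
    next
      assume vH: "v \<in> H"
      then obtain f p q where f: "\<delta> {v} = {f, p, q}" "distinct [f, p, q]" "x p = 1/2" "x q = 1/2"
        unfolding H_def by blast
      have "p \<notin> M" "q \<notin> M" using f by (auto simp: M_def)
      then have "{p, q} \<subseteq> \<delta> {v} - M" using f by blast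
      then have "card {p, q} \<le> deg v" unfolding deg_def by (intro card_mono) auto
      then show ?thesis using f U1_H_disjoint vH by auto
    qed
  qed
  have sumdeg: "(\<Sum>v\<in>V. deg v) = 2 * card (E - M)"
  proof -
    define w where "w = (\<lambda>e. if e \<in> M then 0 else (1::real))"
    have vw: "val w {v} = real (deg v)" for v
    proof -
      have "val w {v} = sum (\<lambda>_. 1) (\<delta> {v} - M)"
        unfolding val_def by (rule sum.mono_neutral_cong_right) (auto simp: w_def)
      then show ?thesis by (simp add: deg_def)
    qed
    have "sum w E = sum (\<lambda>_. 1) (E - M)" by (rule sum.mono_neutral_cong_right) (auto simp: w_def)
    moreover have "inside V = E" "\<delta> V = {}" using ends_sub by (auto simp: inside_def cut_def)
    ultimately have "real (\<Sum>v\<in>V. deg v) = 2 * real (card (E - M))"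
      using sum_val_nodes[of V w] vw by (simp add: val_def)
    then show ?thesis by linarith
  qed
  have split: "(\<Sum>v\<in>V. deg v) = (\<Sum>v\<in>N. deg v) + (\<Sum>v\<in>V - N. deg v)"
    using sum.subset_diff[OF NV finV, of deg] by simp
  have outA: "card A \<le> (\<Sum>v\<in>V - N. deg v)"
  proof -
    have "A \<subseteq> (\<Union>v\<in>V - N. \<delta> {v} - M)"
    proof
      fix e assume e: "e \<in> A"
      then obtain v where v: "v \<in> ends G e" "v \<notin> N" "e \<in> E" by (auto simp: A_def)
      then have "e \<in> \<delta> {v}" "v \<in> V" using node_cut_iff ends_sub by auto
      moreover have "e \<notin> M" using e by (auto simp: A_def M_def)
      ultimately show "e \<in> (\<Union>v\<in>V - N. \<delta> {v} - M)" using v by blast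
    qed
    then have "card A \<le> card (\<Union>v\<in>V - N. \<delta> {v} - M)" by (intro card_mono) auto
    also have "\<dots> \<le> (\<Sum>v\<in>V - N. deg v)" unfolding deg_def by (rule card_UN_le) simp
    finally show ?thesis .
  qed
  have U1N: "U1 \<subseteq> N" by (auto simp: U1_def)
  have "(\<Sum>v\<in>N. if v \<in> U1 then 1 else (2::nat)) + card U1 = 2 * card N"
  proof -
    have "(\<Sum>v\<in>N. if v \<in> U1 then 1 else (2::nat)) + card U1
       = (\<Sum>v\<in>N. if v \<in> U1 then 1 else (2::nat)) + (\<Sum>v\<in>N. if v \<in> U1 then 1 else 0)"
      using U1N by (simp add: sum.If_cases Int_absorb1)
    also have "\<dots> = (\<Sum>v\<in>N. 2)" unfolding sum.distrib[symmetric] by (rule sum.cong) auto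
    finally show ?thesis by simp
  qed
  then have base: "(\<Sum>v\<in>N. if v \<in> U1 then 1 else (2::nat)) + card U1 = 2 * card N" .
  have le: "(\<Sum>v\<in>N. if v \<in> U1 then 1 else 2) \<le> (\<Sum>v\<in>N. deg v)" by (rule sum_mono) (rule degN)
  \<comment> \<open>The chain \<open>2 * card N \<le> (2 * card N - card U1) + card A \<le> 2 * card
    (E - M) \<le> 2 * card N\<close> closes up, so each estimate in it is an equality.\<close>
  have eqs: "(\<Sum>v\<in>N. if v \<in> U1 then 1 else 2) = (\<Sum>v\<in>N. deg v)" "card A1 = card A"
    using base le outA A1A cU card_free_edges sumdeg split by linarith+
  have "(\<Sum>v\<in>N. deg v - (if v \<in> U1 then 1 else 2)) = 0"
    using eqs(1) by (subst sum_subtractf_nat) (use degN in auto)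
  then have "deg v - (if v \<in> U1 then 1 else 2) = 0" if "v \<in> N" for v using that by (simp add: sum_eq_0_iff)
  then have "deg v = (if v \<in> U1 then 1 else 2)" if "v \<in> N" for v using degN[OF that] that by force
  then show "\<And>v. v \<in> N \<Longrightarrow> v \<notin> U1 \<Longrightarrow> card (\<delta> {v} - M) = 2" by (simp add: deg_def)
  have "A1 = A" by (rule card_subset_eq) (use eqs in \<open>auto simp: A1_def\<close>)
  then show "\<And>e. e \<in> E \<Longrightarrow> \<not> ends G e \<subseteq> N \<Longrightarrow> \<exists>u\<in>U1. e \<in> \<delta> {u} \<and> x e = 1"
    by (auto simp: A_def A1_def)
qed

lemma other_end: "f \<in> \<delta> {v} \<Longrightarrow> \<exists>z. ends G f = {v, z} \<and> z \<noteq> v \<and> z \<in> V"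
proof -
  assume f: "f \<in> \<delta> {v}"
  then have fE: "f \<in> E" using cut_sub by blast
  obtain a b where ab: "ends G f = {a, b}" "a \<noteq> b" "a \<in> V" "b \<in> V" using fE by (rule edgeE)
  moreover have "v \<in> ends G f" by (rule in_cut_node[OF f])
  ultimately show ?thesis by (cases "v = a") (auto simp: insert_commute)
qed

text \<open>At a node of \<open>N\<close> in neither class all edges stay in \<open>N\<close>, as an
  edge leaving \<open>N\<close> does so from a node of \<open>U1\<close>. The pair bound limits
  their values to 1, and value 1 would put them in \<open>M\<close>, so all are 1/2; but
  \<open>tight_counting\<close> leaves two of them, of total value 1.\<close>

lemma N_cases: assumes v: "v \<in> N" shows "v \<in> U1 \<or> v \<in> H"
proof (rule ccontr)
  assume n: "\<not> ?thesis"
  have noM: "\<delta> {v} \<inter> M = {}"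
  proof (rule ccontr)
    assume "\<delta> {v} \<inter> M \<noteq> {}"
    then obtain e where "e \<in> M" "v \<in> ends G e" using in_cut_node by blast
    then show False using M_end_cases n by blast
  qed
  have vt: "tight {v}" using v by (simp add: N_def)
  have half: "x f = 1/2" if f: "f \<in> \<delta> {v}" for f
  proof -
    have fE: "f \<in> E" using f cut_sub by blast
    obtain z where z: "ends G f = {v, z}" "z \<noteq> v" "z \<in> V" using other_end[OF f] by blast
    have "ends G f \<subseteq> N"
    proof (rule ccontr)
      assume "\<not> ends G f \<subseteq> N"
      then obtain u where u: "u \<in> U1" "f \<in> \<delta> {u}" using tight_counting(2)[OF fE] by blast
      then have "u \<in> ends G f" "u \<in> N" using in_cut_node by (auto simp: U1_def)
      then have "z \<in> N \<or> u = v" using z by auto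
      then show False using u n \<open>\<not> ends G f \<subseteq> N\<close> z v by auto
    qed
    then have zN: "z \<in> N" and "x f \<noteq> 1" using z noM f fE by (auto simp: M_def)
    have "{v, z} \<subset> V" by (rule pair_psubset) (use v z in \<open>auto simp: N_def\<close>)
    then have "2 \<le> val x {v, z}" by (intro val_ge) auto
    moreover have "val x {v, z} = 4 - 2 * x f"
      using val_pair[OF fE z(1) z(2)[symmetric], of x] v zN by (simp add: N_def tight_def)
    ultimately have "x f \<le> 1" by simp
    then show ?thesis using half_integral[OF fE] \<open>x f \<noteq> 1\<close> by auto
  qed
  have "\<delta> {v} - M = \<delta> {v}" using noM by blast
  then have "card (\<delta> {v}) = 2" using tight_counting(1)[OF v] n by simp
  moreover have "val x {v} = (\<Sum>f\<in>\<delta> {v}. 1/2)" unfolding val_def by (rule sum.cong) (use half in auto)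
  ultimately show False using vt by (simp add: tight_def)
qed

lemma H_edges:
  assumes "v \<in> H"
  obtains e p q where "\<delta> {v} = {e, p, q}" "distinct [e, p, q]" "e \<in> M" "x e = 1" "x p = 1/2" "x q = 1/2" "p \<notin> M" "q \<notin> M"
proof -
  obtain e p q where h: "\<delta> {v} = {e, p, q}" "distinct [e, p, q]" "e \<in> M" "x p = 1/2" "x q = 1/2"
    using assms unfolding H_def by blast
  moreover from h have "x e = 1" "p \<notin> M" "q \<notin> M" by (auto simp: M_def)
  ultimately show ?thesis using that by blast
qed

lemma M_unique: assumes "f \<in> M" "g \<in> M" "v \<in> ends G f" "v \<in> ends G g" shows "f = g"
proof -
  have fg: "f \<in> \<delta> {v}" "g \<in> \<delta> {v}" using assms node_cut_iff by (auto simp: M_def)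
  have "v \<in> N" using assms by (auto simp: M_def)
  from N_cases[OF this] show ?thesis
  proof
    assume "v \<in> U1"
    then obtain e a where "\<delta> {v} = {e, a}" "a \<notin> M" unfolding U1_def by blast
    then show ?thesis using fg assms by auto
  next
    assume "v \<in> H"
    then obtain e p q where "\<delta> {v} = {e, p, q}" "p \<notin> M" "q \<notin> M" using H_edges by metis
    then show ?thesis using fg assms by auto
  qed
qed

text \<open>An edge leaving \<open>N\<close> has value 1 by \<open>tight_counting\<close>, and a
  node of \<open>U1\<close> has only edges of value 1, so an edge of value 1/2 can lead only to
  \<open>H\<close>.\<close>

lemma half_closed: assumes p: "p \<in> \<delta> {v}" "x p = 1/2" and v: "v \<in> H" shows "ends G p \<subseteq> H"
proof -
  have pE: "p \<in> E" using p cut_sub by blast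
  have "ends G p \<subseteq> N"
  proof (rule ccontr)
    assume "\<not> ?thesis"
    then have "x p = 1" using tight_counting(2)[OF pE] by blast
    then show False using p(2) by simp
  qed
  moreover have "z \<notin> U1" if z: "z \<in> ends G p" for z
  proof
    assume "z \<in> U1"
    then obtain e a where ea: "\<delta> {z} = {e, a}" "e \<in> M" "x a = 1" unfolding U1_def by blast
    moreover have "p \<in> \<delta> {z}" using node_cut_iff[OF pE] z by simp
    moreover have "x e = 1" using ea by (simp add: M_def)
    ultimately show False using p(2) by auto
  qed
  ultimately show ?thesis using N_cases by blast
qed

text \<open>If both ends of a tight pair were in \<open>U1\<close>, its cut would have at most two
  edges, against \<open>nontrivial_cut_card\<close>.\<close>

lemma H_nonempty: "H \<noteq> {}"
proof -
  obtain S where S: "tight S" "card S \<ge> 2" "card (V - S) \<ge> 2" using exists_nontrivial_tight by blast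
  obtain T where T: "tight T" "card T = 2"
  proof -
    have "card S = 2 \<or> card (V - S) = 2" using small[OF S(1)] S by auto
    then show ?thesis using that S(1) tight_compl[OF S(1)] by blast
  qed
  obtain u v e where e: "T = {u, v}" "u \<noteq> v" "e \<in> M" "ends G e = {u, v}" using tight_pair_M[OF T] .
  have eE: "e \<in> E" using e by (simp add: M_def)
  have c: "card (\<delta> {u, v}) \<ge> 3"
    by (rule nontrivial_cut_card) (use M_tight[OF e(3,4,2)] e in auto)
  have "u \<in> H \<or> v \<in> H"
  proof (rule ccontr)
    assume "\<not> ?thesis"
    then have "u \<in> U1" "v \<in> U1" using M_end_cases[OF e(3)] e(4) by auto
    then obtain f a g b where f: "\<delta> {u} = {f, a}" "a \<notin> M" "\<delta> {v} = {g, b}" "b \<notin> M" "f \<in> M" "g \<in> M" unfolding U1_def by blast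
    have "e \<in> \<delta> {u}" "e \<in> \<delta> {v}" using node_cut_iff[OF eE] e by auto
    then have ef: "f = e" "g = e" using f e(3) by auto
    have "\<delta> {u, v} \<subseteq> {a, b}"
    proof
      fix h assume h: "h \<in> \<delta> {u, v}"
      then have "h \<in> E" using cut_sub by blast
      moreover have "h \<noteq> e" using h in_cut[OF eE e(4), of "{u, v}"] by auto
      moreover have "h \<in> \<delta> {u} \<or> h \<in> \<delta> {v}" using h node_cut_iff[OF \<open>h \<in> E\<close>] by (auto simp: cut_def)
      ultimately show "h \<in> {a, b}" using f ef by auto
    qed
    then have "card (\<delta> {u, v}) \<le> card {a, b}" by (intro card_mono) auto
    also have "\<dots> \<le> 2" by (simp add: card_insert_if)
    finally show False using c by simp
  qed
  then show ?thesis by blast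
qed

section \<open>Components of half edges\<close>

definition half_adjacent :: "'a set \<Rightarrow> 'a set \<Rightarrow> bool" where
  "half_adjacent A B \<longleftrightarrow> (\<exists>e\<in>E. x e = 1/2 \<and> (\<exists>a\<in>A. \<exists>b\<in>B. ends G e = {a, b}))"

definition half_conn :: "'a set \<Rightarrow> bool" where
  "half_conn U \<longleftrightarrow> U \<noteq> {} \<and> (\<forall>A. A \<noteq> {} \<longrightarrow> A \<subset> U \<longrightarrow> half_adjacent A (U - A))"

definition half_closed_set :: "'a set \<Rightarrow> bool" where
  "half_closed_set C \<longleftrightarrow> (\<forall>p\<in>E. x p = 1/2 \<longrightarrow> ends G p \<inter> C \<noteq> {} \<longrightarrow> ends G p \<subseteq> C)"

lemma half_conn_conn: "half_conn U \<Longrightarrow> conn G U"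
  unfolding half_conn_def conn_def half_adjacent_def by metis

text \<open>A closed nonempty subset of \<open>H\<close> of least size: a part of it without half
  edges to the remainder would be a smaller closed set.\<close>

lemma half_component_exists:
  "\<exists>C. C \<subseteq> H \<and> C \<noteq> {} \<and> half_closed_set C \<and> half_conn C"
proof -
  have HV: "H \<subseteq> V" by (auto simp: H_def N_def)
  have "half_closed_set H" unfolding half_closed_set_def
  proof (intro ballI impI)
    fix p assume p: "p \<in> E" "x p = 1/2" "ends G p \<inter> H \<noteq> {}"
    then obtain v where v: "v \<in> H" "v \<in> ends G p" by blast
    then have "p \<in> \<delta> {v}" using node_cut_iff[OF p(1)] by simp
    then show "ends G p \<subseteq> H" using half_closed p(2) v(1) by blast
  qed
  then obtain C where C: "C \<subseteq> H" "C \<noteq> {}" "half_closed_set C"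
    and min: "\<And>D. D \<subseteq> H \<Longrightarrow> D \<noteq> {} \<Longrightarrow> half_closed_set D \<Longrightarrow> card C \<le> card D"
    using ex_has_least_nat[of "\<lambda>C. C \<subseteq> H \<and> C \<noteq> {} \<and> half_closed_set C" H card] H_nonempty by blast
  have fC: "finite C" using C(1) HV finVsub by blast
  have "half_conn C" unfolding half_conn_def
  proof (intro conjI allI impI)
    fix A assume A: "A \<noteq> {}" "A \<subset> C"
    show "half_adjacent A (C - A)"
    proof (rule ccontr)
      assume n: "\<not> half_adjacent A (C - A)"
      have "half_closed_set A" unfolding half_closed_set_def
      proof (intro ballI impI)
        fix p assume p: "p \<in> E" "x p = 1/2" "ends G p \<inter> A \<noteq> {}"
        then have pC: "ends G p \<subseteq> C" using C(3) A(2) unfolding half_closed_set_def by blast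
        obtain a where a: "a \<in> ends G p" "a \<in> A" using p(3) by blast
        have "p \<in> \<delta> {a}" using node_cut_iff[OF p(1)] a(1) by simp
        then obtain b where b: "ends G p = {a, b}" using other_end by blast
        have "b \<in> A"
        proof (rule ccontr)
          assume "b \<notin> A"
          then have "b \<in> C - A" using pC b by simp
          then have "half_adjacent A (C - A)" unfolding half_adjacent_def using p(1,2) a(2) b by blast
          then show False using n by simp
        qed
        then show "ends G p \<subseteq> A" using a b by simp
      qed
      then have "card C \<le> card A" using min[of A] A C(1) by blast
      then show False using psubset_card_mono[OF fC A(2)] by simp
    qed
  qed (rule C(2))
  then show ?thesis using C by blast
qed

end

locale half_component = small_tight_sets +
  fixes C
  assumes CH: "C \<subseteq> H" and Cne: "C \<noteq> {}" and Cclosed: "half_closed_set C" and Cconn: "half_conn C"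
begin

definition h :: "'b \<Rightarrow> real" where "h e = (if x e = 1/2 then 1 else 0)"

lemma CV: "C \<subseteq> V" using CH by (auto simp: H_def N_def)

lemma finC [simp]: "finite C" using CV by (rule finVsub)

lemma val_h_node: assumes "v \<in> H" shows "val h {v} = 2"
proof -
  obtain e p q where h: "\<delta> {v} = {e, p, q}" "distinct [e, p, q]" "e \<in> M" "x e = 1" "x p = 1/2" "x q = 1/2"
    using assms H_edges by metis
  then show ?thesis by (simp add: val_def h_def)
qed

lemma val_h_card: "val h X = real (card {e \<in> \<delta> X. x e = 1/2})"
proof -
  have "val h X = sum (\<lambda>_. 1) {e \<in> \<delta> X. x e = 1/2}"
    unfolding val_def by (rule sum.mono_neutral_cong_right) (auto simp: h_def)
  then show ?thesis by simp
qed

lemma half_not_cut: assumes "p \<in> \<delta> C" shows "x p \<noteq> 1/2"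
proof
  assume "x p = 1/2"
  then have "ends G p \<subseteq> C" using Cclosed assms cut_sub[of C] unfolding half_closed_set_def by (auto simp: cut_def)
  then show False using assms by (auto simp: cut_def)
qed

lemma half_adjacent_val: assumes "half_adjacent A B" "A \<inter> B = {}" shows "1 \<le> val h A"
proof -
  obtain e a b where e: "e \<in> E" "x e = 1/2" "a \<in> A" "b \<in> B" "ends G e = {a, b}"
    using assms unfolding half_adjacent_def by blast
  have "e \<in> \<delta> A" unfolding in_cut[OF e(1,5)] using e assms(2) by auto
  then have "e \<in> {e \<in> \<delta> A. x e = 1/2}" using e(2) by simp
  then have "card {e \<in> \<delta> A. x e = 1/2} \<noteq> 0" by (metis card_0_eq empty_iff finE)
  then show ?thesis unfolding val_h_card by linarith
qed

lemma card_C: "card C \<ge> 3"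
proof -
  obtain v where v: "v \<in> C" using Cne by blast
  obtain e p q where h: "\<delta> {v} = {e, p, q}" "distinct [e, p, q]" "x p = 1/2" "x q = 1/2"
    using CH v H_edges by (metis subsetD)
  obtain a where a: "ends G p = {v, a}" "a \<noteq> v" using other_end[of p v] h by auto
  obtain b where b: "ends G q = {v, b}" "b \<noteq> v" using other_end[of q v] h by auto
  have E: "p \<in> E" "q \<in> E" using h(1) cut_sub[of "{v}"] by auto
  have "a \<noteq> b" using simple[OF E] a b h(2) by auto
  moreover have "a \<in> C" "b \<in> C" using Cclosed E h a b v unfolding half_closed_set_def by auto
  ultimately have "{v, a, b} \<subseteq> C" "card {v, a, b} = 3" using v a b by auto
  then show ?thesis by (metis card_mono finC)
qed

text \<open>The edges of value 1/2 form a connected 2-regular graph on \<open>C\<close>, that is, a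
  cycle. If removing \<open>c\<close> separated it into \<open>A\<close> and \<open>B\<close>, each
  would receive one of the two half edges at \<open>c\<close>, whereas an even number of half edges
  leaves \<open>A\<close> because all its nodes have half-degree 2.\<close>

lemma half_conn_minus: assumes c: "c \<in> C" shows "half_conn (C - {c})"
  unfolding half_conn_def
proof (intro conjI allI impI)
  have "card (C - {c}) \<noteq> 0" using card_C c by simp
  then show "C - {c} \<noteq> {}" by (metis card.empty)
  fix A assume A: "A \<noteq> {}" "A \<subset> C - {c}"
  define B where "B = C - {c} - A"
  have B: "B \<noteq> {}" "A \<inter> B = {}" "A \<union> B = C - {c}" "c \<notin> A" "c \<notin> B" using A by (auto simp: B_def)
  have AC: "A \<subset> C" "B \<subset> C" using A B c by auto
  show "half_adjacent A (C - {c} - A)"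
  proof (rule ccontr)
    assume n: "\<not> half_adjacent A (C - {c} - A)"
    have hAB: "sum h (between A B) = 0"
    proof (rule sum.neutral, rule ballI)
      fix e assume e: "e \<in> between A B"
      show "h e = 0"
      proof (rule ccontr)
        assume "h e \<noteq> 0"
        then have xe: "x e = 1/2" by (auto simp: h_def split: if_splits)
        have eE: "e \<in> E" using e by (simp add: between_def)
        obtain a b where ab: "a \<in> A" "b \<in> B" "a \<in> ends G e" "b \<in> ends G e" using e by (auto simp: between_def)
        obtain p q where "ends G e = {p, q}" using eE by (rule edgeE)
        then have "ends G e = {a, b}" using ab B(2) by auto
        then show False using n ab eE xe unfolding half_adjacent_def B_def by blast
      qed
    qed
    have hC0: "sum h (\<delta> C \<inter> X) = 0" for X by (rule sum.neutral) (use half_not_cut in \<open>auto simp: h_def\<close>)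
    have vC: "val h C = 0" using hC0[of "\<delta> C"] by (simp add: val_def)
    have cU: "C = {c} \<union> (A \<union> B)" "{c} \<inter> (A \<union> B) = {}" using B c by auto
    have "val h {c} = sum h (between {c} (A \<union> B)) + sum h (\<delta> C \<inter> touch {c})"
      by (rule boundary_split(1)[OF CV cU])
    moreover have "val h {c} + val h (A \<union> B) = val h C + 2 * sum h (between {c} (A \<union> B))"
      using val_disjoint[OF cU(2), of h] cU(1) by simp
    ultimately have "val h (A \<union> B) = 2" using vC hC0 val_h_node c CH by auto
    then have s: "val h A + val h B = 2" using val_disjoint[OF B(2), of h] hAB by simp
    have "1 \<le> val h A" by (rule half_adjacent_val[of A "C - A"]) (use Cconn A AC in \<open>auto simp: half_conn_def\<close>)
    moreover have "1 \<le> val h B" by (rule half_adjacent_val[of B "C - B"]) (use Cconn B AC in \<open>auto simp: half_conn_def\<close>)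
    ultimately have "val h A = 1" using s by linarith
    moreover have "2 * real (card A) = 2 * sum h (inside A) + val h A"
    proof -
      have "(\<Sum>z\<in>A. val h {z}) = (\<Sum>z\<in>A. 2)" by (rule sum.cong) (use val_h_node AC CH in auto)
      then show ?thesis using sum_val_nodes[of A h] AC CV by simp
    qed
    moreover have "sum h (inside A) = real (card {e \<in> inside A. x e = 1/2})"
    proof -
      have "sum h (inside A) = sum (\<lambda>_. 1) {e \<in> inside A. x e = 1/2}"
        by (rule sum.mono_neutral_cong_right) (auto simp: h_def)
      then show ?thesis by simp
    qed
    ultimately have "real (2 * card A) = real (2 * card {e \<in> inside A. x e = 1/2} + 1)" by simp
    then have "2 * card A = 2 * card {e \<in> inside A. x e = 1/2} + 1" by linarith
    then show False by presburger
  qed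
qed

text \<open>If the half edges formed a single cycle through all nodes, its length would be even because
  of the perfect matching \<open>M\<close>, and odd because alternating signs are no direction.\<close>

lemma C_ne_V: "C \<noteq> V"
proof
  assume CVeq: "C = V"
  then have VH: "v \<in> H" if "v \<in> V" for v using CH that by blast
  define F where "F = {e \<in> E. x e = 1/2}"
  have io: "inside V = E" "\<delta> V = {}" using ends_sub by (auto simp: inside_def cut_def)
  have cF: "card F = card V"
  proof -
    have "sum h E = sum (\<lambda>_. 1) F" by (rule sum.mono_neutral_cong_right) (auto simp: h_def F_def)
    moreover have "(\<Sum>v\<in>V. val h {v}) = (\<Sum>v\<in>V. 2)" by (rule sum.cong) (use val_h_node VH in auto)
    ultimately show ?thesis using sum_val_nodes[of V h] io by (simp add: val_def)
  qed
  have even: "card V = 2 * card M"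
  proof -
    define m where "m = (\<lambda>e. if e \<in> M then 1 else (0::real))"
    have "val m {v} = 1" if v: "v \<in> V" for v
    proof -
      obtain e p q where "\<delta> {v} = {e, p, q}" "distinct [e, p, q]" "e \<in> M" "p \<notin> M" "q \<notin> M"
        using H_edges[OF VH[OF v]] by metis
      then show ?thesis by (simp add: val_def m_def)
    qed
    then have "(\<Sum>v\<in>V. val m {v}) = real (card V)" by simp
    moreover have "sum m E = sum (\<lambda>_. 1) M" by (rule sum.mono_neutral_cong_right) (auto simp: m_def M_def)
    ultimately have "real (card V) = 2 * real (card M)" using sum_val_nodes[of V m] io by (simp add: val_def)
    then show ?thesis by linarith
  qed
  obtain u where u: "u \<in> V" using Cne CVeq by blast
  have "card (V - {u}) < card F" using cF u cardV by simp
  \<comment> \<open>Dropping the constraint of one node \<open>u\<close> leaves fewer equations than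
    half edges, so a nonzero solution exists; only its balance at \<open>u\<close> is open.\<close>
  then obtain d e0 where d: "\<And>f. f \<notin> F \<Longrightarrow> d f = 0" "e0 \<in> F" "d e0 \<noteq> 0" "\<And>z. z \<in> V - {u} \<Longrightarrow> val d {z} = 0"
    using node_kernel[of "V - {u}" F] by auto
  have dM: "d f = 0" if "f \<in> M" for f using d(1)[of f] that by (auto simp: F_def M_def)
  obtain eu p q where pq: "\<delta> {u} = {eu, p, q}" "distinct [eu, p, q]" "eu \<in> M" "x p = 1/2" "x q = 1/2"
    using H_edges[OF VH[OF u]] by metis
  have vu: "val d {u} = d p + d q" using pq dM by (simp add: val_def)
  define k where "k = \<bar>d p\<bar>"
  define B where "B = {v \<in> V - {u}. \<forall>f\<in>\<delta> {v}. x f = 1/2 \<longrightarrow> \<bar>d f\<bar> = k}"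
  \<comment> \<open>Balance at a node other than \<open>u\<close> passes the absolute value
    \<open>k\<close> from one of its half edges to the other.\<close>
  have BI: "v \<in> B" if v: "v \<in> V" "v \<noteq> u" and f: "f \<in> \<delta> {v}" "x f = 1/2" "\<bar>d f\<bar> = k" for v f
  proof -
    obtain e p' q' where h: "\<delta> {v} = {e, p', q'}" "distinct [e, p', q']" "e \<in> M" "x e = 1" "x p' = 1/2" "x q' = 1/2"
      using H_edges[OF VH[OF v(1)]] by metis
    have "d p' + d q' = 0" using d(4)[of v] v h dM by (simp add: val_def)
    then have "\<bar>d p'\<bar> = \<bar>d q'\<bar>" by linarith
    then show ?thesis using v f h by (auto simp: B_def)
  qed
  have pE: "p \<in> E" using pq(1) cut_sub[of "{u}"] by auto
  obtain z where z: "ends G p = {u, z}" "z \<noteq> u" "z \<in> V" using other_end[of p u] pq by auto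
  have "z \<in> B" by (rule BI[OF z(3,2), of p]) (use node_cut_iff[OF pE] z pq in \<open>auto simp: k_def\<close>)
  have Ball: "B = V - {u}"
  proof (rule ccontr)
    assume "B \<noteq> V - {u}"
    then have "B \<subset> V - {u}" by (auto simp: B_def)
    then have "half_adjacent B (V - {u} - B)" using half_conn_minus[of u] u \<open>z \<in> B\<close> unfolding CVeq half_conn_def by blast
    then obtain f a b where f: "f \<in> E" "x f = 1/2" "a \<in> B" "b \<in> V - {u} - B" "ends G f = {a, b}"
      unfolding half_adjacent_def by blast
    have "f \<in> \<delta> {a}" "f \<in> \<delta> {b}" using node_cut_iff[OF f(1)] f(5) by auto
    then have "b \<in> B" using f by (intro BI[of b f]) (auto simp: B_def)
    then show False using f by blast
  qed
  have all: "\<bar>d f\<bar> = k" if f: "f \<in> F" for f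
  proof -
    have fE: "f \<in> E" "x f = 1/2" using f by (auto simp: F_def)
    obtain a b where ab: "ends G f = {a, b}" "a \<noteq> b" "a \<in> V" "b \<in> V" using fE(1) by (rule edgeE)
    then have "a \<in> B \<or> b \<in> B" unfolding Ball by blast
    then show ?thesis using node_cut_iff[OF fE(1)] ab fE(2) by (auto simp: B_def)
  qed
  have k0: "k > 0" using all[OF d(2)] d(3) by auto
  have "val d {u} \<noteq> 0"
  proof
    assume v0: "val d {u} = 0"
    have "d e0 = 0"
    proof (rule kernel)
      fix v assume "v \<in> N"
      then show "val d {v} = 0" using d(4)[of v] v0 by (cases "v = u") (auto simp: N_def)
    qed (use dM d(2) in \<open>auto simp: F_def\<close>)
    then show False using d(3) by simp
  qed
  moreover have "\<bar>d q\<bar> = k" by (rule all) (use pq cut_sub[of "{u}"] in \<open>auto simp: F_def\<close>)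
  \<comment> \<open>The two half edges at \<open>u\<close> have equal sign, since a function
    balanced at \<open>u\<close> as well would vanish by \<open>kernel\<close>.\<close>
  ultimately have v2: "val d {u} = 2 * k \<or> val d {u} = - (2 * k)" unfolding vu k_def by linarith
  define P where "P = {f \<in> F. d f = k}"
  define Q where "Q = {f \<in> F. d f = - k}"
  have "d f = k \<or> d f = - k" if "f \<in> F" for f using all[OF that] by linarith
  then have PQ: "F = P \<union> Q" "P \<inter> Q = {}" using k0 by (auto simp: P_def Q_def)
  have cPQ: "card F = card P + card Q" unfolding PQ(1) by (rule card_Un_disjoint) (use PQ in auto)
  \<comment> \<open>The node balances count each edge twice, so \<open>card P - card Q\<close> is 1
    or -1 and \<open>card F\<close> is odd.\<close>
  have "(\<Sum>v\<in>V. val d {v}) = val d {u}"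
    using u d(4) by (simp add: sum.remove[of V u])
  then have "val d {u} = 2 * sum d E" using sum_val_nodes[of V d] io by (simp add: val_def)
  also have "sum d E = sum d F" by (rule sum.mono_neutral_right) (use d(1) in \<open>auto simp: F_def\<close>)
  also have "\<dots> = sum d P + sum d Q" unfolding PQ(1) by (rule sum.union_disjoint) (use PQ in auto)
  also have "sum d P = real (card P) * k" by (simp add: P_def)
  also have "sum d Q = - real (card Q) * k" by (simp add: Q_def)
  finally have "val d {u} = 2 * k * (real (card P) - real (card Q))" by (simp add: algebra_simps)
  then have "2 * k * (real (card P) - real (card Q)) = 2 * k * 1 \<or>
      2 * k * (real (card P) - real (card Q)) = 2 * k * (-1)" using v2 by linarith
  then have "real (card P) - real (card Q) = 1 \<or> real (card P) - real (card Q) = -1"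
    unfolding mult_cancel_left using k0 by linarith
  then have "card P = card Q + 1 \<or> card Q = card P + 1" by linarith
  then have "odd (card F)" using cPQ by auto
  then show False using cF even by simp
qed

lemma cut_C_M: assumes f: "f \<in> \<delta> C" shows "f \<in> M"
proof -
  have t: "tend C f \<in> C" "ends G f = {tend C f, tend (V - C) f}" "f \<in> E" using tend[OF f] by auto
  then have "f \<in> \<delta> {tend C f}" using node_cut_iff[OF t(3)] by simp
  moreover obtain e p q where "\<delta> {tend C f} = {e, p, q}" "e \<in> M" "x p = 1/2" "x q = 1/2"
    using H_edges CH t(1) by (metis subsetD)
  ultimately show ?thesis using half_not_cut[OF f] by auto
qed

lemma cut_C_one: "f \<in> \<delta> C \<Longrightarrow> x f = 1"
  using cut_C_M by (auto simp: M_def)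

lemma cut_C_inj: "inj_on (tend C) (\<delta> C)" "inj_on (tend (V - C)) (\<delta> C)"
proof -
  have "f = g" if "f \<in> \<delta> C" "g \<in> \<delta> C" "v \<in> ends G f" "v \<in> ends G g" for f g v
    using M_unique cut_C_M that by blast
  then show "inj_on (tend C) (\<delta> C)" "inj_on (tend (V - C)) (\<delta> C)"
    using tend(1)[of _ C] by (intro inj_onI; metis insertCI)+
qed

section \<open>Regions outside the cycle\<close>

definition terminals :: "'a set \<Rightarrow> 'a set" where
  "terminals R = R \<inter> tend (V - C) ` \<delta> C"

lemma card_terminals: "card (terminals R) = card (\<delta> C \<inter> touch R)" if R: "R \<subseteq> V - C"
proof -
  have "terminals R = tend (V - C) ` (\<delta> C \<inter> touch R)"
  proof -
    have "f \<in> touch R \<longleftrightarrow> tend (V - C) f \<in> R" if "f \<in> \<delta> C" for f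
      using tend_touch[of f "V - C" R] that R by (simp add: cut_compl)
    then show ?thesis by (auto simp: terminals_def)
  qed
  moreover have "inj_on (tend (V - C)) (\<delta> C \<inter> touch R)" by (rule inj_on_subset[OF cut_C_inj(2)]) blast
  ultimately show ?thesis by (simp add: card_image)
qed

text \<open>The bound 1/2 admits at most one edge, of value 1/2, that leaves \<open>R\<close>
  outside the cut of \<open>C\<close>. This slack is what cutting down a region at a terminal
  requires: the new region keeps one half edge to the discarded part.\<close>

definition good :: "'a set \<Rightarrow> bool" where
  "good R \<longleftrightarrow> R \<subseteq> V - C \<and> conn G R \<and> card (terminals R) \<ge> 3 \<and> sum x (\<delta> R - \<delta> C) \<le> 1/2"

lemma sum_cut_C: "X \<subseteq> \<delta> C \<Longrightarrow> sum x X = real (card X)"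
proof -
  assume "X \<subseteq> \<delta> C"
  then have "sum x X = (\<Sum>f\<in>X. 1)" by (intro sum.cong) (use cut_C_one in auto)
  then show ?thesis by simp
qed

text \<open>A component of \<open>V - C\<close> has cut edges only to \<open>C\<close>, each of
  value 1. The cut constraint asks for at least two, and exactly two would make the component tight,
  against \<open>nontrivial_cut_card\<close>.\<close>

lemma good_exists: "\<exists>R. good R"
proof -
  obtain z0 where z0: "z0 \<in> V - C" using C_ne_V CV by blast
  obtain R where R: "R \<subseteq> V - C" "z0 \<in> R" "conn G R" "\<not> adjacent G R (V - C - R)"
    using component_exists[of "V - C" z0 G] z0 by auto
  have sub: "\<delta> R \<subseteq> \<delta> C \<inter> touch R"
  proof
    fix f assume f: "f \<in> \<delta> R"
    then have fE: "f \<in> E" using cut_sub by blast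
    have t: "ends G f = {tend R f, tend (V - R) f}" "tend R f \<in> R" "tend (V - R) f \<in> V - R" using tend[OF f] by auto
    have "tend (V - R) f \<in> C"
    proof (rule ccontr)
      assume "tend (V - R) f \<notin> C"
      then have "adjacent G R (V - C - R)" unfolding adjacent_def using t fE by blast
      then show False using R(4) by simp
    qed
    then have "f \<in> \<delta> C" using t R(1) unfolding in_cut[OF fE t(1)] by blast
    then show "f \<in> \<delta> C \<inter> touch R" using t fE by (simp add: touch_def)
  qed
  moreover have "\<delta> C \<inter> touch R \<subseteq> \<delta> R"
  proof
    fix f assume f: "f \<in> \<delta> C \<inter> touch R"
    then have "f \<in> \<delta> (V - C)" by (simp add: cut_compl)
    from tend_cut[OF this R(1)] tend_touch[OF this R(1)] show "f \<in> \<delta> R" using f by simp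
  qed
  ultimately have eq: "\<delta> R = \<delta> C \<inter> touch R" by blast
  have vR: "val x R = real (card (\<delta> R))" unfolding val_def by (rule sum_cut_C) (use sub in blast)
  have Rp: "R \<noteq> {}" "R \<subset> V" using R Cne CV by auto
  have ge: "2 \<le> card (\<delta> R)" using val_ge[OF Rp] vR by simp
  have "card (\<delta> R) \<noteq> 2"
  proof
    assume c2: "card (\<delta> R) = 2"
    have "card (terminals R) = 2" using card_terminals[OF R(1)] eq c2 by simp
    moreover have fR: "finite R" using Rp finVsub by blast
    moreover have "terminals R \<subseteq> R" by (auto simp: terminals_def)
    ultimately have "card R \<ge> 2" by (metis card_mono)
    moreover have "C \<subseteq> V - R" using R(1) CV by blast
    then have "card (V - R) \<ge> 2" using card_mono[of "V - R" C] card_C by simp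
    moreover have "tight R" using Rp vR c2 by (simp add: tight_def)
    ultimately show False using nontrivial_cut_card[of R] c2 by simp
  qed
  then have "card (terminals R) \<ge> 3" using ge card_terminals[OF R(1)] eq by simp
  moreover have "sum x (\<delta> R - \<delta> C) = 0"
  proof -
    have "\<delta> R - \<delta> C = {}" using sub by blast
    then show ?thesis by (simp only: sum.empty)
  qed
  ultimately have "good R" unfolding good_def using R(1,3) by simp
  then show ?thesis ..
qed

text \<open>A smallest good region stays connected after the deletion of any terminal, so
  \<open>triangle_or_claw\<close> applies to three of its terminals. Inside \<open>C\<close> a claw
  is excluded because \<open>C\<close> minus a node is connected.\<close>

lemma odd_cycle_roots:
  obtains R a b c where "R \<subseteq> V - C" "a \<in> \<delta> C" "b \<in> \<delta> C" "c \<in> \<delta> C"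
    "rooted_triangle G C (tend C a) (tend C b) (tend C c)"
    "rooted_triangle G R (tend (V - C) a) (tend (V - C) b) (tend (V - C) c) \<or>
     rooted_claw G R (tend (V - C) a) (tend (V - C) b) (tend (V - C) c)"
proof -
  obtain R0 where "good R0" using good_exists by blast
  then obtain R where gR: "good R" and min: "\<And>R'. good R' \<Longrightarrow> card R \<le> card R'"
    using ex_has_least_nat[of good R0 card] by blast
  have R: "R \<subseteq> V - C" "conn G R" "card (terminals R) \<ge> 3" "sum x (\<delta> R - \<delta> C) \<le> 1/2"
    using gR by (auto simp: good_def)
  have RV: "R \<subseteq> V" using R(1) by blast
  have fR: "finite R" using RV by (rule finVsub)
  \<comment> \<open>A part \<open>A\<close> split off by the terminal \<open>z\<close> and left only
    by \<open>fA\<close> and edges to \<open>C\<close> needs value at least 3/2 from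
    \<open>C\<close>, hence two terminals. With \<open>z\<close> it forms a smaller good region,
    whose only cut edge outside the cut of \<open>C\<close> is \<open>fB\<close>.\<close>
  have shrink: False if z: "z \<in> terminals R" and AB: "R - {z} = A \<union> B" "A \<inter> B = {}" "A \<noteq> {}" "B \<noteq> {}"
    "\<not> adjacent G A B" and clean: "(\<delta> R - \<delta> C) \<inter> touch A = {}" and
    f: "\<delta> {z} = {f0, fA, fB}" "f0 \<in> \<delta> C" "x fA = 1/2" "x fB = 1/2" "fA \<in> touch A" "fB \<in> touch B" for z A B f0 fA fB
  proof -
    have zR: "z \<in> R" using z by (simp add: terminals_def)
    have sub: "A \<subseteq> R" "B \<subseteq> R" "z \<notin> A" "z \<notin> B" using AB by auto
    have fE: "fA \<in> E" "fB \<in> E" "f0 \<in> E" using f(1) cut_sub[of "{z}"] by auto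
    have edges_A: "f \<in> \<delta> C \<or> f = fA" if f': "f \<in> \<delta> A" for f
    proof (rule ccontr)
      assume n: "\<not> ?thesis"
      have fE': "f \<in> E" using f' cut_sub by blast
      have t: "ends G f = {tend A f, tend (V - A) f}" "tend A f \<in> A" "tend (V - A) f \<in> V - A" using tend[OF f'] by auto
      have "tend (V - A) f \<notin> B"
      proof
        assume "tend (V - A) f \<in> B"
        then have "adjacent G A B" unfolding adjacent_def using t fE' by blast
        then show False using AB(5) by simp
      qed
      moreover have "tend (V - A) f \<noteq> z"
      proof
        assume "tend (V - A) f = z"
        then have "f \<in> \<delta> {z}" using node_cut_iff[OF fE'] t(1) by simp
        then have "f = fB" using f(1,2) n by auto
        then have "tend A f \<in> B \<or> z \<in> B" using f(6) t(1) \<open>tend (V - A) f = z\<close> by (auto simp: touch_def)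
        then show False using sub t(2) AB(2) by blast
      qed
      ultimately have "tend (V - A) f \<notin> R" using AB(1) t(3) by blast
      then have "f \<in> \<delta> R" using t(2) sub in_cut[OF fE' t(1)] by blast
      then have "f \<in> (\<delta> R - \<delta> C) \<inter> touch A" using n t(1,2) fE' by (auto simp: touch_def)
      then show False using clean by blast
    qed
    have AV: "A \<subset> V" using sub RV zR by blast
    have "2 \<le> val x A" by (rule val_ge[OF AB(3) AV])
    moreover have "val x A \<le> sum x (insert fA (\<delta> C \<inter> touch A))"
      unfolding val_def by (rule sum_mono2) (use edges_A cut_touch[of A A] fE pos cut_sub[of C] in \<open>auto simp: less_imp_le\<close>)
    moreover have "sum x (insert fA (\<delta> C \<inter> touch A)) \<le> 1/2 + real (card (\<delta> C \<inter> touch A))"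
      using sum_cut_C[of "\<delta> C \<inter> touch A"] f(3) pos[OF fE(1)] by (simp add: sum.insert_if)
    ultimately have "3/2 \<le> real (card (\<delta> C \<inter> touch A))" by linarith
    then have "2 \<le> card (\<delta> C \<inter> touch A)" by linarith
    then have tA: "2 \<le> card (terminals A)" using card_terminals[of A] sub(1) R(1) by auto
    define R1 where "R1 = insert z A"
    have R1eq: "R - B = R1" using AB zR sub by (auto simp: R1_def)
    have "terminals R1 = insert z (terminals A)" using z by (auto simp: terminals_def R1_def)
    moreover have "z \<notin> terminals A" using sub by (auto simp: terminals_def)
    moreover have "finite (terminals A)" using sub(1) fR finite_subset[of "terminals A" R] by (auto simp: terminals_def)
    ultimately have "card (terminals R1) = Suc (card (terminals A))" by simp
    then have 3: "card (terminals R1) \<ge> 3" using tA by simp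
    have cR1: "conn G R1"
    proof -
      have "R - {z} - B = A" using AB by blast
      then have "\<not> adjacent G B (R - {z} - B)" using AB(5) by (simp add: adjacent_sym)
      then have "conn G (R - B)" by (intro conn_minus_component[OF R(2) zR]) (use AB in auto)
      then show ?thesis by (simp add: R1eq)
    qed
    have "\<delta> R1 - \<delta> C \<subseteq> {fB}"
    proof
      fix f' assume f': "f' \<in> \<delta> R1 - \<delta> C"
      then have fE': "f' \<in> E" using cut_sub by blast
      have t: "ends G f' = {tend R1 f', tend (V - R1) f'}" "tend R1 f' \<in> R1" "tend (V - R1) f' \<in> V - R1"
        using tend[of f' R1] f' by auto
      show "f' \<in> {fB}"
      proof (cases "tend R1 f' = z")
        case True
        then have "f' \<in> \<delta> {z}" using node_cut_iff[OF fE'] t(1) by simp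
        moreover have "f' \<noteq> fA"
        proof
          assume "f' = fA"
          then have "tend (V - R1) f' \<in> A \<or> z \<in> A" using f(5) t(1) True by (auto simp: touch_def)
          then show False using t(3) sub by (auto simp: R1_def)
        qed
        ultimately show ?thesis using f(1,2) f' by auto
      next
        case False
        then have "tend R1 f' \<in> A" using t(2) by (simp add: R1_def)
        moreover have "tend (V - R1) f' \<notin> A" using t(3) by (auto simp: R1_def)
        ultimately have "f' \<in> \<delta> A" using in_cut[OF fE' t(1)] by blast
        then have "f' = fA" using edges_A f' by blast
        moreover have "fA \<in> \<delta> {z}" using f(1) by simp
        ultimately have "z \<in> ends G f'" using in_cut_node by blast
        then show ?thesis using t False by (auto simp: R1_def)
      qed
    qed
    then have "sum x (\<delta> R1 - \<delta> C) \<le> sum x {fB}" by (intro sum_mono2) (use pos[OF fE(2)] in auto)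
    then have "sum x (\<delta> R1 - \<delta> C) \<le> 1/2" using f(4) by simp
    moreover have "R1 \<subseteq> V - C" using R1eq R(1) by blast
    ultimately have "good R1" using 3 cR1 by (simp add: good_def)
    then have "card R \<le> card R1" by (rule min)
    moreover have "R1 \<subset> R" using R1eq AB(4) sub by blast
    then have "card R1 < card R" by (rule psubset_card_mono[OF fR])
    ultimately show False by simp
  qed
  have connRz: "conn G (R - {z})" if z: "z \<in> terminals R" for z
    unfolding conn_adjacent
  proof (intro conjI allI impI)
    have zR: "z \<in> R" using z by (simp add: terminals_def)
    have "card (terminals R) \<le> card R" by (rule card_mono[OF fR]) (auto simp: terminals_def)
    then have "card (R - {z}) \<noteq> 0" using R(3) zR fR by simp
    then show "R - {z} \<noteq> {}" by (metis card.empty)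
    fix A assume A: "A \<noteq> {}" "A \<subset> R - {z}"
    define B where "B = R - {z} - A"
    have AB: "R - {z} = A \<union> B" "A \<inter> B = {}" "B \<noteq> {}" using A by (auto simp: B_def)
    have "adjacent G A B"
    proof (rule ccontr)
      assume n: "\<not> adjacent G A B"
      then have n': "\<not> adjacent G B A" by (simp add: adjacent_sym)
      have adjz: "\<exists>f\<in>\<delta> {z}. f \<in> touch X" if "X \<noteq> {}" "X \<subset> R" "R - X = insert z Y" "\<not> adjacent G X Y" for X Y
      proof -
        have "adjacent G X (R - X)" by (rule conn_adjD[OF R(2) that(1,2)])
        then have "adjacent G X ({z} \<union> Y)" using that(3) by simp
        then have "adjacent G X {z}" using that(4) by (simp only: adjacent_Un) blast
        then obtain f p where "f \<in> E" "p \<in> X" "ends G f = {p, z}" unfolding adjacent_def by blast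
        then show ?thesis using node_cut_iff[of f z] by (intro bexI[of _ f]) (auto simp: touch_def)
      qed
      obtain fA where fA: "fA \<in> \<delta> {z}" "fA \<in> touch A"
        using adjz[of A B] A AB zR n by auto
      obtain fB where fB: "fB \<in> \<delta> {z}" "fB \<in> touch B"
        using adjz[of B A] A AB zR n' by auto
      obtain f0 where f0: "f0 \<in> \<delta> C" "z = tend (V - C) f0" using z by (auto simp: terminals_def)
      have f0z: "f0 \<in> \<delta> {z}" "f0 \<in> M" using tend(1,4)[OF f0(1)] node_cut_iff[of f0 z] f0 cut_C_M by auto
      have f0AB: "f0 \<notin> touch A" "f0 \<notin> touch B"
      proof -
        have "ends G f0 = {tend C f0, z}" "tend C f0 \<in> C" using tend[OF f0(1)] f0(2) by auto
        then show "f0 \<notin> touch A" "f0 \<notin> touch B" using AB R(1) by (auto simp: touch_def)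
      qed
      have "fA \<noteq> fB"
      proof
        assume "fA = fB"
        obtain w where "ends G fA = {z, w}" "w \<noteq> z" using other_end[OF fA(1)] by blast
        then show False using fA(2) fB(2) \<open>fA = fB\<close> AB by (auto simp: touch_def)
      qed
      then have d3: "distinct [f0, fA, fB]" using f0AB fA fB by auto
      have "z \<in> N" using f0z in_cut_node[OF f0z(1)] by (auto simp: M_def)
      have "z \<notin> U1"
      proof
        assume "z \<in> U1"
        then obtain e a where "\<delta> {z} = {e, a}" unfolding U1_def by blast
        then have "{f0, fA, fB} \<subseteq> {e, a}" using f0z fA fB by auto
        then have "card {f0, fA, fB} \<le> card {e, a}" by (intro card_mono) auto
        also have "\<dots> \<le> 2" by (simp add: card_insert_if)
        finally show False using d3 by simp
      qed
      then have "z \<in> H" using N_cases \<open>z \<in> N\<close> by blast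
      then obtain e p q where epq: "\<delta> {z} = {e, p, q}" "distinct [e, p, q]" "e \<in> M" "x p = 1/2" "x q = 1/2" "p \<notin> M" "q \<notin> M"
        using H_edges by metis
      then have "f0 = e" using f0z by auto
      then have "(fA = p \<and> fB = q) \<or> (fA = q \<and> fB = p)" using epq d3 fA fB by auto
      then have fAB: "\<delta> {z} = {f0, fA, fB}" "\<delta> {z} = {f0, fB, fA}" "x fA = 1/2" "x fB = 1/2" using epq \<open>f0 = e\<close> by auto
      let ?O = "\<delta> R - \<delta> C"
      \<comment> \<open>Two edges in \<open>?O\<close> would have total value at least 1, above the
        bound in \<open>good\<close>.\<close>
      have "(?O \<inter> touch A) = {} \<or> (?O \<inter> touch B) = {}"
      proof (rule ccontr)
        assume "\<not> ?thesis"
        then obtain a b where ab: "a \<in> ?O" "a \<in> touch A" "b \<in> ?O" "b \<in> touch B" by blast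
        have "a \<noteq> b"
        proof
          assume "a = b"
          have "ends G a = {tend R a, tend (V - R) a}" "tend (V - R) a \<in> V - R" using tend[of a R] ab by auto
          then show False using ab \<open>a = b\<close> AB by (auto simp: touch_def)
        qed
        have "sum x {a, b} \<le> sum x ?O" by (rule sum_mono2) (use ab pos cut_sub[of R] in \<open>auto simp: less_imp_le\<close>)
        then have "x a + x b \<le> 1/2" using R(4) \<open>a \<noteq> b\<close> by simp
        moreover have "1/2 \<le> x a" "1/2 \<le> x b" using half_integral ab cut_sub[of R] by fastforce+
        ultimately show False by linarith
      qed
      then show False
      proof
        assume "?O \<inter> touch A = {}"
        then show False using shrink[OF z AB(1,2) A(1) AB(3) n _ fAB(1) f0(1) fAB(3,4) fA(2) fB(2)] by blast
      next
        assume "?O \<inter> touch B = {}"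
        then show False using shrink[OF z, of B A f0 fB fA] AB A(1) n' fAB f0(1) fA(2) fB(2) by blast
      qed
    qed
    then show "adjacent G A (R - {z} - A)" by (simp add: B_def)
  qed
  obtain T where T: "T \<subseteq> terminals R" "card T = 3" using R(3) by (meson obtain_subset_with_card_n)
  then obtain z1 z2 z3 where z: "T = {z1, z2, z3}" "z1 \<noteq> z2" "z2 \<noteq> z3" "z1 \<noteq> z3" by (auto simp: card_3_iff)
  have zt: "z1 \<in> terminals R" "z2 \<in> terminals R" "z3 \<in> terminals R" using T z by auto
  obtain a b c where abc: "a \<in> \<delta> C" "z1 = tend (V - C) a" "b \<in> \<delta> C" "z2 = tend (V - C) b" "c \<in> \<delta> C" "z3 = tend (V - C) c"
    using zt by (auto simp: terminals_def)
  have ne: "a \<noteq> b" "b \<noteq> c" "a \<noteq> c" using z abc by auto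
  have "rooted_triangle G R z1 z2 z3 \<or> rooted_claw G R z1 z2 z3"
    by (rule triangle_or_claw[OF R(2) fR]) (use zt z connRz in \<open>auto simp: terminals_def\<close>)
  moreover have "rooted_triangle G C (tend C a) (tend C b) (tend C c)"
  proof -
    have tC: "tend C a \<in> C" "tend C b \<in> C" "tend C c \<in> C" using tend(2) abc by auto
    have td: "tend C a \<noteq> tend C b" "tend C a \<noteq> tend C c" "tend C b \<noteq> tend C c"
      using cut_C_inj(1) abc ne by (auto simp: inj_on_def)
    have cm: "conn G (C - {v})" if "v \<in> C" for v by (rule half_conn_conn[OF half_conn_minus[OF that]])
    have "\<not> rooted_claw G C (tend C a) (tend C b) (tend C c)"
    proof
      assume "rooted_claw G C (tend C a) (tend C b) (tend C c)"
      then obtain p A B D where p: "p \<in> C" "A \<union> B \<union> D \<subseteq> C - {p}" "A \<inter> B = {}" "tend C a \<in> A" "tend C b \<in> B"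
        "\<not> adjacent G A (C - {p} - A)" unfolding rooted_claw_def by blast
      have "adjacent G A (C - {p} - A)" by (rule conn_adjD[OF cm[OF p(1)]]) (use p in auto)
      then show False using p(6) by simp
    qed
    then show ?thesis
      using triangle_or_claw[OF half_conn_conn[OF Cconn] finC tC td cm[OF tC(1)] cm[OF tC(2)] cm[OF tC(3)]] by blast
  qed
  ultimately show ?thesis using that[of R a b c] R(1) abc by blast
qed

end

context fractional_minimal
begin

lemma conn_V: "conn G V"
  unfolding conn_def
proof (intro conjI allI impI)
  show "V \<noteq> {}" using cardV by (metis card.empty not_numeral_le_zero)
  fix A assume A: "A \<noteq> {}" "A \<subset> V"
  then have "2 \<le> val x A" by (rule val_ge)
  then have "\<delta> A \<noteq> {}" by (auto simp: val_def)
  then obtain f where f: "f \<in> \<delta> A" by blast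
  show "\<exists>e\<in>E. \<exists>a\<in>A. \<exists>b\<in>V - A. ends G e = {a, b}" using tend[OF f] by blast
qed

lemma linked_roots:
  obtains A B e1 e2 e3 a1 a2 a3 b1 b2 b3 where "A \<subseteq> V" "B \<subseteq> V" "A \<inter> B = {}" "e1 \<in> E" "e2 \<in> E" "e3 \<in> E"
    "ends G e1 = {a1, b1}" "ends G e2 = {a2, b2}" "ends G e3 = {a3, b3}"
    "rooted_triangle G A a1 a2 a3" "rooted_triangle G B b1 b2 b3 \<or> rooted_claw G B b1 b2 b3"
proof (cases "\<exists>T. tight T \<and> card T \<ge> 3 \<and> card (V - T) \<ge> 3")
  case True
  then obtain T where T: "tight T" "card T \<ge> 3" "card (V - T) \<ge> 3" by blast
  obtain a b c where abc: "a \<in> \<delta> T" "b \<in> \<delta> T" "c \<in> \<delta> T"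
    "rooted_triangle G T (tend T a) (tend T b) (tend T c)"
    "rooted_triangle G (V - T) (tend (V - T) a) (tend (V - T) b) (tend (V - T) c)"
    using large_tight_cut[OF T] .
  show ?thesis
    by (rule that[of T "V - T" a b c, OF tight_sub[OF T(1)] _ _ tend(4)[OF abc(1)] tend(4)[OF abc(2)] tend(4)[OF abc(3)]
          tend(1)[OF abc(1)] tend(1)[OF abc(2)] tend(1)[OF abc(3)] abc(4)]) (use abc(5) in auto)
next
  case False
  interpret small_tight_sets G x
    by unfold_locales (use False in force)
  obtain C where C: "C \<subseteq> H" "C \<noteq> {}" "half_closed_set C" "half_conn C" using half_component_exists by blast
  interpret half_component G x C
    by unfold_locales (use C in auto)
  obtain R a b c where R: "R \<subseteq> V - C" and abc: "a \<in> \<delta> C" "b \<in> \<delta> C" "c \<in> \<delta> C"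
    and t: "rooted_triangle G C (tend C a) (tend C b) (tend C c)"
    "rooted_triangle G R (tend (V - C) a) (tend (V - C) b) (tend (V - C) c) \<or>
     rooted_claw G R (tend (V - C) a) (tend (V - C) b) (tend (V - C) c)"
    using odd_cycle_roots .
  show ?thesis
    by (rule that[of C R a b c, OF CV _ _ tend(4)[OF abc(1)] tend(4)[OF abc(2)] tend(4)[OF abc(3)]
          tend(1)[OF abc(1)] tend(1)[OF abc(2)] tend(1)[OF abc(3)] t]) (use R in auto)
qed

end

section \<open>Prism and pyramid\<close>

text \<open>Unassigned nodes are absorbed one at a time by a class to which an edge joins them.
  Growing branch sets until they cover \<open>V\<close> turns a minor model into a relabelling, as
  \<open>quotient_minor\<close> expects.\<close>

lemma extend_classes:
  assumes V: "conn G V" "finite V" and W: "W \<subseteq> V" "W \<noteq> {}" "\<And>i. i \<in> f ` W \<Longrightarrow> conn G {v \<in> W. f v = i}"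
  shows "\<exists>g. (\<forall>v\<in>W. g v = f v) \<and> g ` V = f ` W \<and> (\<forall>i\<in>f ` W. conn G {v \<in> V. g v = i})"
  using W
proof (induction "card (V - W)" arbitrary: W f rule: less_induct)
  case less
  show ?case
  proof (cases "W = V")
    case True then show ?thesis using less.prems by blast
  next
    case False
    then have "W \<subset> V" using less.prems by blast
    then obtain e a b where e: "e \<in> edges G" "a \<in> W" "b \<in> V - W" "ends G e = {a, b}"
      using connE[OF V(1) less.prems(2)] by blast
    define f' where "f' = f(b := f a)"
    have ff: "f' v = f v" if "v \<in> W" for v using that e by (auto simp: f'_def)
    have im: "f' ` insert b W = f ` W" using e ff by (auto simp: f'_def image_iff)
    have "\<exists>g. (\<forall>v\<in>insert b W. g v = f' v) \<and> g ` V = f' ` insert b W \<and> (\<forall>i\<in>f' ` insert b W. conn G {v \<in> V. g v = i})"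
    proof (rule less.hyps)
      show "card (V - insert b W) < card (V - W)" by (rule psubset_card_mono) (use V e in auto)
      show "insert b W \<subseteq> V" "insert b W \<noteq> {}" using less.prems e by auto
      fix i assume "i \<in> f' ` insert b W"
      then have i: "i \<in> f ` W" by (simp only: im)
      show "conn G {v \<in> insert b W. f' v = i}"
      proof (cases "i = f a")
        case True
        have "{v \<in> insert b W. f' v = i} = insert b {v \<in> W. f v = i}" using True ff by (auto simp: f'_def)
        moreover have "conn G (insert b {v \<in> W. f v = i})"
          by (rule conn_insert[OF less.prems(3)[OF i] e(1,4)]) (use e True in auto)
        ultimately show ?thesis by simp
      next
        case False
        have "{v \<in> insert b W. f' v = i} = {v \<in> W. f v = i}" using False ff e by (auto simp: f'_def)
        then show ?thesis using less.prems(3)[OF i] by simp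
      qed
    qed
    then obtain g where "\<forall>v\<in>insert b W. g v = f' v" "g ` V = f ` W" "\<forall>i\<in>f ` W. conn G {v \<in> V. g v = i}"
      unfolding im by blast
    then show ?thesis using ff by (intro exI[of _ g]) auto
  qed
qed

lemma branch_sets_cover:
  fixes Bs :: "'v set list"
  assumes V: "conn G V" "finite V" and n: "Bs \<noteq> []"
    and B: "\<forall>i<length Bs. conn G (Bs ! i) \<and> Bs ! i \<subseteq> V"
    and disj: "\<forall>i<length Bs. \<forall>j<length Bs. i < j \<longrightarrow> Bs ! i \<inter> Bs ! j = {}"
  shows "\<exists>g. g ` V = {..<length Bs} \<and> (\<forall>i<length Bs. conn G {v \<in> V. g v = i}) \<and> (\<forall>i<length Bs. \<forall>v\<in>Bs ! i. g v = i)"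
proof -
  define W where "W = (\<Union>i<length Bs. Bs ! i)"
  define f where "f = (\<lambda>v. THE i. i < length Bs \<and> v \<in> Bs ! i)"
  have f: "f v = i" if "i < length Bs" "v \<in> Bs ! i" for i v
    unfolding f_def
  proof (rule the_equality)
    fix j assume j: "j < length Bs \<and> v \<in> Bs ! j"
    show "j = i"
    proof (rule ccontr)
      assume "j \<noteq> i"
      then have "Bs ! i \<inter> Bs ! j = {} \<or> Bs ! j \<inter> Bs ! i = {}" using disj j that(1) by (metis nat_neq_iff)
      then show False using that j by blast
    qed
  qed (use that in auto)
  have ne: "Bs ! i \<noteq> {}" if "i < length Bs" for i using B that by (simp add: conn_def)
  have fib: "{v \<in> W. f v = i} = Bs ! i" if i: "i < length Bs" for i
  proof (intro set_eqI iffI)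
    fix v assume "v \<in> {v \<in> W. f v = i}"
    then obtain j where "j < length Bs" "v \<in> Bs ! j" "f v = i" by (auto simp: W_def)
    then show "v \<in> Bs ! i" using f by blast
  next
    fix v assume "v \<in> Bs ! i" then show "v \<in> {v \<in> W. f v = i}" using f i by (auto simp: W_def)
  qed
  have fW: "f ` W = {..<length Bs}"
  proof (intro set_eqI iffI)
    fix i assume "i \<in> f ` W" then show "i \<in> {..<length Bs}" using f by (auto simp: W_def)
  next
    fix i assume i: "i \<in> {..<length Bs}"
    then obtain v where "v \<in> Bs ! i" using ne by blast
    then have "v \<in> {v \<in> W. f v = i}" using fib i by simp
    then show "i \<in> f ` W" by auto
  qed
  have "W \<subseteq> V" using B by (auto simp: W_def)
  moreover have "W \<noteq> {}" using n fW by (metis image_empty lessThan_eq_iff lessThan_0 length_greater_0_conv less_numeral_extra(3))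
  ultimately obtain g where g: "\<forall>v\<in>W. g v = f v" "g ` V = f ` W" "\<forall>i\<in>f ` W. conn G {v \<in> V. g v = i}"
    using extend_classes[OF V, of W f] fib B unfolding fW by auto
  have "g v = i" if "i < length Bs" "v \<in> Bs ! i" for i v
    using g(1) f[OF that] that by (auto simp: W_def)
  then show ?thesis using g unfolding fW by (intro exI[of _ g]) auto
qed

lemma basic_point_image:
  fixes w :: "'p \<Rightarrow> real" and h :: "'p \<Rightarrow> 'q"
  assumes bp: "basic_point P K w" and h: "inj_on h P" and K: "\<And>C. C \<in> K \<Longrightarrow> C \<subseteq> P"
    and y: "\<And>p. p \<in> P \<Longrightarrow> y (h p) = w p"
  shows "basic_point (h ` P) ((`) h ` K) y"
proof (rule basic_pointI)
  have s: "sum z (h ` C) = (\<Sum>p\<in>C. z (h p))" if "C \<in> K" for z :: "'q \<Rightarrow> real" and C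
    using inj_on_subset[OF h K[OF that]] by (simp add: sum.reindex)
  have sy: "sum y (h ` C) = sum w C" if "C \<in> K" for C
    unfolding s[OF that] by (rule sum.cong) (use y K[OF that] in auto)
  show "0 \<le> y e" if "e \<in> h ` P" for e using that y basic_pointD(1)[OF bp] by auto
  show "2 \<le> sum y C" if "C \<in> (`) h ` K" for C using that sy basic_pointD(2)[OF bp] by auto
  fix d :: "'q \<Rightarrow> real"
  assume d: "\<And>e. e \<notin> h ` P \<Longrightarrow> d e = 0" "\<And>e. e \<in> h ` P \<Longrightarrow> y e = 0 \<Longrightarrow> d e = 0"
    "\<And>C. C \<in> (`) h ` K \<Longrightarrow> sum y C = 2 \<Longrightarrow> sum d C = 0"
  define d' where "d' = (\<lambda>p. if p \<in> P then d (h p) else 0)"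
  have "d' p = 0" for p
  proof (rule basic_pointD(3)[OF bp, where d = d'])
    fix C assume C: "C \<in> K" "sum w C = 2"
    have "sum d' C = (\<Sum>p\<in>C. d (h p))"
    proof (rule sum.cong)
      fix p assume "p \<in> C"
      then have "p \<in> P" using K[OF C(1)] by blast
      then show "d' p = d (h p)" by (simp add: d'_def)
    qed simp
    also have "\<dots> = sum d (h ` C)" by (rule s[OF C(1), symmetric])
    also have "\<dots> = 0" by (rule d(3)) (simp_all add: C sy)
    finally show "sum d' C = 0" .
  next
    fix p assume "p \<in> P" "w p = 0"
    then show "d' p = 0" using d(2)[of "h p"] y by (simp add: d'_def)
  qed (simp add: d'_def)
  then have "d (h p) = 0" if "p \<in> P" for p using that fun_cong[OF d'_def, of p] by simp
  then have "d e = 0" if "e \<in> h ` P" for e using that by auto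
  with d(1) show "\<forall>e. d e = 0" by metis
qed

lemma nodes_simple_graph [simp]: "nodes (simple_graph V P) = V"
  and edges_simple_graph [simp]: "edges (simple_graph V P) = P"
  and ends_simple_graph [simp]: "ends (simple_graph V P) p = p"
  by (simp_all add: simple_graph_def)

context fractional_minimal
begin

text \<open>One edge \<open>h p\<close> is kept for each pair \<open>p\<close> of the model. The
  weights \<open>w\<close> then form a nonintegral basic point of the quotient, so by minimality
  nothing was contracted or deleted, and the model is all of \<open>G\<close>.\<close>

lemma isomorphic_of_model:
  fixes f :: "'v \<Rightarrow> nat"
  assumes f: "f ` V = {..<n}" "2 \<le> n" "\<And>i. i < n \<Longrightarrow> conn G {v \<in> V. f v = i}"
    and P: "\<And>p. p \<in> P \<Longrightarrow> card p = 2 \<and> (\<exists>e\<in>E. f ` ends G e = p)"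
    and w: "basic_point P (cuts (simple_graph {..<n} P)) w" "\<exists>p\<in>P. w p \<notin> \<int>"
  shows "isomorphic G (simple_graph {..<n} P)"
proof -
  have "\<forall>p\<in>P. \<exists>e. e \<in> E \<and> f ` ends G e = p" using P by (simp add: Bex_def)
  from bchoice[OF this] obtain h where "\<forall>p\<in>P. h p \<in> E \<and> f ` ends G (h p) = p" ..
  note h = bspec[OF this]
  have inj: "inj_on h P"
  proof (rule inj_onI)
    fix p q assume "p \<in> P" "q \<in> P" "h p = h q"
    then have "p = f ` ends G (h q)" using h[of p] by simp
    also have "\<dots> = q" using h[OF \<open>q \<in> P\<close>] by simp
    finally show "p = q" .
  qed
  let ?H = "simple_graph {..<n} P"
  have mem: "h p \<in> \<delta> (f -` Y) \<longleftrightarrow> p \<in> cut ?H Y" if p: "p \<in> P" for p Y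
  proof -
    have "ends G (h p) \<inter> f -` Y \<noteq> {} \<longleftrightarrow> f ` ends G (h p) \<inter> Y \<noteq> {}"
      "ends G (h p) - f -` Y \<noteq> {} \<longleftrightarrow> f ` ends G (h p) - Y \<noteq> {}" by blast+
    moreover have "f ` ends G (h p) = p" "h p \<in> E" using h[OF p] by simp_all
    ultimately show ?thesis using p by (simp only: cut_def mem_Collect_eq edges_simple_graph ends_simple_graph)
  qed
  have hc: "h ` P \<inter> \<delta> (f -` Y) = h ` cut ?H Y" for Y
  proof -
    have "cut ?H Y \<subseteq> P" by (auto simp: cut_def)
    then have "h ` cut ?H Y = h ` {p \<in> P. p \<in> cut ?H Y}" by blast
    also have "\<dots> = h ` P \<inter> \<delta> (f -` Y)" using mem[of _ Y] by (auto simp del: edges_simple_graph)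
    finally show ?thesis ..
  qed
  have q: "quotient_cuts G f (h ` P) = (`) h ` cuts ?H"
    unfolding quotient_cuts_def cuts_def hc f(1) by auto
  have bp: "basic_point (h ` P) (quotient_cuts G f (h ` P)) (\<lambda>e. w (f ` ends G e))"
    unfolding q
  proof (rule basic_point_image[OF w(1) inj])
    show "C \<subseteq> P" if "C \<in> cuts ?H" for C using cuts_subset_edges[OF that] by simp
  qed (use h in simp)
  have "inj_on f V \<and> h ` P = E"
  proof (rule ccontr)
    assume ne: "\<not> ?thesis"
    obtain p where p: "p \<in> P" "w p \<notin> \<int>" using w(2) by blast
    have "w (f ` ends G (h p)) \<in> \<int>"
    proof (rule minimal_nat[OF _ _ _ _ ne bp])
      show "conn G {v \<in> V. f v = u}" if "u \<in> f ` V" for u using that f(3) unfolding f(1) by simp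
      show "2 \<le> card (f ` V)" using f(1,2) by simp
      show "h ` P \<subseteq> E" using h by blast
      show "card (f ` ends G e) = 2" if "e \<in> h ` P" for e using that h P by auto
      show "h p \<in> h ` P" using p by blast
    qed
    then show False using p(2) h[OF p(1)] by simp
  qed
  then have iso: "inj_on f V" "h ` P = E" by auto
  show ?thesis unfolding isomorphic_def
  proof (rule exI[of _ f], rule exI[of _ "\<lambda>e. f ` ends G e"], intro conjI ballI)
    show "bij_betw f V (nodes ?H)" using iso f(1) by (simp add: bij_betw_def)
    have hf: "h (f ` ends G e) = e \<and> f ` ends G e \<in> P" if "e \<in> E" for e
    proof -
      from that obtain p where p: "p \<in> P" "e = h p" unfolding iso(2)[symmetric] by (rule imageE)
      then have "f ` ends G e = p" using h[OF p(1)] by simp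
      then show ?thesis using p by simp
    qed
    have "inj_on (\<lambda>e. f ` ends G e) E" by (rule inj_on_inverseI[where g = h]) (use hf in simp)
    moreover have "(\<lambda>e. f ` ends G e) ` E = P"
    proof (intro equalityI subsetI)
      fix p assume "p \<in> P"
      then show "p \<in> (\<lambda>e. f ` ends G e) ` E" using h[of p] by (intro image_eqI[of _ _ "h p"]) simp_all
    next
      fix p assume "p \<in> (\<lambda>e. f ` ends G e) ` E"
      then show "p \<in> P" using hf by auto
    qed
    ultimately show "bij_betw (\<lambda>e. f ` ends G e) E (edges ?H)" by (simp add: bij_betw_def)
  qed simp
qed

end

lemma nonintegral_of_isomorphic:
  fixes G :: "('v, 'e::finite) multigraph"
  assumes iso: "isomorphic G (simple_graph W P)" and G: "is_graph G"
    and w: "basic_point P (cuts (simple_graph W P)) w" "\<exists>p\<in>P. w p \<notin> \<int>"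
  shows "\<exists>x. basic_point (edges G) (cuts G) x \<and> (\<exists>e\<in>edges G. x e \<notin> \<int>)"
proof -
  let ?H = "simple_graph W P"
  obtain f g where f: "bij_betw f (nodes G) W" and g: "bij_betw g (edges G) P"
    and fg: "\<And>e. e \<in> edges G \<Longrightarrow> g e = f ` ends G e"
    using iso unfolding isomorphic_def by auto
  define h where "h = inv_into (edges G) g"
  have gE: "g ` edges G = P" using g by (rule bij_betw_imp_surj_on)
  have gh: "g (h p) = p" "h p \<in> edges G" if "p \<in> P" for p
    unfolding h_def using that unfolding gE[symmetric] by (rule f_inv_into_f, rule inv_into_into)
  have inj: "inj_on h P"
  proof (rule inj_onI)
    fix p q assume "p \<in> P" "q \<in> P" "h p = h q"
    then have "p = g (h q)" using gh(1)[of p] by simp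
    also have "\<dots> = q" using gh(1)[OF \<open>q \<in> P\<close>] .
    finally show "p = q" .
  qed
  have hP: "h ` P = edges G"
    using bij_betw_imp_surj_on[OF bij_betw_inv_into[OF g]] by (simp add: h_def)
  have mem: "h p \<in> cut G S \<longleftrightarrow> p \<in> cut ?H (f ` S)" if p: "p \<in> P" and S: "S \<subseteq> nodes G" for p S
  proof -
    have e: "h p \<in> edges G" "f ` ends G (h p) = p" using gh[OF p] fg[of "h p"] by simp_all
    then have sub: "ends G (h p) \<subseteq> nodes G" using G by (simp add: is_graph_def)
    have m: "v \<in> S \<longleftrightarrow> f v \<in> f ` S" if "v \<in> ends G (h p)" for v
      using inj_on_image_mem_iff[OF bij_betw_imp_inj_on[OF f] subsetD[OF sub that] S] by simp
    have "ends G (h p) \<inter> S \<noteq> {} \<longleftrightarrow> (\<exists>v\<in>ends G (h p). f v \<in> f ` S)" using m by (simp add: disjoint_iff Bex_def)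
    also have "\<dots> \<longleftrightarrow> f ` ends G (h p) \<inter> f ` S \<noteq> {}" by auto
    finally have 1: "ends G (h p) \<inter> S \<noteq> {} \<longleftrightarrow> p \<inter> f ` S \<noteq> {}" by (simp only: e(2))
    have "ends G (h p) - S \<noteq> {} \<longleftrightarrow> (\<exists>v\<in>ends G (h p). f v \<notin> f ` S)"
    proof -
      have "ends G (h p) - S \<noteq> {} \<longleftrightarrow> (\<exists>v\<in>ends G (h p). v \<notin> S)" by auto
      then show ?thesis using m by (simp add: Bex_def)
    qed
    also have "\<dots> \<longleftrightarrow> f ` ends G (h p) - f ` S \<noteq> {}" by auto
    finally have 2: "ends G (h p) - S \<noteq> {} \<longleftrightarrow> p - f ` S \<noteq> {}" by (simp only: e(2))
    show ?thesis using 1 2 e(1) p by (simp only: cut_def mem_Collect_eq edges_simple_graph ends_simple_graph)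
  qed
  have hc: "cut G S = h ` cut ?H (f ` S)" if S: "S \<subseteq> nodes G" for S
  proof -
    have P: "cut ?H (f ` S) \<subseteq> P" "cut G S \<subseteq> h ` P" unfolding hP by (auto simp: cut_def)
    show ?thesis
    proof (intro equalityI subsetI)
      fix e assume e: "e \<in> cut G S"
      then obtain p where "p \<in> P" "e = h p" using P(2) by (meson imageE subsetD)
      then show "e \<in> h ` cut ?H (f ` S)" using mem[of p, OF _ S] e by simp
    next
      fix e assume "e \<in> h ` cut ?H (f ` S)"
      then obtain p where "p \<in> cut ?H (f ` S)" "e = h p" by (rule imageE)
      then show "e \<in> cut G S" using mem[of p, OF _ S] P(1) by (simp add: subsetD)
    qed
  qed
  have cs: "cuts G = (`) h ` cuts ?H"
  proof (intro set_eqI iffI)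
    fix C assume "C \<in> cuts G"
    then obtain S where S: "C = cut G S" "S \<noteq> {}" "S \<subset> nodes G" by (auto simp: cuts_def)
    have "f ` S \<subset> f ` nodes G" using S f by (metis bij_betw_imp_inj_on image_strict_mono)
    then have "f ` S \<noteq> {}" "f ` S \<subset> W" using S f by (auto simp: bij_betw_def)
    then have "cut ?H (f ` S) \<in> cuts ?H" unfolding cuts_def by auto
    then show "C \<in> (`) h ` cuts ?H" using S hc[of S] by auto
  next
    fix C assume "C \<in> (`) h ` cuts ?H"
    then obtain Y where Y: "C = h ` cut ?H Y" "Y \<noteq> {}" "Y \<subset> W" by (auto simp: cuts_def)
    define S where "S = nodes G \<inter> f -` Y"
    have fV: "f ` nodes G = W" using f by (simp add: bij_betw_def)
    have fS: "f ` S = Y" using Y(3) unfolding S_def fV[symmetric] by blast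
    have "S \<noteq> {}" using Y(2) fS by blast
    moreover have "S \<noteq> nodes G" using Y(3) fS fV by blast
    ultimately have "S \<noteq> {}" "S \<subset> nodes G" by (auto simp: S_def)
    moreover have "C = cut G S" using hc[of S] fS Y(1) by (simp add: S_def)
    ultimately show "C \<in> cuts G" unfolding cuts_def by blast
  qed
  have "basic_point (edges G) (cuts G) (\<lambda>e. w (g e))"
    unfolding cs hP[symmetric]
  proof (rule basic_point_image[OF w(1) inj])
    show "C \<subseteq> P" if "C \<in> cuts ?H" for C using cuts_subset_edges[OF that] by simp
  qed (use gh in simp)
  moreover have "\<exists>e\<in>edges G. w (g e) \<notin> \<int>" using w(2) gh by metis
  ultimately show ?thesis by blast
qed

lemma sum_cut_simple_graph:
  fixes z :: "'v set \<Rightarrow> real"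
  assumes "finite P"
  shows "sum z (cut (simple_graph W P) S) = (\<Sum>p\<in>P. if p \<inter> S \<noteq> {} \<and> p - S \<noteq> {} then z p else 0)"
  unfolding cut_def using assms by (simp add: sum.inter_filter)

lemma crossing_pair: "{a, b} \<inter> S \<noteq> {} \<and> {a, b} - S \<noteq> {} \<longleftrightarrow> (a \<in> S) \<noteq> (b \<in> S)"
  by auto

lemma basic_point_simple_graph:
  fixes w :: "'v set \<Rightarrow> real"
  assumes pos: "\<And>p. p \<in> P \<Longrightarrow> 0 < w p"
    and ge: "\<And>S a b. S \<subseteq> W \<Longrightarrow> a \<in> S \<Longrightarrow> b \<in> W \<Longrightarrow> b \<notin> S \<Longrightarrow> 2 \<le> sum w (cut (simple_graph W P) S)"
    and ker: "\<And>(d :: 'v set \<Rightarrow> real) p. (\<And>S a b. S \<subseteq> W \<Longrightarrow> a \<in> S \<Longrightarrow> b \<in> W \<Longrightarrow> b \<notin> S \<Longrightarrow> sum w (cut (simple_graph W P) S) = 2 \<Longrightarrow>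
        sum d (cut (simple_graph W P) S) = 0) \<Longrightarrow> p \<in> P \<Longrightarrow> d p = 0"
  shows "basic_point P (cuts (simple_graph W P)) w"
proof (rule basic_pointI)
  show "0 \<le> w p" if "p \<in> P" for p using pos[OF that] by simp
  show "2 \<le> sum w C" if "C \<in> cuts (simple_graph W P)" for C
  proof -
    obtain S where S: "C = cut (simple_graph W P) S" "S \<noteq> {}" "S \<subset> W" using \<open>C \<in> cuts (simple_graph W P)\<close> by (auto simp: cuts_def)
    then obtain a b where "a \<in> S" "b \<in> W" "b \<notin> S" by blast
    then show ?thesis using ge S by blast
  qed
  fix d :: "'v set \<Rightarrow> real"
  assume d: "\<And>p. p \<notin> P \<Longrightarrow> d p = 0" "\<And>C. C \<in> cuts (simple_graph W P) \<Longrightarrow> sum w C = 2 \<Longrightarrow> sum d C = 0"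
  have "d p = 0" if "p \<in> P" for p
  proof (rule ker[OF _ that])
    fix S a b assume S: "S \<subseteq> W" "a \<in> S" "b \<in> W" "b \<notin> S" and "sum w (cut (simple_graph W P) S) = 2"
    moreover have "cut (simple_graph W P) S \<in> cuts (simple_graph W P)"
      unfolding cuts_def by (rule CollectI, rule exI[of _ S]) (use S in auto)
    ultimately show "sum d (cut (simple_graph W P) S) = 0" using d(2) by simp
  qed
  then show "\<forall>p. d p = 0" using d(1) by metis
qed

text \<open>In the complement of the 6-cycle the even and the odd nodes form the two triangles, and
  antipodal nodes are matched.\<close>

definition prism_edges :: "nat set set" where
  "prism_edges = {{0, 2}, {0, 4}, {2, 4}, {1, 3}, {1, 5}, {3, 5}, {0, 3}, {1, 4}, {2, 5}}"

lemma prism_eq: "prism = simple_graph {..<6} prism_edges"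
proof -
  have six: "{..<6} = {0, 1, 2, 3, 4, 5 :: nat}" by (auto simp: lessThan_def)
  have "{{i, (i + 1) mod 6} | i. i < 6} = (\<lambda>i. {i, (i + 1) mod 6}) ` {..<6 :: nat}" by auto
  also have "\<dots> = {{0, 1}, {1, 2}, {2, 3}, {3, 4}, {4, 5}, {5, 0}}" unfolding six by (simp flip: numeral_2_eq_2)
  finally have cycle: "{{i, (i + 1) mod 6} | i. i < 6} = {{0, 1}, {1, 2}, {2, 3}, {3, 4}, {4, 5}, {5, 0 :: nat}}" .
  have "{e. e \<subseteq> {..<6 :: nat} \<and> card e = 2} - {{0, 1}, {1, 2}, {2, 3}, {3, 4}, {4, 5}, {5, 0}} = prism_edges"
  proof (intro equalityI subsetI)
    fix e assume e: "e \<in> {e. e \<subseteq> {..<6 :: nat} \<and> card e = 2} - {{0, 1}, {1, 2}, {2, 3}, {3, 4}, {4, 5}, {5, 0}}"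
    then have sub: "e \<subseteq> {0, 1, 2, 3, 4, 5}" and c: "card e = 2"
      and no: "e \<notin> {{0, 1}, {1, 2}, {2, 3}, {3, 4}, {4, 5}, {5, 0}}" unfolding six by blast+
    from c obtain a b where ab: "e = {a, b}" "a \<noteq> b" by (rule card_2_iff[THEN iffD1, elim_format]) blast
    have a: "a = 0 \<or> a = 1 \<or> a = 2 \<or> a = 3 \<or> a = 4 \<or> a = 5" and b: "b = 0 \<or> b = 1 \<or> b = 2 \<or> b = 3 \<or> b = 4 \<or> b = 5"
      using sub unfolding ab(1) by simp_all
    show "e \<in> prism_edges" using a b no ab(2) unfolding ab(1) prism_edges_def
      by (elim disjE) (simp_all add: doubleton_eq_iff)
  next
    fix e assume "e \<in> prism_edges"
    then show "e \<in> {e. e \<subseteq> {..<6 :: nat} \<and> card e = 2} - {{0, 1}, {1, 2}, {2, 3}, {3, 4}, {4, 5}, {5, 0}}"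
      unfolding prism_edges_def by (elim insertE) (simp_all add: doubleton_eq_iff)
  qed
  then show ?thesis unfolding prism_def cycle by simp
qed

text \<open>Every node and every matched pair becomes tight, which gives nine equations for the nine
  edges.\<close>

definition prism_point :: "nat set \<Rightarrow> real" where
  "prism_point p = (if p \<in> {{0, 3}, {1, 4}, {2, 5}} then 1 else 1/2)"

lemma prism_point:
  "basic_point prism_edges (cuts (simple_graph {..<6} prism_edges)) prism_point"
  "\<exists>p\<in>prism_edges. prism_point p \<notin> \<int>"
proof -
  define c where "c S z a b = (if (a \<in> S) \<noteq> (b \<in> S) then z {a, b} else (0 :: real))" for S and z :: "nat set \<Rightarrow> real" and a b
  have sum: "sum z (cut (simple_graph {..<6} prism_edges) S) =
      c S z 0 2 + c S z 0 4 + c S z 2 4 + c S z 1 3 + c S z 1 5 + c S z 3 5 + c S z 0 3 + c S z 1 4 + c S z 2 5" for z S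
  proof -
    have "sum z (cut (simple_graph {..<6} prism_edges) S) =
        (\<Sum>p\<in>prism_edges. if p \<inter> S \<noteq> {} \<and> p - S \<noteq> {} then z p else 0)"
      by (rule sum_cut_simple_graph) (simp add: prism_edges_def)
    also have "\<dots> = c S z 0 2 + c S z 0 4 + c S z 2 4 + c S z 1 3 + c S z 1 5 + c S z 3 5 + c S z 0 3 + c S z 1 4 + c S z 2 5"
      unfolding prism_edges_def by (simp add: doubleton_eq_iff crossing_pair c_def del: Int_insert_left Diff_insert_absorb insert_Diff_if)
    finally show ?thesis .
  qed
  have w: "prism_point {0, 2} = 1/2" "prism_point {0, 4} = 1/2" "prism_point {2, 4} = 1/2"
    "prism_point {1, 3} = 1/2" "prism_point {1, 5} = 1/2" "prism_point {3, 5} = 1/2"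
    "prism_point {0, 3} = 1" "prism_point {1, 4} = 1" "prism_point {2, 5} = 1"
    by (simp_all add: prism_point_def doubleton_eq_iff)
  show "\<exists>p\<in>prism_edges. prism_point p \<notin> \<int>"
    by (rule bexI[of _ "{0, 2}"], unfold w) (rule half_not_int, simp add: prism_edges_def)
  show "basic_point prism_edges (cuts (simple_graph {..<6} prism_edges)) prism_point"
  proof (rule basic_point_simple_graph)
    show "0 < prism_point p" for p by (simp add: prism_point_def)
    fix S :: "nat set" and a b assume ab: "a \<in> S" "b \<in> {..<6}" "b \<notin> S" "S \<subseteq> {..<6}"
    then have "a \<in> {0, 1, 2, 3, 4, 5}" "b \<in> {0, 1, 2, 3, 4, 5}" by auto
    then have "0 \<in> S \<or> 1 \<in> S \<or> 2 \<in> S \<or> 3 \<in> S \<or> 4 \<in> S \<or> 5 \<in> S"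
      "0 \<notin> S \<or> 1 \<notin> S \<or> 2 \<notin> S \<or> 3 \<notin> S \<or> 4 \<notin> S \<or> 5 \<notin> S"
      using ab(1,3) by auto
    then show "2 \<le> sum prism_point (cut (simple_graph {..<6} prism_edges) S)"
      unfolding sum c_def w
      by (cases "0 \<in> S"; cases "1 \<in> S"; cases "2 \<in> S"; cases "3 \<in> S"; cases "4 \<in> S"; cases "5 \<in> S"; simp)
  next
    fix d :: "nat set \<Rightarrow> real" and p :: "nat set"
    assume d: "\<And>S a b. S \<subseteq> {..<6} \<Longrightarrow> a \<in> S \<Longrightarrow> b \<in> {..<6} \<Longrightarrow> b \<notin> S \<Longrightarrow>
      sum prism_point (cut (simple_graph {..<6} prism_edges) S) = 2 \<Longrightarrow> sum d (cut (simple_graph {..<6} prism_edges) S) = 0"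
      and p: "p \<in> prism_edges"
    note d' = d[unfolded sum c_def w]
    \<comment> \<open>The tight sets used are the six nodes and the three matched pairs; each
      instance names the set, a node inside and a node outside.\<close>
    have "d {0, 2} + d {0, 4} + d {0, 3} = 0" using d'[of "{0}" 0 1] by simp
    moreover have "d {0, 2} + d {2, 4} + d {2, 5} = 0" using d'[of "{2}" 2 1] by simp
    moreover have "d {0, 4} + d {2, 4} + d {1, 4} = 0" using d'[of "{4}" 4 1] by simp
    moreover have "d {1, 3} + d {1, 5} + d {1, 4} = 0" using d'[of "{1}" 1 0] by simp
    moreover have "d {1, 3} + d {3, 5} + d {0, 3} = 0" using d'[of "{3}" 3 0] by simp
    moreover have "d {1, 5} + d {3, 5} + d {2, 5} = 0" using d'[of "{5}" 5 0] by simp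
    moreover have "d {0, 2} + d {0, 4} + d {1, 3} + d {3, 5} = 0" using d'[of "{0, 3}" 0 1] by simp
    moreover have "d {0, 4} + d {2, 4} + d {1, 3} + d {1, 5} = 0" using d'[of "{1, 4}" 1 0] by simp
    moreover have "d {0, 2} + d {2, 4} + d {1, 5} + d {3, 5} = 0" using d'[of "{2, 5}" 2 0] by simp
    ultimately have "d {0, 2} = 0 \<and> d {0, 4} = 0 \<and> d {2, 4} = 0 \<and> d {1, 3} = 0 \<and> d {1, 5} = 0 \<and> d {3, 5} = 0 \<and>
      d {0, 3} = 0 \<and> d {1, 4} = 0 \<and> d {2, 5} = 0" by linarith
    then show "d p = 0" using p unfolding prism_edges_def by auto
  qed
qed

definition pyramid_edges :: "nat set set" where
  "pyramid_edges = {{0, 4}, {4, 1}, {0, 5}, {5, 2}, {0, 6}, {6, 3}, {1, 2}, {1, 3}, {2, 3}}"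

lemma pyramid_eq: "pyramid = simple_graph {..<7} pyramid_edges"
  by (simp add: pyramid_def pyramid_edges_def)

text \<open>The nodes 1 to 6 become tight, and so does each triangle node together with its
  subdividing neighbour: nine equations for nine edges. The node 0 has value 3.\<close>

definition pyramid_point :: "nat set \<Rightarrow> real" where
  "pyramid_point p = (if p \<in> {{1, 2}, {1, 3}, {2, 3}} then 1/2 else 1)"

lemma pyramid_point:
  "basic_point pyramid_edges (cuts (simple_graph {..<7} pyramid_edges)) pyramid_point"
  "\<exists>p\<in>pyramid_edges. pyramid_point p \<notin> \<int>"
proof -
  define c where "c S z a b = (if (a \<in> S) \<noteq> (b \<in> S) then z {a, b} else (0 :: real))" for S and z :: "nat set \<Rightarrow> real" and a b
  have sum: "sum z (cut (simple_graph {..<7} pyramid_edges) S) =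
      c S z 0 4 + c S z 4 1 + c S z 0 5 + c S z 5 2 + c S z 0 6 + c S z 6 3 + c S z 1 2 + c S z 1 3 + c S z 2 3" for z S
  proof -
    have "sum z (cut (simple_graph {..<7} pyramid_edges) S) =
        (\<Sum>p\<in>pyramid_edges. if p \<inter> S \<noteq> {} \<and> p - S \<noteq> {} then z p else 0)"
      by (rule sum_cut_simple_graph) (simp add: pyramid_edges_def)
    also have "\<dots> = c S z 0 4 + c S z 4 1 + c S z 0 5 + c S z 5 2 + c S z 0 6 + c S z 6 3 + c S z 1 2 + c S z 1 3 + c S z 2 3"
      unfolding pyramid_edges_def by (simp add: doubleton_eq_iff crossing_pair c_def del: Int_insert_left Diff_insert_absorb insert_Diff_if)
    finally show ?thesis .
  qed
  have w: "pyramid_point {0, 4} = 1" "pyramid_point {4, 1} = 1" "pyramid_point {0, 5} = 1"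
    "pyramid_point {5, 2} = 1" "pyramid_point {0, 6} = 1" "pyramid_point {6, 3} = 1"
    "pyramid_point {1, 2} = 1/2" "pyramid_point {1, 3} = 1/2" "pyramid_point {2, 3} = 1/2"
    by (simp_all add: pyramid_point_def doubleton_eq_iff)
  show "\<exists>p\<in>pyramid_edges. pyramid_point p \<notin> \<int>"
    by (rule bexI[of _ "{1, 2}"], unfold w) (rule half_not_int, simp add: pyramid_edges_def)
  show "basic_point pyramid_edges (cuts (simple_graph {..<7} pyramid_edges)) pyramid_point"
  proof (rule basic_point_simple_graph)
    show "0 < pyramid_point p" for p by (simp add: pyramid_point_def)
    fix S :: "nat set" and a b assume ab: "a \<in> S" "b \<in> {..<7}" "b \<notin> S" "S \<subseteq> {..<7}"
    then have "a \<in> {0, 1, 2, 3, 4, 5, 6}" "b \<in> {0, 1, 2, 3, 4, 5, 6}" by auto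
    then have "0 \<in> S \<or> 1 \<in> S \<or> 2 \<in> S \<or> 3 \<in> S \<or> 4 \<in> S \<or> 5 \<in> S \<or> 6 \<in> S"
      "0 \<notin> S \<or> 1 \<notin> S \<or> 2 \<notin> S \<or> 3 \<notin> S \<or> 4 \<notin> S \<or> 5 \<notin> S \<or> 6 \<notin> S"
      using ab(1,3) by auto
    then show "2 \<le> sum pyramid_point (cut (simple_graph {..<7} pyramid_edges) S)"
      unfolding sum c_def w
      by (cases "0 \<in> S"; cases "1 \<in> S"; cases "2 \<in> S"; cases "3 \<in> S"; cases "4 \<in> S"; cases "5 \<in> S"; cases "6 \<in> S"; simp)
  next
    fix d :: "nat set \<Rightarrow> real" and p :: "nat set"
    assume d: "\<And>S a b. S \<subseteq> {..<7} \<Longrightarrow> a \<in> S \<Longrightarrow> b \<in> {..<7} \<Longrightarrow> b \<notin> S \<Longrightarrow>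
      sum pyramid_point (cut (simple_graph {..<7} pyramid_edges) S) = 2 \<Longrightarrow> sum d (cut (simple_graph {..<7} pyramid_edges) S) = 0"
      and p: "p \<in> pyramid_edges"
    note d' = d[unfolded sum c_def w]
    have "d {4, 1} + d {1, 2} + d {1, 3} = 0" using d'[of "{1}" 1 0] by simp
    moreover have "d {5, 2} + d {1, 2} + d {2, 3} = 0" using d'[of "{2}" 2 0] by simp
    moreover have "d {6, 3} + d {1, 3} + d {2, 3} = 0" using d'[of "{3}" 3 0] by simp
    moreover have "d {0, 4} + d {4, 1} = 0" using d'[of "{4}" 4 0] by simp
    moreover have "d {0, 5} + d {5, 2} = 0" using d'[of "{5}" 5 0] by simp
    moreover have "d {0, 6} + d {6, 3} = 0" using d'[of "{6}" 6 0] by simp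
    moreover have "d {0, 4} + d {1, 2} + d {1, 3} = 0" using d'[of "{1, 4}" 1 0] by simp
    moreover have "d {0, 5} + d {1, 2} + d {2, 3} = 0" using d'[of "{2, 5}" 2 0] by simp
    moreover have "d {0, 6} + d {1, 3} + d {2, 3} = 0" using d'[of "{3, 6}" 3 0] by simp
    ultimately have "d {0, 4} = 0 \<and> d {4, 1} = 0 \<and> d {0, 5} = 0 \<and> d {5, 2} = 0 \<and> d {0, 6} = 0 \<and> d {6, 3} = 0 \<and>
      d {1, 2} = 0 \<and> d {1, 3} = 0 \<and> d {2, 3} = 0" by linarith
    then show "d p = 0" using p unfolding pyramid_edges_def by auto
  qed
qed

context fractional_minimal
begin

lemma isomorphic_of_branch_sets:
  assumes n: "length Bs = n" "2 \<le> n" and B: "\<forall>i<length Bs. conn G (Bs ! i) \<and> Bs ! i \<subseteq> V"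
    and disj: "\<forall>i<length Bs. \<forall>j<length Bs. i < j \<longrightarrow> Bs ! i \<inter> Bs ! j = {}"
    and Q: "\<forall>(i, j)\<in>Q. i \<noteq> j \<and> i < length Bs \<and> j < length Bs \<and> adjacent G (Bs ! i) (Bs ! j)"
    and P: "P = (\<lambda>(i, j). {i, j}) ` Q"
    and w: "basic_point P (cuts (simple_graph {..<n} P)) w" "\<exists>p\<in>P. w p \<notin> \<int>"
  shows "isomorphic G (simple_graph {..<n} P)"
proof -
  have ne: "Bs \<noteq> []" using n by auto
  have fin: "finite V" using graph by (simp add: is_graph_def)
  obtain g where g: "g ` V = {..<length Bs}" "\<forall>i<length Bs. conn G {v \<in> V. g v = i}"
    "\<forall>i<length Bs. \<forall>v\<in>Bs ! i. g v = i"
    using branch_sets_cover[OF conn_V fin ne B disj] by (elim exE conjE)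
  show ?thesis
  proof (rule isomorphic_of_model[OF _ n(2) _ _ w])
    show "g ` V = {..<n}" using g(1) n(1) by simp
    show "conn G {v \<in> V. g v = i}" if "i < n" for i using g(2) n(1) that by simp
    fix p assume "p \<in> P"
    then obtain i j where ij: "(i, j) \<in> Q" "p = {i, j}" unfolding P by auto
    have q: "i \<noteq> j" "i < length Bs" "j < length Bs" "adjacent G (Bs ! i) (Bs ! j)" using bspec[OF Q ij(1)] by simp_all
    from q(4) obtain e a b where e: "e \<in> E" "a \<in> Bs ! i" "b \<in> Bs ! j" "ends G e = {a, b}"
      unfolding adjacent_def by (elim bexE)
    have "g ` ends G e = p" using g(3) q(2,3) e ij(2) by simp
    moreover have "card p = 2" using q(1) ij(2) by simp
    ultimately show "card p = 2 \<and> (\<exists>e\<in>E. g ` ends G e = p)" using e(1) by (intro conjI bexI)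
  qed
qed

lemma isomorphic_prism_or_pyramid: "isomorphic G prism \<or> isomorphic G pyramid"
proof -
  obtain A B e1 e2 e3 a1 a2 a3 b1 b2 b3 where sub: "A \<subseteq> V" "B \<subseteq> V" "A \<inter> B = {}"
    and e: "e1 \<in> E" "e2 \<in> E" "e3 \<in> E" "ends G e1 = {a1, b1}" "ends G e2 = {a2, b2}" "ends G e3 = {a3, b3}"
    and A: "rooted_triangle G A a1 a2 a3" and B: "rooted_triangle G B b1 b2 b3 \<or> rooted_claw G B b1 b2 b3"
    using linked_roots .
  from A obtain A1 A2 A3 where A: "A = A1 \<union> A2 \<union> A3" "A1 \<inter> A2 = {}" "A1 \<inter> A3 = {}" "A2 \<inter> A3 = {}"
     "conn G A1" "conn G A2" "conn G A3" "a1 \<in> A1" "a2 \<in> A2" "a3 \<in> A3"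
     "adjacent G A1 A2" "adjacent G A1 A3" "adjacent G A2 A3"
    unfolding rooted_triangle_def by (elim exE conjE)
  have link: "adjacent G X Y" if "ends G f = {a, b}" "f \<in> E" "a \<in> X" "b \<in> Y" for f a b X Y
    unfolding adjacent_def using that by (intro bexI)
  from B show ?thesis
  proof
    assume "rooted_triangle G B b1 b2 b3"
    then obtain B1 B2 B3 where B: "B = B1 \<union> B2 \<union> B3" "B1 \<inter> B2 = {}" "B1 \<inter> B3 = {}" "B2 \<inter> B3 = {}"
       "conn G B1" "conn G B2" "conn G B3" "b1 \<in> B1" "b2 \<in> B2" "b3 \<in> B3"
       "adjacent G B1 B2" "adjacent G B1 B3" "adjacent G B2 B3"
      unfolding rooted_triangle_def by (elim exE conjE)
    have adj: "adjacent G A1 B1" "adjacent G A2 B2" "adjacent G B3 A3" "adjacent G B3 B1" "adjacent G B3 B2"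
      using link[OF e(4,1)] link[OF e(5,2)] link[OF e(6,3)] A(8-10) B(8-10) B(12,13) adjacent_sym[of G B3] by simp_all
    have ss: "A1 \<subseteq> V" "A2 \<subseteq> V" "A3 \<subseteq> V" "B1 \<subseteq> V" "B2 \<subseteq> V" "B3 \<subseteq> V"
      using sub unfolding A(1) B(1) by simp_all
    have dj: "A1 \<inter> B1 = {}" "A1 \<inter> B2 = {}" "A1 \<inter> B3 = {}" "A2 \<inter> B1 = {}" "A2 \<inter> B2 = {}" "A2 \<inter> B3 = {}"
      "A3 \<inter> B1 = {}" "A3 \<inter> B2 = {}" "A3 \<inter> B3 = {}"
      using sub(3) unfolding A(1) B(1) by (simp_all add: Int_Un_distrib Int_Un_distrib2)
    have "isomorphic G (simple_graph {..<6} prism_edges)"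
    \<comment> \<open>The order follows the numbering of the prism: even positions form the triangle
      in \<open>A\<close>, odd ones that in \<open>B\<close>, and positions differing by 3 are
      linked.\<close>
    proof (rule isomorphic_of_branch_sets[where Bs = "[A1, B3, A2, B1, A3, B2]" and
          Q = "{(0, 2), (0, 4), (2, 4), (1, 3), (1, 5), (3, 5), (0, 3), (1, 4), (2, 5)}", OF _ _ _ _ _ _ prism_point])
      show "\<forall>i<length [A1, B3, A2, B1, A3, B2]. conn G ([A1, B3, A2, B1, A3, B2] ! i) \<and> [A1, B3, A2, B1, A3, B2] ! i \<subseteq> V"
        using A(5-7) B(5-7) ss by (simp add: All_less_Suc2)
      show "\<forall>i<length [A1, B3, A2, B1, A3, B2]. \<forall>j<length [A1, B3, A2, B1, A3, B2].
          i < j \<longrightarrow> [A1, B3, A2, B1, A3, B2] ! i \<inter> [A1, B3, A2, B1, A3, B2] ! j = {}"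
        using A(2-4) B(2-4) dj by (simp add: All_less_Suc2 Int_commute)
      show "\<forall>(i, j)\<in>{(0, 2), (0, 4), (2, 4), (1, 3), (1, 5), (3, 5), (0, 3), (1, 4), (2, 5)}.
          i \<noteq> j \<and> i < length [A1, B3, A2, B1, A3, B2] \<and> j < length [A1, B3, A2, B1, A3, B2] \<and>
          adjacent G ([A1, B3, A2, B1, A3, B2] ! i) ([A1, B3, A2, B1, A3, B2] ! j)"
        using A(11-13) B(11) adj by simp
    qed (simp_all add: prism_edges_def)
    then show ?thesis by (simp add: prism_eq)
  next
    assume "rooted_claw G B b1 b2 b3"
    then obtain p B1 B2 B3 where B: "p \<in> B" "B1 \<union> B2 \<union> B3 \<subseteq> B - {p}" "B1 \<inter> B2 = {}" "B1 \<inter> B3 = {}" "B2 \<inter> B3 = {}"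
       "conn G B1" "conn G B2" "conn G B3" "b1 \<in> B1" "b2 \<in> B2" "b3 \<in> B3"
       "adjacent G {p} B1" "adjacent G {p} B2" "adjacent G {p} B3"
      unfolding rooted_claw_def by (elim exE conjE)
    have adj: "adjacent G B1 A1" "adjacent G B2 A2" "adjacent G B3 A3"
      using link[OF e(4,1)] link[OF e(5,2)] link[OF e(6,3)] A(8-10) B(9-11) adjacent_sym[of G] by simp_all
    have ss: "A1 \<subseteq> V" "A2 \<subseteq> V" "A3 \<subseteq> V" "B1 \<subseteq> V" "B2 \<subseteq> V" "B3 \<subseteq> V" "p \<in> V"
      using sub(1,2) B(1,2) unfolding A(1) by blast+
    have pB: "B1 \<subseteq> B" "B2 \<subseteq> B" "B3 \<subseteq> B" "p \<notin> B1" "p \<notin> B2" "p \<notin> B3" using B(2) by blast+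
    have AB: "A1 \<inter> B = {}" "A2 \<inter> B = {}" "A3 \<inter> B = {}" using sub(3) unfolding A(1) by blast+
    have dj: "A1 \<inter> B1 = {}" "A1 \<inter> B2 = {}" "A1 \<inter> B3 = {}" "A2 \<inter> B1 = {}" "A2 \<inter> B2 = {}" "A2 \<inter> B3 = {}"
      "A3 \<inter> B1 = {}" "A3 \<inter> B2 = {}" "A3 \<inter> B3 = {}" "p \<notin> A1" "p \<notin> A2" "p \<notin> A3"
      using AB pB(1-3) B(1) by blast+
    have "isomorphic G (simple_graph {..<7} pyramid_edges)"
    \<comment> \<open>The centre of the claw is node 0, the triangle in \<open>A\<close> gives 1, 2,
      3, and the legs are the subdividing nodes 4, 5, 6.\<close>
    proof (rule isomorphic_of_branch_sets[where Bs = "[{p}, A1, A2, A3, B1, B2, B3]" and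
          Q = "{(0, 4), (4, 1), (0, 5), (5, 2), (0, 6), (6, 3), (1, 2), (1, 3), (2, 3)}", OF _ _ _ _ _ _ pyramid_point])
      show "\<forall>i<length [{p}, A1, A2, A3, B1, B2, B3]. conn G ([{p}, A1, A2, A3, B1, B2, B3] ! i) \<and> [{p}, A1, A2, A3, B1, B2, B3] ! i \<subseteq> V"
        using A(5-7) B(6-8) ss conn_singleton by (simp add: All_less_Suc2)
      show "\<forall>i<length [{p}, A1, A2, A3, B1, B2, B3]. \<forall>j<length [{p}, A1, A2, A3, B1, B2, B3].
          i < j \<longrightarrow> [{p}, A1, A2, A3, B1, B2, B3] ! i \<inter> [{p}, A1, A2, A3, B1, B2, B3] ! j = {}"
        using A(2-4) B(3-5) dj pB(4-6) by (simp add: All_less_Suc2)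
      show "\<forall>(i, j)\<in>{(0, 4), (4, 1), (0, 5), (5, 2), (0, 6), (6, 3), (1, 2), (1, 3), (2, 3)}.
          i \<noteq> j \<and> i < length [{p}, A1, A2, A3, B1, B2, B3] \<and> j < length [{p}, A1, A2, A3, B1, B2, B3] \<and>
          adjacent G ([{p}, A1, A2, A3, B1, B2, B3] ! i) ([{p}, A1, A2, A3, B1, B2, B3] ! j)"
        using A(11-13) B(12-14) adj by simp
    qed (simp_all add: pyramid_edges_def)
    then show ?thesis by (simp add: pyramid_eq)
  qed
qed

end

text \<open>The labels are polymorphic here, so that both minimality assumptions of
  \<open>fractional_minimal\<close> are instances.\<close>

lemma minor_minimal_quotient_integral:
  fixes G :: "('v, 'e::finite) multigraph"
  assumes min: "minor_minimal_non_2_graph G"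
    and q: "\<And>u. u \<in> f ` nodes G \<Longrightarrow> conn G {v \<in> nodes G. f v = u}" "card (f ` nodes G) \<ge> 2"
      "F \<subseteq> edges G" "\<And>e. e \<in> F \<Longrightarrow> card (f ` ends G e) = 2" "\<not> (inj_on f (nodes G) \<and> F = edges G)"
      "basic_point F (quotient_cuts G f F) y" and e: "e \<in> F"
  shows "y e \<in> \<int>"
proof (rule ccontr)
  assume "y e \<notin> \<int>"
  with e have nonint: "\<exists>e\<in>F. y e \<notin> \<int>" by (intro bexI)
  have "is_graph G" using min by (simp add: minor_minimal_non_2_graph_def)
  from quotient_nonintegral_proper_minor[OF this q nonint]
  obtain H where "proper_minor H G" "k_star H > 2" by blast
  then show False using min by (auto simp: minor_minimal_non_2_graph_def)
qed

lemma minor_minimal_isomorphic: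
  fixes G :: "('v, 'e::finite) multigraph"
  assumes min: "minor_minimal_non_2_graph G"
  shows "isomorphic G prism \<or> isomorphic G pyramid"
proof -
  have G: "is_graph G" "k_star G > 2" using min by (simp_all add: minor_minimal_non_2_graph_def)
  obtain x where x: "basic_point (edges G) (cuts G) x" "\<exists>e\<in>edges G. x e \<notin> \<int>"
    using G k_star_gt_2_iff by blast
  interpret fractional_minimal G x
    by unfold_locales (fact G(1) x minor_minimal_quotient_integral[OF min])+
  show ?thesis by (rule isomorphic_prism_or_pyramid)
qed

section \<open>Minimality of the prism and the pyramid\<close>

lemma minor_step_shrinks:
  assumes "minor_step G H" "finite (nodes G)" "finite (edges G)"
  shows "finite (nodes H)" "edges H \<subseteq> edges G" "card (nodes H) + card (edges H) < card (nodes G) + card (edges G)"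
proof -
  have "finite (nodes H) \<and> edges H \<subseteq> edges G \<and> card (nodes H) + card (edges H) < card (nodes G) + card (edges G)"
    using assms
  proof (cases rule: minor_step.cases)
    case (contract e u v)
    have n: "nodes H = (\<lambda>x. if x = v then u else x) ` nodes G" and ed: "edges H = edges G - {e}"
      by (simp_all add: contract(1) contract_edge_def Let_def)
    have "card (nodes H) \<le> card (nodes G)" unfolding n by (rule card_image_le[OF assms(2)])
    moreover have "card (edges H) < card (edges G)"
      unfolding ed using contract(2) assms(3) by (intro card_Diff1_less)
    moreover have "finite (nodes H)" unfolding n using assms(2) by simp
    ultimately show ?thesis using ed by auto
  next
    case (del_edge e)
    have ed: "nodes H = nodes G" "edges H = edges G - {e}" by (simp_all add: del_edge(1) delete_edge_def)
    have "card (edges H) < card (edges G)"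
      unfolding ed using del_edge(2) assms(3) by (intro card_Diff1_less)
    then show ?thesis using ed assms(2) by auto
  next
    case (del_node v)
    have n: "nodes H = nodes G - {v}" "edges H \<subseteq> edges G" by (auto simp: del_node(1) delete_node_def)
    have "card (nodes H) < card (nodes G)"
      unfolding n using del_node(2) assms(2) by (intro card_Diff1_less)
    moreover have "card (edges H) \<le> card (edges G)" by (rule card_mono[OF assms(3) n(2)])
    ultimately show ?thesis using n assms(2) by auto
  qed
  then show "finite (nodes H)" "edges H \<subseteq> edges G" "card (nodes H) + card (edges H) < card (nodes G) + card (edges G)"
    by auto
qed

lemma minor_shrinks:
  assumes "minor_step\<^sup>+\<^sup>+ G H" "finite (nodes G)" "finite (edges G)"
  shows "finite (nodes H) \<and> edges H \<subseteq> edges G \<and> card (nodes H) + card (edges H) < card (nodes G) + card (edges G)"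
  using assms(1)
proof (induction rule: tranclp_induct)
  case (base H)
  then show ?case using minor_step_shrinks[OF base assms(2,3)] by blast
next
  case (step H K)
  have "finite (edges H)" using step.IH assms(3) finite_subset by blast
  then show ?case using minor_step_shrinks[OF step.hyps(2)] step.IH by fastforce
qed

lemma minor_minimal_exists:
  fixes G :: "('v, 'e::finite) multigraph"
  assumes "is_graph G" "k_star G > 2"
  shows "\<exists>H. (H = G \<or> proper_minor H G) \<and> minor_minimal_non_2_graph H"
  using assms
proof (induction "card (nodes G) + card (edges G)" arbitrary: G rule: less_induct)
  case less
  show ?case
  proof (cases "\<exists>H. proper_minor H G \<and> k_star H > 2")
    case True
    then obtain H where H: "proper_minor H G" "k_star H > 2" by blast
    then have Hs: "minor_step\<^sup>+\<^sup>+ G H" "is_graph H" by (simp_all add: proper_minor_def)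
    have "card (nodes H) + card (edges H) < card (nodes G) + card (edges G)"
      using minor_shrinks[OF Hs(1)] less.prems(1) by (simp add: is_graph_def)
    from less.hyps[OF this Hs(2) H(2)] obtain K where K: "K = H \<or> proper_minor K H" "minor_minimal_non_2_graph K" by blast
    have "proper_minor K G" using K(1) H(1) Hs(1) unfolding proper_minor_def by (auto intro: tranclp_trans)
    then show ?thesis using K(2) by blast
  next
    case False
    then have "minor_minimal_non_2_graph G" using less.prems unfolding minor_minimal_non_2_graph_def
      by (auto simp: not_less)
    then show ?thesis by blast
  qed
qed

text \<open>Contracting or deleting an edge loses that edge; deleting a node loses one because no
  node is isolated.\<close>

lemma proper_minor_loses_edge:
  assumes "proper_minor H G" and G: "is_graph G" and cov: "\<And>v. v \<in> nodes G \<Longrightarrow> \<exists>e\<in>edges G. v \<in> ends G e"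
  shows "card (edges H) < card (edges G)"
proof -
  have fin: "finite (nodes G)" "finite (edges G)" using G by (auto simp: is_graph_def)
  have "minor_step\<^sup>+\<^sup>+ G H" using assms(1) by (simp add: proper_minor_def)
  then obtain K where K: "minor_step G K" "K = H \<or> minor_step\<^sup>+\<^sup>+ K H" by (metis tranclpD rtranclpD)
  note Ks = minor_step_shrinks[OF K(1) fin]
  have "edges H \<subseteq> edges K" using K(2) minor_shrinks[of K H, OF _ Ks(1) finite_subset[OF Ks(2) fin(2)]] by blast
  moreover have "edges K \<subset> edges G" using K(1)
  proof (cases rule: minor_step.cases)
    case (contract e u v)
    then show ?thesis by (auto simp: contract_edge_def Let_def)
  next
    case (del_edge e)
    then show ?thesis by (auto simp: delete_edge_def)
  next
    case (del_node v)
    then show ?thesis using cov[of v] by (auto simp: delete_node_def)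
  qed
  ultimately show ?thesis using fin(2) by (intro psubset_card_mono) auto
qed

lemma isomorphic_covers_nodes:
  assumes iso: "isomorphic G (simple_graph W P)" and G: "is_graph G" and P: "\<Union>P = W" and v: "v \<in> nodes G"
  shows "\<exists>e\<in>edges G. v \<in> ends G e"
proof -
  obtain f g where f: "bij_betw f (nodes G) W" and g: "bij_betw g (edges G) P"
    and fg: "\<And>e. e \<in> edges G \<Longrightarrow> g e = f ` ends G e"
    using iso unfolding isomorphic_def by auto
  have "f v \<in> W" using f v by (rule bij_betwE[THEN bspec])
  then obtain p where p: "p \<in> P" "f v \<in> p" unfolding P[symmetric] by blast
  obtain e where e: "e \<in> edges G" "p = g e" using p(1) unfolding bij_betw_imp_surj_on[OF g, symmetric] by (rule imageE)
  then have "f v \<in> f ` ends G e" using p(2) fg by simp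
  then obtain u where u: "u \<in> ends G e" "f v = f u" by (rule imageE)
  then have "u \<in> nodes G" using G e(1) by (auto simp: is_graph_def)
  then have "u = v" using inj_onD[OF bij_betw_imp_inj_on[OF f] u(2)] v by simp
  then show ?thesis using u(1) e(1) by blast
qed

text \<open>A proper minor that is not a 2-graph would be or contain a minor-minimal one. By the
  direction already proved this is a prism or a pyramid, with nine edges, as many as
  \<open>G\<close> itself has.\<close>

lemma isomorphic_minor_minimal:
  fixes G :: "('v, 'e::finite) multigraph"
  assumes G: "is_graph G" and iso: "isomorphic G prism \<or> isomorphic G pyramid"
  shows "minor_minimal_non_2_graph G"
proof -
  have card: "card (edges H) = 9" if "isomorphic H prism \<or> isomorphic H pyramid" for H :: "('v, 'e) multigraph"
  proof -
    have "card prism_edges = 9" "card pyramid_edges = 9"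
      by (simp_all add: prism_edges_def pyramid_edges_def doubleton_eq_iff)
    then show ?thesis using that bij_betw_same_card unfolding isomorphic_def prism_eq pyramid_eq edges_simple_graph by metis
  qed
  have "\<Union>prism_edges = {..<6}" "\<Union>pyramid_edges = {..<7}"
    unfolding prism_edges_def pyramid_edges_def by auto
  note covers = isomorphic_covers_nodes[OF _ G this(1)] isomorphic_covers_nodes[OF _ G this(2)]
  have cov: "\<exists>e\<in>edges G. v \<in> ends G e" if "v \<in> nodes G" for v
    using iso unfolding prism_eq pyramid_eq by (elim disjE) (erule covers[OF _ that])+
  have "\<exists>x. basic_point (edges G) (cuts G) x \<and> (\<exists>e\<in>edges G. x e \<notin> \<int>)"
    using iso unfolding prism_eq pyramid_eq
    by (elim disjE) (erule nonintegral_of_isomorphic[OF _ G prism_point], erule nonintegral_of_isomorphic[OF _ G pyramid_point])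
  then have "k_star G > 2" by (simp only: k_star_gt_2_iff[OF G])
  moreover have "k_star H \<le> 2" if "proper_minor H G" for H
  proof (rule ccontr)
    assume "\<not> k_star H \<le> 2"
    then have "k_star H > 2" by simp
    moreover have "is_graph H" using that by (simp add: proper_minor_def)
    ultimately obtain K where K: "K = H \<or> proper_minor K H" "minor_minimal_non_2_graph K"
      using minor_minimal_exists by blast
    have "proper_minor K G" using K(1) that unfolding proper_minor_def by (auto intro: tranclp_trans)
    then have "card (edges K) < card (edges G)" by (rule proper_minor_loses_edge[OF _ G cov])
    moreover have "card (edges K) = 9" using card[OF minor_minimal_isomorphic[OF K(2)]] .
    moreover have "card (edges G) = 9" using card[OF iso] .
    ultimately show False by simp
  qed
  ultimately show ?thesis using G by (simp add: minor_minimal_non_2_graph_def)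
qed

theorem mainTheorem1:
  fixes G :: "('v, 'e::finite) multigraph"
  assumes "is_graph G"
  shows "minor_minimal_non_2_graph G \<longleftrightarrow> isomorphic G prism \<or> isomorphic G pyramid"
  using minor_minimal_isomorphic isomorphic_minor_minimal[OF assms] by blast

end
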